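(* Let $T>0$, $u_0\in H$, let $w_A(t)=\int_0^tS(t-s)\,dw(s)$, and let $y$ denote the solution of $$y(t)=S(t)u_0+F(y+w_A)(t),\qquad t\in[0,T].$$ Then $y$ satisfies $$\sup_{t\in[0,T]}\|y(t)\|_H^2\le\|u_0\|_H^2\,e^{\int_0^Tf(s)\,ds}+\int_0^Te^{\int_0^Tf(s)\,ds}\,g(\tau)\,d\tau$$ and $$\int_0^T\|y(t)\|_V^2\,dt\le\|u_0\|_H^2+\sup_{s\in[0,T]}\|y(s)\|_H^2\int_0^Tf(\tau)\,d\tau+\int_0^Tg(\tau)\,d\tau,$$ where $$f(t)=\tfrac12\Big(2c+\big(2+\tfrac34C_1C_2\big)^2+C_1C_2\|w_A(t)\|_{L^4(I)}^4\Big),\qquad g(t)=c\,\|w_A(t)\|_H^2+\tfrac14\|w_A(t)\|_{L^4(I)}^4 .$$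
   Context: Let $l>0$ and $I=(-l,l)$. For $k=1,2,\dots$, $H_0^k(I)$ denotes the closure of $C_0^\infty(I)$ (the space of infinitely differentiable functions on $I$ which vanish at the endpoints) with respect to the norm $\|v\|_{H_0^k(I)}=\big(\int_I|v|^2dx+\int_I|v'|^2dx+\dots+\int_I|v^{(k)}|^2dx\big)^{1/2}$. Put $H=L^2(I)$ and $V=H_0^1(I)$, so that $\|v\|_V=\big(\int_I|v|^2dx+\int_I|v'|^2dx\big)^{1/2}$, and let $V'$ be the dual of $V$, with $V\subset H\subset V'$. For $T>0$ let $E=L^4(0,T;L^4(I))$. Constants: $C_1,C_2>0$ are constants such that $\|v\|_{L^4(I)}\le C_1\|v\|_{H^{1/2}(I)}$ (Sobolev embedding) and $\|v\|_{H^{1/2}(I)}\le C_2\|v\|_{L^2(I)}^{1/2}\|v\|_{H^1(I)}^{1/2}$ (interpolation), where $\|\cdot\|_{H^1(I)}$ is the full $H^1$ norm, i.e. $\|v\|_{H^1(I)}=\|v\|_V$ for $v\in V$. Operator $A$: $A$ denotes the self-adjoint operator $Au=-u_{xxxx}-u_{xx}-cu$, where the constant $c$ is chosen sufficiently large that $A$ is a strictly negative operator on $H_0^4(I)$; the fractional powers $(-A)^\alpha$ are defined via Fourier analysis, with domain $D((-A)^\alpha)=H_0^{4\alpha}(I)$, so in particular $D((-A)^{1/4})=V$. $S(t)=e^{tA}$, $t\ge0$, is the semigroup generated by $A$; $A$ and $S(t)$ are extended continuously from $V$ to $V'$. Noise: $w$ is a $Q$-Wiener process on a probability space $(\Omega,\mathcal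 F,\mathbb P)$ with values in the separable Hilbert space $H$ and covariance operator $Q$; $w_A$ denotes the version of the stochastic integral $\int_0^tS(t-s)\,dw(s)$ that is continuous with values in $L^4(I)$. Nonlinear maps: for $u\in C^1([0,T];V)$ put $(G_0u)(t)=-u(t)u_x(t)+cu(t)$ and $(F_0u)(t)=\int_0^tS(t-s)(G_0u)(s)\,ds$, $t\in[0,T]$. $G_0$ has a continuous extension $G:E\to L^2(0,T;V')$, and $F:E\to E$ is the continuous extension of $F_0$, namely $F(u)(t)=\int_0^tS(t-s)G(u)(s)\,ds$.
   Formalization: "c sufficiently large" is taken to include c > 0 (strict negativity alone allows negative c on short intervals, where the bound fails); A has domain {u in H^4 : u = u_xx = 0 at the endpoints}, since A is not self-adjoint on the closure H_0^4 as literally defined. *)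

theory Defs
  imports "HOL-Probability.Probability"
begin

text \<open>
  Elements of the function spaces over \<open>I = (-l,l)\<close> are represented by functions
  \<open>real \<Rightarrow> real\<close>, identified when they agree almost everywhere on \<open>I\<close>; elements of
  the dual space \<open>V'\<close> are functionals on such functions. Paths with values in a
  space \<open>X\<close> are functions of time with values in representatives of \<open>X\<close>.
\<close>

type_synonym rfun = "real \<Rightarrow> real"
type_synonym functional = "rfun \<Rightarrow> real"

abbreviation Ivl :: "real \<Rightarrow> real measure"
  where "Ivl l \<equiv> lebesgue_on {-l<..<l}"

abbreviation Time :: "real \<Rightarrow> real measure"
  where "Time T \<equiv> lebesgue_on {0..T}"

definition ae_eq :: "real \<Rightarrow> rfun \<Rightarrow> rfun \<Rightarrow> bool"
  where "ae_eq l u v \<longleftrightarrow> (AE x in Ivl l. u x = v x)"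

section \<open>Lebesgue spaces on the interval\<close>

definition Lp :: "real \<Rightarrow> nat \<Rightarrow> rfun set"
  where "Lp l p = {u \<in> borel_measurable (Ivl l). integrable (Ivl l) (\<lambda>x. \<bar>u x\<bar> ^ p)}"

definition Lnorm :: "real \<Rightarrow> nat \<Rightarrow> rfun \<Rightarrow> real"
  where "Lnorm l p u = root p (\<integral>x. \<bar>u x\<bar> ^ p \<partial>Ivl l)"

abbreviation Hsp :: "real \<Rightarrow> rfun set"
  where "Hsp l \<equiv> Lp l 2"

abbreviation Hnorm :: "real \<Rightarrow> rfun \<Rightarrow> real"
  where "Hnorm l \<equiv> Lnorm l 2"

definition ip :: "real \<Rightarrow> rfun \<Rightarrow> rfun \<Rightarrow> real"
  where "ip l u v = (\<integral>x. u x * v x \<partial>Ivl l)"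

section \<open>Sobolev spaces\<close>

text \<open>
  Smooth functions which vanish at the endpoints. Smoothness is required up to the
  endpoints, in the form of smoothness of a representative defined on the whole line.
\<close>

definition C0inf :: "real \<Rightarrow> rfun set"
  where "C0inf l = {\<phi>. (\<forall>k x. (deriv ^^ k) \<phi> differentiable (at x)) \<and> \<phi> (-l) = 0 \<and> \<phi> l = 0}"

text \<open>
  The boundary terms of an integration by parts against \<open>\<phi> \<in> C0inf l\<close> vanish, so these
  functions define the same weak derivative as compactly supported ones.
\<close>

definition weak_deriv :: "real \<Rightarrow> rfun \<Rightarrow> rfun \<Rightarrow> bool"
  where "weak_deriv l u g \<longleftrightarrow> g \<in> Lp l 2 \<and>
    (\<forall>\<phi>\<in>C0inf l. (\<integral>x. u x * deriv \<phi> x \<partial>Ivl l) = - (\<integral>x. g x * \<phi> x \<partial>Ivl l))"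

text \<open>The weak derivative is unique almost everywhere; \<open>Dx l u\<close> is a representative.\<close>

definition Dx :: "real \<Rightarrow> rfun \<Rightarrow> rfun"
  where "Dx l u = (SOME g. weak_deriv l u g)"

definition Hk :: "real \<Rightarrow> nat \<Rightarrow> rfun set"
  where "Hk l k = {u \<in> Lp l 2. \<forall>i<k. \<exists>g. weak_deriv l ((Dx l ^^ i) u) g}"

definition Hk_norm :: "real \<Rightarrow> nat \<Rightarrow> rfun \<Rightarrow> real"
  where "Hk_norm l k u = sqrt (\<Sum>i\<le>k. (Lnorm l 2 ((Dx l ^^ i) u))\<^sup>2)"

definition H0 :: "real \<Rightarrow> nat \<Rightarrow> rfun set"
  where "H0 l k = {u \<in> Hk l k. \<exists>\<phi>::nat \<Rightarrow> rfun. (\<forall>j. \<phi> j \<in> C0inf l) \<and>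
           (\<lambda>j. Hk_norm l k (\<lambda>x. u x - \<phi> j x)) \<longlonglongrightarrow> 0}"

abbreviation Vsp :: "real \<Rightarrow> rfun set"
  where "Vsp l \<equiv> H0 l 1"

abbreviation Vnorm :: "real \<Rightarrow> rfun \<Rightarrow> real"
  where "Vnorm l \<equiv> Hk_norm l 1"

text \<open>\<open>H\<^sup>1\<^sup>/\<^sup>2(I)\<close> with the Sobolev--Slobodeckij (Gagliardo) norm.\<close>

definition Hhalf :: "real \<Rightarrow> rfun set"
  where "Hhalf l = {u \<in> Lp l 2.
           integrable (Ivl l \<Otimes>\<^sub>M Ivl l) (\<lambda>(x, y). ((u x - u y) / (x - y))\<^sup>2)}"

definition Hhalf_norm :: "real \<Rightarrow> rfun \<Rightarrow> real"
  where "Hhalf_norm l u = sqrt ((Lnorm l 2 u)\<^sup>2 +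
           (\<integral>z. (case z of (x, y) \<Rightarrow> ((u x - u y) / (x - y))\<^sup>2) \<partial>(Ivl l \<Otimes>\<^sub>M Ivl l)))"

section \<open>The linear operator and its semigroup\<close>

text \<open>
  The differential expression, with the domain given by the sine series on \<open>I\<close>:
  \<open>u = u\<^sub>x\<^sub>x = 0\<close> at the endpoints. On this domain \<open>A\<close> is self-adjoint. Functions in
  \<open>C0inf l\<close> are required to vanish at the endpoints but their derivatives are not;
  accordingly \<open>D((-A)\<^sup>1\<^sup>/\<^sup>2) = H0 l 2\<close>, and \<open>D((-A)\<^sup>1\<^sup>/\<^sup>4) = H0 l 1\<close>. The closure \<open>H0 l 4\<close>
  itself lacks the condition \<open>u\<^sub>x\<^sub>x = 0\<close>, and \<open>A\<close> is not symmetric on it.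
\<close>

definition A_op :: "real \<Rightarrow> real \<Rightarrow> rfun \<Rightarrow> rfun"
  where "A_op l c u = (\<lambda>x. - (Dx l ^^ 4) u x - (Dx l ^^ 2) u x - c * u x)"

definition A_dom :: "real \<Rightarrow> rfun set"
  where "A_dom l = {u \<in> Hk l 4. u \<in> H0 l 1 \<and> (Dx l ^^ 2) u \<in> H0 l 1}"

definition A_strictly_negative :: "real \<Rightarrow> real \<Rightarrow> bool"
  where "A_strictly_negative l c \<longleftrightarrow>
    (\<forall>u\<in>A_dom l. \<not> ae_eq l u (\<lambda>x. 0) \<longrightarrow> ip l (A_op l c u) u < 0)"

definition bounded_op :: "real \<Rightarrow> (rfun \<Rightarrow> rfun) \<Rightarrow> bool"
  where "bounded_op l B \<longleftrightarrow>
    (\<forall>u\<in>Hsp l. B u \<in> Hsp l) \<and>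
    (\<forall>u\<in>Hsp l. \<forall>v\<in>Hsp l. \<forall>a b.
       ae_eq l (B (\<lambda>x. a * u x + b * v x)) (\<lambda>x. a * B u x + b * B v x)) \<and>
    (\<exists>C. \<forall>u\<in>Hsp l. Hnorm l (B u) \<le> C * Hnorm l u)"

text \<open>\<open>S\<close> is a strongly continuous semigroup on \<open>L\<^sup>2(I)\<close> whose generator is \<open>(D, A)\<close>.\<close>

definition semigroup_generated_by ::
    "real \<Rightarrow> rfun set \<Rightarrow> (rfun \<Rightarrow> rfun) \<Rightarrow> (real \<Rightarrow> rfun \<Rightarrow> rfun) \<Rightarrow> bool"
  where "semigroup_generated_by l D A S \<longleftrightarrow>
    (\<forall>t\<ge>0. bounded_op l (S t)) \<and>
    (\<forall>u\<in>Hsp l. ae_eq l (S 0 u) u) \<and>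
    (\<forall>s\<ge>0. \<forall>t\<ge>0. \<forall>u\<in>Hsp l. ae_eq l (S (s + t) u) (S s (S t u))) \<and>
    (\<forall>u\<in>Hsp l. ((\<lambda>t. Hnorm l (\<lambda>x. S t u x - u x)) \<longlongrightarrow> 0) (at_right 0)) \<and>
    (\<forall>u\<in>Hsp l. \<forall>v\<in>Hsp l.
       ((\<lambda>h. Hnorm l (\<lambda>x. (S h u x - u x) / h - v x)) \<longlongrightarrow> 0) (at_right 0) \<longleftrightarrow>
       u \<in> D \<and> ae_eq l v (A u))"

section \<open>The dual space and the nonlinear maps\<close>

definition Vdual :: "real \<Rightarrow> functional set"
  where "Vdual l = {\<psi>.
    (\<forall>\<phi>\<in>Vsp l. \<forall>\<theta>\<in>Vsp l. \<forall>a b. \<psi> (\<lambda>x. a * \<phi> x + b * \<theta> x) = a * \<psi> \<phi> + b * \<psi> \<theta>) \<and>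
    (\<exists>C. \<forall>\<phi>\<in>Vsp l. \<bar>\<psi> \<phi>\<bar> \<le> C * Vnorm l \<phi>)}"

definition dual_norm :: "real \<Rightarrow> functional \<Rightarrow> real"
  where "dual_norm l \<psi> = (SUP \<phi>\<in>{\<phi> \<in> Vsp l. Vnorm l \<phi> \<le> 1}. \<bar>\<psi> \<phi>\<bar>)"

text \<open>
  The continuous extension of an operator of the self-adjoint semigroup to \<open>V'\<close> is the
  transpose of its restriction to \<open>V\<close>.
\<close>

definition dual_op :: "(rfun \<Rightarrow> rfun) \<Rightarrow> functional \<Rightarrow> functional"
  where "dual_op B \<psi> = (\<lambda>\<phi>. \<psi> (B \<phi>))"

text \<open>\<open>L\<^sup>2(0,T;V')\<close>; weak and strong measurability agree because \<open>V'\<close> is separable.\<close>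

definition L2_Vdual :: "real \<Rightarrow> real \<Rightarrow> (real \<Rightarrow> functional) set"
  where "L2_Vdual l T = {g.
    (AE t in Time T. g t \<in> Vdual l) \<and>
    (\<forall>\<phi>\<in>Vsp l. (\<lambda>t. g t \<phi>) \<in> borel_measurable (Time T)) \<and>
    integrable (Time T) (\<lambda>t. (dual_norm l (g t))\<^sup>2)}"

definition L2_Vdual_norm :: "real \<Rightarrow> real \<Rightarrow> (real \<Rightarrow> functional) \<Rightarrow> real"
  where "L2_Vdual_norm l T g = sqrt (\<integral>t. (dual_norm l (g t))\<^sup>2 \<partial>Time T)"

text \<open>
  \<open>E = L\<^sup>4(0,T;L\<^sup>4(I))\<close>. Strong measurability of the path \<open>u\<close> is expressed by a jointly
  measurable \<open>v\<close> such that \<open>u t\<close> and \<open>v (t, \<cdot>)\<close> are the same element of \<open>L\<^sup>4(I)\<close>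
  for almost every \<open>t\<close>.
\<close>

definition Esp :: "real \<Rightarrow> real \<Rightarrow> (real \<Rightarrow> rfun) set"
  where "Esp l T = {u.
    (AE t in Time T. u t \<in> Lp l 4) \<and>
    (\<exists>v \<in> borel_measurable (Time T \<Otimes>\<^sub>M Ivl l).
       integrable (Time T \<Otimes>\<^sub>M Ivl l) (\<lambda>z. \<bar>v z\<bar> ^ 4) \<and>
       (AE t in Time T. ae_eq l (u t) (\<lambda>x. v (t, x))))}"

definition Enorm :: "real \<Rightarrow> real \<Rightarrow> (real \<Rightarrow> rfun) \<Rightarrow> real"
  where "Enorm l T u = root 4 (\<integral>t. (Lnorm l 4 (u t)) ^ 4 \<partial>Time T)"

definition C1_V :: "real \<Rightarrow> real \<Rightarrow> (real \<Rightarrow> rfun) set"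
  where "C1_V l T = {u. \<exists>u'. \<forall>t\<in>{0..T}.
    u t \<in> Vsp l \<and> u' t \<in> Vsp l \<and>
    ((\<lambda>s. Vnorm l (\<lambda>x. (u s x - u t x) / (s - t) - u' t x)) \<longlongrightarrow> 0) (at t within {0..T}) \<and>
    ((\<lambda>s. Vnorm l (\<lambda>x. u' s x - u' t x)) \<longlongrightarrow> 0) (at t within {0..T})}"

text \<open>\<open>-u u\<^sub>x + c u\<close>, regarded as an element of \<open>V'\<close> through \<open>H \<subseteq> V'\<close>.\<close>

definition G0 :: "real \<Rightarrow> real \<Rightarrow> (real \<Rightarrow> rfun) \<Rightarrow> real \<Rightarrow> functional"
  where "G0 l c u t = (\<lambda>\<phi>. ip l (\<lambda>x. - u t x * Dx l (u t) x + c * u t x) \<phi>)"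

definition continuous_extension_G0 ::
    "real \<Rightarrow> real \<Rightarrow> real \<Rightarrow> ((real \<Rightarrow> rfun) \<Rightarrow> real \<Rightarrow> functional) \<Rightarrow> bool"
  where "continuous_extension_G0 l T c G \<longleftrightarrow>
    (\<forall>u\<in>Esp l T. G u \<in> L2_Vdual l T) \<and>
    (\<forall>u\<in>C1_V l T. AE t in Time T. \<forall>\<phi>\<in>Vsp l. G u t \<phi> = G0 l c u t \<phi>) \<and>
    (\<forall>u\<in>Esp l T. \<forall>U::nat \<Rightarrow> real \<Rightarrow> rfun. (\<forall>j. U j \<in> Esp l T) \<longrightarrow>
       (\<lambda>j. Enorm l T (\<lambda>t x. U j t x - u t x)) \<longlonglongrightarrow> 0 \<longrightarrow>
       (\<lambda>j. L2_Vdual_norm l T (\<lambda>t \<phi>. G (U j) t \<phi> - G u t \<phi>)) \<longlonglongrightarrow> 0)"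

text \<open>
  \<open>F(u)(t) = \<integral>\<^sub>0\<^sup>t S(t-s) G(u)(s) ds\<close>: the \<open>V'\<close>-valued integral, given by its values
  on \<open>V\<close>.
\<close>

definition F_map :: "(real \<Rightarrow> rfun \<Rightarrow> rfun) \<Rightarrow> ((real \<Rightarrow> rfun) \<Rightarrow> real \<Rightarrow> functional) \<Rightarrow>
    (real \<Rightarrow> rfun) \<Rightarrow> real \<Rightarrow> functional"
  where "F_map S G u t = (\<lambda>\<phi>. \<integral>s. dual_op (S (t - s)) (G u s) \<phi> \<partial>lebesgue_on {0..t})"

text \<open>The equation holds at every \<open>t\<close>, as an identity in \<open>V'\<close>.\<close>

definition is_solution :: "real \<Rightarrow> real \<Rightarrow> (real \<Rightarrow> rfun \<Rightarrow> rfun) \<Rightarrow>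
    ((real \<Rightarrow> rfun) \<Rightarrow> real \<Rightarrow> functional) \<Rightarrow> rfun \<Rightarrow> (real \<Rightarrow> rfun) \<Rightarrow> (real \<Rightarrow> rfun) \<Rightarrow> bool"
  where "is_solution l T S G u0 wpath y \<longleftrightarrow>
    y \<in> Esp l T \<and> (\<forall>t\<in>{0..T}. y t \<in> Hsp l) \<and>
    (\<forall>t\<in>{0..T}. \<forall>\<phi>\<in>Vsp l.
       ip l (y t) \<phi> = ip l (S t u0) \<phi> + F_map S G (\<lambda>s x. y s x + wpath s x) t \<phi>)"

section \<open>The noise\<close>

definition orthonormal_basis :: "real \<Rightarrow> (nat \<Rightarrow> rfun) \<Rightarrow> bool"
  where "orthonormal_basis l e \<longleftrightarrow>
    (\<forall>n. e n \<in> Hsp l) \<and>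
    (\<forall>m n. ip l (e m) (e n) = (if m = n then 1 else 0)) \<and>
    (\<forall>u\<in>Hsp l. (\<forall>n. ip l u (e n) = 0) \<longrightarrow> ae_eq l u (\<lambda>x. 0))"

definition nonneg_symmetric_op :: "real \<Rightarrow> (rfun \<Rightarrow> rfun) \<Rightarrow> bool"
  where "nonneg_symmetric_op l Q \<longleftrightarrow> bounded_op l Q \<and>
    (\<forall>u\<in>Hsp l. \<forall>v\<in>Hsp l. ip l (Q u) v = ip l u (Q v)) \<and> (\<forall>u\<in>Hsp l. 0 \<le> ip l (Q u) u)"

definition trace_class_covariance :: "real \<Rightarrow> (rfun \<Rightarrow> rfun) \<Rightarrow> bool"
  where "trace_class_covariance l Q \<longleftrightarrow> nonneg_symmetric_op l Q \<and>
    (\<exists>e. orthonormal_basis l e \<and> summable (\<lambda>n. ip l (Q (e n)) (e n)))"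

definition centred_gaussian :: "real \<Rightarrow> real measure"
  where "centred_gaussian v =
    (if v = 0 then return borel 0 else density lborel (normal_density 0 (sqrt v)))"

text \<open>
  The Borel sets of the separable space \<open>H\<close> are generated by the functionals
  \<open>u \<mapsto> ip l u h\<close>. Random variables with values in \<open>H\<close>, their independence and their
  Gaussian law are therefore expressed through these functionals.
\<close>

definition Q_Wiener :: "real \<Rightarrow> 'w measure \<Rightarrow> (rfun \<Rightarrow> rfun) \<Rightarrow> (real \<Rightarrow> 'w \<Rightarrow> rfun) \<Rightarrow> bool"
  where "Q_Wiener l M Q w \<longleftrightarrow>
    trace_class_covariance l Q \<and>
    (\<forall>t\<ge>0. \<forall>\<omega>\<in>space M. w t \<omega> \<in> Hsp l) \<and>
    (AE \<omega> in M. ae_eq l (w 0 \<omega>) (\<lambda>x. 0)) \<and>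
    (AE \<omega> in M. \<forall>t\<ge>0.
       ((\<lambda>s. Hnorm l (\<lambda>x. w s \<omega> x - w t \<omega> x)) \<longlongrightarrow> 0) (at t within {0..})) \<and>
    (\<forall>t\<ge>0. \<forall>h\<in>Hsp l. (\<lambda>\<omega>. ip l (w t \<omega>) h) \<in> borel_measurable M) \<and>
    (\<forall>(m::nat) \<tau>::nat \<Rightarrow> real. 0 \<le> \<tau> 0 \<longrightarrow> (\<forall>i<m. \<tau> i \<le> \<tau> (Suc i)) \<longrightarrow>
       prob_space.indep_vars M (\<lambda>_. PiM (Hsp l) (\<lambda>_. borel :: real measure))
         (\<lambda>i \<omega>. \<lambda>h\<in>Hsp l. ip l (\<lambda>x. w (\<tau> (Suc i)) \<omega> x - w (\<tau> i) \<omega> x) h) {..<m}) \<and>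
    (\<forall>s t. 0 \<le> s \<longrightarrow> s \<le> t \<longrightarrow> (\<forall>h\<in>Hsp l.
       distr M borel (\<lambda>\<omega>. ip l (\<lambda>x. w t \<omega> x - w s \<omega> x) h)
         = centred_gaussian ((t - s) * ip l (Q h) h)))"

text \<open>
  \<open>X = \<integral>\<^sub>0\<^sup>t \<Phi>(s) dw(s)\<close> for a deterministic operator-valued integrand: \<open>X\<close> is the
  mean-square limit of the integrals of step functions \<open>\<Psi>\<^sub>j\<close> (with values \<open>\<Psi> j i\<close> on
  \<open>[\<tau> j i, \<tau> j (i+1)]\<close>) for which
  \<open>\<integral>\<^sub>0\<^sup>t \<parallel>(\<Psi>\<^sub>j(s) - \<Phi>(s)) Q\<^sup>1\<^sup>/\<^sup>2\<parallel>\<^sup>2 ds \<longlonglongrightarrow> 0\<close> in the Hilbert--Schmidt norm. Here \<open>R = Q\<^sup>1\<^sup>/\<^sup>2\<close>.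
\<close>

definition stochastic_integral :: "real \<Rightarrow> 'w measure \<Rightarrow> (rfun \<Rightarrow> rfun) \<Rightarrow>
    (real \<Rightarrow> 'w \<Rightarrow> rfun) \<Rightarrow> real \<Rightarrow> (real \<Rightarrow> rfun \<Rightarrow> rfun) \<Rightarrow> ('w \<Rightarrow> rfun) \<Rightarrow> bool"
  where "stochastic_integral l M Q w t \<Phi> X \<longleftrightarrow>
    (\<forall>h\<in>Hsp l. (\<lambda>\<omega>. ip l (X \<omega>) h) \<in> borel_measurable M) \<and>
    (\<exists>R e. nonneg_symmetric_op l R \<and> (\<forall>u\<in>Hsp l. ae_eq l (R (R u)) (Q u)) \<and>
       orthonormal_basis l e \<and>
       (\<exists>(m::nat \<Rightarrow> nat) (\<tau>::nat \<Rightarrow> nat \<Rightarrow> real) (\<Psi>::nat \<Rightarrow> nat \<Rightarrow> rfun \<Rightarrow> rfun).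
          (\<forall>j. \<tau> j 0 = 0 \<and> \<tau> j (m j) = t \<and>
             (\<forall>i<m j. \<tau> j i \<le> \<tau> j (Suc i) \<and> bounded_op l (\<Psi> j i))) \<and>
          (\<lambda>j. \<Sum>i<m j. \<integral>\<^sup>+s. (\<Sum>n. ennreal
             ((Hnorm l (\<lambda>x. \<Psi> j i (R (e n)) x - \<Phi> s (R (e n)) x))\<^sup>2))
               \<partial>lebesgue_on {\<tau> j i..\<tau> j (Suc i)}) \<longlonglongrightarrow> 0 \<and>
          (\<lambda>j. \<integral>\<^sup>+\<omega>. ennreal ((Hnorm l (\<lambda>x.
             (\<Sum>i<m j. \<Psi> j i (\<lambda>z. w (\<tau> j (Suc i)) \<omega> z - w (\<tau> j i) \<omega> z) x) - X \<omega> x))\<^sup>2)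
               \<partial>M) \<longlonglongrightarrow> 0))"

text \<open>The version of \<open>\<integral>\<^sub>0\<^sup>t S(t-s) dw(s)\<close> with continuous paths in \<open>L\<^sup>4(I)\<close>.\<close>

definition continuous_stochastic_convolution :: "real \<Rightarrow> real \<Rightarrow> 'w measure \<Rightarrow> (rfun \<Rightarrow> rfun) \<Rightarrow>
    (real \<Rightarrow> 'w \<Rightarrow> rfun) \<Rightarrow> (real \<Rightarrow> rfun \<Rightarrow> rfun) \<Rightarrow> (real \<Rightarrow> 'w \<Rightarrow> rfun) \<Rightarrow> bool"
  where "continuous_stochastic_convolution l T M Q w S wA \<longleftrightarrow>
    (\<forall>t\<in>{0..T}. stochastic_integral l M Q w t (\<lambda>s. S (t - s)) (wA t)) \<and>
    (\<forall>\<omega>\<in>space M. \<forall>t\<in>{0..T}. wA t \<omega> \<in> Lp l 4 \<and>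
       ((\<lambda>s. Lnorm l 4 (\<lambda>x. wA s \<omega> x - wA t \<omega> x)) \<longlongrightarrow> 0) (at t within {0..T}))"

end

theory Submission
  imports Defs
begin

text \<open>
  On the sine basis \<open>sb k\<close> of \<open>L\<^sup>2(I)\<close> the semigroup is diagonal with factors \<open>exp (- lam c k * t)\<close>,
  \<open>lam c k = (mu k)\<^sup>4 - (mu k)\<^sup>2 + c\<close>, and \<open>G u t (sb k)\<close> is determined by continuity from smooth paths,
  because tensor products of polynomials and sines are dense in \<open>E\<close>. Hence the coefficients of a
  solution satisfy scalar variation-of-constants formulas. Summing the resulting equations for their
  squares gives a Galerkin energy equality, which first yields \<open>y t \<in> D((-A)\<^sup>1\<^sup>/\<^sup>2)\<close> for almost every \<open>t\<close>
  and then passes to the limit.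

  With \<open>a, b, d\<close> the \<open>L\<^sup>2\<close> norms of \<open>y, y\<^sub>x, y\<^sub>x\<^sub>x\<close> the power is bounded using \<open>\<integral>y\<^sup>2y\<^sub>x = 0\<close>,
  \<open>b\<^sup>2 \<le> a d\<close>, \<open>sup y\<^sup>2 \<le> a b\<close> and \<open>3 \<integral>y\<^sup>2y\<^sub>x\<^sup>2 = - \<integral>y\<^sup>3y\<^sub>x\<^sub>x\<close>, and Gronwall's inequality finishes the
  argument. None of these bounds involves \<open>C1\<close> or \<open>C2\<close>: the stated \<open>f\<close> majorises the power as soon as
  \<open>C1 * C2 \<ge> 23/20\<close>, and this is forced by testing the two embeddings with explicit functions.
\<close>

section \<open>Measure-theoretic preliminaries\<close>

text \<open>The obstacle is that \<open>f\<close> is prescribed. Apart from the cross term of w with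
  y y_x, the power plus the squared V norm calls for 4 b^2 + a^2 \<le> 2 d^2 + k a^2. Under b^2
  \<le> a d this forces k \<ge> 3, while \<open>f\<close> supplies k = (2 + 3/4 C1 C2)^2 / 2, which
  tends to 2 as C1 C2 tends to 0. So this approach needs a numerical lower bound for C1 C2, and the
  cross term raises it to 23/20.

  A second obstacle is the semigroup: it is given through its generator, with a separate bound for
  each t. Two eigenvalues can coincide (when (mu j)^2 + (mu k)^2 = 1), so the orbit of
  \<open>sb k\<close> is first confined to a finite-dimensional eigenspace. There strong continuity
  supplies a bound uniform for small t, and a telescoping argument identifies the orbit.

  Functions are representatives, not classes. Operators and functionals must therefore be shown to
  respect a.e. equality, and paths need jointly measurable versions before Fubini's theorem
  applies.\<close>

lemma complete_lebesgue_on: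
  assumes "S \<in> sets lebesgue"
  shows "complete_measure (lebesgue_on S)"
proof
  fix A B :: "'a set" assume "B \<subseteq> A" "A \<in> null_sets (lebesgue_on S)"
  then have "A \<in> null_sets lebesgue" "B \<subseteq> S"
    using assms by (auto simp: null_sets_restrict_space)
  then have "B \<in> sets lebesgue"
    using \<open>B \<subseteq> A\<close> completion.complete2 by blast
  with \<open>B \<subseteq> S\<close> show "B \<in> sets (lebesgue_on S)"
    using assms by (simp add: sets_restrict_space_iff)
qed

text \<open>By completeness, preimages that differ within a null set are measurable together. Later
  arguments can thus switch representatives without a separate measurability proof.\<close>

lemma measurable_cong_AE_lebesgue_on:
  fixes f g :: "'a::euclidean_space \<Rightarrow> real"
  assumes S: "S \<in> sets lebesgue" and f: "f \<in> borel_measurable (lebesgue_on S)"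
    and eq: "AE x in lebesgue_on S. f x = g x"
  shows "g \<in> borel_measurable (lebesgue_on S)"
proof (rule measurableI)
  interpret complete_measure "lebesgue_on S" by (rule complete_lebesgue_on[OF S])
  fix A :: "real set" assume A: "A \<in> sets borel"
  show "g -` A \<inter> space (lebesgue_on S) \<in> sets (lebesgue_on S)"
    by (rule in_sets_AE[OF _ measurable_sets[OF f A]]) (use eq in auto)
qed auto

lemma integrable_cong_AE_lebesgue_on:
  fixes f g :: "'a::euclidean_space \<Rightarrow> real"
  assumes S: "S \<in> sets lebesgue" and eq: "AE x in lebesgue_on S. f x = g x"
  shows "integrable (lebesgue_on S) f \<longleftrightarrow> integrable (lebesgue_on S) g"
proof -
  have eq': "AE x in lebesgue_on S. g x = f x" using eq by auto
  show ?thesis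
    using measurable_cong_AE_lebesgue_on[OF S _ eq] measurable_cong_AE_lebesgue_on[OF S _ eq']
      integrable_cong_AE_imp[OF _ _ eq] integrable_cong_AE_imp[OF _ _ eq'] borel_measurable_integrable
    by metis
qed

lemma integral_cong_AE_lebesgue_on:
  fixes f g :: "'a::euclidean_space \<Rightarrow> real"
  assumes S: "S \<in> sets lebesgue" and eq: "AE x in lebesgue_on S. f x = g x"
  shows "(\<integral>x. f x \<partial>lebesgue_on S) = (\<integral>x. g x \<partial>lebesgue_on S)"
proof (cases "integrable (lebesgue_on S) f")
  case True
  then have "integrable (lebesgue_on S) g" using integrable_cong_AE_lebesgue_on[OF S eq] by simp
  with True show ?thesis by (intro integral_cong_AE) (use eq in auto)
next
  \<comment> \<open>Neither side is integrable, so both integrals take the default value 0.\<close>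
  case False
  then have "\<not> integrable (lebesgue_on S) g" using integrable_cong_AE_lebesgue_on[OF S eq] by simp
  with False show ?thesis by (simp add: not_integrable_integral_eq)
qed

subsection \<open>Square integrable functions\<close>

text \<open>Kept over an arbitrary measure space so that one Cauchy-Schwarz inequality serves the
  interval, the time axis and their product. Over \<open>Ivl l\<close> it is membership in
  \<open>Hsp l\<close>.\<close>

definition sqint :: "'a measure \<Rightarrow> ('a \<Rightarrow> real) \<Rightarrow> bool"
  where "sqint M u \<longleftrightarrow> u \<in> borel_measurable M \<and> integrable M (\<lambda>x. (u x)\<^sup>2)"

lemma sqint_meas[dest]: "sqint M u \<Longrightarrow> u \<in> borel_measurable M"
  by (simp add: sqint_def)

lemma sqint_sq[dest]: "sqint M u \<Longrightarrow> integrable M (\<lambda>x. (u x)\<^sup>2)"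
  by (simp add: sqint_def)

lemma sqint_mult:
  assumes "sqint M u" "sqint M v" shows "integrable M (\<lambda>x. u x * v x)"
proof (rule Bochner_Integration.integrable_bound)
  show "integrable M (\<lambda>x. (u x)\<^sup>2 + (v x)\<^sup>2)" using assms by (auto simp: sqint_def)
  show "AE x in M. norm (u x * v x) \<le> norm ((u x)\<^sup>2 + (v x)\<^sup>2)"
  proof (rule AE_I2)
    fix x
    have "2 * \<bar>u x * v x\<bar> \<le> (u x)\<^sup>2 + (v x)\<^sup>2"
      using sum_squares_bound[of "\<bar>u x\<bar>" "\<bar>v x\<bar>"] by (simp add: abs_mult)
    then show "norm (u x * v x) \<le> norm ((u x)\<^sup>2 + (v x)\<^sup>2)" by simp
  qed
qed (use assms in \<open>auto simp: sqint_def\<close>)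

lemma sqint_lin:
  assumes "sqint M u" "sqint M v" shows "sqint M (\<lambda>x. a * u x + b * v x)"
proof -
  have "integrable M (\<lambda>x. a\<^sup>2 * (u x)\<^sup>2 + b\<^sup>2 * (v x)\<^sup>2 + 2 * a * b * (u x * v x))"
    using assms sqint_mult[OF assms] by (auto simp: sqint_def)
  then have "integrable M (\<lambda>x. (a * u x + b * v x)\<^sup>2)"
    by (simp add: power2_eq_square algebra_simps)
  then show ?thesis using assms by (auto simp: sqint_def)
qed

lemma sqint_add: "sqint M u \<Longrightarrow> sqint M v \<Longrightarrow> sqint M (\<lambda>x. u x + v x)"
  using sqint_lin[of M u v 1 1] by simp

lemma sqint_diff: "sqint M u \<Longrightarrow> sqint M v \<Longrightarrow> sqint M (\<lambda>x. u x - v x)"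
  using sqint_lin[of M u v 1 "-1"] by simp

lemma sqint_scale: "sqint M u \<Longrightarrow> sqint M (\<lambda>x. a * u x)"
  using sqint_lin[of M u u a 0] by simp

lemma sqint_zero: "sqint M (\<lambda>x. 0)" by (simp add: sqint_def)

lemma sqint_sum: "finite I \<Longrightarrow> (\<And>i. i \<in> I \<Longrightarrow> sqint M (u i)) \<Longrightarrow> sqint M (\<lambda>x. \<Sum>i\<in>I. u i x)"
  by (induction I rule: finite_induct) (auto intro: sqint_zero sqint_add)

lemma sqint_integrable:
  assumes "finite_measure M" "sqint M u" shows "integrable M u"
proof -
  interpret finite_measure M by fact
  have "sqint M (\<lambda>x. 1)" by (simp add: sqint_def)
  from sqint_mult[OF assms(2) this] show ?thesis by simp
qed

text \<open>The vertex t = - C / A gives the bound. For A = 0 the function is affine, and a large t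
  of the sign opposite to C makes it negative unless C = 0.\<close>

lemma quadratic_nonneg_discr:
  fixes A B C :: real
  assumes "0 \<le> A" "\<And>t. 0 \<le> A * t\<^sup>2 + 2 * C * t + B"
  shows "C\<^sup>2 \<le> A * B"
proof (cases "A = 0")
  case True
  have "C = 0"
  proof (rule ccontr)
    assume "C \<noteq> 0"
    have "0 \<le> 2 * C * (- (\<bar>B\<bar> + 1) / C) + B" using assms(2)[of "- (\<bar>B\<bar> + 1) / C"] True by simp
    also have "\<dots> = - 2 * (\<bar>B\<bar> + 1) + B" using \<open>C \<noteq> 0\<close> by (simp add: field_simps)
    finally show False by (auto simp: abs_if split: if_splits)
  qed
  then show ?thesis using True by simp
next
  case False
  with assms(1) have "A > 0" by simp
  have "0 \<le> A * (- C / A)\<^sup>2 + 2 * C * (- C / A) + B" by (rule assms(2))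
  also have "\<dots> = B - C\<^sup>2 / A" using \<open>A > 0\<close> by (simp add: power2_eq_square field_simps)
  finally show ?thesis using \<open>A > 0\<close> by (simp add: field_simps)
qed

text \<open>Discriminant of the nonnegative quadratic \<integral>(t u + v)^2 in the variable
  t.\<close>

lemma sqint_Cauchy_Schwarz:
  assumes u: "sqint M u" and v: "sqint M v"
  shows "(\<integral>x. u x * v x \<partial>M)\<^sup>2 \<le> (\<integral>x. (u x)\<^sup>2 \<partial>M) * (\<integral>x. (v x)\<^sup>2 \<partial>M)"
proof (rule quadratic_nonneg_discr)
  fix t :: real
  note [simp] = sqint_sq[OF u] sqint_sq[OF v] sqint_mult[OF u v]
  have "0 \<le> (\<integral>x. (t * u x + v x)\<^sup>2 \<partial>M)" by (rule integral_nonneg_AE) simp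
  also have "\<dots> = (\<integral>x. t\<^sup>2 * (u x)\<^sup>2 + 2 * t * (u x * v x) + (v x)\<^sup>2 \<partial>M)"
    by (simp add: power2_eq_square algebra_simps)
  also have "\<dots> = (\<integral>x. (u x)\<^sup>2 \<partial>M) * t\<^sup>2 + 2 * (\<integral>x. u x * v x \<partial>M) * t + (\<integral>x. (v x)\<^sup>2 \<partial>M)"
    by simp
  finally show "0 \<le> (\<integral>x. (u x)\<^sup>2 \<partial>M) * t\<^sup>2 + 2 * (\<integral>x. u x * v x \<partial>M) * t + (\<integral>x. (v x)\<^sup>2 \<partial>M)" .
qed (auto intro: integral_nonneg_AE)

lemma sqint_Cauchy_Schwarz_abs:
  assumes u: "sqint M u" and v: "sqint M v"
  shows "\<bar>\<integral>x. u x * v x \<partial>M\<bar> \<le> sqrt (\<integral>x. (u x)\<^sup>2 \<partial>M) * sqrt (\<integral>x. (v x)\<^sup>2 \<partial>M)"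
  using real_sqrt_le_mono[OF sqint_Cauchy_Schwarz[OF u v]] by (simp add: real_sqrt_mult)

lemma sqint_triangle:
  assumes u: "sqint M u" and v: "sqint M v"
  shows "sqrt (\<integral>x. (u x + v x)\<^sup>2 \<partial>M) \<le> sqrt (\<integral>x. (u x)\<^sup>2 \<partial>M) + sqrt (\<integral>x. (v x)\<^sup>2 \<partial>M)"
proof (rule real_le_lsqrt)
  note [simp] = sqint_sq[OF u] sqint_sq[OF v] sqint_mult[OF u v]
  have nn: "(\<integral>x. (u x)\<^sup>2 \<partial>M) \<ge> 0" "(\<integral>x. (v x)\<^sup>2 \<partial>M) \<ge> 0" by (auto intro: integral_nonneg_AE)
  have "(\<integral>x. (u x + v x)\<^sup>2 \<partial>M) = (\<integral>x. (u x)\<^sup>2 + 2 * (u x * v x) + (v x)\<^sup>2 \<partial>M)"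
    by (simp add: power2_eq_square algebra_simps)
  also have "\<dots> = (\<integral>x. (u x)\<^sup>2 \<partial>M) + 2 * (\<integral>x. u x * v x \<partial>M) + (\<integral>x. (v x)\<^sup>2 \<partial>M)" by simp
  also have "\<dots> \<le> (sqrt (\<integral>x. (u x)\<^sup>2 \<partial>M) + sqrt (\<integral>x. (v x)\<^sup>2 \<partial>M))\<^sup>2"
    using sqint_Cauchy_Schwarz_abs[OF u v] nn by (simp add: power2_sum)
  finally show "(\<integral>x. (u x + v x)\<^sup>2 \<partial>M) \<le> (sqrt (\<integral>x. (u x)\<^sup>2 \<partial>M) + sqrt (\<integral>x. (v x)\<^sup>2 \<partial>M))\<^sup>2" .
qed (auto intro: add_nonneg_nonneg integral_nonneg_AE)

subsection \<open>Indefinite integrals\<close>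

text \<open>Trades the moving domain for an indicator on the fixed measure over [0,T], so that
  Fubini and dominated convergence work with one measure for all t.\<close>

lemma integral_lebesgue_on_initial:
  fixes f :: "real \<Rightarrow> real"
  assumes "t \<le> T"
  shows "(\<integral>s. f s \<partial>lebesgue_on {0..t}) = (\<integral>s. indicator {..t} s * f s \<partial>lebesgue_on {0..T})"
proof -
  have "(\<integral>s. f s \<partial>lebesgue_on {0..t}) = (\<integral>s. indicator {0..t} s *\<^sub>R f s \<partial>lebesgue)"
    by (rule integral_restrict_space) auto
  also have "\<dots> = (\<integral>s. indicator {0..T} s *\<^sub>R (indicator {..t} s * f s) \<partial>lebesgue)"
    by (rule Bochner_Integration.integral_cong) (use assms in \<open>auto simp: indicator_def\<close>)
  also have "\<dots> = (\<integral>s. indicator {..t} s * f s \<partial>lebesgue_on {0..T})"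
    by (rule integral_restrict_space[symmetric]) auto
  finally show ?thesis .
qed

lemma integrable_indicator_atMost:
  fixes f :: "real \<Rightarrow> real"
  assumes "integrable (lebesgue_on {0..T}) f"
  shows "integrable (lebesgue_on {0..T}) (\<lambda>s. indicator {..t} s * f s)"
proof -
  have "{..t} \<inter> {0..T} \<in> sets (lebesgue_on {0..T})" by (auto simp: sets_restrict_space_iff)
  then have "integrable (lebesgue_on {0..T}) (\<lambda>s. indicator ({..t} \<inter> {0..T}) s *\<^sub>R f s)"
    by (rule integrable_mult_indicator) fact
  also have "?this \<longleftrightarrow> ?thesis"
    by (rule Bochner_Integration.integrable_cong) (auto simp: indicator_def)
  finally show ?thesis .
qed

lemma integrable_lebesgue_on_initial:
  fixes f :: "real \<Rightarrow> real"
  assumes "integrable (lebesgue_on {0..T}) f" "t \<le> T"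
  shows "integrable (lebesgue_on {0..t}) f"
proof -
  have "integrable lebesgue (\<lambda>s. indicator {0..T} s *\<^sub>R (indicator {..t} s * f s))"
    using integrable_indicator_atMost[OF assms(1), of t] by (subst (asm) integrable_restrict_space) auto
  also have "(\<lambda>s. indicator {0..T} s *\<^sub>R (indicator {..t} s * f s)) = (\<lambda>s. indicator {0..t} s *\<^sub>R f s)"
    using assms(2) by (auto simp: indicator_def fun_eq_iff)
  finally show ?thesis by (subst integrable_restrict_space) auto
qed

lemma finite_lebesgue_on_Icc: "finite_measure (lebesgue_on {a..b::real})"
  by (rule finite_measure_lebesgue_on) simp

lemma finite_Ivl: "finite_measure (Ivl l)"
  by (rule finite_measure_lebesgue_on) simp

lemma id_measurable_lebesgue_on: "(\<lambda>x. x) \<in> borel_measurable (lebesgue_on S)"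
  by (rule measurable_restrict_space1, rule measurable_completion) simp

lemma integrable_product_fun:
  fixes f :: "'a \<Rightarrow> real" and g :: "'b \<Rightarrow> real"
  assumes "sigma_finite_measure M" "sigma_finite_measure N"
    and f: "integrable M f" and g: "integrable N g"
  shows "integrable (M \<Otimes>\<^sub>M N) (\<lambda>z. f (fst z) * g (snd z))"
proof -
  interpret pair_sigma_finite M N using assms by (simp add: pair_sigma_finite_def)
  have [measurable]: "f \<in> borel_measurable M" "g \<in> borel_measurable N" using f g by auto
  show ?thesis
    by (rule Fubini_integrable) (use f g in \<open>auto simp: abs_mult\<close>)
qed

text \<open>Fubini on a square split along its diagonal: the product of the integrals is the
  integral of \<xi>(s) \<eta>(r) over r \<le> s plus the one over s \<le> r. The two regions overlap
  only where r = s, which is null for each s.\<close>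

lemma indefinite_integral_product_aux:
  fixes \<xi> \<eta> :: "real \<Rightarrow> real"
  assumes \<xi>: "integrable (lebesgue_on {0..T}) \<xi>" and \<eta>: "integrable (lebesgue_on {0..T}) \<eta>"
  defines "M \<equiv> lebesgue_on {0..T}"
  shows "integrable M (\<lambda>s. \<xi> s * (\<integral>r. indicator {..s} r * \<eta> r \<partial>M))"
    and "integrable M (\<lambda>s. (\<integral>r. indicator {..s} r * \<xi> r \<partial>M) * \<eta> s)"
    and "(\<integral>s. \<xi> s \<partial>M) * (\<integral>s. \<eta> s \<partial>M) =
      (\<integral>s. \<xi> s * (\<integral>r. indicator {..s} r * \<eta> r \<partial>M) \<partial>M) +
      (\<integral>s. (\<integral>r. indicator {..s} r * \<xi> r \<partial>M) * \<eta> s \<partial>M)"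
proof -
  have fin: "finite_measure M" by (simp add: M_def finite_lebesgue_on_Icc)
  then have sf: "sigma_finite_measure M" by (simp add: finite_measure_def)
  interpret pair_sigma_finite M M using sf by (simp add: pair_sigma_finite_def)
  have [measurable]: "\<xi> \<in> borel_measurable M" "\<eta> \<in> borel_measurable M"
    "(\<lambda>x. x) \<in> borel_measurable M"
    using \<xi> \<eta> by (auto simp: M_def id_measurable_lebesgue_on)
  have prod: "integrable (M \<Otimes>\<^sub>M M) (\<lambda>(s, r). \<xi> s * \<eta> r)"
    using integrable_product_fun[OF sf sf, of \<xi> \<eta>] \<xi> \<eta> by (simp add: M_def split_beta')
  have i1: "integrable (M \<Otimes>\<^sub>M M) (\<lambda>(s, r). indicator {..s} r * (\<xi> s * \<eta> r))"
  proof (rule Bochner_Integration.integrable_bound[OF prod])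
    show "(\<lambda>(s, r). indicator {..s} r * (\<xi> s * \<eta> r)) \<in> borel_measurable (M \<Otimes>\<^sub>M M)"
      unfolding indicator_def atMost_iff by measurable
  qed (auto simp: indicator_def)
  have i2: "integrable (M \<Otimes>\<^sub>M M) (\<lambda>(s, r). indicator {..r} s * (\<xi> s * \<eta> r))"
  proof (rule Bochner_Integration.integrable_bound[OF prod])
    show "(\<lambda>(s, r). indicator {..r} s * (\<xi> s * \<eta> r)) \<in> borel_measurable (M \<Otimes>\<^sub>M M)"
      unfolding indicator_def atMost_iff by measurable
  qed (auto simp: indicator_def)
  have e1: "(\<integral>r. indicator {..s} r * (\<xi> s * \<eta> r) \<partial>M) = \<xi> s * (\<integral>r. indicator {..s} r * \<eta> r \<partial>M)" for s
    by (subst Bochner_Integration.integral_mult_right_zero[symmetric]) (simp add: ac_simps)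
  have e2: "(\<integral>s. indicator {..r} s * (\<xi> s * \<eta> r) \<partial>M) = (\<integral>s. indicator {..r} s * \<xi> s \<partial>M) * \<eta> r" for r
    by (subst Bochner_Integration.integral_mult_left_zero[symmetric]) (simp add: ac_simps)
  show a1: "integrable M (\<lambda>s. \<xi> s * (\<integral>r. indicator {..s} r * \<eta> r \<partial>M))"
    using integrable_fst[OF i1] by (simp add: e1)
  show a2: "integrable M (\<lambda>s. (\<integral>r. indicator {..s} r * \<xi> r \<partial>M) * \<eta> s)"
    using integrable_snd[OF i2] by (simp add: e2)
  \<comment> \<open>Exchanging the order of integration gives both triangles the outer factor \<xi>
    s, so that \<open>split\<close> can reunite the inner integrals.\<close>
  have a3: "(\<integral>s. (\<integral>r. indicator {..s} r * \<xi> r \<partial>M) * \<eta> s \<partial>M)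
      = (\<integral>s. \<xi> s * (\<integral>r. indicator {s..} r * \<eta> r \<partial>M) \<partial>M)"
  proof -
    have "(\<integral>s. (\<integral>r. indicator {..s} r * \<xi> r \<partial>M) * \<eta> s \<partial>M) =
       (\<integral>s. (\<integral>r. indicator {..r} s * (\<xi> s * \<eta> r) \<partial>M) \<partial>M)"
      using Fubini_integral[OF i2] by (simp add: e2)
    also have "\<dots> = (\<integral>s. \<xi> s * (\<integral>r. indicator {s..} r * \<eta> r \<partial>M) \<partial>M)"
      by (subst Bochner_Integration.integral_mult_right_zero[symmetric]) (simp add: ac_simps indicator_def)
    finally show ?thesis .
  qed
  have split: "(\<integral>r. indicator {..s} r * \<eta> r \<partial>M) + (\<integral>r. indicator {s..} r * \<eta> r \<partial>M) = (\<integral>r. \<eta> r \<partial>M)" for s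
  proof -
    have j1: "integrable M (\<lambda>r. indicator {..s} r * \<eta> r)"
      using integrable_indicator_atMost[OF \<eta>] by (simp add: M_def)
    have j2: "integrable M (\<lambda>r. indicator {s..} r * \<eta> r)"
    proof (rule Bochner_Integration.integrable_bound[of _ \<eta>])
      show "(\<lambda>r. indicator {s..} r * \<eta> r) \<in> borel_measurable M"
        unfolding indicator_def atLeast_iff by measurable
    qed (use \<eta> in \<open>auto simp: indicator_def M_def\<close>)
    have "AE r in M. r \<noteq> s"
    proof -
      have "AE r in lebesgue. r \<noteq> s"
        by (rule AE_I'[of "{s}"]) auto
      then have "AE r in lebesgue. r \<in> {0..T} \<longrightarrow> r \<noteq> s" by eventually_elim simp
      then show ?thesis unfolding M_def by (subst AE_restrict_space_iff) auto
    qed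
    then have "AE r in M. indicator {..s} r * \<eta> r + indicator {s..} r * \<eta> r = \<eta> r"
      by eventually_elim (auto simp: indicator_def)
    then have "(\<integral>r. indicator {..s} r * \<eta> r + indicator {s..} r * \<eta> r \<partial>M) = (\<integral>r. \<eta> r \<partial>M)"
      by (intro integral_cong_AE) (use j1 j2 in auto)
    with j1 j2 show ?thesis by simp
  qed
  have split_mult: "\<xi> s * (\<integral>r. \<eta> r \<partial>M) = \<xi> s * (\<integral>r. indicator {..s} r * \<eta> r \<partial>M)
     + \<xi> s * (\<integral>r. indicator {s..} r * \<eta> r \<partial>M)" for s
    using split[of s] by (simp flip: distrib_left)
  have "(\<integral>s. \<xi> s \<partial>M) * (\<integral>s. \<eta> s \<partial>M) = (\<integral>s. \<xi> s * (\<integral>r. \<eta> r \<partial>M) \<partial>M)" by simp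
  also have "\<dots> = (\<integral>s. \<xi> s * (\<integral>r. indicator {..s} r * \<eta> r \<partial>M)
     + \<xi> s * (\<integral>r. indicator {s..} r * \<eta> r \<partial>M) \<partial>M)"
    by (simp only: split_mult)
  also have "\<dots> = (\<integral>s. \<xi> s * (\<integral>r. indicator {..s} r * \<eta> r \<partial>M) \<partial>M)
     + (\<integral>s. \<xi> s * (\<integral>r. indicator {s..} r * \<eta> r \<partial>M) \<partial>M)"
  proof (rule Bochner_Integration.integral_add[OF a1])
    have "(\<lambda>s. \<xi> s * (\<integral>r. indicator {s..} r * \<eta> r \<partial>M)) =
      (\<lambda>s. \<xi> s * (\<integral>r. \<eta> r \<partial>M) - \<xi> s * (\<integral>r. indicator {..s} r * \<eta> r \<partial>M))"
      by (simp only: split_mult) simp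
    then show "integrable M (\<lambda>s. \<xi> s * (\<integral>r. indicator {s..} r * \<eta> r \<partial>M))"
      using a1 \<xi> by (simp add: M_def)
  qed
  finally show "(\<integral>s. \<xi> s \<partial>M) * (\<integral>s. \<eta> s \<partial>M) =
      (\<integral>s. \<xi> s * (\<integral>r. indicator {..s} r * \<eta> r \<partial>M) \<partial>M) +
      (\<integral>s. (\<integral>r. indicator {..s} r * \<xi> r \<partial>M) * \<eta> s \<partial>M)"
    by (simp only: a3)
qed

text \<open>The product rule for absolutely continuous functions in integrated form; the densities
  are merely integrable, so no pointwise derivative is available. It is used with an exponential
  factor for Duhamel's formula and with X = Y for the squares of coefficients.\<close>

lemma indefinite_integral_product:
  fixes \<xi> \<eta> X Y :: "real \<Rightarrow> real"
  assumes \<xi>: "integrable (lebesgue_on {0..T}) \<xi>" and \<eta>: "integrable (lebesgue_on {0..T}) \<eta>"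
    and X: "\<And>t. t \<in> {0..T} \<Longrightarrow> X t = x0 + (\<integral>s. \<xi> s \<partial>lebesgue_on {0..t})"
    and Y: "\<And>t. t \<in> {0..T} \<Longrightarrow> Y t = y0 + (\<integral>s. \<eta> s \<partial>lebesgue_on {0..t})"
    and t: "t \<in> {0..T}"
  shows "integrable (lebesgue_on {0..T}) (\<lambda>s. \<xi> s * Y s)"
    and "integrable (lebesgue_on {0..T}) (\<lambda>s. X s * \<eta> s)"
    and "X t * Y t = x0 * y0 + (\<integral>s. \<xi> s * Y s + X s * \<eta> s \<partial>lebesgue_on {0..t})"
proof -
  have *: "integrable (lebesgue_on {0..t}) (\<lambda>s. \<xi> s * Y s) \<and>
    integrable (lebesgue_on {0..t}) (\<lambda>s. X s * \<eta> s) \<and>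
    X t * Y t = x0 * y0 + (\<integral>s. \<xi> s * Y s + X s * \<eta> s \<partial>lebesgue_on {0..t})"
    if t: "t \<in> {0..T}" for t
  proof -
    define M where "M = lebesgue_on {0..t}"
    have \<xi>t: "integrable (lebesgue_on {0..t}) \<xi>" and \<eta>t: "integrable (lebesgue_on {0..t}) \<eta>"
      using t by (auto intro: integrable_lebesgue_on_initial[OF \<xi>] integrable_lebesgue_on_initial[OF \<eta>])
    note aux = indefinite_integral_product_aux[OF \<xi>t \<eta>t, folded M_def]
    have sp: "s \<in> space M \<longleftrightarrow> 0 \<le> s \<and> s \<le> t" for s by (simp add: M_def)
    have Xs: "X s = x0 + (\<integral>r. indicator {..s} r * \<xi> r \<partial>M)" if "s \<in> space M" for s
      using that t X[of s] integral_lebesgue_on_initial[of s t \<xi>] by (auto simp: M_def)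
    have Ys: "Y s = y0 + (\<integral>r. indicator {..s} r * \<eta> r \<partial>M)" if "s \<in> space M" for s
      using that t Y[of s] integral_lebesgue_on_initial[of s t \<eta>] by (auto simp: M_def)
    have 1: "integrable M (\<lambda>s. \<xi> s * Y s) \<longleftrightarrow>
        integrable M (\<lambda>s. y0 * \<xi> s + \<xi> s * (\<integral>r. indicator {..s} r * \<eta> r \<partial>M))"
      by (rule Bochner_Integration.integrable_cong) (auto simp: Ys algebra_simps)
    have 2: "integrable M (\<lambda>s. X s * \<eta> s) \<longleftrightarrow>
        integrable M (\<lambda>s. x0 * \<eta> s + (\<integral>r. indicator {..s} r * \<xi> r \<partial>M) * \<eta> s)"
      by (rule Bochner_Integration.integrable_cong) (auto simp: Xs algebra_simps)
    have 3: "(\<integral>s. \<xi> s * Y s + X s * \<eta> s \<partial>M) =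
      (\<integral>s. (y0 * \<xi> s + \<xi> s * (\<integral>r. indicator {..s} r * \<eta> r \<partial>M)) +
           (x0 * \<eta> s + (\<integral>r. indicator {..s} r * \<xi> r \<partial>M) * \<eta> s) \<partial>M)"
      by (rule Bochner_Integration.integral_cong) (auto simp: Xs Ys algebra_simps)
    have XY: "X t = x0 + (\<integral>s. \<xi> s \<partial>M)" "Y t = y0 + (\<integral>s. \<eta> s \<partial>M)"
      using X[OF t] Y[OF t] by (auto simp: M_def)
    have \<xi>M: "integrable M \<xi>" and \<eta>M: "integrable M \<eta>" using \<xi>t \<eta>t by (auto simp: M_def)
    show ?thesis
      unfolding M_def[symmetric] 1 2 3 XY
      using aux \<xi>M \<eta>M by (simp add: algebra_simps)
  qed
  show "integrable (lebesgue_on {0..T}) (\<lambda>s. \<xi> s * Y s)"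
    "integrable (lebesgue_on {0..T}) (\<lambda>s. X s * \<eta> s)"
    using *[of T] t by auto
  show "X t * Y t = x0 * y0 + (\<integral>s. \<xi> s * Y s + X s * \<eta> s \<partial>lebesgue_on {0..t})"
    using *[OF t] by blast
qed

lemma indefinite_integral_continuous_on:
  fixes \<xi> :: "real \<Rightarrow> real"
  assumes "integrable (lebesgue_on {0..T}) \<xi>"
  shows "continuous_on {0..T} (\<lambda>t. \<integral>s. \<xi> s \<partial>lebesgue_on {0..t})"
proof -
  have "\<xi> integrable_on {0..T}"
    using has_integral_integral_lebesgue_on[OF assms] by auto
  then have "continuous_on {0..T} (\<lambda>t. integral {0..t} \<xi>)"
    by (rule indefinite_integral_continuous_1)
  moreover have "(\<integral>s. \<xi> s \<partial>lebesgue_on {0..t}) = integral {0..t} \<xi>" if "t \<in> {0..T}" for t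
    by (rule lebesgue_integral_eq_integral[OF integrable_lebesgue_on_initial[OF assms]]) (use that in auto)
  ultimately show ?thesis using continuous_on_eq by (metis (no_types, lifting))
qed

text \<open>The function z = \<phi> exp(-F) - \<gamma> is nonincreasing: \<psi> \<le> \<phi> and 0
  \<le> f cancel the linear term, and g exp(-F) \<le> g disposes of the forcing. Bounding the
  forcing this crudely is what puts the exponential of the full integral in front of both u and the
  integral of g.\<close>

lemma Gronwall_integral:
  fixes f g \<psi> :: "real \<Rightarrow> real"
  assumes f: "continuous_on {0..T} f" and g: "continuous_on {0..T} g" and \<psi>: "continuous_on {0..T} \<psi>"
    and f0: "\<And>t. t \<in> {0..T} \<Longrightarrow> 0 \<le> f t" and g0: "\<And>t. t \<in> {0..T} \<Longrightarrow> 0 \<le> g t"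
    and ineq: "\<And>t. t \<in> {0..T} \<Longrightarrow> \<psi> t \<le> u + (\<integral>s. f s * \<psi> s + g s \<partial>lebesgue_on {0..t})"
    and u: "0 \<le> u" and t: "t \<in> {0..T}"
  shows "\<psi> t \<le> exp (\<integral>s. f s \<partial>lebesgue_on {0..T}) * (u + (\<integral>s. g s \<partial>lebesgue_on {0..T}))"
proof -
  have eq: "(\<integral>s. h s \<partial>lebesgue_on {0..t}) = integral {0..t} h"
    if "continuous_on {0..T} h" "t \<in> {0..T}" for h :: "real \<Rightarrow> real" and t
  proof (rule lebesgue_integral_eq_integral[OF continuous_imp_integrable_real])
    show "continuous_on {0..t} h" by (rule continuous_on_subset[OF that(1)]) (use that(2) in auto)
  qed simp
  \<comment> \<open>The right-hand side of the hypothesis serves as a differentiable majorant of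
    \<psi>, which is only continuous.\<close>
  define \<phi> where "\<phi> t = u + integral {0..t} (\<lambda>s. f s * \<psi> s + g s)" for t
  define F where "F t = integral {0..t} f" for t
  define \<gamma> where "\<gamma> t = integral {0..t} g" for t
  have cont: "continuous_on {0..T} (\<lambda>s. f s * \<psi> s + g s)" by (intro continuous_intros f g \<psi>)
  have le: "\<psi> t \<le> \<phi> t" if "t \<in> {0..T}" for t
    using ineq[OF that] eq[OF cont that] by (simp add: \<phi>_def)
  have mono: "integral {0..s} h \<le> integral {0..t} h"
    if "continuous_on {0..T} h" "\<And>t. t \<in> {0..T} \<Longrightarrow> 0 \<le> h t" "s \<le> t" "t \<in> {0..T}" for h :: "real \<Rightarrow> real" and s t
  proof (rule integral_subset_le)
    show "h integrable_on {0..s}" "h integrable_on {0..t}"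
      by (rule integrable_continuous_real, rule continuous_on_subset[OF that(1)], use that in force)+
  qed (use that in auto)
  have F0: "0 \<le> F t" "F t \<le> F T" and \<gamma>0: "0 \<le> \<gamma> t" "\<gamma> t \<le> \<gamma> T" if "t \<in> {0..T}" for t
    using mono[OF f f0, of 0 t] mono[OF g g0, of 0 t] mono[OF f f0, of t T] mono[OF g g0, of t T] that
    by (auto simp: F_def \<gamma>_def)
  have D: "((\<lambda>t. integral {0..t} h) has_real_derivative h t) (at t)"
    if "continuous_on {0..T} h" "0 < t" "t < T" for h t
  proof -
    have "((\<lambda>t. integral {0..t} h) has_real_derivative h t) (at t within {0..T})"
      using integral_has_vector_derivative[OF that(1), of t] that
      by (simp add: has_real_derivative_iff_has_vector_derivative)
    then show ?thesis using that by (metis at_within_Icc_at)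
  qed
  define z where "z t = \<phi> t * exp (- F t) - \<gamma> t" for t
  have "z t \<le> z 0"
  proof (cases "t = 0")
    case False
    have "z 0 \<ge> z t"
    proof (rule DERIV_nonpos_imp_decreasing_open[of 0 t z])
      show "0 \<le> t" using t by auto
      fix x assume x: "0 < x" "x < t"
      then have x': "0 < x" "x < T" "x \<in> {0..T}" using t by auto
      have "(z has_real_derivative (f x * \<psi> x + g x) * exp (- F x) + \<phi> x * (- f x * exp (- F x)) - g x) (at x)"
      proof -
        have d1: "(\<phi> has_real_derivative (f x * \<psi> x + g x)) (at x)"
          unfolding \<phi>_def using DERIV_add[OF DERIV_const D[OF cont x'(1,2)]] by simp
        have d2: "(F has_real_derivative f x) (at x)" "(\<gamma> has_real_derivative g x) (at x)"
          unfolding F_def \<gamma>_def using D[OF f x'(1,2)] D[OF g x'(1,2)] by auto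
        have d3: "((\<lambda>t. exp (- F t)) has_real_derivative (exp (- F x) * (- f x))) (at x)"
          by (rule DERIV_chain2[OF DERIV_exp DERIV_minus[OF d2(1)]])
        show ?thesis unfolding z_def
          using DERIV_diff[OF DERIV_mult[OF d1 d3] d2(2)] by (simp add: mult.commute)
      qed
      moreover have "(f x * \<psi> x + g x) * exp (- F x) + \<phi> x * (- f x * exp (- F x)) - g x \<le> 0"
      proof -
        have "f x * \<psi> x \<le> f x * \<phi> x" using le[OF x'(3)] f0[OF x'(3)] by (intro mult_left_mono)
        then have "(f x * \<psi> x) * exp (- F x) \<le> f x * \<phi> x * exp (- F x)" by (intro mult_right_mono) auto
        moreover have "g x * exp (- F x) \<le> g x * 1"
          using F0[OF x'(3)] g0[OF x'(3)] by (intro mult_left_mono) auto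
        ultimately show ?thesis by (simp add: algebra_simps)
      qed
      ultimately show "\<exists>y. (z has_real_derivative y) (at x) \<and> y \<le> 0" by blast
    next
      have "continuous_on {0..T} z"
        unfolding z_def \<phi>_def F_def \<gamma>_def
        by (intro continuous_intros indefinite_integral_continuous_1 integrable_continuous_real f g cont)
      then show "continuous_on {0..t} z" by (rule continuous_on_subset) (use t in auto)
    qed
    then show ?thesis .
  qed simp
  also have "z 0 = u" by (simp add: z_def \<phi>_def F_def \<gamma>_def)
  finally have "\<phi> t * exp (- F t) \<le> u + \<gamma> t" by (simp add: z_def)
  then have "\<phi> t \<le> exp (F t) * (u + \<gamma> t)" by (simp add: exp_minus field_simps)
  also have "\<dots> \<le> exp (F T) * (u + \<gamma> T)"
    using F0[OF t] \<gamma>0[OF t] u by (intro mult_mono) auto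
  finally show ?thesis
    using le[OF t] t eq[OF f, of T] eq[OF g, of T] by (auto simp: F_def \<gamma>_def)
qed

subsection \<open>Continuous functions on the interval\<close>

lemma continuous_imp_measurable_Ivl:
  fixes f :: "real \<Rightarrow> real"
  assumes "continuous_on {-l..l} f"
  shows "f \<in> borel_measurable (Ivl l)"
proof -
  have "continuous_on {-l<..<l} f" by (rule continuous_on_subset[OF assms]) auto
  then show ?thesis by (intro continuous_imp_measurable_on_sets_lebesgue) auto
qed

lemma continuous_imp_integrable_Ivl:
  fixes f :: "real \<Rightarrow> real"
  assumes "continuous_on {-l..l} f"
  shows "integrable (Ivl l) f"
    and "(\<integral>x. f x \<partial>Ivl l) = integral {-l..l} f"
proof -
  have "set_integrable lebesgue {-l..l} f"
    by (rule absolutely_integrable_continuous_real[OF assms])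
  then have "set_integrable lebesgue {-l<..<l} f"
    by (rule set_integrable_subset) auto
  then show i: "integrable (Ivl l) f"
    by (simp add: set_integrable_def integrable_restrict_space)
  have "(\<integral>x. f x \<partial>Ivl l) = integral {-l<..<l} f"
    by (rule lebesgue_integral_eq_integral[OF i]) simp
  then show "(\<integral>x. f x \<partial>Ivl l) = integral {-l..l} f"
    by (simp add: integral_open_interval_real)
qed

lemma continuous_imp_sqint_Ivl: "continuous_on {-l..l} f \<Longrightarrow> sqint (Ivl l) f"
  unfolding sqint_def
  by (auto intro!: continuous_imp_measurable_Ivl continuous_imp_integrable_Ivl(1) continuous_intros)

lemma integral_Ivl_FTC:
  fixes f F :: "real \<Rightarrow> real"
  assumes "0 \<le> l" "continuous_on {-l..l} f"
    and "\<And>x. x \<in> {-l..l} \<Longrightarrow> (F has_real_derivative f x) (at x within {-l..l})"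
  shows "(\<integral>x. f x \<partial>Ivl l) = F l - F (-l)"
proof -
  have "(f has_integral (F l - F (-l))) {-l..l}"
    by (rule fundamental_theorem_of_calculus)
      (use assms in \<open>auto simp: has_real_derivative_iff_has_vector_derivative\<close>)
  then show ?thesis using continuous_imp_integrable_Ivl(2)[OF assms(2)] by (simp add: integral_unique)
qed

subsection \<open>Density in Lebesgue spaces\<close>

text \<open>Distance is measured by the p-th power of the norm, so that the crude
  \<open>abs_add_power_le\<close> can replace Minkowski's inequality. Only the difference from the
  approximant has to be integrable.\<close>

definition Lp_closure :: "'a measure \<Rightarrow> nat \<Rightarrow> ('a \<Rightarrow> real) set \<Rightarrow> ('a \<Rightarrow> real) set"
  where "Lp_closure M p \<A> = {f \<in> borel_measurable M. \<forall>\<epsilon>>0. \<exists>u\<in>\<A>. u \<in> borel_measurable M \<and>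
    integrable M (\<lambda>x. \<bar>f x - u x\<bar> ^ p) \<and> (\<integral>x. \<bar>f x - u x\<bar> ^ p \<partial>M) < \<epsilon>}"

lemma Lp_closureI:
  assumes "f \<in> borel_measurable M"
    and "\<And>\<epsilon>. \<epsilon> > 0 \<Longrightarrow> \<exists>u\<in>\<A>. u \<in> borel_measurable M \<and>
      integrable M (\<lambda>x. \<bar>f x - u x\<bar> ^ p) \<and> (\<integral>x. \<bar>f x - u x\<bar> ^ p \<partial>M) < \<epsilon>"
  shows "f \<in> Lp_closure M p \<A>"
  using assms by (simp add: Lp_closure_def)

lemma abs_add_power_le:
  fixes a b :: real
  shows "\<bar>a + b\<bar> ^ p \<le> 2 ^ p * (\<bar>a\<bar> ^ p + \<bar>b\<bar> ^ p)"
proof -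
  have "\<bar>a + b\<bar> ^ p \<le> (2 * max \<bar>a\<bar> \<bar>b\<bar>) ^ p" by (intro power_mono) auto
  also have "\<dots> = 2 ^ p * max \<bar>a\<bar> \<bar>b\<bar> ^ p" by (simp add: power_mult_distrib)
  also have "\<dots> \<le> 2 ^ p * (\<bar>a\<bar> ^ p + \<bar>b\<bar> ^ p)" by (intro mult_left_mono) (auto simp: max_def)
  finally show ?thesis .
qed

lemma integrable_abs_add_power:
  fixes f g :: "'a \<Rightarrow> real"
  assumes [measurable]: "f \<in> borel_measurable M" "g \<in> borel_measurable M"
    and i: "integrable M (\<lambda>x. \<bar>f x\<bar> ^ p)" "integrable M (\<lambda>x. \<bar>g x\<bar> ^ p)"
  shows "integrable M (\<lambda>x. \<bar>f x + g x\<bar> ^ p)"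
    and "(\<integral>x. \<bar>f x + g x\<bar> ^ p \<partial>M) \<le> 2 ^ p * ((\<integral>x. \<bar>f x\<bar> ^ p \<partial>M) + (\<integral>x. \<bar>g x\<bar> ^ p \<partial>M))"
proof -
  show int: "integrable M (\<lambda>x. \<bar>f x + g x\<bar> ^ p)"
    by (rule Bochner_Integration.integrable_bound[of _ "\<lambda>x. 2 ^ p * (\<bar>f x\<bar> ^ p + \<bar>g x\<bar> ^ p)"])
      (use i abs_add_power_le in auto)
  have "(\<integral>x. \<bar>f x + g x\<bar> ^ p \<partial>M) \<le> (\<integral>x. 2 ^ p * (\<bar>f x\<bar> ^ p + \<bar>g x\<bar> ^ p) \<partial>M)"
    by (rule integral_mono) (use int i abs_add_power_le in auto)
  then show "(\<integral>x. \<bar>f x + g x\<bar> ^ p \<partial>M) \<le> 2 ^ p * ((\<integral>x. \<bar>f x\<bar> ^ p \<partial>M) + (\<integral>x. \<bar>g x\<bar> ^ p \<partial>M))"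
    using i by simp
qed

lemma Lp_closure_closed:
  assumes f: "f \<in> borel_measurable M"
    and ex: "\<And>\<epsilon>. \<epsilon> > 0 \<Longrightarrow> \<exists>g\<in>Lp_closure M p \<A>.
      integrable M (\<lambda>x. \<bar>f x - g x\<bar> ^ p) \<and> (\<integral>x. \<bar>f x - g x\<bar> ^ p \<partial>M) < \<epsilon>"
  shows "f \<in> Lp_closure M p \<A>"
proof (rule Lp_closureI[OF f])
  fix \<epsilon> :: real assume "\<epsilon> > 0"
  define \<delta> where "\<delta> = \<epsilon> / (2 * 2 ^ p)"
  have "\<delta> > 0" using \<open>\<epsilon> > 0\<close> by (simp add: \<delta>_def)
  obtain g where g: "g \<in> Lp_closure M p \<A>" "integrable M (\<lambda>x. \<bar>f x - g x\<bar> ^ p)"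
    "(\<integral>x. \<bar>f x - g x\<bar> ^ p \<partial>M) < \<delta>" using ex[OF \<open>\<delta> > 0\<close>] by blast
  obtain u where u: "u \<in> \<A>" "u \<in> borel_measurable M" "integrable M (\<lambda>x. \<bar>g x - u x\<bar> ^ p)"
    "(\<integral>x. \<bar>g x - u x\<bar> ^ p \<partial>M) < \<delta>" using g(1) \<open>\<delta> > 0\<close> unfolding Lp_closure_def by blast
  have gm: "g \<in> borel_measurable M" using g(1) by (simp add: Lp_closure_def)
  have *: "f x - u x = (f x - g x) + (g x - u x)" for x by simp
  have m: "(\<lambda>x. f x - g x) \<in> borel_measurable M" "(\<lambda>x. g x - u x) \<in> borel_measurable M"
    using f gm u(2) by auto
  have "(\<integral>x. \<bar>f x - u x\<bar> ^ p \<partial>M) \<le>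
      2 ^ p * ((\<integral>x. \<bar>f x - g x\<bar> ^ p \<partial>M) + (\<integral>x. \<bar>g x - u x\<bar> ^ p \<partial>M))"
    unfolding * by (rule integrable_abs_add_power(2)) fact+
  also have "\<dots> < 2 ^ p * (\<delta> + \<delta>)" using g(3) u(4) by (intro mult_strict_left_mono add_strict_mono) auto
  also have "\<dots> = \<epsilon>" by (simp add: \<delta>_def)
  finally have "(\<integral>x. \<bar>f x - u x\<bar> ^ p \<partial>M) < \<epsilon>" .
  moreover have "integrable M (\<lambda>x. \<bar>f x - u x\<bar> ^ p)"
    unfolding * by (rule integrable_abs_add_power(1)) fact+
  ultimately show "\<exists>u\<in>\<A>. u \<in> borel_measurable M \<and>
      integrable M (\<lambda>x. \<bar>f x - u x\<bar> ^ p) \<and> (\<integral>x. \<bar>f x - u x\<bar> ^ p \<partial>M) < \<epsilon>" using u by blast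
qed

lemma Lp_closure_dominated:
  assumes f: "f \<in> borel_measurable M" and p: "p > 0"
    and F: "\<And>i::nat. F i \<in> Lp_closure M p \<A>"
    and lim: "AE x in M. (\<lambda>i. F i x) \<longlonglongrightarrow> f x"
    and dom: "integrable M G" "\<And>i. AE x in M. \<bar>f x - F i x\<bar> ^ p \<le> G x"
  shows "f \<in> Lp_closure M p \<A>"
proof (rule Lp_closure_closed[OF f])
  fix \<epsilon> :: real assume "\<epsilon> > 0"
  have [measurable]: "f \<in> borel_measurable M" "\<And>i. F i \<in> borel_measurable M"
    using f F by (auto simp: Lp_closure_def)
  have "(\<lambda>i. \<integral>x. \<bar>f x - F i x\<bar> ^ p \<partial>M) \<longlonglongrightarrow> (\<integral>x. 0 \<partial>M)"
  proof (rule integral_dominated_convergence[where w=G])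
    show "AE x in M. (\<lambda>i. \<bar>f x - F i x\<bar> ^ p) \<longlonglongrightarrow> 0"
      using lim
    proof eventually_elim
      case (elim x)
      have "(\<lambda>i. \<bar>f x - F i x\<bar> ^ p) \<longlonglongrightarrow> \<bar>f x - f x\<bar> ^ p" by (intro tendsto_intros elim)
      moreover have "\<bar>f x - f x\<bar> ^ p = 0" using p by simp
      ultimately show ?case by metis
    qed
  qed (use dom in auto)
  then have "(\<lambda>i. \<integral>x. \<bar>f x - F i x\<bar> ^ p \<partial>M) \<longlonglongrightarrow> 0" by simp
  then have "\<forall>\<^sub>F i in sequentially. (\<integral>x. \<bar>f x - F i x\<bar> ^ p \<partial>M) < \<epsilon>"
    using \<open>\<epsilon> > 0\<close> by (rule order_tendstoD)
  then obtain i where i: "(\<integral>x. \<bar>f x - F i x\<bar> ^ p \<partial>M) < \<epsilon>"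
    using eventually_sequentially by auto
  moreover have "integrable M (\<lambda>x. \<bar>f x - F i x\<bar> ^ p)"
    by (rule Bochner_Integration.integrable_bound[OF dom(1)]) (use dom(2)[of i] in auto)
  ultimately show "\<exists>g\<in>Lp_closure M p \<A>. integrable M (\<lambda>x. \<bar>f x - g x\<bar> ^ p) \<and>
      (\<integral>x. \<bar>f x - g x\<bar> ^ p \<partial>M) < \<epsilon>" using F by blast
qed

lemma Lp_closure_base:
  assumes "u \<in> \<A>" "u \<in> borel_measurable M" "p > 0"
  shows "u \<in> Lp_closure M p \<A>"
  by (rule Lp_closureI) (use assms in \<open>auto intro!: bexI[of _ u] simp: zero_power\<close>)

locale function_subspace =
  fixes \<A> :: "('a \<Rightarrow> real) set"
  assumes zero_mem: "(\<lambda>x. 0) \<in> \<A>"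
    and add_mem: "u \<in> \<A> \<Longrightarrow> v \<in> \<A> \<Longrightarrow> (\<lambda>x. u x + v x) \<in> \<A>"
    and scale_mem: "u \<in> \<A> \<Longrightarrow> (\<lambda>x. a * u x) \<in> \<A>"
begin

lemma sum_mem:
  "finite I \<Longrightarrow> (\<And>i. i \<in> I \<Longrightarrow> u i \<in> \<A>) \<Longrightarrow> (\<lambda>x. \<Sum>i\<in>I. c i * u i x) \<in> \<A>"
proof (induction I rule: finite_induct)
  case (insert i I)
  then show ?case using add_mem[OF scale_mem[of "u i" "c i"], of "\<lambda>x. \<Sum>i\<in>I. c i * u i x"] by simp
qed (simp add: zero_mem)

lemma Lp_closure_add:
  assumes "f \<in> Lp_closure M p \<A>" "g \<in> Lp_closure M p \<A>"
  shows "(\<lambda>x. f x + g x) \<in> Lp_closure M p \<A>"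
proof (rule Lp_closureI)
  fix \<epsilon> :: real assume "\<epsilon> > 0"
  define \<delta> where "\<delta> = \<epsilon> / (2 * 2 ^ p)"
  have "\<delta> > 0" using \<open>\<epsilon> > 0\<close> by (simp add: \<delta>_def)
  obtain u where u: "u \<in> \<A>" "u \<in> borel_measurable M" "integrable M (\<lambda>x. \<bar>f x - u x\<bar> ^ p)"
    "(\<integral>x. \<bar>f x - u x\<bar> ^ p \<partial>M) < \<delta>" using assms(1) \<open>\<delta> > 0\<close> unfolding Lp_closure_def by blast
  obtain v where v: "v \<in> \<A>" "v \<in> borel_measurable M" "integrable M (\<lambda>x. \<bar>g x - v x\<bar> ^ p)"
    "(\<integral>x. \<bar>g x - v x\<bar> ^ p \<partial>M) < \<delta>" using assms(2) \<open>\<delta> > 0\<close> unfolding Lp_closure_def by blast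
  have *: "f x + g x - (u x + v x) = (f x - u x) + (g x - v x)" for x by simp
  have m: "(\<lambda>x. f x - u x) \<in> borel_measurable M" "(\<lambda>x. g x - v x) \<in> borel_measurable M"
    using assms u(2) v(2) by (auto simp: Lp_closure_def)
  have "(\<integral>x. \<bar>f x + g x - (u x + v x)\<bar> ^ p \<partial>M) \<le>
      2 ^ p * ((\<integral>x. \<bar>f x - u x\<bar> ^ p \<partial>M) + (\<integral>x. \<bar>g x - v x\<bar> ^ p \<partial>M))"
    unfolding * by (rule integrable_abs_add_power(2)) fact+
  also have "\<dots> < 2 ^ p * (\<delta> + \<delta>)" using u(4) v(4) by (intro mult_strict_left_mono add_strict_mono) auto
  also have "\<dots> = \<epsilon>" by (simp add: \<delta>_def)
  finally have "(\<integral>x. \<bar>f x + g x - (u x + v x)\<bar> ^ p \<partial>M) < \<epsilon>" .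
  moreover have "integrable M (\<lambda>x. \<bar>f x + g x - (u x + v x)\<bar> ^ p)"
    unfolding * by (rule integrable_abs_add_power(1)) fact+
  ultimately show "\<exists>w\<in>\<A>. w \<in> borel_measurable M \<and>
      integrable M (\<lambda>x. \<bar>f x + g x - w x\<bar> ^ p) \<and> (\<integral>x. \<bar>f x + g x - w x\<bar> ^ p \<partial>M) < \<epsilon>"
    using u v add_mem[OF u(1) v(1)] by (intro bexI[of _ "\<lambda>x. u x + v x"]) auto
qed (use assms in \<open>auto simp: Lp_closure_def\<close>)

lemma Lp_closure_scale:
  assumes "f \<in> Lp_closure M p \<A>"
  shows "(\<lambda>x. a * f x) \<in> Lp_closure M p \<A>"
proof (rule Lp_closureI)
  fix \<epsilon> :: real assume "\<epsilon> > 0"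
  define \<delta> where "\<delta> = \<epsilon> / (\<bar>a\<bar> ^ p + 1)"
  have pos: "\<bar>a\<bar> ^ p + 1 > 0" by (simp add: add_nonneg_pos)
  have "\<delta> > 0" using \<open>\<epsilon> > 0\<close> pos by (simp add: \<delta>_def)
  obtain u where u: "u \<in> \<A>" "u \<in> borel_measurable M" "integrable M (\<lambda>x. \<bar>f x - u x\<bar> ^ p)"
    "(\<integral>x. \<bar>f x - u x\<bar> ^ p \<partial>M) < \<delta>" using assms(1) \<open>\<delta> > 0\<close> unfolding Lp_closure_def by blast
  have *: "\<bar>a * f x - a * u x\<bar> ^ p = \<bar>a\<bar> ^ p * \<bar>f x - u x\<bar> ^ p" for x
    by (simp add: power_mult_distrib[symmetric] abs_mult[symmetric] algebra_simps)
  have "\<bar>a\<bar> ^ p * (\<integral>x. \<bar>f x - u x\<bar> ^ p \<partial>M) \<le> \<bar>a\<bar> ^ p * \<delta>"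
    using u(4) by (intro mult_left_mono) auto
  also have "\<dots> < (\<bar>a\<bar> ^ p + 1) * \<delta>" using \<open>\<delta> > 0\<close> by (simp add: algebra_simps)
  also have "\<dots> = \<epsilon>" using pos by (simp add: \<delta>_def)
  finally have "(\<integral>x. \<bar>a * f x - a * u x\<bar> ^ p \<partial>M) < \<epsilon>" unfolding * by simp
  then show "\<exists>w\<in>\<A>. w \<in> borel_measurable M \<and>
      integrable M (\<lambda>x. \<bar>a * f x - w x\<bar> ^ p) \<and> (\<integral>x. \<bar>a * f x - w x\<bar> ^ p \<partial>M) < \<epsilon>"
    using u scale_mem[OF u(1), of a] * by (intro bexI[of _ "\<lambda>x. a * u x"]) auto
qed (use assms in \<open>auto simp: Lp_closure_def\<close>)

lemma Lp_closure_sum: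
  assumes "finite I" "p > 0" "\<And>i. i \<in> I \<Longrightarrow> f i \<in> Lp_closure M p \<A>"
  shows "(\<lambda>x. \<Sum>i\<in>I. c i * f i x) \<in> Lp_closure M p \<A>"
  using assms(1,3)
proof (induction I rule: finite_induct)
  case empty
  then show ?case using Lp_closure_base[OF zero_mem _ assms(2)] by simp
next
  case (insert i I)
  then show ?case
    using Lp_closure_add[OF Lp_closure_scale[of "f i" M p "c i"], of "\<lambda>x. \<Sum>i\<in>I. c i * f i x"] by simp
qed

text \<open>Simple functions F i with |F i| \<le> 2 |f| converge pointwise to f, and each is a
  finite combination of indicators. Dominated convergence applies because |f - F i| \<le> 3
  |f|.\<close>

lemma Lp_closure_from_indicators:
  assumes p: "p > 0" and f: "f \<in> borel_measurable M" "integrable M (\<lambda>x. \<bar>f x\<bar> ^ p)"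
    and ind: "\<And>A. A \<in> sets M \<Longrightarrow> indicator A \<in> Lp_closure M p \<A>"
  shows "f \<in> Lp_closure M p \<A>"
proof -
  obtain F where F: "\<And>i. simple_function M (F i)" "\<And>x. x \<in> space M \<Longrightarrow> (\<lambda>i. F i x) \<longlonglongrightarrow> f x"
    "\<And>i x. x \<in> space M \<Longrightarrow> dist (F i x) 0 \<le> 2 * dist (f x) 0"
    using borel_measurable_implies_sequence_metric[OF f(1), of 0] by blast
  show ?thesis
  proof (rule Lp_closure_dominated[OF f(1) p])
    fix i
    define s where "s = (\<lambda>x. \<Sum>y\<in>F i ` space M. y * indicator (F i -` {y} \<inter> space M) x)"
    have "s \<in> Lp_closure M p \<A>"
      unfolding s_def
      by (rule Lp_closure_sum) (use F(1)[of i] p ind in \<open>auto simp: simple_function_def\<close>)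
    moreover have eq: "s x = F i x" if "x \<in> space M" for x
    proof -
      have fin: "finite (F i ` space M)" using F(1)[of i] by (simp add: simple_function_def)
      have "s x = (\<Sum>y\<in>F i ` space M. if y = F i x then y else 0)"
        unfolding s_def by (rule sum.cong) (use that in \<open>auto simp: indicator_def\<close>)
      also have "\<dots> = F i x" using fin that by (simp add: sum.delta)
      finally show ?thesis .
    qed
    ultimately have "s \<in> Lp_closure M p \<A>" "\<And>x. x \<in> space M \<Longrightarrow> F i x = s x" by auto
    moreover have "F i \<in> borel_measurable M" using F(1) by (rule borel_measurable_simple_function)
    ultimately show "F i \<in> Lp_closure M p \<A>"
      unfolding Lp_closure_def
      by (auto cong: Bochner_Integration.integral_cong Bochner_Integration.integrable_cong)
  next
    show "AE x in M. (\<lambda>i. F i x) \<longlonglongrightarrow> f x" using F(2) by (intro AE_I2)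
    show "integrable M (\<lambda>x. 3 ^ p * \<bar>f x\<bar> ^ p)" using f(2) by simp
    fix i
    show "AE x in M. \<bar>f x - F i x\<bar> ^ p \<le> 3 ^ p * \<bar>f x\<bar> ^ p"
    proof (rule AE_I2)
      fix x assume "x \<in> space M"
      then have "\<bar>f x - F i x\<bar> \<le> 3 * \<bar>f x\<bar>" using F(3)[of x i] by (simp add: dist_real_def)
      then have "\<bar>f x - F i x\<bar> ^ p \<le> (3 * \<bar>f x\<bar>) ^ p" by (intro power_mono) auto
      then show "\<bar>f x - F i x\<bar> ^ p \<le> 3 ^ p * \<bar>f x\<bar> ^ p" by (simp add: power_mult_distrib)
    qed
  qed
qed

end

lemma AE_lebesgue_on_negligible:
  assumes "negligible N" "S \<in> sets lebesgue"
  shows "AE x in lebesgue_on S. x \<notin> N"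
proof -
  have "N \<in> null_sets lebesgue" using assms(1) by (simp add: negligible_iff_null_sets)
  then have "AE x in lebesgue. x \<notin> N" by (rule AE_not_in)
  then have "AE x in lebesgue. x \<in> S \<longrightarrow> x \<notin> N" by eventually_elim simp
  then show ?thesis using assms(2) by (subst AE_restrict_space_iff) auto
qed

text \<open>Stone-Weierstrass with a weight s that may vanish at the ends of the interval. The
  indicator is an a.e. limit of continuous functions; these are divided by s, the quotient is
  approximated uniformly from the ring R, and multiplying by s leads back. The weight is needed
  because sines vanish at the endpoints and hence do not contain the constants.\<close>

lemma indicator_in_Lp_closure:
  fixes S :: "real set"
  assumes R: "function_ring_on R {a..b}"
    and S: "S \<in> lmeasurable" "S \<subseteq> {a..b}" and p: "p > 0"
    and s: "continuous_on {a..b} s" "\<And>x. x \<in> {a..b} \<Longrightarrow> 0 \<le> s x" "\<And>x. x \<in> {a..b} \<Longrightarrow> s x \<le> 1"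
      "\<And>x. x \<in> S \<Longrightarrow> 0 < s x"
    and \<A>: "\<And>r. r \<in> R \<Longrightarrow> (\<lambda>x. s x * r x) \<in> \<A>"
    and A: "A \<in> sets (lebesgue_on S)"
  shows "indicator A \<in> Lp_closure (lebesgue_on S) p \<A>"
proof -
  have S': "S \<in> sets lebesgue" using S(1) by (rule fmeasurableD)
  have AS: "A \<in> sets lebesgue" "A \<subseteq> S" using A S' by (auto simp: sets_restrict_space_iff)
  have "(indicator A :: real \<Rightarrow> real) measurable_on UNIV"
    using AS by (simp add: measurable_on_iff_borel_measurable)
  then obtain N and g :: "nat \<Rightarrow> real \<Rightarrow> real" where N: "negligible N" and g: "\<And>n. continuous_on UNIV (g n)"
    "\<And>x. x \<notin> N \<Longrightarrow> (\<lambda>n. g n x) \<longlonglongrightarrow> indicator A x"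
    unfolding measurable_on_def by auto
  \<comment> \<open>Clamping to [0,1] does not disturb convergence to an indicator and yields a
    uniform bound for dominated convergence.\<close>
  define h where "h n x = max 0 (min 1 (g n x))" for n :: nat and x :: real
  \<comment> \<open>The divisor is cut off at 1/(n+1) to keep Q continuous where s vanishes. At each
    point of S the cutoff is eventually inactive, and then s Q = h.\<close>
  define Q where "Q n x = h n x / max (s x) (1 / real (Suc n))" for n x
  have pos: "max (s x) (1 / real (Suc n)) > 0" for x n by (simp add: less_max_iff_disj)
  have hc: "continuous_on {a..b} (h n)" for n
    unfolding h_def by (intro continuous_intros continuous_on_subset[OF g(1)]) auto
  have Qc: "continuous_on {a..b} (Q n)" for n
    unfolding Q_def by (intro continuous_intros hc s(1)) (use pos in \<open>auto simp: less_imp_neq[symmetric]\<close>)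
  have "\<exists>r\<in>R. \<forall>x\<in>{a..b}. \<bar>Q n x - r x\<bar> < 1 / real (Suc n)" for n
    by (rule function_ring_on.Stone_Weierstrass_basic[OF R Qc]) simp
  then obtain r where r: "\<And>n. r n \<in> R" "\<And>n x. x \<in> {a..b} \<Longrightarrow> \<bar>Q n x - r n x\<bar> < 1 / real (Suc n)"
    by metis
  define u where "u n x = s x * r n x" for n x
  have uc: "continuous_on {a..b} (u n)" for n
    unfolding u_def by (intro continuous_intros s(1) function_ring_on.continuous[OF R r(1)])
  have um: "u n \<in> borel_measurable (lebesgue_on S)" for n
    by (rule continuous_imp_measurable_on_sets_lebesgue[OF continuous_on_subset[OF uc S(2)] S'])
  have uQ: "\<bar>s x * Q n x - u n x\<bar> \<le> 1 / real (Suc n)" if "x \<in> {a..b}" for n x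
  proof -
    have "\<bar>s x * Q n x - u n x\<bar> = s x * \<bar>Q n x - r n x\<bar>"
      using s(2)[OF that] by (simp add: u_def right_diff_distrib[symmetric] abs_mult)
    also have "\<dots> \<le> 1 * (1 / real (Suc n))"
      using s(2,3)[OF that] r(2)[OF that, of n] by (intro mult_mono) auto
    finally show ?thesis by simp
  qed
  have sQ: "0 \<le> s x * Q n x \<and> s x * Q n x \<le> 1" if "x \<in> {a..b}" for n x
  proof -
    have "s x * h n x \<le> max (s x) (1 / real (Suc n)) * 1"
      using s(2)[OF that] by (intro mult_mono) (auto simp: h_def)
    moreover have "0 \<le> s x * h n x" using s(2)[OF that] by (simp add: h_def)
    ultimately show ?thesis using pos[of x n] by (simp add: Q_def field_simps)
  qed
  interpret finite_measure "lebesgue_on S" by (rule finite_measure_lebesgue_on[OF S(1)])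
  show ?thesis
  proof (rule Lp_closure_dominated[OF _ p])
    show "(indicator A :: real \<Rightarrow> real) \<in> borel_measurable (lebesgue_on S)"
      using A by simp
    show "u n \<in> Lp_closure (lebesgue_on S) p \<A>" for n
      by (rule Lp_closure_base[OF _ um p]) (use \<A>[OF r(1)] in \<open>simp add: u_def[abs_def]\<close>)
    show "AE x in lebesgue_on S. (\<lambda>n. u n x) \<longlonglongrightarrow> indicator A x"
      using AE_lebesgue_on_negligible[OF N S'] AE_space
    proof eventually_elim
      case (elim x)
      then have x: "x \<in> S" "x \<in> {a..b}" using S by auto
      have "(\<lambda>n. h n x) \<longlonglongrightarrow> max 0 (min 1 (indicator A x))"
        unfolding h_def by (intro tendsto_intros g(2) elim(1))
      moreover have "max 0 (min 1 (indicator A x)) = (indicator A x :: real)" by (auto simp: indicator_def)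
      ultimately have hl: "(\<lambda>n. h n x) \<longlonglongrightarrow> indicator A x" by simp
      have "(\<lambda>n. 1 / real (Suc n)) \<longlonglongrightarrow> 0" using LIMSEQ_inverse_real_of_nat by (simp add: inverse_eq_divide)
      then have "\<forall>\<^sub>F n in sequentially. 1 / real (Suc n) < s x"
        using s(4)[OF x(1)] by (rule order_tendstoD)
      then have "\<forall>\<^sub>F n in sequentially. h n x = s x * Q n x"
        by eventually_elim (use s(4)[OF x(1)] in \<open>auto simp: Q_def max_def\<close>)
      then have 1: "(\<lambda>n. s x * Q n x) \<longlonglongrightarrow> indicator A x" using hl by (rule Lim_transform_eventually[rotated])
      have 2: "(\<lambda>n. s x * Q n x - u n x) \<longlonglongrightarrow> 0"
        by (rule tendsto_rabs_zero_cancel, rule tendsto_sandwich[OF _ _ tendsto_const \<open>(\<lambda>n. 1 / real (Suc n)) \<longlonglongrightarrow> 0\<close>])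
          (use uQ[OF x(2)] in auto)
      show ?case using tendsto_diff[OF 1 2] by simp
    qed
    show "integrable (lebesgue_on S) (\<lambda>x. 3 ^ p)" by simp
    show "AE x in lebesgue_on S. \<bar>indicator A x - u n x\<bar> ^ p \<le> 3 ^ p" for n
    proof (rule AE_I2)
      fix x assume "x \<in> space (lebesgue_on S)"
      then have x: "x \<in> {a..b}" using S by auto
      have "\<bar>s x * Q n x - u n x\<bar> \<le> 1" using uQ[OF x, of n] by (rule order_trans) simp
      moreover have "0 \<le> indicat_real A x" "indicat_real A x \<le> 1" by (auto simp: indicator_def)
      ultimately have "\<bar>indicator A x - u n x\<bar> \<le> 3"
        using sQ[OF x, of n] by linarith
      then show "\<bar>indicator A x - u n x\<bar> ^ p \<le> 3 ^ p" by (intro power_mono) auto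
    qed
  qed
qed

lemma Hsp_iff: "u \<in> Hsp l \<longleftrightarrow> sqint (Ivl l) u"
  by (simp add: Lp_def sqint_def)

lemma Hnorm_eq: "Hnorm l u = sqrt (\<integral>x. (u x)\<^sup>2 \<partial>Ivl l)"
  by (simp add: Lnorm_def sqrt_def)

lemma Hnorm_sq: "(Hnorm l u)\<^sup>2 = (\<integral>x. (u x)\<^sup>2 \<partial>Ivl l)"
  by (simp add: Hnorm_eq)

lemma Hnorm_nonneg: "0 \<le> Hnorm l u"
  by (simp add: Hnorm_eq)

section \<open>The sine basis\<close>

locale interval =
  fixes l :: real
  assumes l_pos: "l > 0"
begin

text \<open>The numbers (mu k)^2 are the Dirichlet eigenvalues of the negative second derivative on
  an interval of length 2 l. \<open>Suc k\<close> makes index 0 the lowest mode.\<close>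

definition mu :: "nat \<Rightarrow> real"
  where "mu k = pi * real (Suc k) / (2 * l)"

text \<open>Division by sqrt l normalises in L^2: over a length 2 l, a whole number of half periods,
  the squared sine has integral l.\<close>

definition sb :: "nat \<Rightarrow> real \<Rightarrow> real"
  where "sb k x = sin (mu k * (x + l)) / sqrt l"

definition sb' :: "nat \<Rightarrow> real \<Rightarrow> real"
  where "sb' k x = mu k * cos (mu k * (x + l)) / sqrt l"

lemma mu_pos: "mu k > 0"
  using l_pos by (simp add: mu_def)

lemma mu_inj: "mu j = mu k \<longleftrightarrow> j = k"
  using l_pos by (simp add: mu_def)

lemma sb_has_derivative [derivative_intros]: "(sb k has_real_derivative sb' k x) (at x within S)"
proof -
  have "((\<lambda>x. sin (mu k * (x + l))) has_real_derivative mu k * cos (mu k * (x + l))) (at x within S)"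
    by (auto intro!: derivative_eq_intros)
  from DERIV_cdivide[OF this, of "sqrt l"] show ?thesis by (simp add: sb_def[abs_def] sb'_def)
qed

lemma sb'_has_derivative: "(sb' k has_real_derivative - (mu k)\<^sup>2 * sb k x) (at x within S)"
proof -
  have "((\<lambda>x. mu k * cos (mu k * (x + l))) has_real_derivative - (mu k)\<^sup>2 * sin (mu k * (x + l))) (at x within S)"
    by (auto intro!: derivative_eq_intros simp: power2_eq_square)
  from DERIV_cdivide[OF this, of "sqrt l"] show ?thesis by (simp add: sb_def sb'_def[abs_def])
qed

lemma sb_continuous [continuous_intros]: "continuous_on S (sb k)"
  by (rule DERIV_continuous_on[OF sb_has_derivative])

lemma sb'_continuous [continuous_intros]: "continuous_on S (sb' k)"
  by (rule DERIV_continuous_on[OF sb'_has_derivative])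

lemma mu_2l: "mu k * (2 * l) = real (Suc k) * pi"
  using l_pos by (simp add: mu_def)

lemma sb_ends [simp]: "sb k l = 0" "sb k (-l) = 0"
proof -
  have "mu k * (l + l) = real (Suc k) * pi" using mu_2l[of k] by (simp add: algebra_simps)
  then show "sb k l = 0" by (simp only: sb_def sin_npi div_0)
qed (simp add: sb_def)

lemma abs_sb_le: "\<bar>sb k x\<bar> \<le> 1 / sqrt l"
  using l_pos by (simp add: sb_def abs_mult divide_right_mono)

lemma abs_sb'_le: "\<bar>sb' k x\<bar> \<le> mu k / sqrt l"
proof -
  have "\<bar>sb' k x\<bar> = mu k * \<bar>cos (mu k * (x + l))\<bar> / sqrt l"
    using l_pos mu_pos[of k] by (simp add: sb'_def abs_mult)
  also have "\<dots> \<le> mu k * 1 / sqrt l"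
    using l_pos mu_pos[of k] by (intro divide_right_mono mult_left_mono) auto
  finally show ?thesis by simp
qed

lemma sqint_cont: "continuous_on {-l..l} f \<Longrightarrow> sqint (Ivl l) f"
  by (rule continuous_imp_sqint_Ivl)

lemma sqint_sb: "sqint (Ivl l) (sb k)" and sqint_sb': "sqint (Ivl l) (sb' k)"
  by (intro sqint_cont continuous_intros)+

lemmas int_cont = continuous_imp_integrable_Ivl(1)

text \<open>One integration by parts expresses the derivative product by (mu i)^2 times the plain
  product. By symmetry (mu j)^2 serves as well, which forces orthogonality for i \<noteq> j. The
  norm then follows from sin^2 + cos^2 = 1.\<close>

lemma sb_orthonormal: "(\<integral>x. sb i x * sb j x \<partial>Ivl l) = (if i = j then 1 else 0)"
  and sb'_orthogonal: "(\<integral>x. sb' i x * sb' j x \<partial>Ivl l) = (if i = j then (mu i)\<^sup>2 else 0)"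
proof -
  have A: "(\<integral>x. sb' i x * sb' j x \<partial>Ivl l) = (mu i)\<^sup>2 * (\<integral>x. sb i x * sb j x \<partial>Ivl l)" for i j
  proof -
    have "(\<integral>x. sb' i x * sb' j x - (mu i)\<^sup>2 * (sb i x * sb j x) \<partial>Ivl l) = sb' i l * sb j l - sb' i (-l) * sb j (-l)"
      by (rule integral_Ivl_FTC)
        (use l_pos in \<open>auto intro!: continuous_intros derivative_eq_intros sb'_has_derivative\<close>)
    moreover have "integrable (Ivl l) (\<lambda>x. sb' i x * sb' j x)" "integrable (Ivl l) (\<lambda>x. sb i x * sb j x)"
      by (intro int_cont continuous_intros)+
    ultimately show ?thesis by simp
  qed
  have off: "(\<integral>x. sb i x * sb j x \<partial>Ivl l) = 0" if "i \<noteq> j" for i j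
  proof -
    have "(mu i)\<^sup>2 * (\<integral>x. sb i x * sb j x \<partial>Ivl l) = (mu j)\<^sup>2 * (\<integral>x. sb i x * sb j x \<partial>Ivl l)"
      using A[of i j] A[of j i] by (simp add: mult.commute)
    moreover have "(mu i)\<^sup>2 \<noteq> (mu j)\<^sup>2"
      using that mu_inj[of i j] mu_pos[of i] mu_pos[of j] by (simp add: power2_eq_iff)
    ultimately show ?thesis by simp
  qed
  have on: "(\<integral>x. sb i x * sb i x \<partial>Ivl l) = 1" for i
  proof -
    have pt: "(mu i)\<^sup>2 * (sb i x * sb i x) + sb' i x * sb' i x = (mu i)\<^sup>2 / l" for x
    proof -
      define s c where "s = sin (mu i * (x + l))" and "c = cos (mu i * (x + l))"
      have sc: "s * s + c * c = 1"
        using sin_cos_squared_add[of "mu i * (x + l)"] by (simp add: s_def c_def power2_eq_square)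
      have "(mu i)\<^sup>2 * (sb i x * sb i x) + sb' i x * sb' i x =
        (mu i)\<^sup>2 * (s * s + c * c) / (sqrt l * sqrt l)"
        unfolding sb_def sb'_def s_def[symmetric] c_def[symmetric]
        by (simp add: power2_eq_square add_divide_distrib algebra_simps)
      then show ?thesis using l_pos by (simp add: sc)
    qed
    have "(mu i)\<^sup>2 * (\<integral>x. sb i x * sb i x \<partial>Ivl l) + (\<integral>x. sb' i x * sb' i x \<partial>Ivl l) =
      (\<integral>x. (mu i)\<^sup>2 * (sb i x * sb i x) + sb' i x * sb' i x \<partial>Ivl l)"
    proof -
      have "integrable (Ivl l) (\<lambda>x. sb' i x * sb' i x)" "integrable (Ivl l) (\<lambda>x. sb i x * sb i x)"
        by (intro int_cont continuous_intros)+
      then show ?thesis by simp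
    qed
    also have "\<dots> = (\<integral>x. (mu i)\<^sup>2 / l \<partial>Ivl l)" by (simp only: pt)
    also have "\<dots> = 2 * (mu i)\<^sup>2"
      using l_pos by (subst continuous_imp_integrable_Ivl(2)) auto
    finally show ?thesis using A[of i i] mu_pos[of i] by simp
  qed
  show "(\<integral>x. sb i x * sb j x \<partial>Ivl l) = (if i = j then 1 else 0)" using off on by auto
  then show "(\<integral>x. sb' i x * sb' j x \<partial>Ivl l) = (if i = j then (mu i)\<^sup>2 else 0)" using A by auto
qed

definition sp :: "nat \<Rightarrow> (nat \<Rightarrow> real) \<Rightarrow> real \<Rightarrow> real"
  where "sp N c x = (\<Sum>k<N. c k * sb k x)"

definition sp' :: "nat \<Rightarrow> (nat \<Rightarrow> real) \<Rightarrow> real \<Rightarrow> real"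
  where "sp' N c x = (\<Sum>k<N. c k * sb' k x)"

definition sines :: "(real \<Rightarrow> real) set"
  where "sines = {sp N c | N c. True}"

lemma sp_continuous [continuous_intros]: "continuous_on S (sp N c)"
  unfolding sp_def by (intro continuous_intros)

lemma sp'_continuous [continuous_intros]: "continuous_on S (sp' N c)"
  unfolding sp'_def by (intro continuous_intros)

lemma sp_has_derivative: "(sp N c has_real_derivative sp' N c x) (at x within S)"
  unfolding sp_def sp'_def by (auto intro!: derivative_eq_intros simp: mult.commute)

lemma sp'_has_derivative:
  "(sp' N c has_real_derivative sp N (\<lambda>k. - (mu k)\<^sup>2 * c k) x) (at x within S)"
  unfolding sp_def sp'_def
  by (auto intro!: derivative_eq_intros sb'_has_derivative sum.cong simp: ac_simps)

lemma sp_ends [simp]: "sp N c l = 0" "sp N c (-l) = 0"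
  by (simp_all add: sp_def)

lemma sp_pad: "N \<le> N' \<Longrightarrow> sp N c = sp N' (\<lambda>k. if k < N then c k else 0)"
  unfolding sp_def by (rule ext, rule sum.mono_neutral_cong_left) auto

lemma sp_add: "sp N c x + sp N d x = sp N (\<lambda>k. c k + d k) x"
  by (simp add: sp_def sum.distrib algebra_simps)

lemma sp_scale: "a * sp N c x = sp N (\<lambda>k. a * c k) x"
  by (simp add: sp_def sum_distrib_left mult.assoc)

sublocale sines: function_subspace sines
proof
  show "(\<lambda>x. 0) \<in> sines" unfolding sines_def by (auto simp: sp_def fun_eq_iff intro!: exI[of _ "0::nat"])
  show "(\<lambda>x. a * u x) \<in> sines" if u: "u \<in> sines" for u a
  proof -
    obtain N c where "u = sp N c" using u by (auto simp: sines_def)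
    then have "(\<lambda>x. a * u x) = sp N (\<lambda>k. a * c k)" by (simp add: sp_scale fun_eq_iff)
    then show ?thesis unfolding sines_def by blast
  qed
  show "(\<lambda>x. u x + v x) \<in> sines" if uv: "u \<in> sines" "v \<in> sines" for u v
  proof -
    obtain N c M d where u: "u = sp N c" and v: "v = sp M d" using uv by (auto simp: sines_def)
    have "u = sp (max N M) (\<lambda>k. if k < N then c k else 0)" "v = sp (max N M) (\<lambda>k. if k < M then d k else 0)"
      by (auto simp only: u v intro!: sp_pad)
    then show ?thesis unfolding sines_def by (auto simp: sp_add)
  qed
qed

lemma sb_in_sines: "sb k \<in> sines"
proof -
  have "sb k = sp (Suc k) (\<lambda>j. if j = k then 1 else 0)"
    by (auto simp: sp_def fun_eq_iff if_distrib[of "\<lambda>c. c * _"] sum.delta cong: if_cong)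
  then show ?thesis unfolding sines_def by blast
qed

lemma mu_eq: "mu k = real (Suc k) * mu 0"
  by (simp add: mu_def)

text \<open>Product-to-sum formula: cos \<theta> sin(k\<theta>) is half the sum of
  sin((k+1)\<theta>) and sin((k-1)\<theta>). The sine span is thus a module over polynomials in cos
  \<theta>.\<close>

lemma sines_mult_cos:
  assumes "u \<in> sines" shows "(\<lambda>x. cos (mu 0 * (x + l)) * u x) \<in> sines"
proof -
  have sbc: "(\<lambda>x. cos (mu 0 * (x + l)) * sb k x) \<in> sines" for k
  proof (cases k)
    \<comment> \<open>Index 0 is sin \<theta> itself; its lower neighbour would be sin 0, so only
      the doubling formula remains.\<close>
    case 0
    have "cos (mu 0 * (x + l)) * sb 0 x = (1/2) * sb 1 x" for x
    proof -
      have "mu 1 * (x + l) = 2 * (mu 0 * (x + l))" using mu_eq[of 1] by simp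
      then show ?thesis by (simp only: sb_def sin_double) simp
    qed
    then have "(\<lambda>x. cos (mu 0 * (x + l)) * sb 0 x) = (\<lambda>x. (1/2) * sb 1 x)" by (rule ext)
    then show ?thesis using sines.scale_mem[OF sb_in_sines[of 1], of "1/2"] 0 by metis
  next
    case (Suc j)
    have "cos (mu 0 * (x + l)) * sb k x = (1/2) * sb (Suc k) x + (1/2) * sb j x" for x
    proof -
      have "mu (Suc k) * (x + l) = mu k * (x + l) + mu 0 * (x + l)"
        "mu j * (x + l) = mu k * (x + l) - mu 0 * (x + l)"
        using mu_eq[of "Suc k"] mu_eq[of k] mu_eq[of j] Suc by (simp_all add: algebra_simps)
      then show ?thesis by (simp only: sb_def sin_add sin_diff) (simp add: add_divide_distrib diff_divide_distrib)
    qed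
    then show ?thesis
      using sines.add_mem[OF sines.scale_mem[OF sb_in_sines[of "Suc k"], of "1/2"]
        sines.scale_mem[OF sb_in_sines[of j], of "1/2"]] by simp
  qed
  obtain N c where u: "u = sp N c" using assms by (auto simp: sines_def)
  have "(\<lambda>x. \<Sum>k\<in>{..<N}. c k * (cos (mu 0 * (x + l)) * sb k x)) \<in> sines"
    by (rule sines.sum_mem) (auto intro: sbc)
  moreover have "(\<lambda>x. \<Sum>k\<in>{..<N}. c k * (cos (mu 0 * (x + l)) * sb k x)) = (\<lambda>x. cos (mu 0 * (x + l)) * u x)"
    by (simp add: u sp_def sum_distrib_left mult.left_commute)
  ultimately show ?thesis by simp
qed

lemma sin_poly_cos_in_sines: "(\<lambda>x. sin (mu 0 * (x + l)) * poly p (cos (mu 0 * (x + l)))) \<in> sines"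
proof (induction p)
  case 0
  then show ?case by (simp add: sines.zero_mem)
next
  case (pCons a p)
  have "(\<lambda>x. (a * sqrt l) * sb 0 x) \<in> sines" by (rule sines.scale_mem[OF sb_in_sines])
  then have "(\<lambda>x. a * sin (mu 0 * (x + l))) \<in> sines" using l_pos by (simp add: sb_def)
  from sines.add_mem[OF this sines_mult_cos[OF pCons.IH]] show ?case
    by (simp add: algebra_simps)
qed

lemma theta_range: "x \<in> {-l..l} \<Longrightarrow> mu 0 * (x + l) \<in> {0..pi}"
  using mult_left_mono[of "x + l" "2 * l" "mu 0"] mu_2l[of 0] mu_pos[of 0] by auto

text \<open>The sine span is no ring, so Stone-Weierstrass is applied to polynomials in cos \<theta>
  with weight sin \<theta>; \<open>sin_poly_cos_in_sines\<close> brings the products back into the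
  span. Points are separated because \<theta> = mu 0 (x + l) ranges over [0,pi], where cos is
  injective.\<close>

lemma sines_Lp_dense:
  assumes p: "p > 0" and f: "f \<in> borel_measurable (Ivl l)" "integrable (Ivl l) (\<lambda>x. \<bar>f x\<bar> ^ p)"
  shows "f \<in> Lp_closure (Ivl l) p sines"
proof (rule sines.Lp_closure_from_indicators[OF p f])
  fix A assume A: "A \<in> sets (Ivl l)"
  let ?R = "{\<lambda>x. poly q (cos (mu 0 * (x + l))) | q. True}"
  have cont: "continuous_on S (\<lambda>x. cos (mu 0 * (x + l)))" for S :: "real set"
    by (intro continuous_intros)
  have R: "function_ring_on ?R {-l..l}"
  proof
    show "continuous_on {-l..l} f" if "f \<in> ?R" for f
      using that by (auto intro!: continuous_on_poly cont)
    show "(\<lambda>x. f x + g x) \<in> ?R" if fg: "f \<in> ?R" "g \<in> ?R" for f g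
    proof -
      obtain p q where "f = (\<lambda>x. poly p (cos (mu 0 * (x + l))))" "g = (\<lambda>x. poly q (cos (mu 0 * (x + l))))"
        using fg by auto
      then show ?thesis by (auto intro!: exI[of _ "p + q"])
    qed
    show "(\<lambda>x. f x * g x) \<in> ?R" if fg: "f \<in> ?R" "g \<in> ?R" for f g
    proof -
      obtain p q where "f = (\<lambda>x. poly p (cos (mu 0 * (x + l))))" "g = (\<lambda>x. poly q (cos (mu 0 * (x + l))))"
        using fg by auto
      then show ?thesis by (auto intro!: exI[of _ "p * q"])
    qed
    show "(\<lambda>_. c) \<in> ?R" for c by (auto intro!: exI[of _ "[:c:]"])
    show "\<exists>f\<in>?R. f x \<noteq> f y" if "x \<in> {-l..l}" "y \<in> {-l..l}" "x \<noteq> y" for x y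
    proof -
      have "cos (mu 0 * (x + l)) \<noteq> cos (mu 0 * (y + l))"
        using that theta_range[of x] theta_range[of y] mu_pos[of 0] by (auto dest!: cos_inj_pi[rotated 4])
      then show ?thesis
        by (intro bexI[of _ "\<lambda>x. poly [:0, 1:] (cos (mu 0 * (x + l)))"]) (simp, blast)
    qed
  qed auto
  show "indicator A \<in> Lp_closure (Ivl l) p sines"
  proof (rule indicator_in_Lp_closure[OF R _ _ p, where s = "\<lambda>x. sin (mu 0 * (x + l))"])
    show "continuous_on {-l..l} (\<lambda>x. sin (mu 0 * (x + l)))" by (intro continuous_intros)
    show "0 \<le> sin (mu 0 * (x + l))" if "x \<in> {-l..l}" for x
      using theta_range[OF that] by (intro sin_ge_zero) auto
    show "0 < sin (mu 0 * (x + l))" if "x \<in> {-l<..<l}" for x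
      using that mu_pos[of 0] mu_2l[of 0] mult_strict_left_mono[of "x + l" "2 * l" "mu 0"]
      by (intro sin_gt_zero) auto
    show "(\<lambda>x. sin (mu 0 * (x + l)) * r x) \<in> sines" if "r \<in> ?R" for r
      using that by (auto intro: sin_poly_cos_in_sines)
  qed (use A in auto)
qed

subsection \<open>Parseval's identity\<close>

definition coef :: "(real \<Rightarrow> real) \<Rightarrow> nat \<Rightarrow> real"
  where "coef h k = (\<integral>x. h x * sb k x \<partial>Ivl l)"

lemma sp_inner:
  assumes "sqint (Ivl l) h"
  shows "(\<integral>x. h x * sp N c x \<partial>Ivl l) = (\<Sum>k<N. c k * coef h k)"
proof -
  have "(\<integral>x. h x * sp N c x \<partial>Ivl l) = (\<integral>x. (\<Sum>k<N. c k * (h x * sb k x)) \<partial>Ivl l)"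
    by (simp add: sp_def sum_distrib_left algebra_simps)
  also have "\<dots> = (\<Sum>k<N. c k * coef h k)"
    unfolding coef_def
    by (subst Bochner_Integration.integral_sum) (use sqint_mult[OF assms sqint_sb] in auto)
  finally show ?thesis .
qed

lemma sqint_sp: "sqint (Ivl l) (sp N c)" and sqint_sp': "sqint (Ivl l) (sp' N c)"
  by (intro sqint_cont continuous_intros)+

lemma coef_sb: "coef (sb j) k = (if j = k then 1 else 0)"
  by (simp add: coef_def sb_orthonormal)

lemma coef_sp: "coef (sp N c) k = (if k < N then c k else 0)"
proof -
  have "coef (sp N c) k = (\<integral>x. sb k x * sp N c x \<partial>Ivl l)" by (simp add: coef_def mult.commute)
  also have "\<dots> = (\<Sum>j<N. c j * coef (sb k) j)" by (rule sp_inner[OF sqint_sb])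
  also have "\<dots> = (\<Sum>j<N. if k = j then c j else 0)" by (rule sum.cong) (auto simp: coef_sb)
  also have "\<dots> = (if k < N then c k else 0)" by (simp add: sum.delta)
  finally show ?thesis .
qed

lemma coef_lin:
  assumes "sqint (Ivl l) u" "sqint (Ivl l) v"
  shows "coef (\<lambda>x. a * u x + b * v x) k = a * coef u k + b * coef v k"
  using sqint_mult[OF assms(1) sqint_sb[of k]] sqint_mult[OF assms(2) sqint_sb[of k]]
  by (simp add: coef_def algebra_simps)

lemma sp_norm: "(\<integral>x. (sp N c x)\<^sup>2 \<partial>Ivl l) = (\<Sum>k<N. (c k)\<^sup>2)"
proof -
  have "(\<integral>x. (sp N c x)\<^sup>2 \<partial>Ivl l) = (\<Sum>k<N. c k * coef (sp N c) k)"
    using sp_inner[OF sqint_sp] by (simp add: power2_eq_square)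
  also have "\<dots> = (\<Sum>k<N. (c k)\<^sup>2)" by (rule sum.cong) (auto simp: coef_sp power2_eq_square)
  finally show ?thesis .
qed

lemma sp'_norm: "(\<integral>x. (sp' N c x)\<^sup>2 \<partial>Ivl l) = (\<Sum>k<N. (mu k)\<^sup>2 * (c k)\<^sup>2)"
proof -
  have FTC: "(\<integral>x. sp' N c x * sp' N c x + sp N c x * sp N (\<lambda>k. - (mu k)\<^sup>2 * c k) x \<partial>Ivl l) =
     sp N c l * sp' N c l - sp N c (-l) * sp' N c (-l)"
    by (rule integral_Ivl_FTC)
      (use l_pos in \<open>auto intro!: continuous_intros derivative_eq_intros sp_has_derivative sp'_has_derivative\<close>)
  have i: "integrable (Ivl l) (\<lambda>x. sp' N c x * sp' N c x)"
     "integrable (Ivl l) (\<lambda>x. sp N c x * sp N (\<lambda>k. - (mu k)\<^sup>2 * c k) x)"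
    by (intro int_cont continuous_intros)+
  have "(\<integral>x. (sp' N c x)\<^sup>2 \<partial>Ivl l) = - (\<integral>x. sp N c x * sp N (\<lambda>k. - (mu k)\<^sup>2 * c k) x \<partial>Ivl l)"
    using FTC i by (simp add: power2_eq_square)
  also have "\<dots> = - (\<Sum>k<N. - (mu k)\<^sup>2 * c k * coef (sp N c) k)"
    by (simp add: sp_inner[OF sqint_sp])
  also have "\<dots> = (\<Sum>k<N. (mu k)\<^sup>2 * (c k)\<^sup>2)"
    unfolding sum_negf[symmetric] by (rule sum.cong) (auto simp: coef_sp power2_eq_square)
  finally show ?thesis .
qed

lemma best_approx:
  assumes h: "sqint (Ivl l) h"
  shows "(\<integral>x. (h x - sp N c x)\<^sup>2 \<partial>Ivl l) =
    (\<integral>x. (h x)\<^sup>2 \<partial>Ivl l) - (\<Sum>k<N. (coef h k)\<^sup>2) + (\<Sum>k<N. (coef h k - c k)\<^sup>2)"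
proof -
  note [simp] = sqint_sq[OF h] sqint_sq[OF sqint_sp] sqint_mult[OF h sqint_sp]
  have "(\<integral>x. (h x - sp N c x)\<^sup>2 \<partial>Ivl l) = (\<integral>x. (h x)\<^sup>2 - 2 * (h x * sp N c x) + (sp N c x)\<^sup>2 \<partial>Ivl l)"
    by (simp add: power2_eq_square algebra_simps)
  also have "\<dots> = (\<integral>x. (h x)\<^sup>2 \<partial>Ivl l) - 2 * (\<Sum>k<N. c k * coef h k) + (\<Sum>k<N. (c k)\<^sup>2)"
    by (simp add: sp_inner[OF h] sp_norm)
  finally have "(\<integral>x. (h x - sp N c x)\<^sup>2 \<partial>Ivl l) =
    (\<integral>x. (h x)\<^sup>2 \<partial>Ivl l) - 2 * (\<Sum>k<N. c k * coef h k) + (\<Sum>k<N. (c k)\<^sup>2)" .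
  moreover have "- 2 * (\<Sum>k<N. c k * coef h k) + (\<Sum>k<N. (c k)\<^sup>2) =
      - (\<Sum>k<N. (coef h k)\<^sup>2) + (\<Sum>k<N. (coef h k - c k)\<^sup>2)"
    by (simp add: power2_diff sum.distrib sum_subtractf sum_distrib_left sum_negf algebra_simps)
  ultimately show ?thesis by linarith
qed

lemma Bessel:
  assumes h: "sqint (Ivl l) h"
  shows "(\<Sum>k<N. (coef h k)\<^sup>2) \<le> (\<integral>x. (h x)\<^sup>2 \<partial>Ivl l)"
proof -
  have "0 \<le> (\<integral>x. (h x - sp N (coef h) x)\<^sup>2 \<partial>Ivl l)" by (intro integral_nonneg_AE) auto
  then show ?thesis using best_approx[OF h, of N "coef h"] by simp
qed

lemma sines_dense_sqint:
  assumes h: "sqint (Ivl l) h" and "\<epsilon> > 0"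
  shows "\<exists>N c. (\<integral>x. (h x - sp N c x)\<^sup>2 \<partial>Ivl l) < \<epsilon>"
proof -
  have "h \<in> Lp_closure (Ivl l) 2 sines"
    by (rule sines_Lp_dense) (use h in \<open>auto simp: sqint_def\<close>)
  then show ?thesis using \<open>\<epsilon> > 0\<close> unfolding Lp_closure_def sines_def by fastforce
qed

text \<open>Density gives some sine polynomial within r of h. By \<open>best_approx\<close> the
  Fourier partial sum of the same length is at least as close, and longer partial sums only
  improve.\<close>

lemma Parseval:
  assumes h: "sqint (Ivl l) h"
  shows "(\<lambda>k. (coef h k)\<^sup>2) sums (\<integral>x. (h x)\<^sup>2 \<partial>Ivl l)"
  unfolding sums_def
proof (rule LIMSEQ_I)
  fix r :: real assume "r > 0"
  obtain N c where N: "(\<integral>x. (h x - sp N c x)\<^sup>2 \<partial>Ivl l) < r" using sines_dense_sqint[OF h \<open>r > 0\<close>] by blast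
  have "norm ((\<Sum>k<n. (coef h k)\<^sup>2) - (\<integral>x. (h x)\<^sup>2 \<partial>Ivl l)) < r" if "n \<ge> N" for n
  proof -
    have "(\<integral>x. (h x)\<^sup>2 \<partial>Ivl l) - (\<Sum>k<N. (coef h k)\<^sup>2) < r"
      using best_approx[OF h, of N c] N sum_nonneg[of "{..<N}" "\<lambda>k. (coef h k - c k)\<^sup>2"] by simp
    moreover have "(\<Sum>k<N. (coef h k)\<^sup>2) \<le> (\<Sum>k<n. (coef h k)\<^sup>2)"
      using that by (intro sum_mono2) auto
    ultimately show ?thesis using Bessel[OF h, of n] by (simp add: abs_if)
  qed
  then show "\<exists>no. \<forall>n\<ge>no. norm ((\<Sum>k<n. (coef h k)\<^sup>2) - (\<integral>x. (h x)\<^sup>2 \<partial>Ivl l)) < r" by blast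
qed

lemma sqint_norm_zero_AE:
  assumes "sqint M h" "(\<integral>x. (h x)\<^sup>2 \<partial>M) = 0"
  shows "AE x in M. h x = 0"
  using assms by (subst (asm) integral_nonneg_eq_0_iff_AE) (auto simp: sqint_def)

lemma coef_zero_imp_AE:
  assumes h: "sqint (Ivl l) h" and "\<And>k. coef h k = 0"
  shows "AE x in Ivl l. h x = 0"
  using sqint_norm_zero_AE[OF h] Parseval[OF h] assms(2) by (simp add: sums_unique2)

lemma coef_abs_le:
  assumes h: "sqint (Ivl l) h" shows "\<bar>coef h k\<bar> \<le> sqrt (\<integral>x. (h x)\<^sup>2 \<partial>Ivl l)"
  using sqint_Cauchy_Schwarz_abs[OF h sqint_sb[of k]] sb_orthonormal[of k k]
  by (simp add: coef_def power2_eq_square)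

lemma coef_cong_AE:
  assumes "AE x in Ivl l. u x = v x" shows "coef u k = coef v k"
  unfolding coef_def by (rule integral_cong_AE_lebesgue_on) (use assms in auto)

lemma Parseval_partial:
  assumes h: "sqint (Ivl l) h"
  shows "(\<lambda>N. (\<integral>x. (h x - sp N (coef h) x)\<^sup>2 \<partial>Ivl l)) \<longlonglongrightarrow> 0"
proof -
  have "(\<lambda>N. (\<integral>x. (h x)\<^sup>2 \<partial>Ivl l) - (\<Sum>k<N. (coef h k)\<^sup>2)) \<longlonglongrightarrow> (\<integral>x. (h x)\<^sup>2 \<partial>Ivl l) - (\<integral>x. (h x)\<^sup>2 \<partial>Ivl l)"
    using Parseval[OF h] unfolding sums_def by (intro tendsto_intros)
  then show ?thesis by (simp add: best_approx[OF h])
qed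

end

section \<open>Weak derivatives and the space V\<close>

text \<open>Keeps the order 1 in \<open>H0 l 1\<close> and \<open>Hk_norm l 1\<close> from becoming
  \<open>Suc 0\<close>, so that rules about V continue to match.\<close>

declare One_nat_def [simp del]

lemma C0inf_derivs:
  assumes "\<phi> \<in> C0inf l"
  shows "((deriv ^^ k) \<phi> has_real_derivative (deriv ^^ Suc k) \<phi> x) (at x within S)"
proof -
  have "(deriv ^^ k) \<phi> differentiable (at x)" using assms by (simp add: C0inf_def)
  then have "((deriv ^^ k) \<phi> has_real_derivative deriv ((deriv ^^ k) \<phi>) x) (at x)"
    by (simp add: DERIV_deriv_iff_real_differentiable)
  then show ?thesis by (simp add: has_field_derivative_at_within)
qed

lemma C0inf_derivative:
  assumes "\<phi> \<in> C0inf l"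
  shows "(\<phi> has_real_derivative deriv \<phi> x) (at x within S)"
    and "(deriv \<phi> has_real_derivative deriv (deriv \<phi>) x) (at x within S)"
  using C0inf_derivs[OF assms, of 0 x S] C0inf_derivs[OF assms, of "Suc 0" x S] by simp_all

lemma C0inf_continuous:
  assumes "\<phi> \<in> C0inf l"
  shows "continuous_on S \<phi>" "continuous_on S (deriv \<phi>)" "continuous_on S (deriv (deriv \<phi>))"
  using DERIV_continuous_on[OF C0inf_derivs[OF assms, of 0]] DERIV_continuous_on[OF C0inf_derivs[OF assms, of "Suc 0"]]
    DERIV_continuous_on[OF C0inf_derivs[OF assms, of 2]] by (simp_all add: numeral_2_eq_2)

lemma C0inf_ends: "\<phi> \<in> C0inf l \<Longrightarrow> \<phi> (-l) = 0 \<and> \<phi> l = 0"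
  by (simp add: C0inf_def)

lemma C0inf_lin:
  assumes \<phi>: "\<phi> \<in> C0inf l" and \<theta>: "\<theta> \<in> C0inf l"
  shows "(\<lambda>x. a * \<phi> x + b * \<theta> x) \<in> C0inf l"
proof -
  have D: "((\<lambda>x. a * (deriv ^^ k) \<phi> x + b * (deriv ^^ k) \<theta> x) has_real_derivative
      a * (deriv ^^ Suc k) \<phi> x + b * (deriv ^^ Suc k) \<theta> x) (at x)" for k x
    by (intro DERIV_add DERIV_cmult C0inf_derivs[OF \<phi>] C0inf_derivs[OF \<theta>])
  have *: "(deriv ^^ k) (\<lambda>x. a * \<phi> x + b * \<theta> x) = (\<lambda>x. a * (deriv ^^ k) \<phi> x + b * (deriv ^^ k) \<theta> x)" for k
  proof (induction k)
    case (Suc k)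
    have "deriv (\<lambda>x. a * (deriv ^^ k) \<phi> x + b * (deriv ^^ k) \<theta> x) x =
        a * (deriv ^^ Suc k) \<phi> x + b * (deriv ^^ Suc k) \<theta> x" for x
      by (rule DERIV_imp_deriv[OF D])
    then show ?case by (intro ext) (simp only: funpow.simps(2) o_apply Suc)
  qed simp
  have "(\<lambda>x. a * (deriv ^^ k) \<phi> x + b * (deriv ^^ k) \<theta> x) differentiable (at x)" for k x
    using D[of k x] by (auto simp: real_differentiable_def simp del: funpow.simps)
  then show ?thesis using assms by (simp add: C0inf_def *)
qed

lemma weak_deriv_iff:
  "weak_deriv l u g \<longleftrightarrow> sqint (Ivl l) g \<and>
    (\<forall>\<phi>\<in>C0inf l. (\<integral>x. u x * deriv \<phi> x \<partial>Ivl l) = - (\<integral>x. g x * \<phi> x \<partial>Ivl l))"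
  by (simp add: weak_deriv_def Hsp_iff)

lemma sqint_cong_AE:
  assumes "AE x in Ivl l. u x = v x" "sqint (Ivl l) u" shows "sqint (Ivl l) v"
proof -
  have "AE x in Ivl l. (u x)\<^sup>2 = (v x)\<^sup>2" using assms(1) by eventually_elim simp
  then show ?thesis
    using assms measurable_cong_AE_lebesgue_on[OF _ _ assms(1)]
      integrable_cong_AE_lebesgue_on[of "{-l<..<l}" "\<lambda>x. (u x)\<^sup>2" "\<lambda>x. (v x)\<^sup>2"]
    by (auto simp: sqint_def)
qed

lemma sq_integral_cong_AE:
  fixes u v :: "real \<Rightarrow> real"
  assumes "AE x in Ivl l. u x = v x" shows "(\<integral>x. (u x)\<^sup>2 \<partial>Ivl l) = (\<integral>x. (v x)\<^sup>2 \<partial>Ivl l)"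
  by (rule integral_cong_AE_lebesgue_on) (use assms in auto)

lemma mult_integral_cong_AE:
  fixes u v w :: "real \<Rightarrow> real"
  assumes "AE x in Ivl l. u x = v x" shows "(\<integral>x. u x * w x \<partial>Ivl l) = (\<integral>x. v x * w x \<partial>Ivl l)"
  by (rule integral_cong_AE_lebesgue_on) (use assms in auto)

lemma weak_deriv_cong:
  assumes "AE x in Ivl l. u x = v x" "weak_deriv l u g" shows "weak_deriv l v g"
  using assms(2) mult_integral_cong_AE[OF assms(1)] by (simp add: weak_deriv_iff)

lemma weak_deriv_lin:
  assumes u: "sqint (Ivl l) u" "weak_deriv l u g" and v: "sqint (Ivl l) v" "weak_deriv l v h"
  shows "weak_deriv l (\<lambda>x. a * u x + b * v x) (\<lambda>x. a * g x + b * h x)"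
  unfolding weak_deriv_iff
proof (intro conjI ballI)
  have g: "sqint (Ivl l) g" and h: "sqint (Ivl l) h" using u v by (auto simp: weak_deriv_iff)
  show "sqint (Ivl l) (\<lambda>x. a * g x + b * h x)" by (rule sqint_lin[OF g h])
  fix \<phi> assume \<phi>: "\<phi> \<in> C0inf l"
  have s: "sqint (Ivl l) \<phi>" "sqint (Ivl l) (deriv \<phi>)"
    by (intro continuous_imp_sqint_Ivl C0inf_continuous[OF \<phi>])+
  note i = sqint_mult[OF u(1) s(2)] sqint_mult[OF v(1) s(2)] sqint_mult[OF g s(1)] sqint_mult[OF h s(1)]
  have "(\<integral>x. (a * u x + b * v x) * deriv \<phi> x \<partial>Ivl l) =
      a * (\<integral>x. u x * deriv \<phi> x \<partial>Ivl l) + b * (\<integral>x. v x * deriv \<phi> x \<partial>Ivl l)"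
    using i by (simp add: distrib_right mult.assoc)
  also have "\<dots> = - (a * (\<integral>x. g x * \<phi> x \<partial>Ivl l) + b * (\<integral>x. h x * \<phi> x \<partial>Ivl l))"
    using u v \<phi> by (simp add: weak_deriv_iff)
  also have "a * (\<integral>x. g x * \<phi> x \<partial>Ivl l) + b * (\<integral>x. h x * \<phi> x \<partial>Ivl l) =
      (\<integral>x. (a * g x + b * h x) * \<phi> x \<partial>Ivl l)"
    using i by (simp add: distrib_right mult.assoc)
  finally show "(\<integral>x. (a * u x + b * v x) * deriv \<phi> x \<partial>Ivl l) = - (\<integral>x. (a * g x + b * h x) * \<phi> x \<partial>Ivl l)" .
qed

lemma weak_deriv_Dx: "weak_deriv l u g \<Longrightarrow> weak_deriv l u (Dx l u)"
  unfolding Dx_def using someI[of "weak_deriv l u" g] by simp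

text \<open>Fundamental theorem for u \<phi> with finitely many exceptional points. Continuity of u
  excludes jumps, and the boundary terms vanish through \<phi>, so u may be nonzero at the ends. The
  kinked test functions for the embeddings rely on this.\<close>

lemma weak_deriv_piecewise:
  assumes l: "l > 0" and S: "finite S" and u: "continuous_on {-l..l} u"
    and d: "\<And>x. x \<in> {-l<..<l} - S \<Longrightarrow> (u has_real_derivative g x) (at x)"
    and g: "sqint (Ivl l) g"
  shows "weak_deriv l u g"
  unfolding weak_deriv_iff
proof (intro conjI ballI g)
  fix \<phi> assume \<phi>: "\<phi> \<in> C0inf l"
  have 1: "((\<lambda>x. u x * deriv \<phi> x + g x * \<phi> x) has_integral (u l * \<phi> l - u (-l) * \<phi> (-l))) {-l..l}"
  proof (rule fundamental_theorem_of_calculus_interior_strong[OF S])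
    show "-l \<le> l" using l by simp
    show "continuous_on {-l..l} (\<lambda>x. u x * \<phi> x)"
      by (intro continuous_intros u C0inf_continuous[OF \<phi>])
    fix x assume "x \<in> {-l<..<l} - S"
    from DERIV_mult[OF d[OF this] C0inf_derivative(1)[OF \<phi>]]
    show "((\<lambda>x. u x * \<phi> x) has_vector_derivative u x * deriv \<phi> x + g x * \<phi> x) (at x)"
      by (simp add: has_real_derivative_iff_has_vector_derivative algebra_simps)
  qed
  have i: "integrable (Ivl l) (\<lambda>x. u x * deriv \<phi> x)" "integrable (Ivl l) (\<lambda>x. g x * \<phi> x)"
    using u g by (auto intro!: sqint_mult continuous_imp_sqint_Ivl C0inf_continuous[OF \<phi>])
  have "(\<integral>x. u x * deriv \<phi> x + g x * \<phi> x \<partial>Ivl l) = integral {-l<..<l} (\<lambda>x. u x * deriv \<phi> x + g x * \<phi> x)"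
    by (rule lebesgue_integral_eq_integral) (use i in auto)
  also have "\<dots> = u l * \<phi> l - u (-l) * \<phi> (-l)"
    using integral_unique[OF 1] by (simp only: integral_open_interval_real)
  also have "\<dots> = 0" using C0inf_ends[OF \<phi>] by simp
  finally show "(\<integral>x. u x * deriv \<phi> x \<partial>Ivl l) = - (\<integral>x. g x * \<phi> x \<partial>Ivl l)"
    using i by simp
qed

lemma weak_deriv_C1:
  assumes l: "l > 0" and g: "continuous_on {-l..l} g"
    and d: "\<And>x. (u has_real_derivative g x) (at x)"
  shows "weak_deriv l u g"
  by (rule weak_deriv_piecewise[OF l, of "{}"])
    (use d g in \<open>auto intro!: continuous_imp_sqint_Ivl DERIV_continuous_on has_field_derivative_at_within[OF d]\<close>)

lemma Hk1_iff: "u \<in> Hk l 1 \<longleftrightarrow> sqint (Ivl l) u \<and> (\<exists>g. weak_deriv l u g)"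
  by (simp add: Hk_def Hsp_iff)

section \<open>Weak derivatives and the V norm through the sine basis\<close>

context interval
begin

lemma trig_in_C0inf_aux:
  assumes "f \<in> {sp N c | c. True} \<union> {sp' N c | c. True}"
  shows "(deriv ^^ k) f \<in> {sp N c | c. True} \<union> {sp' N c | c. True}"
proof (induction k)
  case (Suc k)
  have "deriv (sp N c) = sp' N c" "deriv (sp' N c) = sp N (\<lambda>k. - (mu k)\<^sup>2 * c k)" for c
    by (rule ext, rule DERIV_imp_deriv, rule sp_has_derivative sp'_has_derivative)+
  then show ?case using Suc by force
qed (use assms in simp)

lemma sp_in_C0inf: "sp N c \<in> C0inf l"
proof -
  have "f differentiable (at x)" if "f \<in> {sp N c | c. True} \<union> {sp' N c | c. True}" for f x
    using that by (auto simp: real_differentiable_def intro: sp_has_derivative sp'_has_derivative)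
  moreover have "(deriv ^^ k) (sp N c) \<in> {sp N c | c. True} \<union> {sp' N c | c. True}" for k
    by (rule trig_in_C0inf_aux) blast
  ultimately show ?thesis unfolding C0inf_def by simp
qed

lemma sb_eq_sp: "sb k = sp (Suc k) (\<lambda>j. if j = k then 1 else 0)"
  by (auto simp: sp_def fun_eq_iff if_distrib[of "\<lambda>c. c * _"] sum.delta cong: if_cong)

lemma sb_in_C0inf: "sb k \<in> C0inf l"
  using sp_in_C0inf by (simp add: sb_eq_sp)

lemma deriv_sb: "deriv (sb k) = sb' k"
  by (rule ext, rule DERIV_imp_deriv, rule sb_has_derivative)

lemma weak_deriv_sp: "weak_deriv l (sp N c) (sp' N c)"
  by (rule weak_deriv_C1[OF l_pos]) (intro continuous_intros sp_has_derivative)+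

lemma weak_deriv_sb: "weak_deriv l (sb k) (sb' k)"
  by (rule weak_deriv_C1[OF l_pos]) (intro continuous_intros sb_has_derivative)+

lemma weak_deriv_sb': "weak_deriv l (sb' k) (\<lambda>x. - (mu k)\<^sup>2 * sb k x)"
  by (rule weak_deriv_C1[OF l_pos]) (intro continuous_intros sb'_has_derivative)+

text \<open>Testing with the sines suffices, since they lie in \<open>C0inf l\<close> and are
  complete in L^2. This makes the choice inside \<open>Dx\<close> harmless up to a.e.
  equality.\<close>

lemma weak_deriv_unique:
  assumes g: "weak_deriv l u g" and h: "weak_deriv l u h"
  shows "AE x in Ivl l. g x = h x"
proof -
  have s: "sqint (Ivl l) g" "sqint (Ivl l) h" using g h by (auto simp: weak_deriv_iff)
  have "coef g k = coef h k" for k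
    using g h sb_in_C0inf[of k] unfolding weak_deriv_iff coef_def by force
  then have "coef (\<lambda>x. 1 * g x + (-1) * h x) k = 0" for k using coef_lin[OF s, of 1 "-1" k] by simp
  from coef_zero_imp_AE[OF sqint_lin[OF s] this] show ?thesis by simp
qed

lemma Dx_AE:
  assumes "weak_deriv l u g" shows "AE x in Ivl l. Dx l u x = g x"
  by (rule weak_deriv_unique[OF weak_deriv_Dx assms]) (rule assms)

lemma Vnorm_eq: "Vnorm l u = sqrt ((\<integral>x. (u x)\<^sup>2 \<partial>Ivl l) + (\<integral>x. (Dx l u x)\<^sup>2 \<partial>Ivl l))"
proof -
  have "{..1::nat} = {0, 1}" by auto
  then show ?thesis by (simp add: Hk_norm_def Hnorm_sq One_nat_def)
qed

lemma Vnorm_weak: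
  assumes "weak_deriv l u g"
  shows "Vnorm l u = sqrt ((\<integral>x. (u x)\<^sup>2 \<partial>Ivl l) + (\<integral>x. (g x)\<^sup>2 \<partial>Ivl l))"
  by (simp add: Vnorm_eq sq_integral_cong_AE[OF Dx_AE[OF assms]])

lemma Vnorm_nonneg: "0 \<le> Vnorm l u"
  by (simp add: Hk_norm_def sum_nonneg)

lemma Vsp_iff:
  "u \<in> Vsp l \<longleftrightarrow> sqint (Ivl l) u \<and> (\<exists>g. weak_deriv l u g) \<and>
    (\<exists>\<phi>::nat \<Rightarrow> rfun. (\<forall>j. \<phi> j \<in> C0inf l) \<and> (\<lambda>j. Vnorm l (\<lambda>x. u x - \<phi> j x)) \<longlonglongrightarrow> 0)"
  by (simp add: H0_def Hk1_iff)

lemma VspD: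
  assumes "u \<in> Vsp l" shows "sqint (Ivl l) u" "weak_deriv l u (Dx l u)" "sqint (Ivl l) (Dx l u)"
proof -
  obtain g where g: "weak_deriv l u g" using assms by (auto simp: Vsp_iff)
  show "sqint (Ivl l) u" using assms by (auto simp: Vsp_iff)
  show w: "weak_deriv l u (Dx l u)" by (rule weak_deriv_Dx[OF g])
  show "sqint (Ivl l) (Dx l u)" using w by (simp add: weak_deriv_iff)
qed

lemma C0inf_weak_deriv: "\<phi> \<in> C0inf l \<Longrightarrow> weak_deriv l \<phi> (deriv \<phi>)"
  by (rule weak_deriv_C1[OF l_pos]) (auto intro: C0inf_continuous C0inf_derivative)

lemma C0inf_sqint: "\<phi> \<in> C0inf l \<Longrightarrow> sqint (Ivl l) \<phi>"
  by (auto intro: sqint_cont C0inf_continuous)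

text \<open>Minkowski twice: in L^2 for the functions and for their derivatives, then in the plane
  for the pair of norms.\<close>

lemma Vnorm_lin_le:
  assumes u: "sqint (Ivl l) u" "weak_deriv l u g" and v: "sqint (Ivl l) v" "weak_deriv l v h"
  shows "Vnorm l (\<lambda>x. a * u x + b * v x) \<le> \<bar>a\<bar> * Vnorm l u + \<bar>b\<bar> * Vnorm l v"
proof -
  have g: "sqint (Ivl l) g" and h: "sqint (Ivl l) h" using u v by (auto simp: weak_deriv_iff)
  define p q r s where "p = sqrt (\<integral>x. (u x)\<^sup>2 \<partial>Ivl l)" and "q = sqrt (\<integral>x. (v x)\<^sup>2 \<partial>Ivl l)"
    and "r = sqrt (\<integral>x. (g x)\<^sup>2 \<partial>Ivl l)" and "s = sqrt (\<integral>x. (h x)\<^sup>2 \<partial>Ivl l)"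
  have nn: "0 \<le> p" "0 \<le> q" "0 \<le> r" "0 \<le> s" by (simp_all add: p_def q_def r_def s_def)
  have sc: "sqrt (\<integral>x. (a * w x)\<^sup>2 \<partial>Ivl l) = \<bar>a\<bar> * sqrt (\<integral>x. (w x)\<^sup>2 \<partial>Ivl l)" for a and w :: rfun
    by (simp add: power_mult_distrib real_sqrt_mult)
  have t1: "sqrt (\<integral>x. (a * u x + b * v x)\<^sup>2 \<partial>Ivl l) \<le> \<bar>a\<bar> * p + \<bar>b\<bar> * q"
    using sqint_triangle[OF sqint_scale[OF u(1), of a] sqint_scale[OF v(1), of b]] unfolding sc p_def q_def .
  have t2: "sqrt (\<integral>x. (a * g x + b * h x)\<^sup>2 \<partial>Ivl l) \<le> \<bar>a\<bar> * r + \<bar>b\<bar> * s"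
    using sqint_triangle[OF sqint_scale[OF g, of a] sqint_scale[OF h, of b]] unfolding sc r_def s_def .
  have "Vnorm l (\<lambda>x. a * u x + b * v x) =
      sqrt ((sqrt (\<integral>x. (a * u x + b * v x)\<^sup>2 \<partial>Ivl l))\<^sup>2 + (sqrt (\<integral>x. (a * g x + b * h x)\<^sup>2 \<partial>Ivl l))\<^sup>2)"
    by (simp add: Vnorm_weak[OF weak_deriv_lin[OF u v]])
  also have "\<dots> \<le> sqrt ((\<bar>a\<bar> * p + \<bar>b\<bar> * q)\<^sup>2 + (\<bar>a\<bar> * r + \<bar>b\<bar> * s)\<^sup>2)"
    by (intro real_sqrt_le_mono add_mono power_mono t1 t2) auto
  also have "\<dots> \<le> sqrt ((\<bar>a\<bar> * p)\<^sup>2 + (\<bar>a\<bar> * r)\<^sup>2) + sqrt ((\<bar>b\<bar> * q)\<^sup>2 + (\<bar>b\<bar> * s)\<^sup>2)"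
    by (rule real_sqrt_sum_squares_triangle_ineq)
  also have "sqrt ((\<bar>a\<bar> * p)\<^sup>2 + (\<bar>a\<bar> * r)\<^sup>2) = \<bar>a\<bar> * sqrt (p\<^sup>2 + r\<^sup>2)"
    by (simp add: power_mult_distrib distrib_left[symmetric] real_sqrt_mult)
  also have "sqrt ((\<bar>b\<bar> * q)\<^sup>2 + (\<bar>b\<bar> * s)\<^sup>2) = \<bar>b\<bar> * sqrt (q\<^sup>2 + s\<^sup>2)"
    by (simp add: power_mult_distrib distrib_left[symmetric] real_sqrt_mult)
  finally show ?thesis
    by (simp add: Vnorm_weak[OF u(2)] Vnorm_weak[OF v(2)] p_def q_def r_def s_def)
qed

lemma Vsp_lin:
  assumes "u \<in> Vsp l" "v \<in> Vsp l" shows "(\<lambda>x. a * u x + b * v x) \<in> Vsp l"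
proof -
  note u = VspD[OF assms(1)] and v = VspD[OF assms(2)]
  obtain \<phi> where \<phi>: "\<And>j. \<phi> j \<in> C0inf l" "(\<lambda>j. Vnorm l (\<lambda>x. u x - \<phi> j x)) \<longlonglongrightarrow> 0"
    using assms(1) unfolding Vsp_iff by blast
  obtain \<theta> where \<theta>: "\<And>j. \<theta> j \<in> C0inf l" "(\<lambda>j. Vnorm l (\<lambda>x. v x - \<theta> j x)) \<longlonglongrightarrow> 0"
    using assms(2) unfolding Vsp_iff by blast
  have le: "Vnorm l (\<lambda>x. a * u x + b * v x - (a * \<phi> j x + b * \<theta> j x)) \<le>
     \<bar>a\<bar> * Vnorm l (\<lambda>x. u x - \<phi> j x) + \<bar>b\<bar> * Vnorm l (\<lambda>x. v x - \<theta> j x)" for j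
  proof -
    have 1: "weak_deriv l (\<lambda>x. u x - \<phi> j x) (\<lambda>x. Dx l u x - deriv (\<phi> j) x)"
      using weak_deriv_lin[OF u(1,2) C0inf_sqint[OF \<phi>(1)[of j]] C0inf_weak_deriv[OF \<phi>(1)[of j]], of 1 "-1"] by simp
    have 2: "weak_deriv l (\<lambda>x. v x - \<theta> j x) (\<lambda>x. Dx l v x - deriv (\<theta> j) x)"
      using weak_deriv_lin[OF v(1,2) C0inf_sqint[OF \<theta>(1)[of j]] C0inf_weak_deriv[OF \<theta>(1)[of j]], of 1 "-1"] by simp
    have "(\<lambda>x. a * u x + b * v x - (a * \<phi> j x + b * \<theta> j x)) = (\<lambda>x. a * (u x - \<phi> j x) + b * (v x - \<theta> j x))"
      by (simp add: algebra_simps)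
    then show ?thesis
      using Vnorm_lin_le[OF sqint_diff[OF u(1) C0inf_sqint[OF \<phi>(1)]] 1 sqint_diff[OF v(1) C0inf_sqint[OF \<theta>(1)]] 2, of a b]
      by simp
  qed
  have "(\<lambda>j. \<bar>a\<bar> * Vnorm l (\<lambda>x. u x - \<phi> j x) + \<bar>b\<bar> * Vnorm l (\<lambda>x. v x - \<theta> j x)) \<longlonglongrightarrow> \<bar>a\<bar> * 0 + \<bar>b\<bar> * 0"
    by (intro tendsto_intros \<phi> \<theta>)
  then have "(\<lambda>j. \<bar>a\<bar> * Vnorm l (\<lambda>x. u x - \<phi> j x) + \<bar>b\<bar> * Vnorm l (\<lambda>x. v x - \<theta> j x)) \<longlonglongrightarrow> 0"
    by simp
  from real_tendsto_sandwich[OF _ _ tendsto_const this]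
  have "(\<lambda>j. Vnorm l (\<lambda>x. a * u x + b * v x - (a * \<phi> j x + b * \<theta> j x))) \<longlonglongrightarrow> 0"
    using le Vnorm_nonneg by (simp add: eventually_sequentially)
  then show ?thesis
    unfolding Vsp_iff
    using sqint_lin[OF u(1) v(1), of a b] weak_deriv_lin[OF u(1,2) v(1,2), of a b] C0inf_lin[OF \<phi>(1) \<theta>(1)]
    by (intro conjI exI[of _ "\<lambda>j x. a * \<phi> j x + b * \<theta> j x"] exI[of _ "\<lambda>x. a * Dx l u x + b * Dx l v x"]) auto
qed

lemma weak_deriv_zero: "weak_deriv l (\<lambda>x. 0) (\<lambda>x. 0)"
  by (simp add: weak_deriv_iff sqint_zero)

lemma Vnorm_AE_zero:
  assumes "AE x in Ivl l. u x = 0" shows "Vnorm l u = 0"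
proof -
  have "weak_deriv l u (\<lambda>x. 0)" by (rule weak_deriv_cong[OF _ weak_deriv_zero]) (use assms in auto)
  then show ?thesis using sq_integral_cong_AE[of u "\<lambda>x. 0" l] assms by (simp add: Vnorm_weak)
qed

lemma C0inf_in_Vsp: "\<phi> \<in> C0inf l \<Longrightarrow> \<phi> \<in> Vsp l"
  unfolding Vsp_iff using C0inf_sqint C0inf_weak_deriv Vnorm_AE_zero[of "\<lambda>x. 0"]
  by (auto intro!: exI[of _ "\<lambda>j. \<phi>"])

lemma sp_in_Vsp: "sp N c \<in> Vsp l" and sb_in_Vsp: "sb k \<in> Vsp l"
  by (intro C0inf_in_Vsp sp_in_C0inf sb_in_C0inf)+

lemma Vsp_cong_AE:
  assumes "AE x in Ivl l. u x = v x" "u \<in> Vsp l" shows "v \<in> Vsp l"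
proof -
  note u = VspD[OF assms(2)]
  obtain \<phi> where \<phi>: "\<And>j. \<phi> j \<in> C0inf l" "(\<lambda>j. Vnorm l (\<lambda>x. u x - \<phi> j x)) \<longlonglongrightarrow> 0"
    using assms(2) unfolding Vsp_iff by blast
  have "Vnorm l (\<lambda>x. u x - \<phi> j x) = Vnorm l (\<lambda>x. v x - \<phi> j x)" for j
  proof -
    have 1: "weak_deriv l (\<lambda>x. u x - \<phi> j x) (\<lambda>x. Dx l u x - deriv (\<phi> j) x)"
      using weak_deriv_lin[OF u(1,2) C0inf_sqint[OF \<phi>(1)[of j]] C0inf_weak_deriv[OF \<phi>(1)[of j]], of 1 "-1"] by simp
    have ae: "AE x in Ivl l. u x - \<phi> j x = v x - \<phi> j x" using assms(1) by eventually_elim simp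
    show ?thesis
      using Vnorm_weak[OF 1] Vnorm_weak[OF weak_deriv_cong[OF ae 1]] sq_integral_cong_AE[OF ae] by simp
  qed
  then show ?thesis
    unfolding Vsp_iff using sqint_cong_AE[OF assms(1) u(1)] weak_deriv_cong[OF assms(1) u(2)] \<phi> by auto
qed

lemma Vnorm_sp: "Vnorm l (sp N c) = sqrt (\<Sum>k<N. (1 + (mu k)\<^sup>2) * (c k)\<^sup>2)"
  by (simp add: Vnorm_weak[OF weak_deriv_sp] sp_norm sp'_norm sum.distrib[symmetric] algebra_simps)

text \<open>Tested against arbitrary smooth functions, not only those vanishing at the endpoints.\<close>

lemma Vsp_integration_by_parts:
  assumes z: "z \<in> Vsp l" and \<psi>: "continuous_on {-l..l} \<psi>'" "\<And>x. (\<psi> has_real_derivative \<psi>' x) (at x)"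
  shows "(\<integral>x. Dx l z x * \<psi> x \<partial>Ivl l) = - (\<integral>x. z x * \<psi>' x \<partial>Ivl l)"
proof -
  note zD = VspD[OF z]
  obtain \<phi> where \<phi>: "\<And>j. \<phi> j \<in> C0inf l" "(\<lambda>j. Vnorm l (\<lambda>x. z x - \<phi> j x)) \<longlonglongrightarrow> 0"
    using z unfolding Vsp_iff by blast
  have \<psi>c: "continuous_on {-l..l} \<psi>"
    by (rule DERIV_continuous_on) (use \<psi>(2) has_field_derivative_at_within in blast)
  have s: "sqint (Ivl l) \<psi>" "sqint (Ivl l) \<psi>'" using \<psi>(1) \<psi>c by (auto intro: sqint_cont)
  define B where "B = sqrt (\<integral>x. (\<psi> x)\<^sup>2 \<partial>Ivl l) + sqrt (\<integral>x. (\<psi>' x)\<^sup>2 \<partial>Ivl l)"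
  define \<Delta> where "\<Delta> = (\<integral>x. Dx l z x * \<psi> x \<partial>Ivl l) + (\<integral>x. z x * \<psi>' x \<partial>Ivl l)"
  have le: "\<bar>\<Delta>\<bar> \<le> B * Vnorm l (\<lambda>x. z x - \<phi> j x)" for j
  proof -
    have s1: "sqint (Ivl l) (\<phi> j)" "sqint (Ivl l) (deriv (\<phi> j))"
      using C0inf_continuous[OF \<phi>(1)[of j]] by (auto intro: sqint_cont)
    \<comment> \<open>The boundary terms vanish through \<open>\<phi> j\<close>; \<psi> is arbitrary
      at the ends. The identity then passes to z by convergence in V.\<close>
    have zero: "(\<integral>x. deriv (\<phi> j) x * \<psi> x \<partial>Ivl l) + (\<integral>x. \<phi> j x * \<psi>' x \<partial>Ivl l) = 0"
    proof -
      have "(\<integral>x. deriv (\<phi> j) x * \<psi> x + \<phi> j x * \<psi>' x \<partial>Ivl l) = \<phi> j l * \<psi> l - \<phi> j (-l) * \<psi> (-l)"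
        by (rule integral_Ivl_FTC)
          (use l_pos \<psi> \<psi>c in \<open>auto intro!: continuous_intros C0inf_continuous[OF \<phi>(1)] derivative_eq_intros
            C0inf_derivative(1)[OF \<phi>(1)] has_field_derivative_at_within[OF \<psi>(2)]\<close>)
      then show ?thesis
        using C0inf_ends[OF \<phi>(1)[of j]] sqint_mult[OF s1(1) s(2)] sqint_mult[OF s1(2) s(1)] by simp
    qed
    have s2: "sqint (Ivl l) (\<lambda>x. z x - \<phi> j x)" "sqint (Ivl l) (\<lambda>x. Dx l z x - deriv (\<phi> j) x)"
      using zD s1 by (auto intro: sqint_diff)
    have w: "weak_deriv l (\<lambda>x. z x - \<phi> j x) (\<lambda>x. Dx l z x - deriv (\<phi> j) x)"
      using weak_deriv_lin[OF zD(1,2) C0inf_sqint[OF \<phi>(1)[of j]] C0inf_weak_deriv[OF \<phi>(1)[of j]], of 1 "-1"] by simp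
    have V: "sqrt (\<integral>x. (z x - \<phi> j x)\<^sup>2 \<partial>Ivl l) \<le> Vnorm l (\<lambda>x. z x - \<phi> j x)"
      "sqrt (\<integral>x. (Dx l z x - deriv (\<phi> j) x)\<^sup>2 \<partial>Ivl l) \<le> Vnorm l (\<lambda>x. z x - \<phi> j x)"
      unfolding Vnorm_weak[OF w] by (auto intro: integral_nonneg_AE)
    have "\<Delta> = (\<integral>x. (Dx l z x - deriv (\<phi> j) x) * \<psi> x \<partial>Ivl l) + (\<integral>x. (z x - \<phi> j x) * \<psi>' x \<partial>Ivl l)"
      using zero sqint_mult[OF s1(1) s(2)] sqint_mult[OF s1(2) s(1)] sqint_mult[OF zD(1) s(2)] sqint_mult[OF zD(3) s(1)]
      by (simp add: \<Delta>_def left_diff_distrib)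
    then have "\<bar>\<Delta>\<bar> \<le> \<bar>\<integral>x. (Dx l z x - deriv (\<phi> j) x) * \<psi> x \<partial>Ivl l\<bar> + \<bar>\<integral>x. (z x - \<phi> j x) * \<psi>' x \<partial>Ivl l\<bar>"
      by linarith
    also have "\<dots> \<le> Vnorm l (\<lambda>x. z x - \<phi> j x) * sqrt (\<integral>x. (\<psi> x)\<^sup>2 \<partial>Ivl l)
        + Vnorm l (\<lambda>x. z x - \<phi> j x) * sqrt (\<integral>x. (\<psi>' x)\<^sup>2 \<partial>Ivl l)"
      using V by (intro add_mono order_trans[OF sqint_Cauchy_Schwarz_abs[OF s2(2) s(1)]]
          order_trans[OF sqint_Cauchy_Schwarz_abs[OF s2(1) s(2)]] mult_right_mono) auto
    finally show ?thesis by (simp add: B_def algebra_simps)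
  qed
  have "(\<lambda>j. B * Vnorm l (\<lambda>x. z x - \<phi> j x)) \<longlonglongrightarrow> B * 0" by (intro tendsto_intros \<phi>)
  then have "\<bar>\<Delta>\<bar> \<le> B * 0" by (rule LIMSEQ_le_const) (use le in auto)
  then show ?thesis by (simp add: \<Delta>_def)
qed

end

context interval
begin

subsection \<open>Sine series\<close>

definition ser :: "(nat \<Rightarrow> real) \<Rightarrow> real \<Rightarrow> real"
  where "ser c x = (\<Sum>k. c k * sb k x)"

definition ser' :: "(nat \<Rightarrow> real) \<Rightarrow> real \<Rightarrow> real"
  where "ser' c x = (\<Sum>k. c k * sb' k x)"

lemma mu_mono: "mu 0 \<le> mu k"
  using mu_eq[of k] mu_pos[of 0] by (simp add: algebra_simps)

lemma summable_inverse_mu_sq: "summable (\<lambda>k. 1 / (mu k)\<^sup>2)"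
proof -
  have "summable (\<lambda>k. (2 * l / pi)\<^sup>2 * inverse ((real (Suc k))\<^sup>2))"
    by (rule summable_mult) (use inverse_power_summable[of 2, where 'a=real] in \<open>subst summable_Suc_iff, simp add: power_inverse\<close>)
  moreover have eq: "(2 * l / pi)\<^sup>2 * inverse ((real (Suc k))\<^sup>2) = 1 / (mu k)\<^sup>2" for k
    using l_pos by (simp add: mu_def power_mult_distrib power_divide inverse_eq_divide)
  ultimately show ?thesis by (simp only: eq)
qed

end

text \<open>The coefficients of an element of D((-A)^(1/2)), that is, of H^2 with zero boundary
  values. The decay is enough for the series and its termwise derivative to converge
  uniformly.\<close>

locale sine_series = interval +
  fixes c :: "nat \<Rightarrow> real"
  assumes summable_mu4: "summable (\<lambda>k. (mu k) ^ 4 * (c k)\<^sup>2)"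
begin

text \<open>Write mu |c| as the product of mu^2 |c| and 1 / mu; both factors are square
  summable.\<close>

lemma summable_mu1: "summable (\<lambda>k. mu k * \<bar>c k\<bar>)"
proof (rule summable_comparison_test')
  show "summable (\<lambda>k. (mu k) ^ 4 * (c k)\<^sup>2 + 1 / (mu k)\<^sup>2)"
    by (intro summable_add summable_mu4 summable_inverse_mu_sq)
  fix k :: nat
  have "2 * ((mu k)\<^sup>2 * \<bar>c k\<bar>) * (1 / mu k) \<le> ((mu k)\<^sup>2 * \<bar>c k\<bar>)\<^sup>2 + (1 / mu k)\<^sup>2"
    by (rule sum_squares_bound)
  moreover have "((mu k)\<^sup>2 * \<bar>c k\<bar>) * (1 / mu k) = mu k * \<bar>c k\<bar>"
    using mu_pos[of k] by (simp add: power2_eq_square)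
  moreover have "((mu k)\<^sup>2 * \<bar>c k\<bar>)\<^sup>2 = (mu k) ^ 4 * (c k)\<^sup>2"
    by (simp add: power_mult_distrib flip: power_mult)
  moreover have "0 \<le> mu k * \<bar>c k\<bar>" using mu_pos[of k] by simp
  ultimately show "norm (mu k * \<bar>c k\<bar>) \<le> (mu k) ^ 4 * (c k)\<^sup>2 + 1 / (mu k)\<^sup>2"
    by (simp add: power_divide)
qed

lemma summable_mu0: "summable (\<lambda>k. \<bar>c k\<bar>)"
proof (rule summable_comparison_test')
  show "summable (\<lambda>k. (1 / mu 0) * (mu k * \<bar>c k\<bar>))" by (intro summable_mult summable_mu1)
  fix k :: nat
  have "mu 0 * \<bar>c k\<bar> \<le> mu k * \<bar>c k\<bar>" using mu_mono by (intro mult_right_mono) auto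
  then show "norm \<bar>c k\<bar> \<le> (1 / mu 0) * (mu k * \<bar>c k\<bar>)" using mu_pos[of 0] by (simp add: field_simps)
qed

lemma term_bounds: "\<bar>c k * sb k x\<bar> \<le> \<bar>c k\<bar> / sqrt l" "\<bar>c k * sb' k x\<bar> \<le> mu k * \<bar>c k\<bar> / sqrt l"
  using mult_left_mono[OF abs_sb_le[of k x], of "\<bar>c k\<bar>"] mult_left_mono[OF abs_sb'_le[of k x], of "\<bar>c k\<bar>"]
  by (simp_all add: abs_mult mult.commute)

lemma uniform_sp: "uniform_limit UNIV (\<lambda>N x. sp N c x) (ser c) sequentially"
  unfolding sp_def ser_def[abs_def]
  by (rule Weierstrass_m_test[OF _ summable_divide[OF summable_mu0, of "sqrt l"]]) (simp add: term_bounds)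

lemma uniform_sp': "uniform_limit UNIV (\<lambda>N x. sp' N c x) (ser' c) sequentially"
  unfolding sp'_def ser'_def[abs_def]
  by (rule Weierstrass_m_test[OF _ summable_divide[OF summable_mu1, of "sqrt l"]]) (simp add: term_bounds)

lemma sp_tendsto: "(\<lambda>N. sp N c x) \<longlonglongrightarrow> ser c x" and sp'_tendsto: "(\<lambda>N. sp' N c x) \<longlonglongrightarrow> ser' c x"
  using tendsto_uniform_limitI[OF uniform_sp, of x] tendsto_uniform_limitI[OF uniform_sp', of x] by simp_all

definition bnd :: real where "bnd = (\<Sum>k. \<bar>c k\<bar>) / sqrt l"
definition bnd' :: real where "bnd' = (\<Sum>k. mu k * \<bar>c k\<bar>) / sqrt l"

lemma sp_bounded: "\<bar>sp N c x\<bar> \<le> bnd"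
proof -
  have "\<bar>sp N c x\<bar> \<le> (\<Sum>k<N. \<bar>c k\<bar> / sqrt l)"
    unfolding sp_def using term_bounds(1) by (intro order_trans[OF sum_abs] sum_mono)
  also have "\<dots> = (\<Sum>k<N. \<bar>c k\<bar>) / sqrt l" by (simp add: sum_divide_distrib)
  also have "\<dots> \<le> bnd" unfolding bnd_def
    using l_pos by (intro divide_right_mono sum_le_suminf summable_mu0) auto
  finally show ?thesis .
qed

lemma sp'_bounded: "\<bar>sp' N c x\<bar> \<le> bnd'"
proof -
  have "\<bar>sp' N c x\<bar> \<le> (\<Sum>k<N. mu k * \<bar>c k\<bar> / sqrt l)"
    unfolding sp'_def using term_bounds(2) by (intro order_trans[OF sum_abs] sum_mono)
  also have "\<dots> = (\<Sum>k<N. mu k * \<bar>c k\<bar>) / sqrt l" by (simp add: sum_divide_distrib)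
  also have "\<dots> \<le> bnd'" unfolding bnd'_def
    using l_pos mu_pos by (intro divide_right_mono sum_le_suminf summable_mu1) (auto simp: less_imp_le)
  finally show ?thesis .
qed

lemma ser_bounded: "\<bar>ser c x\<bar> \<le> bnd" and ser'_bounded: "\<bar>ser' c x\<bar> \<le> bnd'"
  by (rule LIMSEQ_le_const2[OF tendsto_rabs[OF sp_tendsto]], use sp_bounded in auto)
     (rule LIMSEQ_le_const2[OF tendsto_rabs[OF sp'_tendsto]], use sp'_bounded in auto)

lemma ser_continuous [continuous_intros]: "continuous_on S (ser c)"
  by (rule continuous_on_subset[OF uniform_limit_theorem[OF _ uniform_sp]])
     (auto intro!: always_eventually sp_continuous)

lemma ser'_continuous [continuous_intros]: "continuous_on S (ser' c)"
  by (rule continuous_on_subset[OF uniform_limit_theorem[OF _ uniform_sp']])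
     (auto intro!: always_eventually sp'_continuous)

lemma ser_has_derivative_at: "(ser c has_real_derivative ser' c x) (at x)"
  unfolding ser_def[abs_def] ser'_def
proof (rule has_field_derivative_series'(2)[of UNIV])
  show "((\<lambda>x. c n * sb n x) has_real_derivative c n * sb' n x) (at x within UNIV)" for n x
    by (intro DERIV_cmult sb_has_derivative)
  show "uniformly_convergent_on UNIV (\<lambda>n x. \<Sum>i<n. c i * sb' i x)"
    using uniform_sp' unfolding uniformly_convergent_on_def sp'_def by blast
  show "summable (\<lambda>n. c n * sb n 0)"
    using sp_tendsto[of 0] unfolding sp_def sums_def[symmetric] by (rule sums_summable)
qed auto

lemma ser_has_derivative: "(ser c has_real_derivative ser' c x) (at x within S)"
  using ser_has_derivative_at by (rule has_field_derivative_at_within)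

lemma ser_ends: "ser c l = 0" "ser c (-l) = 0"
  by (simp_all add: ser_def)

lemma sqint_ser: "sqint (Ivl l) (ser c)" and sqint_ser': "sqint (Ivl l) (ser' c)"
  by (intro sqint_cont continuous_intros)+

lemma integral_sp_limit:
  fixes F :: "nat \<Rightarrow> real \<Rightarrow> real" and G :: "real \<Rightarrow> real"
  assumes F: "\<And>N. continuous_on {-l..l} (F N)" "continuous_on {-l..l} G"
    and B: "\<And>N x. x \<in> {-l<..<l} \<Longrightarrow> \<bar>F N x\<bar> \<le> B" and lim: "\<And>x. x \<in> {-l<..<l} \<Longrightarrow> (\<lambda>N. F N x) \<longlonglongrightarrow> G x"
  shows "(\<lambda>N. \<integral>x. F N x \<partial>Ivl l) \<longlonglongrightarrow> (\<integral>x. G x \<partial>Ivl l)"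
proof (rule integral_dominated_convergence[where w = "\<lambda>_. B"])
  interpret finite_measure "Ivl l" by (rule finite_Ivl)
  show "integrable (Ivl l) (\<lambda>_. B)" by simp
qed (use F B lim in \<open>auto intro!: continuous_imp_measurable_Ivl AE_I2\<close>)

lemma coef_ser: "coef (ser c) k = c k"
proof -
  have "(\<lambda>N. \<integral>x. sp N c x * sb k x \<partial>Ivl l) \<longlonglongrightarrow> (\<integral>x. ser c x * sb k x \<partial>Ivl l)"
  proof (rule integral_sp_limit[where B = "bnd * (1 / sqrt l)"])
    show "\<bar>sp N c x * sb k x\<bar> \<le> bnd * (1 / sqrt l)" for N x
      unfolding abs_mult using sp_bounded[of N x] by (intro mult_mono sp_bounded abs_sb_le) auto
  qed (intro continuous_intros tendsto_intros sp_tendsto)+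
  then have "(\<lambda>N. coef (sp N c) k) \<longlonglongrightarrow> coef (ser c) k" by (simp add: coef_def)
  moreover have "(\<lambda>N. coef (sp N c) k) \<longlonglongrightarrow> c k"
    by (rule tendsto_eventually) (auto simp: coef_sp eventually_sequentially intro!: exI[of _ "Suc k"])
  ultimately show ?thesis by (rule LIMSEQ_unique)
qed

lemma ser_norm: "(\<lambda>k. (c k)\<^sup>2) sums (\<integral>x. (ser c x)\<^sup>2 \<partial>Ivl l)"
  using Parseval[OF sqint_ser] by (simp add: coef_ser)

lemma ser'_norm: "(\<lambda>k. (mu k)\<^sup>2 * (c k)\<^sup>2) sums (\<integral>x. (ser' c x)\<^sup>2 \<partial>Ivl l)"
proof -
  have "(\<lambda>N. \<integral>x. (sp' N c x)\<^sup>2 \<partial>Ivl l) \<longlonglongrightarrow> (\<integral>x. (ser' c x)\<^sup>2 \<partial>Ivl l)"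
  proof (rule integral_sp_limit[where B = "bnd'\<^sup>2"])
    show "\<bar>(sp' N c x)\<^sup>2\<bar> \<le> bnd'\<^sup>2" for N x
      using sp'_bounded[of N x] by (simp add: abs_le_square_iff[symmetric])
  qed (intro continuous_intros tendsto_intros sp'_tendsto)+
  then show ?thesis by (simp add: sums_def sp'_norm)
qed

lemma sp_L2_tendsto: "(\<lambda>N. \<integral>x. (ser c x - sp N c x)\<^sup>2 \<partial>Ivl l) \<longlonglongrightarrow> 0"
  using Parseval_partial[OF sqint_ser] by (simp add: coef_ser[abs_def])

lemma sp'_L2_tendsto: "(\<lambda>N. \<integral>x. (ser' c x - sp' N c x)\<^sup>2 \<partial>Ivl l) \<longlonglongrightarrow> 0"
proof -
  have "(\<lambda>N. \<integral>x. (ser' c x - sp' N c x)\<^sup>2 \<partial>Ivl l) \<longlonglongrightarrow> (\<integral>x. (ser' c x - ser' c x)\<^sup>2 \<partial>Ivl l)"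
  proof (rule integral_sp_limit[where B = "(2 * bnd')\<^sup>2"])
    show "\<bar>(ser' c x - sp' N c x)\<^sup>2\<bar> \<le> (2 * bnd')\<^sup>2" for N x
    proof -
      have "\<bar>ser' c x - sp' N c x\<bar> \<le> \<bar>2 * bnd'\<bar>"
        using sp'_bounded[of N x] ser'_bounded[of x] by linarith
      then show ?thesis by (simp add: abs_le_square_iff)
    qed
  qed (intro continuous_intros tendsto_intros sp'_tendsto)+
  then show ?thesis by simp
qed

lemma weak_deriv_ser: "weak_deriv l (ser c) (ser' c)"
  by (rule weak_deriv_C1[OF l_pos]) (intro continuous_intros ser_has_derivative)+

lemma weak_deriv_ser_diff: "weak_deriv l (\<lambda>x. ser c x - sp N c x) (\<lambda>x. ser' c x - sp' N c x)"
  using weak_deriv_lin[OF sqint_ser weak_deriv_ser sqint_sp weak_deriv_sp, of 1 "-1" N c] by simp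

lemma sp_V_tendsto: "(\<lambda>N. Vnorm l (\<lambda>x. ser c x - sp N c x)) \<longlonglongrightarrow> 0"
proof -
  have "(\<lambda>N. sqrt ((\<integral>x. (ser c x - sp N c x)\<^sup>2 \<partial>Ivl l) + (\<integral>x. (ser' c x - sp' N c x)\<^sup>2 \<partial>Ivl l))) \<longlonglongrightarrow> sqrt (0 + 0)"
    by (intro tendsto_intros sp_L2_tendsto sp'_L2_tendsto)
  then show ?thesis by (simp add: Vnorm_weak[OF weak_deriv_ser_diff])
qed

lemma ser_in_Vsp: "ser c \<in> Vsp l"
  unfolding Vsp_iff using sqint_ser weak_deriv_ser sp_V_tendsto
  by (auto intro!: exI[of _ "\<lambda>j. sp j c"] sp_in_C0inf)

end

section \<open>Density of the sine span in V\<close>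

context interval
begin

text \<open>Green's formula. Both \<phi> and \<open>sb k\<close> vanish at the ends, so every
  boundary term drops although the derivative of \<phi> is arbitrary there.\<close>

lemma coef_deriv2:
  assumes \<phi>: "\<phi> \<in> C0inf l"
  shows "coef (deriv (deriv \<phi>)) k = - (mu k)\<^sup>2 * coef \<phi> k"
proof -
  have "(\<integral>x. deriv (deriv \<phi>) x * sb k x - \<phi> x * (- (mu k)\<^sup>2 * sb k x) \<partial>Ivl l) =
      (deriv \<phi> l * sb k l - \<phi> l * sb' k l) - (deriv \<phi> (-l) * sb k (-l) - \<phi> (-l) * sb' k (-l))"
    by (rule integral_Ivl_FTC)
      (use l_pos in \<open>auto intro!: continuous_intros C0inf_continuous[OF \<phi>] derivative_eq_intros
        C0inf_derivative[OF \<phi>] sb'_has_derivative\<close>)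
  also have "\<dots> = 0" using C0inf_ends[OF \<phi>] by simp
  finally have "(\<integral>x. deriv (deriv \<phi>) x * sb k x + (mu k)\<^sup>2 * (\<phi> x * sb k x) \<partial>Ivl l) = 0"
    by (simp add: algebra_simps)
  moreover have "integrable (Ivl l) (\<lambda>x. deriv (deriv \<phi>) x * sb k x)" "integrable (Ivl l) (\<lambda>x. \<phi> x * sb k x)"
    by (intro int_cont continuous_intros C0inf_continuous[OF \<phi>])+
  ultimately show ?thesis by (simp add: coef_def)
qed

text \<open>The second derivative of \<phi> is in L^2, so by \<open>coef_deriv2\<close> the
  coefficients decay as \<open>sine_series\<close> demands. Then \<phi> agrees a.e. with its sine
  series, which converges in V.\<close>

lemma sines_dense_C0inf:
  assumes \<phi>: "\<phi> \<in> C0inf l"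
  shows "(\<lambda>N. Vnorm l (\<lambda>x. \<phi> x - sp N (coef \<phi>) x)) \<longlonglongrightarrow> 0"
proof -
  have s2: "sqint (Ivl l) (deriv (deriv \<phi>))" by (intro sqint_cont C0inf_continuous[OF \<phi>])
  have "summable (\<lambda>k. (coef (deriv (deriv \<phi>)) k)\<^sup>2)" using Parseval[OF s2] by (rule sums_summable)
  then have "summable (\<lambda>k. (mu k) ^ 4 * (coef \<phi> k)\<^sup>2)"
    by (simp add: coef_deriv2[OF \<phi>] power_mult_distrib flip: power_mult)
  then interpret sine_series l "coef \<phi>" by unfold_locales
  have ae: "AE x in Ivl l. ser (coef \<phi>) x = \<phi> x"
  proof -
    have "coef (\<lambda>x. 1 * ser (coef \<phi>) x + (-1) * \<phi> x) k = 0" for k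
      using coef_lin[OF sqint_ser C0inf_sqint[OF \<phi>], of 1 "-1" k] by (simp add: coef_ser)
    from coef_zero_imp_AE[OF sqint_lin[OF sqint_ser C0inf_sqint[OF \<phi>]] this] show ?thesis by simp
  qed
  have "Vnorm l (\<lambda>x. \<phi> x - sp N (coef \<phi>) x) = Vnorm l (\<lambda>x. ser (coef \<phi>) x - sp N (coef \<phi>) x)" for N
  proof -
    have ae': "AE x in Ivl l. ser (coef \<phi>) x - sp N (coef \<phi>) x = \<phi> x - sp N (coef \<phi>) x"
      using ae by eventually_elim simp
    show ?thesis
      using Vnorm_weak[OF weak_deriv_ser_diff] Vnorm_weak[OF weak_deriv_cong[OF ae' weak_deriv_ser_diff]]
        sq_integral_cong_AE[OF ae'] by simp
  qed
  then show ?thesis using sp_V_tendsto by simp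
qed

lemma Vnorm_diff_triangle:
  assumes "u \<in> Vsp l" "v \<in> Vsp l" "w \<in> Vsp l"
  shows "Vnorm l (\<lambda>x. u x - w x) \<le> Vnorm l (\<lambda>x. u x - v x) + Vnorm l (\<lambda>x. v x - w x)"
proof -
  have 1: "(\<lambda>x. u x - v x) \<in> Vsp l" "(\<lambda>x. v x - w x) \<in> Vsp l"
    using Vsp_lin[OF assms(1,2), of 1 "-1"] Vsp_lin[OF assms(2,3), of 1 "-1"] by simp_all
  show ?thesis
    using Vnorm_lin_le[OF VspD(1,2)[OF 1(1)] VspD(1,2)[OF 1(2)], of 1 1] by simp
qed

lemma sines_dense_Vsp:
  assumes u: "u \<in> Vsp l" and "\<epsilon> > 0"
  shows "\<exists>N c. Vnorm l (\<lambda>x. u x - sp N c x) < \<epsilon>"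
proof -
  obtain \<phi> where \<phi>: "\<And>j. \<phi> j \<in> C0inf l" "(\<lambda>j. Vnorm l (\<lambda>x. u x - \<phi> j x)) \<longlonglongrightarrow> 0"
    using u unfolding Vsp_iff by blast
  have "\<forall>\<^sub>F j in sequentially. Vnorm l (\<lambda>x. u x - \<phi> j x) < \<epsilon> / 2"
    using \<open>\<epsilon> > 0\<close> by (intro order_tendstoD[OF \<phi>(2)]) simp
  then obtain j where j: "Vnorm l (\<lambda>x. u x - \<phi> j x) < \<epsilon> / 2" by (auto simp: eventually_sequentially)
  have "\<forall>\<^sub>F N in sequentially. Vnorm l (\<lambda>x. \<phi> j x - sp N (coef (\<phi> j)) x) < \<epsilon> / 2"
    using \<open>\<epsilon> > 0\<close> by (intro order_tendstoD[OF sines_dense_C0inf[OF \<phi>(1)]]) simp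
  then obtain N where N: "Vnorm l (\<lambda>x. \<phi> j x - sp N (coef (\<phi> j)) x) < \<epsilon> / 2" by (auto simp: eventually_sequentially)
  show ?thesis
    using Vnorm_diff_triangle[OF u C0inf_in_Vsp[OF \<phi>(1)[of j]] sp_in_Vsp[of N "coef (\<phi> j)"]] j N
    by (intro exI[of _ N] exI[of _ "coef (\<phi> j)"]) linarith
qed

subsection \<open>The dual norm in terms of the sine basis\<close>

lemma VdualD:
  assumes "\<psi> \<in> Vdual l" "\<phi> \<in> Vsp l" "\<theta> \<in> Vsp l"
  shows "\<psi> (\<lambda>x. a * \<phi> x + b * \<theta> x) = a * \<psi> \<phi> + b * \<psi> \<theta>"
  using assms by (simp add: Vdual_def)

lemma zero_in_Vsp: "(\<lambda>x. 0) \<in> Vsp l"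
  using sp_in_Vsp[of 0 "\<lambda>_. 0"] by (simp add: sp_def[abs_def])

lemma Vdual_zero: "\<psi> \<in> Vdual l \<Longrightarrow> \<psi> (\<lambda>x. 0) = 0"
  using VdualD[OF _ zero_in_Vsp zero_in_Vsp, of \<psi> 0 0] by simp

lemma Vnorm_zero: "Vnorm l (\<lambda>x. 0) = 0"
  by (rule Vnorm_AE_zero) simp

lemma Vdual_bound:
  assumes \<psi>: "\<psi> \<in> Vdual l" and \<phi>: "\<phi> \<in> Vsp l"
  shows "\<bar>\<psi> \<phi>\<bar> \<le> dual_norm l \<psi> * Vnorm l \<phi>"
proof -
  obtain C where C: "\<And>\<phi>. \<phi> \<in> Vsp l \<Longrightarrow> \<bar>\<psi> \<phi>\<bar> \<le> C * Vnorm l \<phi>" using \<psi> unfolding Vdual_def by blast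
  show ?thesis
  proof (cases "Vnorm l \<phi> = 0")
    case True
    then show ?thesis using C[OF \<phi>] by simp
  next
    case False
    then have pos: "Vnorm l \<phi> > 0" using Vnorm_nonneg[of \<phi>] by simp
    define \<theta> where "\<theta> = (\<lambda>x. (1 / Vnorm l \<phi>) * \<phi> x + 0 * \<phi> x)"
    have \<theta>V: "\<theta> \<in> Vsp l" unfolding \<theta>_def by (rule Vsp_lin[OF \<phi> \<phi>])
    have "Vnorm l \<theta> \<le> \<bar>1 / Vnorm l \<phi>\<bar> * Vnorm l \<phi> + \<bar>0\<bar> * Vnorm l \<phi>"
      unfolding \<theta>_def by (rule Vnorm_lin_le[OF VspD(1,2)[OF \<phi>] VspD(1,2)[OF \<phi>]])
    then have \<theta>1: "Vnorm l \<theta> \<le> 1" using pos by simp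
    have "\<bar>\<psi> \<theta>\<bar> \<le> dual_norm l \<psi>"
      unfolding dual_norm_def
    proof (rule cSUP_upper)
      show "bdd_above ((\<lambda>\<phi>. \<bar>\<psi> \<phi>\<bar>) ` {\<phi> \<in> Vsp l. Vnorm l \<phi> \<le> 1})"
      proof (rule bdd_aboveI2[where M = "\<bar>C\<bar>"])
        fix \<phi> assume "\<phi> \<in> {\<phi> \<in> Vsp l. Vnorm l \<phi> \<le> 1}"
        then have "\<bar>\<psi> \<phi>\<bar> \<le> C * Vnorm l \<phi>" "Vnorm l \<phi> \<le> 1" using C by auto
        moreover have "C * Vnorm l \<phi> \<le> \<bar>C\<bar> * 1"
          using Vnorm_nonneg[of \<phi>] \<open>Vnorm l \<phi> \<le> 1\<close> by (intro mult_mono) auto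
        ultimately show "\<bar>\<psi> \<phi>\<bar> \<le> \<bar>C\<bar>" by linarith
      qed
    qed (use \<theta>V \<theta>1 in simp)
    moreover have "\<psi> \<theta> = \<psi> \<phi> / Vnorm l \<phi>" unfolding \<theta>_def by (subst VdualD[OF \<psi> \<phi> \<phi>]) simp
    ultimately show ?thesis using pos by (simp add: field_simps)
  qed
qed

lemma Vdual_cong_AE:
  assumes \<psi>: "\<psi> \<in> Vdual l" and "\<phi> \<in> Vsp l" "\<theta> \<in> Vsp l" and ae: "AE x in Ivl l. \<phi> x = \<theta> x"
  shows "\<psi> \<phi> = \<psi> \<theta>"
proof -
  have "(\<lambda>x. 1 * \<phi> x + (-1) * \<theta> x) \<in> Vsp l" by (rule Vsp_lin) fact+
  moreover have "Vnorm l (\<lambda>x. 1 * \<phi> x + (-1) * \<theta> x) = 0"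
    by (rule Vnorm_AE_zero) (use ae in auto)
  ultimately have "\<psi> (\<lambda>x. 1 * \<phi> x + (-1) * \<theta> x) = 0" using Vdual_bound[OF \<psi>] by force
  then show ?thesis using VdualD[OF assms(1-3), of 1 "-1"] by simp
qed

lemma Vdual_sp:
  assumes \<psi>: "\<psi> \<in> Vdual l" shows "\<psi> (sp N c) = (\<Sum>k<N. c k * \<psi> (sb k))"
proof (induction N)
  case 0
  then show ?case using Vdual_zero[OF \<psi>] by (simp add: sp_def[abs_def])
next
  case (Suc N)
  have "sp (Suc N) c = (\<lambda>x. 1 * sp N c x + c N * sb N x)" by (simp add: sp_def fun_eq_iff)
  then show ?case using VdualD[OF \<psi> sp_in_Vsp sb_in_Vsp, of 1 N c "c N" N] Suc by simp
qed

lemma dual_norm_nonneg: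
  assumes \<psi>: "\<psi> \<in> Vdual l" shows "0 \<le> dual_norm l \<psi>"
proof -
  have "Vnorm l (sb 0) > 0"
    using mu_pos[of 0] unfolding sb_eq_sp Vnorm_sp by (simp add: add_pos_nonneg)
  moreover have "0 \<le> dual_norm l \<psi> * Vnorm l (sb 0)"
    using Vdual_bound[OF \<psi> sb_in_Vsp[of 0]] by linarith
  ultimately show ?thesis by (simp add: zero_le_mult_iff)
qed

text \<open>The \<open>sb k\<close> are orthogonal in V with squared norm 1 + (mu k)^2, so this is
  Parseval's identity in V'. It turns the supremum, which is unsuited to measurability questions,
  into a countable series.\<close>

lemma dual_norm_sums:
  assumes \<psi>: "\<psi> \<in> Vdual l"
  shows "(\<lambda>k. (\<psi> (sb k))\<^sup>2 / (1 + (mu k)\<^sup>2)) sums (dual_norm l \<psi>)\<^sup>2"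
proof -
  define q where "q k = (\<psi> (sb k))\<^sup>2 / (1 + (mu k)\<^sup>2)" for k
  have m: "1 + (mu k)\<^sup>2 > 0" for k by (simp add: add_pos_nonneg)
  have q0: "0 \<le> q k" for k by (simp add: q_def)
  have le: "(\<Sum>k<N. q k) \<le> (dual_norm l \<psi>)\<^sup>2" for N
  proof -
    \<comment> \<open>The truncated Riesz representative of \<psi> in V: \<psi> applied to it and
      its squared V norm are both s.\<close>
    define c where "c k = \<psi> (sb k) / (1 + (mu k)\<^sup>2)" for k
    define s where "s = (\<Sum>k<N. q k)"
    have s0: "0 \<le> s" unfolding s_def by (intro sum_nonneg q0)
    have 1: "\<psi> (sp N c) = s"
      unfolding Vdual_sp[OF \<psi>] s_def by (rule sum.cong) (auto simp: c_def q_def power2_eq_square)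
    have "(1 + (mu k)\<^sup>2) * (c k)\<^sup>2 = q k" for k
      using m[of k] by (simp add: c_def q_def power_divide power2_eq_square)
    then have 2: "Vnorm l (sp N c) = sqrt s" by (simp add: Vnorm_sp s_def)
    have *: "s \<le> dual_norm l \<psi> * sqrt s" using Vdual_bound[OF \<psi> sp_in_Vsp[of N c]] s0 by (simp add: 1 2)
    have "s \<le> (dual_norm l \<psi>)\<^sup>2"
    proof (cases "s = 0")
      case False
      then have "sqrt s > 0" using s0 by simp
      have "sqrt s * sqrt s \<le> dual_norm l \<psi> * sqrt s" using * s0 by simp
      then have "sqrt s \<le> dual_norm l \<psi>" using \<open>sqrt s > 0\<close> by (rule mult_right_le_imp_le)
      then have "(sqrt s)\<^sup>2 \<le> (dual_norm l \<psi>)\<^sup>2" using s0 by (intro power_mono) auto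
      then show ?thesis using s0 by simp
    qed simp
    then show ?thesis by (simp add: s_def)
  qed
  have sm: "summable q"
    by (rule summableI_nonneg_bounded[OF q0 le])
  define r where "r = sqrt (suminf q)"
  have r0: "0 \<le> r" unfolding r_def using suminf_nonneg[OF sm q0] by simp
  have up: "r\<^sup>2 \<le> (dual_norm l \<psi>)\<^sup>2"
    unfolding r_def using suminf_nonneg[OF sm q0] suminf_le_const[OF sm le] by simp
  have bsp: "\<bar>\<psi> (sp N c)\<bar> \<le> r * Vnorm l (sp N c)" for N c
  proof -
    have "\<psi> (sp N c) = (\<Sum>k<N. (sqrt (1 + (mu k)\<^sup>2) * c k) * (\<psi> (sb k) / sqrt (1 + (mu k)\<^sup>2)))"
      unfolding Vdual_sp[OF \<psi>] by (rule sum.cong) (use m in \<open>auto simp: less_imp_neq[symmetric]\<close>)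
    then have "(\<psi> (sp N c))\<^sup>2 \<le> (\<Sum>k<N. (sqrt (1 + (mu k)\<^sup>2) * c k)\<^sup>2) * (\<Sum>k<N. (\<psi> (sb k) / sqrt (1 + (mu k)\<^sup>2))\<^sup>2)"
      using Cauchy_Schwarz_ineq_sum[of "\<lambda>k. sqrt (1 + (mu k)\<^sup>2) * c k" "\<lambda>k. \<psi> (sb k) / sqrt (1 + (mu k)\<^sup>2)" "{..<N}"] by simp
    also have "(\<Sum>k<N. (sqrt (1 + (mu k)\<^sup>2) * c k)\<^sup>2) = (Vnorm l (sp N c))\<^sup>2"
      unfolding Vnorm_sp by (subst real_sqrt_pow2)
        (auto intro!: sum_nonneg sum.cong simp: power_mult_distrib less_imp_le[OF m])
    also have "(\<Sum>k<N. (\<psi> (sb k) / sqrt (1 + (mu k)\<^sup>2))\<^sup>2) = (\<Sum>k<N. q k)"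
      by (rule sum.cong) (auto simp: q_def power_divide less_imp_le[OF m])
    also have "(Vnorm l (sp N c))\<^sup>2 * (\<Sum>k<N. q k) \<le> (Vnorm l (sp N c))\<^sup>2 * r\<^sup>2"
      unfolding r_def using suminf_nonneg[OF sm q0] by (intro mult_left_mono) (auto intro!: sum_le_suminf sm q0)
    also have "\<dots> = (r * Vnorm l (sp N c))\<^sup>2" by (simp add: power_mult_distrib)
    finally show ?thesis
      using r0 Vnorm_nonneg[of "sp N c"] by (simp add: abs_le_square_iff[symmetric])
  qed
  have ball: "\<bar>\<psi> \<phi>\<bar> \<le> r * Vnorm l \<phi>" if \<phi>: "\<phi> \<in> Vsp l" for \<phi>
  proof (rule field_le_epsilon)
    fix e :: real assume "e > 0"
    \<comment> \<open>D collects what a V error in the approximation costs: the dual norm for \<psi>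
      itself and r for the norm of the approximant. The summand 1 keeps it positive.\<close>
    define D where "D = \<bar>dual_norm l \<psi>\<bar> + r + 1"
    have D: "D > 0" using r0 by (simp add: D_def)
    obtain N c where N: "Vnorm l (\<lambda>x. \<phi> x - sp N c x) < e / D"
      using sines_dense_Vsp[OF \<phi>, of "e / D"] \<open>e > 0\<close> D by auto
    define \<delta> where "\<delta> = (\<lambda>x. \<phi> x - sp N c x)"
    have \<delta>V: "\<delta> \<in> Vsp l" unfolding \<delta>_def using Vsp_lin[OF \<phi> sp_in_Vsp, of 1 "-1"] by simp
    have "\<psi> \<delta> = \<psi> \<phi> - \<psi> (sp N c)"
      unfolding \<delta>_def using VdualD[OF \<psi> \<phi> sp_in_Vsp, of 1 "-1"] by simp
    then have "\<bar>\<psi> \<phi>\<bar> \<le> \<bar>\<psi> \<delta>\<bar> + \<bar>\<psi> (sp N c)\<bar>" by linarith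
    also have "\<dots> \<le> dual_norm l \<psi> * Vnorm l \<delta> + r * Vnorm l (sp N c)"
      by (intro add_mono Vdual_bound[OF \<psi> \<delta>V] bsp)
    also have "Vnorm l (sp N c) \<le> Vnorm l \<phi> + Vnorm l \<delta>"
    proof -
      have "sp N c = (\<lambda>x. 1 * \<phi> x + (-1) * \<delta> x)" by (simp add: \<delta>_def)
      then show ?thesis
        using Vnorm_lin_le[OF VspD(1,2)[OF \<phi>] VspD(1,2)[OF \<delta>V], of 1 "-1"] by simp
    qed
    finally have "\<bar>\<psi> \<phi>\<bar> \<le> dual_norm l \<psi> * Vnorm l \<delta> + r * (Vnorm l \<phi> + Vnorm l \<delta>)"
      using r0 by (simp add: mult_left_mono)
    also have "\<dots> = r * Vnorm l \<phi> + (dual_norm l \<psi> + r) * Vnorm l \<delta>" by (simp add: algebra_simps)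
    also have "(dual_norm l \<psi> + r) * Vnorm l \<delta> \<le> D * (e / D)"
      using N Vnorm_nonneg[of \<delta>] D by (intro mult_mono) (auto simp: \<delta>_def D_def)
    also have "D * (e / D) = e" using D by simp
    finally show "\<bar>\<psi> \<phi>\<bar> \<le> r * Vnorm l \<phi> + e" by simp
  qed
  have "dual_norm l \<psi> \<le> r"
    unfolding dual_norm_def
  proof (rule cSUP_least)
    show "{\<phi> \<in> Vsp l. Vnorm l \<phi> \<le> 1} \<noteq> {}" using zero_in_Vsp Vnorm_zero by auto
    fix \<phi> assume "\<phi> \<in> {\<phi> \<in> Vsp l. Vnorm l \<phi> \<le> 1}"
    then show "\<bar>\<psi> \<phi>\<bar> \<le> r" using ball[of \<phi>] mult_left_mono[of "Vnorm l \<phi>" 1 r] r0 by auto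
  qed
  then have "(dual_norm l \<psi>)\<^sup>2 \<le> r\<^sup>2" using dual_norm_nonneg[OF \<psi>] by (intro power_mono) auto
  with up have "(dual_norm l \<psi>)\<^sup>2 = suminf q" unfolding r_def using suminf_nonneg[OF sm q0] by simp
  then show ?thesis using summable_sums[OF sm] by (simp add: q_def[abs_def])
qed

text \<open>Convergence in L^2(0,T;V') implies L^2 convergence of each sine coefficient, because a
  coefficient is one term of the series in \<open>dual_norm_sums\<close>. Part of the work is that
  the difference has a measurable and square integrable dual norm.\<close>

lemma L2_Vdual_diff_bound:
  assumes g1: "g1 \<in> L2_Vdual l T" and g2: "g2 \<in> L2_Vdual l T"
  shows "sqint (Time T) (\<lambda>t. g1 t (sb k) - g2 t (sb k))"
    and "(\<integral>t. (g1 t (sb k) - g2 t (sb k))\<^sup>2 \<partial>Time T) \<le>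
      (1 + (mu k)\<^sup>2) * (L2_Vdual_norm l T (\<lambda>t \<phi>. g1 t \<phi> - g2 t \<phi>))\<^sup>2"
proof -
  define D where "D = (\<lambda>t \<phi>. g1 t \<phi> - g2 t \<phi>)"
  have m: "1 + (mu k)\<^sup>2 > 0" for k by (simp add: add_pos_nonneg)
  have ae1: "AE t in Time T. g1 t \<in> Vdual l" and ae2: "AE t in Time T. g2 t \<in> Vdual l"
    and [measurable]: "(\<lambda>t. g1 t (sb k)) \<in> borel_measurable (Time T)" "(\<lambda>t. g2 t (sb k)) \<in> borel_measurable (Time T)"
    and i1: "integrable (Time T) (\<lambda>t. (dual_norm l (g1 t))\<^sup>2)" and i2: "integrable (Time T) (\<lambda>t. (dual_norm l (g2 t))\<^sup>2)"
    for k
    using g1 g2 sb_in_Vsp by (auto simp: L2_Vdual_def)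
  have DV: "D t \<in> Vdual l" if g12: "g1 t \<in> Vdual l" "g2 t \<in> Vdual l" for t
  proof -
    obtain C1 where C1: "\<And>\<phi>. \<phi> \<in> Vsp l \<Longrightarrow> \<bar>g1 t \<phi>\<bar> \<le> C1 * Vnorm l \<phi>"
      using g12 unfolding Vdual_def by blast
    obtain C2 where C2: "\<And>\<phi>. \<phi> \<in> Vsp l \<Longrightarrow> \<bar>g2 t \<phi>\<bar> \<le> C2 * Vnorm l \<phi>"
      using g12 unfolding Vdual_def by blast
    from C1 C2 have "\<forall>\<phi>\<in>Vsp l. \<bar>D t \<phi>\<bar> \<le> (C1 + C2) * Vnorm l \<phi>"
      unfolding D_def distrib_right by (smt (verit, best))
    moreover have "\<forall>\<phi>\<in>Vsp l. \<forall>\<theta>\<in>Vsp l. \<forall>a b. D t (\<lambda>x. a * \<phi> x + b * \<theta> x) = a * D t \<phi> + b * D t \<theta>"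
      using VdualD[OF g12(1)] VdualD[OF g12(2)] by (simp add: D_def algebra_simps)
    ultimately show ?thesis unfolding Vdual_def by blast
  qed
  have sums: "AE t in Time T. (\<lambda>k. (D t (sb k))\<^sup>2 / (1 + (mu k)\<^sup>2)) sums (dual_norm l (D t))\<^sup>2 \<and>
      (dual_norm l (D t))\<^sup>2 \<le> 2 * (dual_norm l (g1 t))\<^sup>2 + 2 * (dual_norm l (g2 t))\<^sup>2"
    using ae1 ae2
  proof eventually_elim
    case (elim t)
    note s = dual_norm_sums[OF DV[OF elim]]
    have "(dual_norm l (D t))\<^sup>2 \<le> 2 * (dual_norm l (g1 t))\<^sup>2 + 2 * (dual_norm l (g2 t))\<^sup>2"
    proof (rule sums_le[OF _ s sums_add[OF sums_mult[OF dual_norm_sums[OF elim(1)]] sums_mult[OF dual_norm_sums[OF elim(2)]]]])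
      fix k
      have "(D t (sb k))\<^sup>2 \<le> 2 * (g1 t (sb k))\<^sup>2 + 2 * (g2 t (sb k))\<^sup>2"
        using zero_le_power2[of "g1 t (sb k) + g2 t (sb k)"] by (simp add: D_def power2_sum power2_diff)
      from divide_right_mono[OF this, of "1 + (mu k)\<^sup>2"]
      show "(D t (sb k))\<^sup>2 / (1 + (mu k)\<^sup>2) \<le> 2 * ((g1 t (sb k))\<^sup>2 / (1 + (mu k)\<^sup>2)) + 2 * ((g2 t (sb k))\<^sup>2 / (1 + (mu k)\<^sup>2))"
        using m[of k] by (simp add: add_divide_distrib)
    qed
    with s show ?case by simp
  qed
  \<comment> \<open>Measurability comes from the series of coefficients, each of which is measurable
    in t; the supremum runs over an uncountable set.\<close>
  have meas: "(\<lambda>t. (dual_norm l (D t))\<^sup>2) \<in> borel_measurable (Time T)"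
  proof (rule measurable_cong_AE_lebesgue_on)
    show "(\<lambda>t. \<Sum>k. (D t (sb k))\<^sup>2 / (1 + (mu k)\<^sup>2)) \<in> borel_measurable (Time T)"
      unfolding D_def by measurable
    show "AE t in Time T. (\<Sum>k. (D t (sb k))\<^sup>2 / (1 + (mu k)\<^sup>2)) = (dual_norm l (D t))\<^sup>2"
      using sums by eventually_elim (auto simp: sums_iff)
  qed simp
  have int: "integrable (Time T) (\<lambda>t. (dual_norm l (D t))\<^sup>2)"
  proof (rule Bochner_Integration.integrable_bound[OF _ meas])
    show "integrable (Time T) (\<lambda>t. 2 * (dual_norm l (g1 t))\<^sup>2 + 2 * (dual_norm l (g2 t))\<^sup>2)"
      using i1 i2 by simp
    show "AE t in Time T. norm ((dual_norm l (D t))\<^sup>2) \<le> norm (2 * (dual_norm l (g1 t))\<^sup>2 + 2 * (dual_norm l (g2 t))\<^sup>2)"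
      using sums by eventually_elim simp
  qed
  have le: "AE t in Time T. (D t (sb k))\<^sup>2 \<le> (1 + (mu k)\<^sup>2) * (dual_norm l (D t))\<^sup>2"
    using sums
  proof eventually_elim
    case (elim t)
    have "(D t (sb k))\<^sup>2 / (1 + (mu k)\<^sup>2) \<le> (dual_norm l (D t))\<^sup>2"
    proof -
      have s: "summable (\<lambda>k. (D t (sb k))\<^sup>2 / (1 + (mu k)\<^sup>2))" "(\<Sum>k. (D t (sb k))\<^sup>2 / (1 + (mu k)\<^sup>2)) = (dual_norm l (D t))\<^sup>2"
        using elim by (auto simp: sums_iff)
      have "(\<Sum>i\<in>{k}. (D t (sb i))\<^sup>2 / (1 + (mu i)\<^sup>2)) \<le> (\<Sum>k. (D t (sb k))\<^sup>2 / (1 + (mu k)\<^sup>2))"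
        by (rule sum_le_suminf[OF s(1)]) auto
      then show ?thesis by (simp add: s(2))
    qed
    then show ?case using m[of k] by (simp add: field_simps)
  qed
  have Dm: "(\<lambda>t. (D t (sb k))\<^sup>2) \<in> borel_measurable (Time T)" unfolding D_def by measurable
  have Di: "integrable (Time T) (\<lambda>t. (D t (sb k))\<^sup>2)"
    by (rule Bochner_Integration.integrable_bound[OF integrable_mult_right[OF int, of "1 + (mu k)\<^sup>2"] Dm])
      (use le in \<open>eventually_elim, auto\<close>)
  then show "sqint (Time T) (\<lambda>t. g1 t (sb k) - g2 t (sb k))"
    by (auto simp: sqint_def D_def)
  have "(\<integral>t. (D t (sb k))\<^sup>2 \<partial>Time T) \<le> (\<integral>t. (1 + (mu k)\<^sup>2) * (dual_norm l (D t))\<^sup>2 \<partial>Time T)"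
    by (rule integral_mono_AE[OF Di _ le]) (use int in simp)
  also have "\<dots> = (1 + (mu k)\<^sup>2) * (L2_Vdual_norm l T D)\<^sup>2"
    by (simp add: L2_Vdual_norm_def integral_nonneg_AE)
  finally show "(\<integral>t. (g1 t (sb k) - g2 t (sb k))\<^sup>2 \<partial>Time T) \<le>
      (1 + (mu k)\<^sup>2) * (L2_Vdual_norm l T (\<lambda>t \<phi>. g1 t \<phi> - g2 t \<phi>))\<^sup>2"
    by (simp add: D_def)
qed

end

section \<open>The semigroup on the sine basis\<close>

lemma Hnorm_triangle:
  assumes "sqint (Ivl l) u" "sqint (Ivl l) v"
  shows "Hnorm l (\<lambda>x. u x + v x) \<le> Hnorm l u + Hnorm l v"
  using sqint_triangle[OF assms] by (simp add: Hnorm_eq)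

lemma Hnorm_scale: "Hnorm l (\<lambda>x. a * u x) = \<bar>a\<bar> * Hnorm l u"
  by (simp add: Hnorm_eq power_mult_distrib real_sqrt_mult)

lemma Hnorm_cong_AE:
  assumes "AE x in Ivl l. u x = v x" shows "Hnorm l u = Hnorm l v"
  by (simp add: Hnorm_eq sq_integral_cong_AE[OF assms])

lemma Hnorm_zero_AE:
  assumes "sqint (Ivl l) u" "Hnorm l u = 0" shows "AE x in Ivl l. u x = 0"
proof -
  have "(\<integral>x. (u x)\<^sup>2 \<partial>Ivl l) = 0" using assms(2) Hnorm_sq[of l u] by simp
  then show ?thesis using assms(1) by (subst (asm) integral_nonneg_eq_0_iff_AE) (auto simp: sqint_def)
qed

lemma Hnorm_lin_le:
  assumes "sqint (Ivl l) u" "sqint (Ivl l) v"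
  shows "Hnorm l (\<lambda>x. a * u x + b * v x) \<le> \<bar>a\<bar> * Hnorm l u + \<bar>b\<bar> * Hnorm l v"
  using Hnorm_triangle[OF sqint_scale[OF assms(1), of a] sqint_scale[OF assms(2), of b]] by (simp add: Hnorm_scale)

context
  fixes l :: real and B :: "rfun \<Rightarrow> rfun"
  assumes B: "bounded_op l B"
begin

lemma bounded_op_sqint: "sqint (Ivl l) u \<Longrightarrow> sqint (Ivl l) (B u)"
  using B by (auto simp: bounded_op_def Hsp_iff)

lemma bounded_op_lin:
  assumes "sqint (Ivl l) u" "sqint (Ivl l) v"
  shows "AE x in Ivl l. B (\<lambda>x. a * u x + b * v x) x = a * B u x + b * B v x"
  using B assms by (auto simp: bounded_op_def Hsp_iff ae_eq_def)

lemma bounded_op_bound: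
  obtains C where "C \<ge> 0" "\<And>u. sqint (Ivl l) u \<Longrightarrow> Hnorm l (B u) \<le> C * Hnorm l u"
proof -
  obtain C where C: "\<And>u. sqint (Ivl l) u \<Longrightarrow> Hnorm l (B u) \<le> C * Hnorm l u"
    using B unfolding bounded_op_def Hsp_iff[symmetric] by blast
  have "Hnorm l (B u) \<le> \<bar>C\<bar> * Hnorm l u" if "sqint (Ivl l) u" for u
    using C[OF that] mult_right_mono[OF abs_ge_self[of C] Hnorm_nonneg[of l u]] by linarith
  then show thesis using that[of "\<bar>C\<bar>"] by auto
qed

text \<open>Operators act on representatives. Linearity and boundedness together make the image of a
  null function null, so that B descends to classes.\<close>

lemma bounded_op_cong:
  assumes u: "sqint (Ivl l) u" and v: "sqint (Ivl l) v" and ae: "AE x in Ivl l. u x = v x"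
  shows "AE x in Ivl l. B u x = B v x"
proof -
  obtain C where C: "\<And>u. sqint (Ivl l) u \<Longrightarrow> Hnorm l (B u) \<le> C * Hnorm l u" using bounded_op_bound by blast
  let ?d = "\<lambda>x. 1 * u x + (-1) * v x"
  have d: "sqint (Ivl l) ?d" by (rule sqint_lin[OF u v])
  have "Hnorm l ?d = Hnorm l (\<lambda>x. 0)" by (rule Hnorm_cong_AE) (use ae in auto)
  then have "Hnorm l (B ?d) \<le> 0" using C[OF d] by (simp add: Hnorm_eq)
  then have "Hnorm l (B ?d) = 0" using Hnorm_nonneg[of l "B ?d"] by linarith
  from Hnorm_zero_AE[OF bounded_op_sqint[OF d] this] bounded_op_lin[OF u v, of 1 "-1"]
  show ?thesis
  proof eventually_elim
    case (elim x)
    then have "1 * B u x + (-1) * B v x = 0" by metis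
    then show ?case by simp
  qed
qed

end

section \<open>The operator A on the sine basis\<close>

context interval
begin

lemma coef_abs_le_Hnorm: "sqint (Ivl l) h \<Longrightarrow> \<bar>coef h k\<bar> \<le> Hnorm l h"
  using coef_abs_le by (simp add: Hnorm_eq)

lemma Hnorm_sb: "Hnorm l (sb k) = 1"
  using sb_orthonormal[of k k] by (simp add: Hnorm_eq power2_eq_square)

lemma bounded_op_sp:
  assumes B: "bounded_op l B"
  shows "AE x in Ivl l. B (sp N c) x = (\<Sum>k<N. c k * B (sb k) x)"
proof (induction N)
  case 0
  have "AE x in Ivl l. B (\<lambda>x. 0 * sb 0 x + 0 * sb 0 x) x = 0 * B (sb 0) x + 0 * B (sb 0) x"
    by (rule bounded_op_lin[OF B sqint_sb sqint_sb])
  then show ?case by (simp add: sp_def[abs_def])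
next
  case (Suc N)
  have eq: "sp (Suc N) c = (\<lambda>x. 1 * sp N c x + c N * sb N x)" by (simp add: sp_def fun_eq_iff)
  have "AE x in Ivl l. B (sp (Suc N) c) x = 1 * B (sp N c) x + c N * B (sb N) x"
    unfolding eq by (rule bounded_op_lin[OF B sqint_sp sqint_sb])
  then show ?case using Suc by eventually_elim simp
qed

definition lam :: "real \<Rightarrow> nat \<Rightarrow> real"
  where "lam c k = (mu k) ^ 4 - (mu k)\<^sup>2 + c"

lemma Dx_scaled_sb:
  assumes "AE x in Ivl l. z x = a * sb k x"
  shows "weak_deriv l z (\<lambda>x. a * sb' k x)" "AE x in Ivl l. Dx l z x = a * sb' k x"
proof -
  have "weak_deriv l (\<lambda>x. a * sb k x) (\<lambda>x. a * sb' k x)"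
    using weak_deriv_lin[OF sqint_sb weak_deriv_sb sqint_sb weak_deriv_sb, of a k 0 k] by simp
  then show "weak_deriv l z (\<lambda>x. a * sb' k x)"
    by (rule weak_deriv_cong[rotated]) (use assms in auto)
  then show "AE x in Ivl l. Dx l z x = a * sb' k x" by (rule Dx_AE)
qed

lemma Dx_scaled_sb':
  assumes "AE x in Ivl l. z x = a * sb' k x"
  shows "weak_deriv l z (\<lambda>x. - a * (mu k)\<^sup>2 * sb k x)" "AE x in Ivl l. Dx l z x = - a * (mu k)\<^sup>2 * sb k x"
proof -
  have "weak_deriv l (\<lambda>x. a * sb' k x) (\<lambda>x. - a * (mu k)\<^sup>2 * sb k x)"
    using weak_deriv_lin[OF sqint_sb' weak_deriv_sb' sqint_sb' weak_deriv_sb', of a k 0 k] by (simp add: mult.assoc)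
  then show "weak_deriv l z (\<lambda>x. - a * (mu k)\<^sup>2 * sb k x)"
    by (rule weak_deriv_cong[rotated]) (use assms in auto)
  then show "AE x in Ivl l. Dx l z x = - a * (mu k)\<^sup>2 * sb k x" by (rule Dx_AE)
qed

lemma sb_eigen:
  "sb k \<in> A_dom l" "AE x in Ivl l. A_op l c (sb k) x = - lam c k * sb k x"
proof -
  have 0: "AE x in Ivl l. (Dx l ^^ 0) (sb k) x = 1 * sb k x" by simp
  note 1 = Dx_scaled_sb[OF 0]
  note 2 = Dx_scaled_sb'[OF 1(2)]
  note 3 = Dx_scaled_sb[OF 2(2)]
  note 4 = Dx_scaled_sb'[OF 3(2)]
  have ex: "\<exists>g. weak_deriv l ((Dx l ^^ i) (sb k)) g" if "i < 4" for i
  proof -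
    consider "i = 0" | "i = 1" | "i = 2" | "i = 3" using \<open>i < 4\<close> by linarith
    then show ?thesis
    proof cases
      assume "i = 0" then show ?thesis using 1(1) by auto
    next
      assume "i = 1" then show ?thesis using 2(1) by (auto simp: One_nat_def)
    next
      assume "i = 2" then show ?thesis using 3(1) by (auto simp: numeral_2_eq_2)
    next
      assume "i = 3" then show ?thesis using 4(1) by (auto simp: numeral_3_eq_3)
    qed
  qed
  have "(\<lambda>x. (- 1 * (mu k)\<^sup>2) * sb k x + 0 * sb k x) \<in> Vsp l"
    by (rule Vsp_lin[OF sb_in_Vsp sb_in_Vsp])
  then have V2: "(Dx l ^^ 2) (sb k) \<in> Vsp l"
    by (rule Vsp_cong_AE[rotated]) (use 2(2) in \<open>auto simp: numeral_2_eq_2\<close>)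
  show "sb k \<in> A_dom l"
    unfolding A_dom_def Hk_def using ex sb_in_Vsp V2 sqint_sb by (simp add: Hsp_iff)
  have a2: "AE x in Ivl l. (Dx l ^^ 2) (sb k) x = - 1 * (mu k)\<^sup>2 * sb k x"
    using 2(2) by (simp add: numeral_2_eq_2)
  have a4: "AE x in Ivl l. (Dx l ^^ 4) (sb k) x = - (- 1 * (mu k)\<^sup>2) * (mu k)\<^sup>2 * sb k x"
  proof -
    have "(Dx l ^^ 4) (sb k) = Dx l (Dx l (Dx l (Dx l ((Dx l ^^ 0) (sb k)))))" by (simp add: eval_nat_numeral One_nat_def)
    then show ?thesis using 4(2) by (simp only:)
  qed
  show "AE x in Ivl l. A_op l c (sb k) x = - lam c k * sb k x"
    unfolding A_op_def using a2 a4
    by eventually_elim (simp add: lam_def algebra_simps power4_eq_xxxx power2_eq_square)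
qed

text \<open>Symmetry of A, tested against an eigenfunction. It uses exactly the boundary conditions
  in \<open>A_dom\<close>: both u and u_xx lie in V.\<close>

lemma coef_A_op:
  assumes u: "u \<in> A_dom l"
  shows "coef (A_op l c u) k = - lam c k * coef u k"
proof -
  define u1 where "u1 = Dx l u"
  define u2 where "u2 = Dx l u1"
  define u3 where "u3 = Dx l u2"
  define u4 where "u4 = Dx l u3"
  have e: "(Dx l ^^ 0) u = u" "(Dx l ^^ 1) u = u1" "(Dx l ^^ 2) u = u2" "(Dx l ^^ 3) u = u3" "(Dx l ^^ 4) u = u4"
    by (simp_all add: u1_def u2_def u3_def u4_def eval_nat_numeral One_nat_def)
  have ex: "\<exists>g. weak_deriv l ((Dx l ^^ i) u) g" if "i < 4" for i
    using u that by (simp add: A_dom_def Hk_def)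
  have w1: "weak_deriv l u u1" using ex[of 0] weak_deriv_Dx by (auto simp: e u1_def)
  have w2: "weak_deriv l u1 u2" using ex[of 1] weak_deriv_Dx by (auto simp: e u2_def)
  have w3: "weak_deriv l u2 u3" using ex[of 2] weak_deriv_Dx by (auto simp: e u3_def)
  have w4: "weak_deriv l u3 u4" using ex[of 3] weak_deriv_Dx by (auto simp: e u4_def)
  have V: "u \<in> Vsp l" "u2 \<in> Vsp l" using u by (auto simp: A_dom_def e)
  have s: "sqint (Ivl l) u" "sqint (Ivl l) u2" "sqint (Ivl l) u4"
    using V w2 w4 by (auto simp: weak_deriv_iff VspD)
  have by_parts: "(\<integral>x. Dx l z x * sb' k x \<partial>Ivl l) = (mu k)\<^sup>2 * coef z k" if "z \<in> Vsp l" for z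
  proof -
    have "(\<integral>x. Dx l z x * sb' k x \<partial>Ivl l) = - (\<integral>x. z x * (- (mu k)\<^sup>2 * sb k x) \<partial>Ivl l)"
      by (rule Vsp_integration_by_parts[OF that]) (intro continuous_intros sb'_has_derivative)+
    also have "(\<lambda>x. z x * (- (mu k)\<^sup>2 * sb k x)) = (\<lambda>x. - (mu k)\<^sup>2 * (z x * sb k x))" by auto
    finally show ?thesis by (simp add: coef_def)
  qed
  \<comment> \<open>Two integrations by parts: z in V removes the boundary term against the cosine
    \<open>sb' k\<close>, and the zeros of \<open>sb k\<close> remove the one for the derivative of
    z. It is applied to z = u and to z = u_xx.\<close>
  have step: "coef z2 k = - (mu k)\<^sup>2 * coef z k" if "z \<in> Vsp l" "weak_deriv l (Dx l z) z2" for z z2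
  proof -
    have "(\<integral>x. Dx l z x * deriv (sb k) x \<partial>Ivl l) = - (\<integral>x. z2 x * sb k x \<partial>Ivl l)"
      using that(2) sb_in_C0inf unfolding weak_deriv_iff by blast
    then show ?thesis using by_parts[OF that(1)] by (simp add: coef_def deriv_sb)
  qed
  have c2: "coef u2 k = - (mu k)\<^sup>2 * coef u k" by (rule step[OF V(1)]) (use w2 in \<open>simp add: u1_def\<close>)
  have c4: "coef u4 k = - (mu k)\<^sup>2 * coef u2 k" by (rule step[OF V(2)]) (use w4 in \<open>simp add: u3_def\<close>)
  have "A_op l c u = (\<lambda>x. - u4 x - u2 x - c * u x)" by (simp add: A_op_def e)
  then have "coef (A_op l c u) k = coef (\<lambda>x. - u4 x - u2 x - c * u x) k" by simp
  also have "\<dots> = - coef u4 k - coef u2 k - c * coef u k"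
    unfolding coef_def
    using sqint_mult[OF s(1) sqint_sb[of k]] sqint_mult[OF s(2) sqint_sb[of k]] sqint_mult[OF s(3) sqint_sb[of k]]
    by (simp add: left_diff_distrib mult.assoc)
  finally show ?thesis by (simp add: c2 c4 lam_def algebra_simps power4_eq_xxxx power2_eq_square)
qed

text \<open>Equality of two eigenvalues factors as ((mu j)^2 - (mu k)^2) ((mu j)^2 + (mu k)^2 - 1) =
  0, so at most one further index shares the value.\<close>

lemma finite_lam_eq: "finite {j. lam c j = lam c k}"
proof (rule finite_subset)
  have "mu j = mu k \<or> mu j = sqrt (1 - (mu k)\<^sup>2)" if "lam c j = lam c k" for j
  proof -
    have "((mu j)\<^sup>2 - (mu k)\<^sup>2) * ((mu j)\<^sup>2 + (mu k)\<^sup>2 - 1) = 0"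
      using that by (simp add: lam_def algebra_simps power4_eq_xxxx power2_eq_square)
    then have "(mu j)\<^sup>2 = (mu k)\<^sup>2 \<or> 1 - (mu k)\<^sup>2 = (mu j)\<^sup>2" by auto
    then show ?thesis using mu_pos[of j] mu_pos[of k] by (auto simp: power2_eq_iff)
  qed
  then show "{j. lam c j = lam c k} \<subseteq> mu -` {mu k, sqrt (1 - (mu k)\<^sup>2)}" by auto
  show "finite (mu -` {mu k, sqrt (1 - (mu k)\<^sup>2)})"
    by (rule finite_vimageI) (auto simp: inj_def mu_inj)
qed

end

section \<open>The semigroup acts diagonally on the sine basis\<close>

locale kuramoto_semigroup = interval +
  fixes c :: real and S :: "real \<Rightarrow> rfun \<Rightarrow> rfun"
  assumes generated: "semigroup_generated_by l (A_dom l) (A_op l c) S"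
begin

lemma S_bounded: "t \<ge> 0 \<Longrightarrow> bounded_op l (S t)"
  using generated by (simp add: semigroup_generated_by_def)

lemma S_zero: "sqint (Ivl l) u \<Longrightarrow> AE x in Ivl l. S 0 u x = u x"
  using generated by (simp add: semigroup_generated_by_def Hsp_iff ae_eq_def)

lemma S_add: "s \<ge> 0 \<Longrightarrow> t \<ge> 0 \<Longrightarrow> sqint (Ivl l) u \<Longrightarrow> AE x in Ivl l. S (s + t) u x = S s (S t u) x"
  using generated by (simp add: semigroup_generated_by_def Hsp_iff ae_eq_def)

lemma S_continuous: "sqint (Ivl l) u \<Longrightarrow> ((\<lambda>t. Hnorm l (\<lambda>x. S t u x - u x)) \<longlongrightarrow> 0) (at_right 0)"
  using generated by (simp add: semigroup_generated_by_def Hsp_iff)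

lemma S_generator:
  assumes "sqint (Ivl l) u" "sqint (Ivl l) v"
  shows "((\<lambda>h. Hnorm l (\<lambda>x. (S h u x - u x) / h - v x)) \<longlongrightarrow> 0) (at_right 0) \<longleftrightarrow>
    u \<in> A_dom l \<and> (AE x in Ivl l. v x = A_op l c u x)"
  using generated assms by (simp add: semigroup_generated_by_def Hsp_iff ae_eq_def)

lemma S_sqint: "t \<ge> 0 \<Longrightarrow> sqint (Ivl l) u \<Longrightarrow> sqint (Ivl l) (S t u)"
  by (rule bounded_op_sqint[OF S_bounded])

lemma S_sb_difference_quotient:
  "((\<lambda>h. Hnorm l (\<lambda>x. (S h (sb k) x - sb k x) / h - (- lam c k * sb k x))) \<longlongrightarrow> 0) (at_right 0)"
proof (subst S_generator[OF sqint_sb])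
  show "sqint (Ivl l) (\<lambda>x. - lam c k * sb k x)" by (rule sqint_scale[OF sqint_sb])
  have "AE x in Ivl l. - lam c k * sb k x = A_op l c (sb k) x" using sb_eigen(2)[of c k] by eventually_elim simp
  then show "sb k \<in> A_dom l \<and> (AE x in Ivl l. - lam c k * sb k x = A_op l c (sb k) x)"
    using sb_eigen(1) by blast
qed

text \<open>The orbit of an eigenfunction stays in its eigenspace, because \<open>S t\<close> commutes with the generator.\<close>

lemma S_sb_eigenspace:
  assumes t: "t \<ge> 0" and j: "lam c j \<noteq> lam c k"
  shows "coef (S t (sb k)) j = 0"
proof -
  define u where "u = S t (sb k)"
  have u: "sqint (Ivl l) u" unfolding u_def by (rule S_sqint[OF t sqint_sb])
  obtain C where C: "C \<ge> 0" "\<And>u. sqint (Ivl l) u \<Longrightarrow> Hnorm l (S t u) \<le> C * Hnorm l u"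
    using bounded_op_bound[OF S_bounded[OF t]] by blast
  let ?q = "\<lambda>h x. (S h (sb k) x - sb k x) / h - (- lam c k * sb k x)"
  have le: "Hnorm l (\<lambda>x. (S h u x - u x) / h - (- lam c k * u x)) \<le> C * Hnorm l (?q h)" if h: "h > 0" for h
  proof -
    have sh: "sqint (Ivl l) (S h (sb k))" using S_sqint[OF _ sqint_sb, of h] h by simp
    let ?r = "\<lambda>x. (1 / h) * S h (sb k) x + (- 1 / h + lam c k) * sb k x"
    have qr: "?q h = ?r" by (auto simp: field_simps diff_divide_distrib)
    have r: "sqint (Ivl l) ?r" by (rule sqint_lin[OF sh sqint_sb])
    have 1: "AE x in Ivl l. S t ?r x = (1 / h) * S t (S h (sb k)) x + (- 1 / h + lam c k) * S t (sb k) x"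
      by (rule bounded_op_lin[OF S_bounded[OF t] sh sqint_sb])
    have 2: "AE x in Ivl l. S (t + h) (sb k) x = S t (S h (sb k)) x" using h t by (intro S_add sqint_sb) auto
    have 3: "AE x in Ivl l. S (h + t) (sb k) x = S h (S t (sb k)) x" using h t by (intro S_add sqint_sb) auto
    have "AE x in Ivl l. (S h u x - u x) / h - (- lam c k * u x) = S t ?r x"
      using 1 2 3
    proof eventually_elim
      case (elim x)
      then have "S h u x = S t (S h (sb k)) x" by (simp add: u_def add.commute)
      with elim(1) show ?case using h by (simp add: u_def field_simps)
    qed
    then have "Hnorm l (\<lambda>x. (S h u x - u x) / h - (- lam c k * u x)) = Hnorm l (S t ?r)" by (rule Hnorm_cong_AE)
    then show ?thesis using C(2)[OF r] by (simp only: qr)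
  qed
  have "((\<lambda>h. C * Hnorm l (?q h)) \<longlongrightarrow> C * 0) (at_right 0)" by (intro tendsto_intros S_sb_difference_quotient)
  then have lim: "((\<lambda>h. C * Hnorm l (?q h)) \<longlongrightarrow> 0) (at_right 0)" by simp
  have "((\<lambda>h. Hnorm l (\<lambda>x. (S h u x - u x) / h - (- lam c k * u x))) \<longlongrightarrow> 0) (at_right 0)"
  proof (rule real_tendsto_sandwich[OF _ _ tendsto_const lim])
    show "\<forall>\<^sub>F h in at_right 0. Hnorm l (\<lambda>x. (S h u x - u x) / h - (- lam c k * u x)) \<le> C * Hnorm l (?q h)"
      using le by (auto simp: eventually_at_right_field intro!: exI[of _ 1])
  qed (auto simp: Hnorm_nonneg)
  then have "u \<in> A_dom l \<and> (AE x in Ivl l. - lam c k * u x = A_op l c u x)"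
    by (subst (asm) S_generator[OF u sqint_scale[OF u]])
  then have "coef (A_op l c u) j = coef (\<lambda>x. - lam c k * u x) j" and "u \<in> A_dom l"
    by (auto intro: coef_cong_AE elim: AE_mp)
  moreover have "coef (\<lambda>x. - lam c k * u x) j = - lam c k * coef u j"
    using coef_lin[OF u u, of "- lam c k" 0 j] by simp
  \<comment> \<open>Index j of the equation A u = - lam k u: by \<open>coef_A_op\<close> the left
    side carries lam j, so the coefficient vanishes when the two values differ.\<close>
  ultimately have "- lam c k * coef u j = - lam c j * coef u j" using coef_A_op[of u c j] by metis
  then show ?thesis using j by (auto simp: u_def)
qed

text \<open>The eigenspace is spanned by finitely many sines. Strong continuity at 0 keeps all their
  images of norm at most 2 for small t, and each coefficient is at most the norm of w, hence K = 2
  card J. This replaces a uniform bound for S on the whole space.\<close>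

lemma S_bound_on_eigenspace:
  "\<exists>\<epsilon>>0. \<exists>K\<ge>0. \<forall>t w. 0 \<le> t \<and> t \<le> \<epsilon> \<and> sqint (Ivl l) w \<and> (\<forall>j. lam c j \<noteq> lam c k \<longrightarrow> coef w j = 0) \<longrightarrow>
    Hnorm l (S t w) \<le> K * Hnorm l w"
proof -
  define J where "J = {j. lam c j = lam c k}"
  have fJ: "finite J" unfolding J_def by (rule finite_lam_eq)
  have "\<forall>\<^sub>F t in at_right 0. \<forall>j\<in>J. Hnorm l (\<lambda>x. S t (sb j) x - sb j x) < 1"
    by (rule eventually_ball_finite[OF fJ]) (auto intro!: order_tendstoD(2)[OF S_continuous[OF sqint_sb]])
  then obtain \<delta> where \<delta>: "\<delta> > 0" "\<And>t j. 0 < t \<Longrightarrow> t < \<delta> \<Longrightarrow> j \<in> J \<Longrightarrow> Hnorm l (\<lambda>x. S t (sb j) x - sb j x) < 1"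
    by (auto simp: eventually_at_right_field)
  have le2: "Hnorm l (S t (sb j)) \<le> 2" if "0 \<le> t" "t \<le> \<delta> / 2" "j \<in> J" for t j
  proof (cases "t = 0")
    case True
    then show ?thesis using Hnorm_cong_AE[OF S_zero[OF sqint_sb]] by (simp add: Hnorm_sb)
  next
    case False
    then have "Hnorm l (\<lambda>x. S t (sb j) x - sb j x) < 1" using \<delta>(2)[of t j] \<delta>(1) that by simp
    moreover have "Hnorm l (\<lambda>x. (S t (sb j) x - sb j x) + sb j x) \<le> Hnorm l (\<lambda>x. S t (sb j) x - sb j x) + Hnorm l (sb j)"
      by (rule Hnorm_triangle[OF sqint_diff[OF S_sqint[OF that(1) sqint_sb] sqint_sb] sqint_sb])
    ultimately show ?thesis by (simp add: Hnorm_sb)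
  qed
  have "Hnorm l (S t w) \<le> (2 * real (card J)) * Hnorm l w"
    if t: "0 \<le> t" "t \<le> \<delta> / 2" and w: "sqint (Ivl l) w" "\<And>j. j \<notin> J \<Longrightarrow> coef w j = 0" for t w
  proof -
    obtain N where N: "J \<subseteq> {..<N}" using finite_nat_iff_bounded[of J] fJ by blast
    have "coef (\<lambda>x. 1 * sp N (coef w) x + (-1) * w x) j = 0" for j
      using coef_lin[OF sqint_sp w(1), of 1 N "coef w" "-1" j] w(2)[of j] N by (auto simp: coef_sp)
    from coef_zero_imp_AE[OF sqint_lin[OF sqint_sp w(1)] this]
    have ae: "AE x in Ivl l. sp N (coef w) x = w x" by simp
    have aeS: "AE x in Ivl l. S t (sp N (coef w)) x = S t w x"
      by (rule bounded_op_cong[OF S_bounded[OF t(1)] sqint_sp w(1) ae])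
    have bound: "Hnorm l (\<lambda>x. \<Sum>j\<in>I. coef w j * S t (sb j) x) \<le> (\<Sum>j\<in>I. \<bar>coef w j\<bar> * Hnorm l (S t (sb j)))"
      if "finite I" for I
      using that
    proof (induction I rule: finite_induct)
      case (insert i I)
      have "sqint (Ivl l) (\<lambda>x. coef w i * S t (sb i) x)" for i by (intro sqint_scale S_sqint[OF t(1)] sqint_sb)
      then have "Hnorm l (\<lambda>x. coef w i * S t (sb i) x + (\<Sum>j\<in>I. coef w j * S t (sb j) x)) \<le>
          Hnorm l (\<lambda>x. coef w i * S t (sb i) x) + Hnorm l (\<lambda>x. \<Sum>j\<in>I. coef w j * S t (sb j) x)"
        by (intro Hnorm_triangle sqint_sum insert) auto
      then show ?case using insert by (simp add: Hnorm_scale)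
    qed (simp add: Hnorm_eq)
    have "Hnorm l (S t w) = Hnorm l (S t (sp N (coef w)))" using Hnorm_cong_AE[OF aeS] by simp
    also have "\<dots> = Hnorm l (\<lambda>x. \<Sum>j<N. coef w j * S t (sb j) x)"
      by (rule Hnorm_cong_AE[OF bounded_op_sp[OF S_bounded[OF t(1)]]])
    also have "\<dots> \<le> (\<Sum>j<N. \<bar>coef w j\<bar> * Hnorm l (S t (sb j)))" by (rule bound) simp
    also have "\<dots> = (\<Sum>j\<in>J. \<bar>coef w j\<bar> * Hnorm l (S t (sb j)))"
      by (rule sum.mono_neutral_right) (use N w(2) in auto)
    also have "\<dots> \<le> (\<Sum>j\<in>J. Hnorm l w * 2)"
      by (intro sum_mono mult_mono coef_abs_le_Hnorm w le2 t) (auto simp: Hnorm_nonneg)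
    finally show ?thesis by simp
  qed
  then show ?thesis using \<delta>(1)
    by (intro exI[of _ "\<delta> / 2"] conjI exI[of _ "2 * real (card J)"]) (auto simp: J_def)
qed

text \<open>The defect r h = S h (sb k) - exp(- lam h) sb k is o(h) and stays in the eigenspace,
  where K controls S. With n+1 steps of length h = t/(n+1), the defects obey r((j+1) h) = S(j h) (r
  h) + exp(- lam h) r(j h). So n+1 errors of size o(h) accumulate, and the total vanishes in the
  limit.\<close>

lemma S_sb_local: "\<exists>\<epsilon>>0. \<forall>t. 0 \<le> t \<and> t \<le> \<epsilon> \<longrightarrow> (AE x in Ivl l. S t (sb k) x = exp (- lam c k * t) * sb k x)"
proof -
  obtain \<epsilon> K where \<epsilon>: "\<epsilon> > 0" "K \<ge> 0" and K: "\<And>t w. 0 \<le> t \<Longrightarrow> t \<le> \<epsilon> \<Longrightarrow> sqint (Ivl l) w \<Longrightarrow>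
      (\<And>j. lam c j \<noteq> lam c k \<Longrightarrow> coef w j = 0) \<Longrightarrow> Hnorm l (S t w) \<le> K * Hnorm l w"
    using S_bound_on_eigenspace[of k] by blast
  define r where "r h = (\<lambda>x. 1 * S h (sb k) x + (- exp (- lam c k * h)) * sb k x)" for h
  have rs: "sqint (Ivl l) (r h)" if "h \<ge> 0" for h
    unfolding r_def by (intro sqint_lin S_sqint that sqint_sb)
  have rc: "coef (r h) j = 0" if "h \<ge> 0" "lam c j \<noteq> lam c k" for h j
    unfolding r_def using coef_lin[OF S_sqint[OF that(1) sqint_sb] sqint_sb, of 1 k "- exp (- lam c k * h)" k j]
      S_sb_eigenspace[OF that] that(2) by (auto simp: coef_sb)
  \<comment> \<open>S h (sb k) and exp(- lam h) sb k have the same right derivative at h = 0, so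
    their difference is o(h).\<close>
  have rlim: "((\<lambda>h. Hnorm l (r h) / h) \<longlongrightarrow> 0) (at_right 0)"
  proof -
    let ?q = "\<lambda>h. Hnorm l (\<lambda>x. (S h (sb k) x - sb k x) / h - (- lam c k * sb k x))"
    let ?e = "\<lambda>h. \<bar>(exp (- lam c k * h) - 1) / h + lam c k\<bar>"
    have "((\<lambda>h. exp (- lam c k * h)) has_real_derivative - lam c k) (at 0)"
      by (auto intro!: derivative_eq_intros)
    then have "((\<lambda>h. (exp (- lam c k * h) - 1) / h) \<longlongrightarrow> - lam c k) (at 0)"
      by (simp add: has_field_derivative_iff)
    then have "((\<lambda>h. (exp (- lam c k * h) - 1) / h) \<longlongrightarrow> - lam c k) (at_right 0)"
      by (rule filterlim_mono) (auto simp: at_within_le_at)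
    from tendsto_rabs_zero[OF tendsto_add[OF this tendsto_const[of "lam c k"], simplified add.left_inverse]]
    have e: "(?e \<longlongrightarrow> 0) (at_right 0)" by simp
    have lim: "((\<lambda>h. ?q h + ?e h) \<longlongrightarrow> 0) (at_right 0)"
      using tendsto_add[OF S_sb_difference_quotient[of k] e] by simp
    show ?thesis
    proof (rule real_tendsto_sandwich[OF _ _ tendsto_const lim])
      show "\<forall>\<^sub>F h in at_right 0. 0 \<le> Hnorm l (r h) / h"
        by (auto simp: eventually_at_right_field Hnorm_nonneg intro!: exI[of _ 1])
      have "Hnorm l (r h) / h \<le> ?q h + ?e h" if h: "h > 0" for h
      proof -
        have sh: "sqint (Ivl l) (S h (sb k))" using S_sqint[OF _ sqint_sb, of h] h by simp
        have "sqint (Ivl l) (\<lambda>x. (1 / h) * S h (sb k) x + (- 1 / h + lam c k) * sb k x)"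
          by (rule sqint_lin[OF sh sqint_sb])
        then have s1: "sqint (Ivl l) (\<lambda>x. (S h (sb k) x - sb k x) / h - (- lam c k * sb k x))"
          using h by (simp add: diff_divide_distrib algebra_simps)
        have "Hnorm l (r h) / h = Hnorm l (\<lambda>x. (1 / h) * r h x)" using h by (simp only: Hnorm_scale) simp
        also have "(\<lambda>x. (1 / h) * r h x) = (\<lambda>x. 1 * ((S h (sb k) x - sb k x) / h - (- lam c k * sb k x))
            + (- ((exp (- lam c k * h) - 1) / h + lam c k)) * sb k x)"
          using h by (auto simp: r_def field_simps)
        also have "Hnorm l \<dots> \<le> \<bar>1\<bar> * ?q h + \<bar>- ((exp (- lam c k * h) - 1) / h + lam c k)\<bar> * Hnorm l (sb k)"
          by (rule Hnorm_lin_le[OF s1 sqint_sb])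
        finally show ?thesis by (simp add: Hnorm_sb)
      qed
      then show "\<forall>\<^sub>F h in at_right 0. Hnorm l (r h) / h \<le> ?q h + ?e h"
        by (auto simp: eventually_at_right_field intro!: exI[of _ 1])
    qed
  qed
  have "AE x in Ivl l. S t (sb k) x = exp (- lam c k * t) * sb k x" if t: "0 < t" "t \<le> \<epsilon>" for t
  proof -
    define P where "P = exp (\<bar>lam c k\<bar> * t)"
    have P1: "P \<ge> 1" unfolding P_def using t by simp
    have bound: "Hnorm l (r t) \<le> t * P * K * (Hnorm l (r (t / real (Suc n))) / (t / real (Suc n)))" for n
    proof -
      define h where "h = t / real (Suc n)"
      have h: "h > 0" "real (Suc n) * h = t" using t by (auto simp: h_def)
      define p where "p = exp (\<bar>lam c k\<bar> * h)"
      have p1: "p \<ge> 1" unfolding p_def using h by simp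
      \<comment> \<open>Discrete Gronwall: each step adds one defect, enlarged by at most K, and
        multiplies the earlier ones by at most p.\<close>
      have ind: "Hnorm l (r (real j * h)) \<le> real j * p ^ j * (K * Hnorm l (r h))" if "j \<le> Suc n" for j
        using that
      proof (induction j)
        case 0
        have "AE x in Ivl l. r 0 x = 0" using S_zero[OF sqint_sb[of k]] by eventually_elim (simp add: r_def)
        then have "Hnorm l (r 0) = Hnorm l (\<lambda>x. 0)" by (intro Hnorm_cong_AE)
        then show ?case by (simp add: Hnorm_eq)
      next
        case (Suc j)
        have "real j \<le> real (Suc n)" using Suc.prems by simp
        then have "real j * h \<le> real (Suc n) * h" by (intro mult_right_mono) (use h in auto)
        then have "real j * h \<le> t" by (simp only: h(2))
        then have jh: "0 \<le> real j * h" "real j * h \<le> \<epsilon>" using h(1) t by auto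
        have h0: "0 \<le> h" using h by simp
        let ?q = "exp (- lam c k * h)"
        have 1: "AE x in Ivl l. S (real j * h + h) (sb k) x = S (real j * h) (S h (sb k)) x"
          by (rule S_add[OF jh(1) h0 sqint_sb])
        have 2: "AE x in Ivl l. S (real j * h) (r h) x = 1 * S (real j * h) (S h (sb k)) x + (- ?q) * S (real j * h) (sb k) x"
          unfolding r_def by (rule bounded_op_lin[OF S_bounded[OF jh(1)] S_sqint[OF h0 sqint_sb] sqint_sb])
        have "AE x in Ivl l. r (real (Suc j) * h) x = 1 * S (real j * h) (r h) x + ?q * r (real j * h) x"
          using 1 2
        proof eventually_elim
          case (elim x)
          have "real (Suc j) * h = real j * h + h" by (simp add: algebra_simps)
          moreover have "exp (- lam c k * (real j * h + h)) = ?q * exp (- lam c k * (real j * h))"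
            by (simp add: exp_add[symmetric] algebra_simps)
          ultimately show ?case using elim by (simp add: r_def algebra_simps)
        qed
        then have "Hnorm l (r (real (Suc j) * h)) = Hnorm l (\<lambda>x. 1 * S (real j * h) (r h) x + ?q * r (real j * h) x)"
          by (rule Hnorm_cong_AE)
        also have "\<dots> \<le> \<bar>1\<bar> * Hnorm l (S (real j * h) (r h)) + \<bar>?q\<bar> * Hnorm l (r (real j * h))"
          by (rule Hnorm_lin_le[OF S_sqint[OF jh(1) rs[OF h0]] rs[OF jh(1)]])
        also have "\<dots> \<le> K * Hnorm l (r h) + p * (real j * p ^ j * (K * Hnorm l (r h)))"
        proof (intro add_mono)
          show "\<bar>1\<bar> * Hnorm l (S (real j * h) (r h)) \<le> K * Hnorm l (r h)"
            using K[OF jh rs[OF h0] rc[OF h0]] by simp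
          have "- lam c k * h \<le> \<bar>lam c k\<bar> * h" using h by (intro mult_right_mono) auto
          then have "\<bar>?q\<bar> \<le> p" by (simp add: p_def)
          then show "\<bar>?q\<bar> * Hnorm l (r (real j * h)) \<le> p * (real j * p ^ j * (K * Hnorm l (r h)))"
            using Suc p1 by (intro mult_mono) (auto simp: Hnorm_nonneg)
        qed
        also have "\<dots> \<le> p ^ Suc j * (K * Hnorm l (r h)) + p * (real j * p ^ j * (K * Hnorm l (r h)))"
        proof -
          have "1 * (K * Hnorm l (r h)) \<le> p ^ Suc j * (K * Hnorm l (r h))"
            using p1 \<epsilon> by (intro mult_right_mono one_le_power) (auto simp: Hnorm_nonneg)
          then show ?thesis by simp
        qed
        finally show ?case by (simp add: algebra_simps)
      qed
      \<comment> \<open>The growth factors of all n+1 steps combine to a constant independent of n,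
        because (n+1) h = t.\<close>
      have pP: "p ^ Suc n = P"
        unfolding p_def P_def exp_of_nat_mult[symmetric] using h(2) by (metis mult.left_commute)
      have "Hnorm l (r t) \<le> real (Suc n) * P * (K * Hnorm l (r h))"
        using ind[of "Suc n"] by (simp only: h(2) pP order_refl)
      also have "\<dots> = t * P * K * (Hnorm l (r h) / h)"
        using h by (simp only: h(2)[symmetric]) (simp add: field_simps)
      finally show ?thesis by (simp only: h_def)
    qed
    have tn: "filterlim (\<lambda>n. t / real (Suc n)) (at_right 0) sequentially"
    proof -
      have "(\<lambda>n. t * inverse (real (Suc n))) \<longlonglongrightarrow> t * 0" by (intro tendsto_intros LIMSEQ_inverse_real_of_nat)
      then have "(\<lambda>n. t / real (Suc n)) \<longlonglongrightarrow> 0" by (simp add: divide_inverse)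
      then show ?thesis using t by (auto simp: filterlim_at)
    qed
    have "(\<lambda>n. t * P * K * (Hnorm l (r (t / real (Suc n))) / (t / real (Suc n)))) \<longlonglongrightarrow> t * P * K * 0"
      by (intro tendsto_intros filterlim_compose[OF rlim tn])
    then have "Hnorm l (r t) \<le> t * P * K * 0" by (rule LIMSEQ_le_const) (use bound in blast)
    then have "Hnorm l (r t) = 0" using Hnorm_nonneg[of l "r t"] by simp
    from Hnorm_zero_AE[OF rs this] have "AE x in Ivl l. r t x = 0" using t by simp
    then show ?thesis by eventually_elim (simp add: r_def)
  qed
  moreover have "AE x in Ivl l. S 0 (sb k) x = exp (- lam c k * 0) * sb k x" using S_zero[OF sqint_sb[of k]] by simp
  ultimately have "AE x in Ivl l. S t (sb k) x = exp (- lam c k * t) * sb k x" if "0 \<le> t" "t \<le> \<epsilon>" for t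
    using that by (cases "t = 0") auto
  then show ?thesis using \<epsilon>(1) by blast
qed

text \<open>Any t is a multiple of a step no longer than \<epsilon>; the local formula is iterated
  with the semigroup law.\<close>

lemma S_sb:
  assumes t: "t \<ge> 0"
  shows "AE x in Ivl l. S t (sb k) x = exp (- lam c k * t) * sb k x"
proof -
  obtain \<epsilon> where \<epsilon>: "\<epsilon> > 0" "\<And>t. 0 \<le> t \<Longrightarrow> t \<le> \<epsilon> \<Longrightarrow> AE x in Ivl l. S t (sb k) x = exp (- lam c k * t) * sb k x"
    using S_sb_local[of k] by blast
  obtain m :: nat where m: "t / \<epsilon> < real m" using reals_Archimedean2 by blast
  define h where "h = t / real (Suc m)"
  have h0: "h \<ge> 0" using t by (simp add: h_def)
  have "t < real m * \<epsilon>" using m \<epsilon>(1) by (simp add: field_simps)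
  also have "\<dots> \<le> real (Suc m) * \<epsilon>" using \<epsilon>(1) by simp
  finally have h\<epsilon>: "h \<le> \<epsilon>" by (simp add: h_def field_simps)
  have mh: "real (Suc m) * h = t" by (simp add: h_def)
  have "AE x in Ivl l. S (real j * h) (sb k) x = exp (- lam c k * (real j * h)) * sb k x" for j
  proof (induction j)
    case 0
    then show ?case using S_zero[OF sqint_sb[of k]] by simp
  next
    case (Suc j)
    let ?q = "exp (- lam c k * (real j * h))"
    have jh: "0 \<le> real j * h" using h0 by simp
    have 1: "AE x in Ivl l. S (h + real j * h) (sb k) x = S h (S (real j * h) (sb k)) x"
      by (rule S_add[OF h0 jh sqint_sb])
    have 2: "AE x in Ivl l. S h (S (real j * h) (sb k)) x = S h (\<lambda>x. ?q * sb k x + 0 * sb k x) x"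
      by (rule bounded_op_cong[OF S_bounded[OF h0] S_sqint[OF jh sqint_sb] sqint_lin[OF sqint_sb sqint_sb]])
        (use Suc in auto)
    have 3: "AE x in Ivl l. S h (\<lambda>x. ?q * sb k x + 0 * sb k x) x = ?q * S h (sb k) x + 0 * S h (sb k) x"
      by (rule bounded_op_lin[OF S_bounded[OF h0] sqint_sb sqint_sb])
    have 4: "AE x in Ivl l. S h (sb k) x = exp (- lam c k * h) * sb k x" by (rule \<epsilon>(2)[OF h0 h\<epsilon>])
    have e: "exp (- lam c k * (real (Suc j) * h)) = ?q * exp (- lam c k * h)"
      by (simp add: exp_add[symmetric] algebra_simps)
    have e2: "real (Suc j) * h = h + real j * h" by (simp add: algebra_simps)
    show ?case unfolding e unfolding e2 using 1 2 3 4 by eventually_elim simp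
  qed
  from this[of "Suc m"] show ?thesis by (simp only: mh)
qed

text \<open>The identity holds on sine polynomials by \<open>S_sb\<close>. For fixed t both sides
  are continuous in L^2, and sine polynomials are dense.\<close>

lemma coef_S:
  assumes t: "t \<ge> 0" and u: "sqint (Ivl l) u"
  shows "coef (S t u) k = exp (- lam c k * t) * coef u k"
proof -
  obtain C where C: "C \<ge> 0" "\<And>u. sqint (Ivl l) u \<Longrightarrow> Hnorm l (S t u) \<le> C * Hnorm l u"
    using bounded_op_bound[OF S_bounded[OF t]] by blast
  define \<Delta> where "\<Delta> = coef (S t u) k - exp (- lam c k * t) * coef u k"
  define E where "E = exp (- lam c k * t)"
  have le: "\<bar>\<Delta>\<bar> \<le> (C + E) * Hnorm l (\<lambda>x. u x - sp N d x)" for N d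
  proof -
    let ?w = "\<lambda>x. 1 * u x + (-1) * sp N d x"
    have w: "sqint (Ivl l) ?w" by (rule sqint_lin[OF u sqint_sp])
    have sp: "coef (S t (sp N d)) k = E * coef (sp N d) k"
    proof -
      have "AE x in Ivl l. \<forall>j<N. S t (sb j) x = exp (- lam c j * t) * sb j x"
        using S_sb[OF t] by (simp add: AE_all_countable)
      then have "AE x in Ivl l. S t (sp N d) x = sp N (\<lambda>j. exp (- lam c j * t) * d j) x"
        using bounded_op_sp[OF S_bounded[OF t], of N d]
        by eventually_elim (auto simp: sp_def intro!: sum.cong)
      then have "coef (S t (sp N d)) k = coef (sp N (\<lambda>j. exp (- lam c j * t) * d j)) k" by (rule coef_cong_AE)
      then show ?thesis by (simp add: coef_sp E_def)
    qed
    have "coef (S t ?w) k = coef (\<lambda>x. 1 * S t u x + (-1) * S t (sp N d) x) k"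
      by (rule coef_cong_AE[OF bounded_op_lin[OF S_bounded[OF t] u sqint_sp]])
    also have "\<dots> = coef (S t u) k - E * coef (sp N d) k"
      using coef_lin[OF S_sqint[OF t u] S_sqint[OF t sqint_sp], of 1 "-1" N d k] by (simp add: sp)
    finally have 1: "coef (S t ?w) k = coef (S t u) k - E * coef (sp N d) k" .
    have 2: "coef ?w k = coef u k - coef (sp N d) k" using coef_lin[OF u sqint_sp, of 1 "-1" N d k] by simp
    have "\<Delta> = coef (S t ?w) k - E * coef ?w k" unfolding 1 2 by (simp add: \<Delta>_def E_def algebra_simps)
    then have "\<bar>\<Delta>\<bar> \<le> \<bar>coef (S t ?w) k\<bar> + E * \<bar>coef ?w k\<bar>"
      by (simp add: E_def abs_mult order_trans[OF abs_triangle_ineq4])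
    also have "\<dots> \<le> C * Hnorm l ?w + E * Hnorm l ?w"
      using coef_abs_le_Hnorm[OF S_sqint[OF t w], of k] C(2)[OF w] coef_abs_le_Hnorm[OF w, of k]
      by (intro add_mono mult_left_mono) (auto simp: E_def)
    finally show ?thesis by (simp add: algebra_simps)
  qed
  have "(\<lambda>N. (C + E) * Hnorm l (\<lambda>x. u x - sp N (coef u) x)) \<longlonglongrightarrow> (C + E) * sqrt 0"
    unfolding Hnorm_eq by (intro tendsto_intros Parseval_partial[OF u])
  then have "\<bar>\<Delta>\<bar> \<le> (C + E) * sqrt 0" by (rule LIMSEQ_le_const) (use le in blast)
  then show ?thesis by (simp add: \<Delta>_def)
qed

end

section \<open>The nonlinear map on the sine basis\<close>

lemma finite_measure_pair:
  assumes "finite_measure M" "finite_measure N" shows "finite_measure (M \<Otimes>\<^sub>M N)"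
proof -
  interpret M: finite_measure M by fact
  interpret N: finite_measure N by fact
  show ?thesis
    by (rule finite_measureI)
      (simp add: space_pair_measure N.emeasure_pair_measure_Times M.emeasure_eq_measure N.emeasure_eq_measure
        ennreal_mult_eq_top_iff)
qed

lemma sqint_of_fourth_power:
  assumes "finite_measure M" and u: "u \<in> borel_measurable M" "integrable M (\<lambda>x. \<bar>u x\<bar> ^ 4)"
  shows "sqint M u" "sqint M (\<lambda>x. (u x)\<^sup>2)"
    and "(\<integral>x. (u x)\<^sup>2 \<partial>M)\<^sup>2 \<le> (\<integral>x. \<bar>u x\<bar> ^ 4 \<partial>M) * measure M (space M)"
proof -
  interpret finite_measure M by fact
  have e: "((u x)\<^sup>2)\<^sup>2 = \<bar>u x\<bar> ^ 4" for x by (simp add: power_mult[symmetric])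
  show s: "sqint M (\<lambda>x. (u x)\<^sup>2)" using u by (auto simp: sqint_def e)
  have one: "sqint M (\<lambda>x. 1)" by (simp add: sqint_def)
  show "sqint M u" using sqint_mult[OF s one] u(1) by (simp add: sqint_def)
  show "(\<integral>x. (u x)\<^sup>2 \<partial>M)\<^sup>2 \<le> (\<integral>x. \<bar>u x\<bar> ^ 4 \<partial>M) * measure M (space M)"
    using sqint_Cauchy_Schwarz[OF s one] by (simp add: e)
qed

locale space_time = interval +
  fixes T :: real
  assumes T_pos: "T > 0"
begin

abbreviation PM :: "(real \<times> real) measure"
  where "PM \<equiv> Time T \<Otimes>\<^sub>M Ivl l"

sublocale PM: pair_sigma_finite "Time T" "Ivl l"
  using finite_lebesgue_on_Icc[of 0 T] finite_Ivl[of l] by (simp add: pair_sigma_finite_def finite_measure_def)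

lemma finite_PM: "finite_measure PM"
  by (intro finite_measure_pair finite_lebesgue_on_Icc finite_Ivl)

lemma id_measurable_Time [measurable]: "(\<lambda>t. t) \<in> borel_measurable (Time T)"
  and id_measurable_Ivl [measurable]: "(\<lambda>x. x) \<in> borel_measurable (Ivl l)"
  by (rule id_measurable_lebesgue_on)+

text \<open>Time dependence is polynomial: such paths are C^1 into V, where G is prescribed by
  \<open>G0\<close>, and polynomials form a ring to which Stone-Weierstrass applies.\<close>

definition tens :: "(real \<times> real \<Rightarrow> real) set"
  where "tens = {\<lambda>z. sp N (\<lambda>k. poly (\<eta> k) (fst z)) (snd z) | N \<eta>. True}"

lemma tensI: "(\<And>z. u z = sp N (\<lambda>k. poly (\<eta> k) (fst z)) (snd z)) \<Longrightarrow> u \<in> tens"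
  unfolding tens_def by blast

sublocale tens: function_subspace tens
proof
  show "(\<lambda>x. 0) \<in> tens" by (rule tensI[of _ 0 "\<lambda>_. 0"]) (simp add: sp_def)
  show "(\<lambda>x. a * u x) \<in> tens" if u: "u \<in> tens" for u a
  proof -
    obtain N \<eta> where "u = (\<lambda>z. sp N (\<lambda>k. poly (\<eta> k) (fst z)) (snd z))" using u by (auto simp: tens_def)
    then show ?thesis by (intro tensI[of _ N "\<lambda>k. smult a (\<eta> k)"]) (simp add: sp_scale)
  qed
  show "(\<lambda>x. u x + v x) \<in> tens" if uv: "u \<in> tens" "v \<in> tens" for u v
  proof -
    obtain N \<eta> where u: "u = (\<lambda>z. sp N (\<lambda>k. poly (\<eta> k) (fst z)) (snd z))" using uv by (auto simp: tens_def)
    obtain M \<theta> where v: "v = (\<lambda>z. sp M (\<lambda>k. poly (\<theta> k) (fst z)) (snd z))" using uv by (auto simp: tens_def)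
    show ?thesis
    proof (rule tensI[of _ "max N M" "\<lambda>k. (if k < N then \<eta> k else 0) + (if k < M then \<theta> k else 0)"])
      fix z :: "real \<times> real"
      have "sp N (\<lambda>k. poly (\<eta> k) (fst z)) = sp (max N M) (\<lambda>k. if k < N then poly (\<eta> k) (fst z) else 0)"
        "sp M (\<lambda>k. poly (\<theta> k) (fst z)) = sp (max N M) (\<lambda>k. if k < M then poly (\<theta> k) (fst z) else 0)"
        by (auto intro!: sp_pad)
      then show "u z + v z = sp (max N M) (\<lambda>k. poly ((if k < N then \<eta> k else 0) + (if k < M then \<theta> k else 0)) (fst z)) (snd z)"
        by (simp add: u v sp_add if_distrib[of "\<lambda>p. poly p _"] cong: if_cong)
    qed
  qed
qed

lemma sb_measurable [measurable]: "sb k \<in> borel_measurable borel"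
  and sb'_measurable [measurable]: "sb' k \<in> borel_measurable borel"
  by (intro borel_measurable_continuous_onI continuous_intros)+

lemma poly_measurable [measurable]: "poly p \<in> borel_measurable (borel :: real measure)"
  by (intro borel_measurable_continuous_onI continuous_intros)

lemma tens_measurable: "u \<in> tens \<Longrightarrow> u \<in> borel_measurable PM"
  by (auto simp: tens_def sp_def)

lemma integral_product_fun:
  fixes f g :: "real \<Rightarrow> real"
  assumes f: "integrable (Time T) f" and g: "integrable (Ivl l) g"
  shows "integrable PM (\<lambda>z. f (fst z) * g (snd z))"
    and "(\<integral>z. f (fst z) * g (snd z) \<partial>PM) = (\<integral>t. f t \<partial>Time T) * (\<integral>x. g x \<partial>Ivl l)"
proof -
  show i: "integrable PM (\<lambda>z. f (fst z) * g (snd z))"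
    using integrable_product_fun[OF PM.M1.sigma_finite_measure_axioms PM.M2.sigma_finite_measure_axioms f g] .
  show "(\<integral>z. f (fst z) * g (snd z) \<partial>PM) = (\<integral>t. f t \<partial>Time T) * (\<integral>x. g x \<partial>Ivl l)"
    using PM.integral_fst'[OF i] by simp
qed

text \<open>The weight is 1 here, since polynomials contain the constants and time carries no
  boundary condition.\<close>

lemma poly_dense:
  assumes p: "p > 0" and A: "A \<in> sets (Time T)"
  shows "indicator A \<in> Lp_closure (Time T) p {poly q | q. True}"
proof (rule indicator_in_Lp_closure[where s = "\<lambda>_. 1" and R = "{poly q | q. True}"])
  show "function_ring_on {poly q |q. True} {0..T}"
  proof
    fix f g :: "real \<Rightarrow> real"
    assume "f \<in> {poly q |q. True}" "g \<in> {poly q |q. True}"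
    then obtain p q where "f = poly p" "g = poly q" by blast
    then have "(\<lambda>x. f x + g x) = poly (p + q)" "(\<lambda>x. f x * g x) = poly (p * q)" by auto
    then show "(\<lambda>x. f x + g x) \<in> {poly q |q. True}" "(\<lambda>x. f x * g x) \<in> {poly q |q. True}" by blast+
  next
    show "(\<lambda>_. c) \<in> {poly q |q. True}" for c :: real by (auto intro!: exI[of _ "[:c:]"])
    show "\<exists>f\<in>{poly q |q. True}. f x \<noteq> f y" if "x \<noteq> y" for x y :: real
      using that by (intro bexI[of _ "poly [:0, 1:]"]) auto
  qed (auto intro: continuous_intros)
qed (use assms in auto)

text \<open>Two stages. With a fixed polynomial in time the space factor is approximated by sines;
  afterwards the time factor is approximated by polynomials. Each error is a small integral in one
  variable times a fixed integral in the other.\<close>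

lemma tens_dense_rectangle:
  assumes a: "a \<in> sets (Time T)" and b: "b \<in> sets (Ivl l)"
  shows "indicator (a \<times> b) \<in> Lp_closure PM 4 tens"
proof -
  interpret T: finite_measure "Time T" by (rule finite_lebesgue_on_Icc)
  interpret I: finite_measure "Ivl l" by (rule finite_Ivl)
  have [measurable]: "indicator a \<in> borel_measurable (Time T)" "indicator b \<in> borel_measurable (Ivl l)"
    using a b by auto
  have first: "(\<lambda>z. poly q (fst z) * indicator b (snd z)) \<in> Lp_closure PM 4 tens" for q
  proof (rule Lp_closureI)
    show "(\<lambda>z. poly q (fst z) * indicat_real b (snd z)) \<in> borel_measurable PM" by measurable
    fix \<epsilon> :: real assume "\<epsilon> > 0"
    define Q where "Q = (\<integral>t. \<bar>poly q t\<bar> ^ 4 \<partial>Time T)"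
    have Q0: "Q \<ge> 0" by (simp add: Q_def integral_nonneg_AE)
    have Qi: "integrable (Time T) (\<lambda>t. \<bar>poly q t\<bar> ^ 4)"
      by (intro continuous_imp_integrable_real continuous_intros)
    have Lb: "integrable (Ivl l) (\<lambda>x. \<bar>indicat_real b x\<bar> ^ 4)"
    proof (rule I.integrable_const_bound[where B = 1])
      show "(\<lambda>x. \<bar>indicat_real b x\<bar> ^ 4) \<in> borel_measurable (Ivl l)" by measurable
    qed (auto simp: indicator_def)
    have "indicator b \<in> Lp_closure (Ivl l) 4 sines"
      by (rule sines_Lp_dense[OF _ _ Lb]) auto
    moreover have "\<epsilon> / (Q + 1) > 0" using \<open>\<epsilon> > 0\<close> Q0 by simp
    ultimately obtain u where u: "u \<in> sines" "u \<in> borel_measurable (Ivl l)"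
      "integrable (Ivl l) (\<lambda>x. \<bar>indicator b x - u x\<bar> ^ 4)" "(\<integral>x. \<bar>indicator b x - u x\<bar> ^ 4 \<partial>Ivl l) < \<epsilon> / (Q + 1)"
      unfolding Lp_closure_def by blast
    obtain N d where ud: "u = sp N d" using u(1) by (auto simp: sines_def)
    have mem: "(\<lambda>z. poly q (fst z) * u (snd z)) \<in> tens"
      by (rule tensI[of _ N "\<lambda>k. smult (d k) q"]) (simp add: ud sp_scale mult.commute)
    have e: "\<bar>poly q (fst z) * indicator b (snd z) - poly q (fst z) * u (snd z)\<bar> ^ 4 =
        \<bar>poly q (fst z)\<bar> ^ 4 * \<bar>indicator b (snd z) - u (snd z)\<bar> ^ 4" for z
      by (simp only: right_diff_distrib[symmetric] abs_mult power_mult_distrib)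
    note pf = integral_product_fun[OF Qi u(3)]
    have "Q * (\<integral>x. \<bar>indicator b x - u x\<bar> ^ 4 \<partial>Ivl l) \<le> Q * (\<epsilon> / (Q + 1))"
      using u(4) Q0 by (intro mult_left_mono) auto
    also have "\<dots> < \<epsilon>" using \<open>\<epsilon> > 0\<close> Q0 by (simp add: field_simps)
    finally have "(\<integral>z. \<bar>poly q (fst z)\<bar> ^ 4 * \<bar>indicator b (snd z) - u (snd z)\<bar> ^ 4 \<partial>PM) < \<epsilon>"
      using pf(2) by (simp add: Q_def)
    then show "\<exists>w\<in>tens. w \<in> borel_measurable PM \<and>
        integrable PM (\<lambda>z. \<bar>poly q (fst z) * indicat_real b (snd z) - w z\<bar> ^ 4) \<and>
        (\<integral>z. \<bar>poly q (fst z) * indicat_real b (snd z) - w z\<bar> ^ 4 \<partial>PM) < \<epsilon>"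
      using pf(1) tens_measurable[OF mem] by (intro bexI[OF _ mem] conjI) (unfold e)
  qed
  show ?thesis
  proof (rule Lp_closure_closed)
    show "indicat_real (a \<times> b) \<in> borel_measurable PM"
      using a b by (intro borel_measurable_indicator) (rule pair_measureI)
    fix \<epsilon> :: real assume "\<epsilon> > 0"
    define L where "L = (\<integral>x. \<bar>indicat_real b x\<bar> ^ 4 \<partial>Ivl l)"
    have L0: "L \<ge> 0" by (simp add: L_def integral_nonneg_AE)
    have Li: "integrable (Ivl l) (\<lambda>x. \<bar>indicat_real b x\<bar> ^ 4)"
    proof (rule I.integrable_const_bound[where B = 1])
      show "(\<lambda>x. \<bar>indicat_real b x\<bar> ^ 4) \<in> borel_measurable (Ivl l)" by measurable
    qed (auto simp: indicator_def)
    have "\<epsilon> / (L + 1) > 0" using \<open>\<epsilon> > 0\<close> L0 by simp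
    then obtain q where q: "integrable (Time T) (\<lambda>t. \<bar>indicator a t - poly q t\<bar> ^ 4)"
      "(\<integral>t. \<bar>indicator a t - poly q t\<bar> ^ 4 \<partial>Time T) < \<epsilon> / (L + 1)"
      using poly_dense[OF _ a, of 4] unfolding Lp_closure_def by fastforce
    have e: "\<bar>indicator (a \<times> b) z - poly q (fst z) * indicator b (snd z)\<bar> ^ 4 =
        \<bar>indicator a (fst z) - poly q (fst z)\<bar> ^ 4 * \<bar>indicat_real b (snd z)\<bar> ^ 4" for z
      by (cases z) (auto simp: indicator_def)
    note pf = integral_product_fun[OF q(1) Li]
    have "(\<integral>t. \<bar>indicator a t - poly q t\<bar> ^ 4 \<partial>Time T) * L \<le> \<epsilon> / (L + 1) * L"
      using q(2) L0 by (intro mult_right_mono) auto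
    also have "\<dots> < \<epsilon>" using \<open>\<epsilon> > 0\<close> L0 by (simp add: field_simps)
    finally have "(\<integral>z. \<bar>indicator a (fst z) - poly q (fst z)\<bar> ^ 4 * \<bar>indicat_real b (snd z)\<bar> ^ 4 \<partial>PM) < \<epsilon>"
      using pf(2) by (simp add: L_def)
    then show "\<exists>g\<in>Lp_closure PM 4 tens. integrable PM (\<lambda>x. \<bar>indicat_real (a \<times> b) x - g x\<bar> ^ 4) \<and>
        (\<integral>x. \<bar>indicat_real (a \<times> b) x - g x\<bar> ^ 4 \<partial>PM) < \<epsilon>"
      using pf(1) by (intro bexI[OF _ first[of q]]) (simp only: e)
  qed
qed

text \<open>Dynkin's argument: rectangles form an intersection-stable generator, and the closure of
  the tensor span is stable under complements and countable disjoint unions.\<close>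

lemma tens_dense_indicator:
  assumes "C \<in> sets PM" shows "indicator C \<in> Lp_closure PM 4 tens"
proof -
  interpret finite_measure PM by (rule finite_PM)
  let ?G = "{a \<times> b | a b. a \<in> sets (Time T) \<and> b \<in> sets (Ivl l)}"
  let ?\<Omega> = "space (Time T) \<times> space (Ivl l)"
  have sets: "sets PM = sigma_sets ?\<Omega> ?G" by (rule sets_pair_measure)
  have "Int_stable ?G" by (rule Int_stable_pair_measure_generator)
  moreover have "?G \<subseteq> Pow ?\<Omega>" by (rule pair_measure_closed)
  moreover have "C \<in> sigma_sets ?\<Omega> ?G" using assms sets by simp
  ultimately show ?thesis
  proof (induction rule: sigma_sets_induct_disjoint)
    case (basic A)
    then show ?case using tens_dense_rectangle by auto
  next
    case empty
    have "indicat_real {} = (\<lambda>z. 0 :: real)" by auto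
    then show ?case using Lp_closure_base[OF tens.zero_mem, of PM 4] by simp
  next
    case (compl A)
    have "indicator ?\<Omega> \<in> Lp_closure PM 4 tens" by (rule tens_dense_rectangle) auto
    from tens.Lp_closure_add[OF this tens.Lp_closure_scale[OF compl(2), of "-1"]]
    have "(\<lambda>z. indicat_real ?\<Omega> z + (-1) * indicator A z) \<in> Lp_closure PM 4 tens" .
    moreover have "A \<subseteq> ?\<Omega>" using compl(1) sets sets.sets_into_space[of A PM] by (simp add: space_pair_measure)
    then have "(\<lambda>z. indicat_real ?\<Omega> z + (-1) * indicator A z) = indicator (?\<Omega> - A)"
      by (auto simp: indicator_def fun_eq_iff)
    ultimately show ?case by simp
  next
    case (union A)
    have A: "A i \<in> sets PM" for i using union(2) sets by auto
    show ?case
    proof (rule Lp_closure_dominated[where G = "\<lambda>_. 1"])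
      show "indicat_real (\<Union>i. A i) \<in> borel_measurable PM" using A by (intro borel_measurable_indicator) auto
      show "(\<lambda>z. \<Sum>i<n. 1 * indicat_real (A i) z) \<in> Lp_closure PM 4 tens" for n
        by (rule tens.Lp_closure_sum) (use union(3) in auto)
      have fin: "(\<Sum>i<n. 1 * indicat_real (A i) z) = indicator (\<Union>i<n. A i) z" for n z
      proof -
        have "indicat_real (\<Union>i<n. A i) z = (\<Sum>i<n. indicat_real (A i) z)"
          by (rule indicator_UN_disjoint) (use union(1) in \<open>auto simp: disjoint_family_on_def\<close>)
        then show ?thesis by simp
      qed
      show "AE z in PM. (\<lambda>n. \<Sum>i<n. 1 * indicat_real (A i) z) \<longlonglongrightarrow> indicat_real (\<Union>i. A i) z"
        unfolding fin by (intro AE_I2 LIMSEQ_indicator_UN)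
      show "AE z in PM. \<bar>indicat_real (\<Union>i. A i) z - (\<Sum>i<n. 1 * indicat_real (A i) z)\<bar> ^ 4 \<le> 1" for n
        unfolding fin by (intro AE_I2 power_le_one) (auto simp: indicator_def)
    qed auto
  qed
qed

lemma tens_dense:
  assumes "F \<in> borel_measurable PM" "integrable PM (\<lambda>z. \<bar>F z\<bar> ^ 4)"
  shows "F \<in> Lp_closure PM 4 tens"
  by (rule tens.Lp_closure_from_indicators) (use assms tens_dense_indicator in auto)

subsection \<open>Approximating paths\<close>

definition tpath :: "nat \<Rightarrow> (nat \<Rightarrow> real poly) \<Rightarrow> real \<Rightarrow> real \<Rightarrow> real"
  where "tpath N \<eta> t = sp N (\<lambda>k. poly (\<eta> k) t)"

text \<open>All difference quotients in time stay in the span of N sines, on which the V norm is a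
  finite sum; convergence reduces to that of each polynomial coefficient.\<close>

lemma tpath_C1_V: "tpath N \<eta> \<in> C1_V l T"
  unfolding C1_V_def
proof (intro CollectI exI[of _ "tpath N (\<lambda>k. pderiv (\<eta> k))"] ballI conjI)
  fix t
  have V0: "((\<lambda>s. Vnorm l (sp N (\<lambda>k. q k s))) \<longlongrightarrow> 0) F"
    if "\<And>k. (q k \<longlongrightarrow> 0) F" for q :: "nat \<Rightarrow> real \<Rightarrow> real" and F
  proof -
    have "((\<lambda>s. sqrt (\<Sum>k<N. (1 + (mu k)\<^sup>2) * (q k s)\<^sup>2)) \<longlongrightarrow> sqrt (\<Sum>k<N. (1 + (mu k)\<^sup>2) * 0\<^sup>2)) F"
      by (intro tendsto_intros that)
    then show ?thesis by (simp add: Vnorm_sp)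
  qed
  have "(\<lambda>x. (tpath N \<eta> s x - tpath N \<eta> t x) / (s - t) - tpath N (\<lambda>k. pderiv (\<eta> k)) t x) =
     sp N (\<lambda>k. (poly (\<eta> k) s - poly (\<eta> k) t) / (s - t) - poly (pderiv (\<eta> k)) t)" for s
    by (simp add: tpath_def sp_def fun_eq_iff sum_divide_distrib sum_subtractf[symmetric] left_diff_distrib diff_divide_distrib)
  moreover have "((\<lambda>s. (poly (\<eta> k) s - poly (\<eta> k) t) / (s - t) - poly (pderiv (\<eta> k)) t) \<longlongrightarrow> 0) (at t within {0..T})" for k
  proof -
    have "(poly (\<eta> k) has_real_derivative poly (pderiv (\<eta> k)) t) (at t within {0..T})"
      by (rule has_field_derivative_at_within[OF poly_DERIV])
    then show ?thesis unfolding has_field_derivative_iff by (rule LIM_zero)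
  qed
  ultimately show "((\<lambda>s. Vnorm l (\<lambda>x. (tpath N \<eta> s x - tpath N \<eta> t x) / (s - t) - tpath N (\<lambda>k. pderiv (\<eta> k)) t x)) \<longlongrightarrow> 0) (at t within {0..T})"
    by (simp add: V0)
  have "(\<lambda>x. tpath N (\<lambda>k. pderiv (\<eta> k)) s x - tpath N (\<lambda>k. pderiv (\<eta> k)) t x) =
      sp N (\<lambda>k. poly (pderiv (\<eta> k)) s - poly (pderiv (\<eta> k)) t)" for s
    by (simp add: tpath_def sp_def fun_eq_iff sum_subtractf[symmetric] left_diff_distrib)
  moreover have "((\<lambda>s. poly (pderiv (\<eta> k)) s - poly (pderiv (\<eta> k)) t) \<longlongrightarrow> 0) (at t within {0..T})" for k
    by (rule LIM_zero) (intro tendsto_intros)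
  ultimately show "((\<lambda>s. Vnorm l (\<lambda>x. tpath N (\<lambda>k. pderiv (\<eta> k)) s x - tpath N (\<lambda>k. pderiv (\<eta> k)) t x)) \<longlongrightarrow> 0) (at t within {0..T})"
    by (simp add: V0)
qed (auto simp: tpath_def sp_in_Vsp)

lemma tens_path: "(\<lambda>z. tpath N \<eta> (fst z) (snd z)) \<in> tens"
  unfolding tpath_def by (rule tensI) simp

lemma tpath_measurable [measurable]: "(\<lambda>z. tpath N \<eta> (fst z) (snd z)) \<in> borel_measurable PM"
  by (rule tens_measurable[OF tens_path])

lemma tpath_integrable: "integrable PM (\<lambda>z. \<bar>tpath N \<eta> (fst z) (snd z)\<bar> ^ 4)"
proof (rule PM.Fubini_integrable)
  have i: "integrable (Ivl l) (\<lambda>x. \<bar>tpath N \<eta> t x\<bar> ^ 4)" for t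
    unfolding tpath_def by (intro int_cont continuous_intros)
  show "AE t in Time T. integrable (Ivl l) (\<lambda>x. \<bar>tpath N \<eta> (fst (t, x)) (snd (t, x))\<bar> ^ 4)"
    using i by simp
  interpret T: finite_measure "Time T" by (rule finite_lebesgue_on_Icc)
  have "\<exists>B. \<forall>t\<in>{0..T}. \<bar>poly (\<eta> k) t\<bar> \<le> B" for k
  proof -
    have "continuous_on {0..T} (poly (\<eta> k))" by (intro continuous_intros)
    from compact_imp_bounded[OF compact_continuous_image[OF this compact_Icc]]
    show ?thesis by (auto simp: bounded_iff)
  qed
  then obtain B where B: "\<And>k t. t \<in> {0..T} \<Longrightarrow> \<bar>poly (\<eta> k) t\<bar> \<le> B k" by metis
  define C where "C = (\<Sum>k<N. B k / sqrt l)"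
  have bd: "\<bar>tpath N \<eta> t x\<bar> \<le> C" if "t \<in> {0..T}" for t x
  proof -
    have "\<bar>poly (\<eta> k) t * sb k x\<bar> \<le> B k / sqrt l" for k
      using mult_mono[OF B[OF that, of k] abs_sb_le[of k x]] order_trans[OF abs_ge_zero B[OF that, of k]]
      by (simp add: abs_mult)
    then show ?thesis unfolding tpath_def sp_def C_def by (intro order_trans[OF sum_abs] sum_mono) auto
  qed
  show "integrable (Time T) (\<lambda>t. \<integral>x. norm (\<bar>tpath N \<eta> (fst (t, x)) (snd (t, x))\<bar> ^ 4) \<partial>Ivl l)"
  proof (rule T.integrable_const_bound[where B = "C ^ 4 * measure (Ivl l) (space (Ivl l))"])
    show "AE t in Time T. norm (\<integral>x. norm (\<bar>tpath N \<eta> (fst (t, x)) (snd (t, x))\<bar> ^ 4) \<partial>Ivl l) \<le> C ^ 4 * measure (Ivl l) (space (Ivl l))"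
    proof (rule AE_I2)
      fix t assume "t \<in> space (Time T)"
      then have t: "t \<in> {0..T}" by simp
      interpret I: finite_measure "Ivl l" by (rule finite_Ivl)
      have "(\<integral>x. \<bar>tpath N \<eta> t x\<bar> ^ 4 \<partial>Ivl l) \<le> (\<integral>x. C ^ 4 \<partial>Ivl l)"
      proof (rule integral_mono)
        show "integrable (Ivl l) (\<lambda>x. \<bar>tpath N \<eta> t x\<bar> ^ 4)" by (rule i)
        show "\<bar>tpath N \<eta> t x\<bar> ^ 4 \<le> C ^ 4" for x by (intro power_mono bd[OF t]) simp
      qed simp
      then show "norm (\<integral>x. norm (\<bar>tpath N \<eta> (fst (t, x)) (snd (t, x))\<bar> ^ 4) \<partial>Ivl l) \<le> C ^ 4 * measure (Ivl l) (space (Ivl l))"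
        by (simp add: integral_nonneg_AE mult.commute)
    qed
    have "(\<lambda>t. \<integral>x. norm ((\<lambda>z. \<bar>tpath N \<eta> (fst z) (snd z)\<bar> ^ 4) (t, x)) \<partial>Ivl l) \<in> borel_measurable (Time T)"
      by measurable
    then show "(\<lambda>t. \<integral>x. norm (\<bar>tpath N \<eta> (fst (t, x)) (snd (t, x))\<bar> ^ 4) \<partial>Ivl l) \<in> borel_measurable (Time T)" by simp
  qed
qed measurable

lemma Lp4_iff: "u \<in> Lp l 4 \<longleftrightarrow> u \<in> borel_measurable (Ivl l) \<and> integrable (Ivl l) (\<lambda>x. \<bar>u x\<bar> ^ 4)"
  by (simp add: Lp_def)

lemma tpath_Esp: "tpath N \<eta> \<in> Esp l T"
  unfolding Esp_def
proof (intro CollectI conjI bexI[of _ "\<lambda>z. tpath N \<eta> (fst z) (snd z)"] tpath_integrable tpath_measurable)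
  have "tpath N \<eta> t \<in> Lp l 4" for t
    unfolding Lp4_iff tpath_def
    by (intro conjI continuous_imp_measurable_Ivl int_cont continuous_intros)
  then show "AE t in Time T. tpath N \<eta> t \<in> Lp l 4" by simp
qed (auto simp: ae_eq_def)

lemma G0_tpath: "G0 l c (tpath N \<eta>) t (sb k) =
   (\<integral>x. (1/2) * (tpath N \<eta> t x)\<^sup>2 * sb' k x + c * tpath N \<eta> t x * sb k x \<partial>Ivl l)"
proof -
  define u where "u = tpath N \<eta> t"
  define u' where "u' = sp' N (\<lambda>k. poly (\<eta> k) t)"
  have cu: "continuous_on S u" "continuous_on S u'" for S unfolding u_def u'_def tpath_def by (intro continuous_intros)+
  have du: "(u has_real_derivative u' x) (at x within S)" for x S
    unfolding u_def u'_def tpath_def by (rule sp_has_derivative)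
  have wu: "weak_deriv l u u'" unfolding u_def u'_def tpath_def by (rule weak_deriv_sp)
  have "G0 l c (tpath N \<eta>) t (sb k) = (\<integral>x. (- u x * Dx l u x + c * u x) * sb k x \<partial>Ivl l)"
    by (simp add: G0_def ip_def u_def)
  also have "\<dots> = (\<integral>x. (- u x * u' x + c * u x) * sb k x \<partial>Ivl l)"
    by (rule integral_cong_AE_lebesgue_on) (use Dx_AE[OF wu] in auto)
  \<comment> \<open>The subtracted bracket is the derivative of u^2 sb k / 2, which vanishes at both
    ends, so its integral is zero.\<close>
  also have "\<dots> = (\<integral>x. ((1/2) * (u x)\<^sup>2 * sb' k x + c * u x * sb k x) - (u x * u' x * sb k x + (1/2) * (u x)\<^sup>2 * sb' k x) \<partial>Ivl l)"
    by (rule Bochner_Integration.integral_cong) (auto simp: algebra_simps)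
  also have "\<dots> = (\<integral>x. (1/2) * (u x)\<^sup>2 * sb' k x + c * u x * sb k x \<partial>Ivl l) - (\<integral>x. u x * u' x * sb k x + (1/2) * (u x)\<^sup>2 * sb' k x \<partial>Ivl l)"
    by (rule Bochner_Integration.integral_diff) (intro int_cont continuous_intros cu)+
  also have "(\<integral>x. u x * u' x * sb k x + (1/2) * (u x)\<^sup>2 * sb' k x \<partial>Ivl l) = (1/2) * (u l)\<^sup>2 * sb k l - (1/2) * (u (-l))\<^sup>2 * sb k (-l)"
    by (rule integral_Ivl_FTC)
      (use l_pos in \<open>auto intro!: continuous_intros cu derivative_eq_intros du simp: algebra_simps power2_eq_square\<close>)
  finally show ?thesis by (simp add: u_def)
qed

text \<open>This is \<open>\<langle>-u u\<^sub>x + c u, sb k\<rangle>\<close> with the derivative of \<open>-u u\<^sub>x = -(u\<^sup>2/2)\<^sub>x\<close> moved to \<open>sb k\<close>, hence defined on \<open>E\<close>.\<close>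

definition gfun :: "real \<Rightarrow> (real \<times> real \<Rightarrow> real) \<Rightarrow> nat \<Rightarrow> real \<Rightarrow> real"
  where "gfun c v k t = (\<integral>x. (1/2) * (v (t, x))\<^sup>2 * sb' k x + c * v (t, x) * sb k x \<partial>Ivl l)"

lemma gfun_integrand:
  assumes v: "v \<in> borel_measurable PM" "integrable PM (\<lambda>z. \<bar>v z\<bar> ^ 4)"
  shows "integrable PM (\<lambda>z. (1/2) * (v z)\<^sup>2 * sb' k (snd z) + c * v z * sb k (snd z))"
proof -
  have [measurable]: "v \<in> borel_measurable PM" by fact
  interpret finite_measure PM by (rule finite_PM)
  note s = sqint_of_fourth_power[OF finite_PM v]
  have b: "sqint PM (\<lambda>z. sb k (snd z))" "sqint PM (\<lambda>z. (1/2) * sb' k (snd z))"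
  proof -
    have "integrable PM (\<lambda>z. (sb k (snd z))\<^sup>2)"
      by (rule integrable_const_bound[where B = "(1 / sqrt l)\<^sup>2"])
        (use abs_sb_le l_pos in \<open>auto simp: abs_le_square_iff[symmetric]\<close>)
    moreover have "integrable PM (\<lambda>z. ((1/2) * sb' k (snd z))\<^sup>2)"
    proof (rule integrable_const_bound[where B = "(mu k / sqrt l)\<^sup>2"])
      have "\<bar>(1/2) * sb' k x\<bar> \<le> \<bar>mu k / sqrt l\<bar>" for x
      proof -
        have "\<bar>(1/2) * sb' k x\<bar> \<le> \<bar>sb' k x\<bar>" by (simp add: abs_mult)
        also note abs_sb'_le[of k x]
        also note abs_ge_self[of "mu k / sqrt l"]
        finally show ?thesis .
      qed
      then show "AE z in PM. norm (((1/2) * sb' k (snd z))\<^sup>2) \<le> (mu k / sqrt l)\<^sup>2"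
        unfolding abs_le_square_iff by simp
    qed measurable
    ultimately show "sqint PM (\<lambda>z. sb k (snd z))" "sqint PM (\<lambda>z. (1/2) * sb' k (snd z))" by (auto simp: sqint_def)
  qed
  have "integrable PM (\<lambda>z. (v z)\<^sup>2 * ((1/2) * sb' k (snd z)) + c * (v z * sb k (snd z)))"
    using sqint_mult[OF s(2) b(2)] sqint_mult[OF s(1) b(1)] by simp
  then show ?thesis by (simp add: algebra_simps)
qed

lemma gfun_integrable:
  assumes "v \<in> borel_measurable PM" "integrable PM (\<lambda>z. \<bar>v z\<bar> ^ 4)"
  shows "integrable (Time T) (gfun c v k)"
  using PM.integrable_fst'[OF gfun_integrand[OF assms, of k c]] by (simp add: gfun_def[abs_def])

lemma integral_abs_le_sqrt:
  assumes "finite_measure M" "sqint M h"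
  shows "(\<integral>x. \<bar>h x\<bar> \<partial>M) \<le> sqrt (\<integral>x. (h x)\<^sup>2 \<partial>M) * sqrt (measure M (space M))"
proof -
  interpret finite_measure M by fact
  have "sqint M (\<lambda>x. \<bar>h x\<bar>)" "sqint M (\<lambda>x. 1)" using assms(2) by (auto simp: sqint_def)
  from sqint_Cauchy_Schwarz_abs[OF this] show ?thesis by (simp add: integral_nonneg_AE)
qed

text \<open>From v^2 - u^2 = 2 v (v - u) - (v - u)^2. Only the distance d and a norm of v enter, so
  the bound tends to 0 along any sequence of u with d tending to 0.\<close>

lemma gfun_diff:
  assumes v: "v \<in> borel_measurable PM" "integrable PM (\<lambda>z. \<bar>v z\<bar> ^ 4)"
    and u: "u \<in> borel_measurable PM" "integrable PM (\<lambda>z. \<bar>u z\<bar> ^ 4)"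
  defines "d \<equiv> sqrt (\<integral>z. (v z - u z)\<^sup>2 \<partial>PM)"
  shows "(\<integral>t. \<bar>gfun c v k t - gfun c u k t\<bar> \<partial>Time T) \<le>
    mu k / sqrt l * (d\<^sup>2 + 2 * (sqrt (\<integral>z. (v z)\<^sup>2 \<partial>PM) * d)) + \<bar>c\<bar> / sqrt l * (d * sqrt (measure PM (space PM)))"
proof -
  note iv = gfun_integrand[OF v, of k c] and iu = gfun_integrand[OF u, of k c]
  note sv = sqint_of_fourth_power[OF finite_PM v] and su = sqint_of_fourth_power[OF finite_PM u]
  define \<Phi> where "\<Phi> z = ((1/2) * (v z)\<^sup>2 * sb' k (snd z) + c * v z * sb k (snd z)) - ((1/2) * (u z)\<^sup>2 * sb' k (snd z) + c * u z * sb k (snd z))" for z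
  have \<Phi>: "integrable PM \<Phi>" unfolding \<Phi>_def using iv iu by simp
  have sD: "sqint PM (\<lambda>z. v z - u z)" by (rule sqint_diff[OF sv(1) su(1)])
  have sa: "sqint PM (\<lambda>z. \<bar>v z\<bar>)" "sqint PM (\<lambda>z. \<bar>v z - u z\<bar>)" using sv(1) sD by (auto simp: sqint_def)
  let ?B = "\<lambda>z. mu k / sqrt l * ((v z - u z)\<^sup>2 + 2 * (\<bar>v z\<bar> * \<bar>v z - u z\<bar>)) + \<bar>c\<bar> / sqrt l * \<bar>v z - u z\<bar>"
  have iB: "integrable PM ?B"
    using sqint_mult[OF sa] sqint_sq[OF sD] sqint_integrable[OF finite_PM sD] by simp
  have pt: "\<bar>\<Phi> z\<bar> \<le> ?B z" for z
  proof -
    have "\<Phi> z = (1/2) * (2 * (v z * (v z - u z)) - (v z - u z)\<^sup>2) * sb' k (snd z) + c * (v z - u z) * sb k (snd z)"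
      by (simp add: \<Phi>_def power2_eq_square algebra_simps)
    also have "\<bar>\<dots>\<bar> \<le> \<bar>(1/2) * (2 * (v z * (v z - u z)) - (v z - u z)\<^sup>2)\<bar> * \<bar>sb' k (snd z)\<bar> + \<bar>c * (v z - u z)\<bar> * \<bar>sb k (snd z)\<bar>"
      by (simp only: abs_mult[symmetric] abs_triangle_ineq)
    also have "\<dots> \<le> ((v z - u z)\<^sup>2 + 2 * (\<bar>v z\<bar> * \<bar>v z - u z\<bar>)) * (mu k / sqrt l) + (\<bar>c\<bar> * \<bar>v z - u z\<bar>) * (1 / sqrt l)"
    proof (intro add_mono mult_mono abs_sb'_le abs_sb_le)
      have "\<bar>2 * (v z * (v z - u z)) - (v z - u z)\<^sup>2\<bar> \<le> \<bar>2 * (v z * (v z - u z))\<bar> + \<bar>(v z - u z)\<^sup>2\<bar>" by (rule abs_triangle_ineq4)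
      then show "\<bar>(1/2) * (2 * (v z * (v z - u z)) - (v z - u z)\<^sup>2)\<bar> \<le> (v z - u z)\<^sup>2 + 2 * (\<bar>v z\<bar> * \<bar>v z - u z\<bar>)"
        by (simp add: abs_mult)
    qed (auto simp: abs_mult)
    finally show ?thesis by (simp add: algebra_simps)
  qed
  have "(\<integral>t. \<bar>gfun c v k t - gfun c u k t\<bar> \<partial>Time T) \<le> (\<integral>t. (\<integral>x. \<bar>\<Phi> (t, x)\<bar> \<partial>Ivl l) \<partial>Time T)"
  proof (rule integral_mono_AE)
    show "integrable (Time T) (\<lambda>t. \<bar>gfun c v k t - gfun c u k t\<bar>)"
      using gfun_integrable[OF v] gfun_integrable[OF u] by simp
    show "integrable (Time T) (\<lambda>t. \<integral>x. \<bar>\<Phi> (t, x)\<bar> \<partial>Ivl l)" using PM.integrable_fst'[OF integrable_abs[OF \<Phi>]] .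
    show "AE t in Time T. \<bar>gfun c v k t - gfun c u k t\<bar> \<le> (\<integral>x. \<bar>\<Phi> (t, x)\<bar> \<partial>Ivl l)"
      using PM.AE_integrable_fst'[OF iv] PM.AE_integrable_fst'[OF iu]
    proof eventually_elim
      case (elim t)
      then have "gfun c v k t - gfun c u k t = (\<integral>x. \<Phi> (t, x) \<partial>Ivl l)"
        unfolding gfun_def \<Phi>_def by (subst Bochner_Integration.integral_diff) auto
      then show ?case using integral_abs_bound[of "Ivl l" "\<lambda>x. \<Phi> (t, x)"] by simp
    qed
  qed
  also have "\<dots> = (\<integral>z. \<bar>\<Phi> z\<bar> \<partial>PM)" using PM.integral_fst'[OF integrable_abs[OF \<Phi>]] .
  also have "\<dots> \<le> (\<integral>z. ?B z \<partial>PM)" by (rule integral_mono[OF integrable_abs[OF \<Phi>] iB pt])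
  also have "\<dots> = mu k / sqrt l * ((\<integral>z. (v z - u z)\<^sup>2 \<partial>PM) + 2 * (\<integral>z. \<bar>v z\<bar> * \<bar>v z - u z\<bar> \<partial>PM)) + \<bar>c\<bar> / sqrt l * (\<integral>z. \<bar>v z - u z\<bar> \<partial>PM)"
    using sqint_mult[OF sa] sqint_sq[OF sD] sqint_integrable[OF finite_PM sD] by simp
  also have "\<dots> \<le> mu k / sqrt l * (d\<^sup>2 + 2 * (sqrt (\<integral>z. (v z)\<^sup>2 \<partial>PM) * d)) + \<bar>c\<bar> / sqrt l * (d * sqrt (measure PM (space PM)))"
  proof (intro add_mono mult_left_mono)
    show "(\<integral>z. (v z - u z)\<^sup>2 \<partial>PM) \<le> d\<^sup>2" by (simp add: d_def integral_nonneg_AE)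
    show "(\<integral>z. \<bar>v z\<bar> * \<bar>v z - u z\<bar> \<partial>PM) \<le> sqrt (\<integral>z. (v z)\<^sup>2 \<partial>PM) * d"
      using sqint_Cauchy_Schwarz_abs[OF sa] unfolding d_def by simp
    show "(\<integral>z. \<bar>v z - u z\<bar> \<partial>PM) \<le> d * sqrt (measure PM (space PM))"
      unfolding d_def by (rule integral_abs_le_sqrt[OF finite_PM sD])
  qed (use mu_pos[of k] l_pos in auto)
  finally show ?thesis .
qed

text \<open>Tensor paths approximating v in L^4 also approximate u in E. Along them both sides agree
  by \<open>G0_tpath\<close>; the left side converges by the continuity of G, the right side by
  \<open>gfun_diff\<close>. Hence the L^1 norm of the difference is 0.\<close>

lemma G_on_basis:
  assumes ext: "continuous_extension_G0 l T c G" and u: "u \<in> Esp l T"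
    and v: "v \<in> borel_measurable PM" "integrable PM (\<lambda>z. \<bar>v z\<bar> ^ 4)"
    and uv: "AE t in Time T. ae_eq l (u t) (\<lambda>x. v (t, x))"
  shows "AE t in Time T. G u t (sb k) = gfun c v k t"
proof -
  have "\<exists>N \<eta>. integrable PM (\<lambda>z. \<bar>v z - tpath N \<eta> (fst z) (snd z)\<bar> ^ 4) \<and>
      (\<integral>z. \<bar>v z - tpath N \<eta> (fst z) (snd z)\<bar> ^ 4 \<partial>PM) < 1 / real (Suc n)" for n
  proof -
    have "1 / real (Suc n) > 0" by simp
    then obtain w where "w \<in> tens" "integrable PM (\<lambda>z. \<bar>v z - w z\<bar> ^ 4)" "(\<integral>z. \<bar>v z - w z\<bar> ^ 4 \<partial>PM) < 1 / real (Suc n)"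
      using tens_dense[OF v] unfolding Lp_closure_def by blast
    then show ?thesis by (auto simp: tens_def tpath_def)
  qed
  then have "\<forall>n. \<exists>N \<eta>. integrable PM (\<lambda>z. \<bar>v z - tpath N \<eta> (fst z) (snd z)\<bar> ^ 4) \<and>
      (\<integral>z. \<bar>v z - tpath N \<eta> (fst z) (snd z)\<bar> ^ 4 \<partial>PM) < 1 / real (Suc n)" by blast
  from choice[OF this] obtain N where "\<forall>n. \<exists>\<eta>. integrable PM (\<lambda>z. \<bar>v z - tpath (N n) \<eta> (fst z) (snd z)\<bar> ^ 4) \<and>
      (\<integral>z. \<bar>v z - tpath (N n) \<eta> (fst z) (snd z)\<bar> ^ 4 \<partial>PM) < 1 / real (Suc n)" by blast
  from choice[OF this] obtain \<eta> where N\<eta>: "\<forall>n. integrable PM (\<lambda>z. \<bar>v z - tpath (N n) (\<eta> n) (fst z) (snd z)\<bar> ^ 4) \<and>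
      (\<integral>z. \<bar>v z - tpath (N n) (\<eta> n) (fst z) (snd z)\<bar> ^ 4 \<partial>PM) < 1 / real (Suc n)" by blast
  then have iD: "integrable PM (\<lambda>z. \<bar>v z - tpath (N n) (\<eta> n) (fst z) (snd z)\<bar> ^ 4)"
    and eD: "(\<integral>z. \<bar>v z - tpath (N n) (\<eta> n) (fst z) (snd z)\<bar> ^ 4 \<partial>PM) < 1 / real (Suc n)" for n by blast+
  define U where "U n = tpath (N n) (\<eta> n)" for n
  define r where "r n z = U n (fst z) (snd z)" for n z
  have r: "r n \<in> borel_measurable PM" "integrable PM (\<lambda>z. \<bar>r n z\<bar> ^ 4)" for n
    using tpath_measurable[of "N n" "\<eta> n"] tpath_integrable[of "N n" "\<eta> n"] by (simp_all add: r_def[abs_def] U_def)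
  define e where "e n = (\<integral>z. \<bar>v z - r n z\<bar> ^ 4 \<partial>PM)" for n
  have e_lim: "e \<longlonglongrightarrow> 0"
  proof (rule real_tendsto_sandwich[OF _ _ tendsto_const LIMSEQ_inverse_real_of_nat])
    show "\<forall>\<^sub>F n in sequentially. 0 \<le> e n" by (simp add: e_def integral_nonneg_AE)
    show "\<forall>\<^sub>F n in sequentially. e n \<le> inverse (real (Suc n))"
      using eD by (auto simp: e_def r_def U_def inverse_eq_divide less_imp_le)
  qed
  have UE: "U n \<in> Esp l T" for n unfolding U_def by (rule tpath_Esp)
  have En: "Enorm l T (\<lambda>t x. U n t x - u t x) = root 4 (e n)" for n
  proof -
    have "(\<integral>t. (Lnorm l 4 (\<lambda>x. U n t x - u t x)) ^ 4 \<partial>Time T) = (\<integral>t. (\<integral>x. \<bar>v (t, x) - r n (t, x)\<bar> ^ 4 \<partial>Ivl l) \<partial>Time T)"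
    proof (rule integral_cong_AE_lebesgue_on)
      show "AE t in Time T. (Lnorm l 4 (\<lambda>x. U n t x - u t x)) ^ 4 = (\<integral>x. \<bar>v (t, x) - r n (t, x)\<bar> ^ 4 \<partial>Ivl l)"
        using uv
      proof eventually_elim
        case (elim t)
        have "(Lnorm l 4 (\<lambda>x. U n t x - u t x)) ^ 4 = (\<integral>x. \<bar>U n t x - u t x\<bar> ^ 4 \<partial>Ivl l)"
          by (simp add: Lnorm_def integral_nonneg_AE)
        also have "\<dots> = (\<integral>x. \<bar>v (t, x) - r n (t, x)\<bar> ^ 4 \<partial>Ivl l)"
        proof (rule integral_cong_AE_lebesgue_on)
          show "AE x in Ivl l. \<bar>U n t x - u t x\<bar> ^ 4 = \<bar>v (t, x) - r n (t, x)\<bar> ^ 4"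
            using elim unfolding ae_eq_def
            by eventually_elim (simp add: r_def abs_minus_commute del: power_even_abs_numeral)
        qed simp
        finally show ?case .
      qed
    qed simp
    also have "\<dots> = e n" unfolding e_def by (rule PM.integral_fst') (use iD in \<open>simp add: r_def U_def\<close>)
    finally show ?thesis by (simp add: Enorm_def)
  qed
  have "(\<lambda>n. root 4 (e n)) \<longlonglongrightarrow> root 4 0" by (intro tendsto_intros e_lim)
  then have "(\<lambda>n. Enorm l T (\<lambda>t x. U n t x - u t x)) \<longlonglongrightarrow> 0" by (simp add: En)
  then have Llim: "(\<lambda>n. L2_Vdual_norm l T (\<lambda>t \<phi>. G (U n) t \<phi> - G u t \<phi>)) \<longlonglongrightarrow> 0"
    using ext u UE unfolding continuous_extension_G0_def by blast
  have GL: "G w \<in> L2_Vdual l T" if "w \<in> Esp l T" for w using ext that by (simp add: continuous_extension_G0_def)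
  define h where "h n t = G (U n) t (sb k) - G u t (sb k)" for n t
  note hb = L2_Vdual_diff_bound[OF GL[OF UE] GL[OF u], of _ k, folded h_def]
  have hg: "AE t in Time T. G (U n) t (sb k) = gfun c (r n) k t" for n
  proof -
    have "AE t in Time T. \<forall>\<phi>\<in>Vsp l. G (U n) t \<phi> = G0 l c (U n) t \<phi>"
      using ext tpath_C1_V unfolding continuous_extension_G0_def U_def by blast
    then show ?thesis
      by eventually_elim (simp add: sb_in_Vsp U_def G0_tpath gfun_def r_def)
  qed
  define D where "D t = G u t (sb k) - gfun c v k t" for t
  have Gm: "(\<lambda>t. G u t (sb k)) \<in> borel_measurable (Time T)" using GL[OF u] sb_in_Vsp by (simp add: L2_Vdual_def)
  have gm: "gfun c v k \<in> borel_measurable (Time T)" using gfun_integrable[OF v] by auto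
  define d where "d n = sqrt (\<integral>z. (v z - r n z)\<^sup>2 \<partial>PM)" for n
  define m where "m = sqrt (measure (Time T) (space (Time T)))"
  \<comment> \<open>Bounds the L^1 norm of D and tends to 0: the first summand measures the
    convergence of G in L^2(0,T;V'), the second is the bound from \<open>gfun_diff\<close>.\<close>
  let ?b = "\<lambda>n. sqrt ((1 + (mu k)\<^sup>2) * (L2_Vdual_norm l T (\<lambda>t \<phi>. G (U n) t \<phi> - G u t \<phi>))\<^sup>2) * m +
     (mu k / sqrt l * ((d n)\<^sup>2 + 2 * (sqrt (\<integral>z. (v z)\<^sup>2 \<partial>PM) * d n)) + \<bar>c\<bar> / sqrt l * (d n * sqrt (measure PM (space PM))))"
  have i1: "integrable (Time T) (\<lambda>t. \<bar>h n t\<bar>)" for n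
    using sqint_integrable[OF finite_lebesgue_on_Icc hb(1)] by simp
  have i2: "integrable (Time T) (\<lambda>t. \<bar>gfun c v k t - gfun c (r n) k t\<bar>)" for n
    using gfun_integrable[OF v] gfun_integrable[OF r] by simp
  have ptD: "AE t in Time T. \<bar>D t\<bar> \<le> \<bar>h n t\<bar> + \<bar>gfun c v k t - gfun c (r n) k t\<bar>" for n
    using hg[of n] by eventually_elim (simp add: D_def h_def)
  have iD': "integrable (Time T) (\<lambda>t. \<bar>D t\<bar>)"
    by (rule Bochner_Integration.integrable_bound[OF Bochner_Integration.integrable_add[OF i1[of 0] i2[of 0]]])
      (use Gm gm ptD[of 0] in \<open>auto simp: D_def\<close>)
  have le: "(\<integral>t. \<bar>D t\<bar> \<partial>Time T) \<le> ?b n" for n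
  proof -
    have "(\<integral>t. \<bar>D t\<bar> \<partial>Time T) \<le> (\<integral>t. \<bar>h n t\<bar> + \<bar>gfun c v k t - gfun c (r n) k t\<bar> \<partial>Time T)"
      by (rule integral_mono_AE[OF iD' Bochner_Integration.integrable_add[OF i1 i2] ptD])
    also have "\<dots> = (\<integral>t. \<bar>h n t\<bar> \<partial>Time T) + (\<integral>t. \<bar>gfun c v k t - gfun c (r n) k t\<bar> \<partial>Time T)"
      using i1 i2 by simp
    also have "\<dots> \<le> ?b n"
    proof (intro add_mono)
      have "(\<integral>t. \<bar>h n t\<bar> \<partial>Time T) \<le> sqrt (\<integral>t. (h n t)\<^sup>2 \<partial>Time T) * m"
        unfolding m_def by (rule integral_abs_le_sqrt[OF finite_lebesgue_on_Icc hb(1)])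
      also have "\<dots> \<le> sqrt ((1 + (mu k)\<^sup>2) * (L2_Vdual_norm l T (\<lambda>t \<phi>. G (U n) t \<phi> - G u t \<phi>))\<^sup>2) * m"
        by (intro mult_right_mono real_sqrt_le_mono hb(2)) (simp add: m_def)
      finally show "(\<integral>t. \<bar>h n t\<bar> \<partial>Time T) \<le> sqrt ((1 + (mu k)\<^sup>2) * (L2_Vdual_norm l T (\<lambda>t \<phi>. G (U n) t \<phi> - G u t \<phi>))\<^sup>2) * m" .
      show "(\<integral>t. \<bar>gfun c v k t - gfun c (r n) k t\<bar> \<partial>Time T) \<le> mu k / sqrt l * ((d n)\<^sup>2 + 2 * (sqrt (\<integral>z. (v z)\<^sup>2 \<partial>PM) * d n)) + \<bar>c\<bar> / sqrt l * (d n * sqrt (measure PM (space PM)))"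
        unfolding d_def by (rule gfun_diff[OF v r])
    qed
    finally show ?thesis .
  qed
  have d_lim: "d \<longlonglongrightarrow> 0"
  proof -
    have q: "(\<integral>z. (v z - r n z)\<^sup>2 \<partial>PM)\<^sup>2 \<le> e n * measure PM (space PM)" for n
      unfolding e_def by (rule sqint_of_fourth_power(3)[OF finite_PM]) (use v(1) r(1) iD in \<open>auto simp: r_def U_def\<close>)
    have "(\<lambda>n. sqrt (sqrt (e n * measure PM (space PM)))) \<longlonglongrightarrow> sqrt (sqrt (0 * measure PM (space PM)))"
      by (intro tendsto_intros e_lim)
    then have lim: "(\<lambda>n. sqrt (sqrt (e n * measure PM (space PM)))) \<longlonglongrightarrow> 0" by simp
    show ?thesis
    proof (rule real_tendsto_sandwich[OF _ _ tendsto_const lim])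
      show "\<forall>\<^sub>F n in sequentially. 0 \<le> d n" by (simp add: d_def integral_nonneg_AE)
      have "d n \<le> sqrt (sqrt (e n * measure PM (space PM)))" for n
        unfolding d_def by (intro real_sqrt_le_mono real_le_rsqrt q)
      then show "\<forall>\<^sub>F n in sequentially. d n \<le> sqrt (sqrt (e n * measure PM (space PM)))" by simp
    qed
  qed
  have "?b \<longlonglongrightarrow> sqrt ((1 + (mu k)\<^sup>2) * 0\<^sup>2) * m + (mu k / sqrt l * (0\<^sup>2 + 2 * (sqrt (\<integral>z. (v z)\<^sup>2 \<partial>PM) * 0)) + \<bar>c\<bar> / sqrt l * (0 * sqrt (measure PM (space PM))))"
    by (intro tendsto_intros Llim d_lim)
  then have "?b \<longlonglongrightarrow> 0" by simp
  then have "(\<integral>t. \<bar>D t\<bar> \<partial>Time T) \<le> 0" by (rule LIMSEQ_le_const) (use le in blast)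
  moreover have "0 \<le> (\<integral>t. \<bar>D t\<bar> \<partial>Time T)" by (rule integral_nonneg_AE) simp
  ultimately have "(\<integral>t. \<bar>D t\<bar> \<partial>Time T) = 0" by linarith
  then have "AE t in Time T. \<bar>D t\<bar> = 0" using iD' by (subst (asm) integral_nonneg_eq_0_iff_AE) auto
  then show ?thesis by eventually_elim (simp add: D_def)
qed

end

section \<open>Continuous paths in \<open>L\<^sup>4\<close>\<close>

lemma Lnorm4_pow: "(Lnorm l 4 u) ^ 4 = (\<integral>x. \<bar>u x\<bar> ^ 4 \<partial>Ivl l)"
  by (simp add: Lnorm_def integral_nonneg_AE)

lemma Lnorm4_nonneg: "0 \<le> Lnorm l 4 u"
  by (simp add: Lnorm_def integral_nonneg_AE)

lemma Lp4_measurable: "u \<in> Lp l 4 \<Longrightarrow> u \<in> borel_measurable (Ivl l)"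
  and Lp4_integrable: "u \<in> Lp l 4 \<Longrightarrow> integrable (Ivl l) (\<lambda>x. \<bar>u x\<bar> ^ 4)"
  by (auto simp: Lp_def)

lemma Lp4I: "u \<in> borel_measurable (Ivl l) \<Longrightarrow> integrable (Ivl l) (\<lambda>x. \<bar>u x\<bar> ^ 4) \<Longrightarrow> u \<in> Lp l 4"
  by (simp add: Lp_def)

lemma Lp4_add: "u \<in> Lp l 4 \<Longrightarrow> v \<in> Lp l 4 \<Longrightarrow> (\<lambda>x. u x + v x) \<in> Lp l 4"
  by (rule Lp4I[OF borel_measurable_add[OF Lp4_measurable Lp4_measurable]
      integrable_abs_add_power(1)[OF Lp4_measurable Lp4_measurable Lp4_integrable Lp4_integrable]])

lemma Lp4_uminus: "u \<in> Lp l 4 \<Longrightarrow> (\<lambda>x. - u x) \<in> Lp l 4"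
  by (simp add: Lp_def)

lemma Lp4_diff: "u \<in> Lp l 4 \<Longrightarrow> v \<in> Lp l 4 \<Longrightarrow> (\<lambda>x. u x - v x) \<in> Lp l 4"
  using Lp4_add[OF _ Lp4_uminus, of u l v] by simp

lemma Lp4_sqint: "u \<in> Lp l 4 \<Longrightarrow> sqint (Ivl l) u" and Lp4_sqint_sq: "u \<in> Lp l 4 \<Longrightarrow> sqint (Ivl l) (\<lambda>x. (u x)\<^sup>2)"
  by (rule sqint_of_fourth_power(1,2)[OF finite_Ivl Lp4_measurable Lp4_integrable]; assumption)+

lemma square_add_weighted:
  fixes x y A B :: real
  assumes "A > 0" "B > 0"
  shows "(x + y)\<^sup>2 \<le> (A + B) * (x\<^sup>2 / A + y\<^sup>2 / B)"
proof -
  have "(A + B) * (x\<^sup>2 / A + y\<^sup>2 / B) - (x + y)\<^sup>2 = (x * B - y * A)\<^sup>2 / (A * B)"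
    using assms by (simp add: field_simps power2_eq_square)
  also have "\<dots> \<ge> 0" using assms by simp
  finally show ?thesis by simp
qed

text \<open>Convexity of the fourth power with weights A/(A+B) and B/(A+B), obtained by using
  convexity of the square twice.\<close>

lemma fourth_power_add_weighted:
  fixes x y A B :: real
  assumes A: "A > 0" and B: "B > 0"
  shows "(x + y) ^ 4 \<le> (A + B) ^ 3 * (x ^ 4 / A ^ 3 + y ^ 4 / B ^ 3)"
proof -
  have "(x + y) ^ 4 = ((x + y)\<^sup>2)\<^sup>2" by simp
  also have "\<dots> \<le> ((A + B) * (x\<^sup>2 / A + y\<^sup>2 / B))\<^sup>2"
    by (intro power_mono square_add_weighted A B) simp
  also have "\<dots> = (A + B)\<^sup>2 * (x\<^sup>2 / A + y\<^sup>2 / B)\<^sup>2" by (simp add: power_mult_distrib)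
  also have "\<dots> \<le> (A + B)\<^sup>2 * ((A + B) * ((x\<^sup>2 / A)\<^sup>2 / A + (y\<^sup>2 / B)\<^sup>2 / B))"
    by (intro mult_left_mono square_add_weighted A B) simp
  also have "\<dots> = (A + B) ^ 3 * (x ^ 4 / A ^ 3 + y ^ 4 / B ^ 3)"
    by (simp add: power_divide power2_eq_square power3_eq_cube power4_eq_xxxx)
  finally show ?thesis .
qed

text \<open>Integrating the weighted inequality with A and B equal to the two norms gives (A + B)^4
  directly. The added e/2 keeps the weights positive.\<close>

lemma Lnorm4_triangle:
  assumes u: "u \<in> Lp l 4" and v: "v \<in> Lp l 4"
  shows "Lnorm l 4 (\<lambda>x. u x + v x) \<le> Lnorm l 4 u + Lnorm l 4 v"
proof (rule field_le_epsilon)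
  fix e :: real assume "e > 0"
  define A where "A = Lnorm l 4 u + e / 2"
  define B where "B = Lnorm l 4 v + e / 2"
  have AB: "A > 0" "B > 0" using \<open>e > 0\<close> Lnorm4_nonneg[of l u] Lnorm4_nonneg[of l v] by (auto simp: A_def B_def)
  note i = Lp4_integrable[OF u] Lp4_integrable[OF v]
  have "(Lnorm l 4 (\<lambda>x. u x + v x)) ^ 4 = (\<integral>x. \<bar>u x + v x\<bar> ^ 4 \<partial>Ivl l)" by (rule Lnorm4_pow)
  also have "\<dots> \<le> (\<integral>x. (A + B) ^ 3 * (\<bar>u x\<bar> ^ 4 / A ^ 3 + \<bar>v x\<bar> ^ 4 / B ^ 3) \<partial>Ivl l)"
  proof (rule integral_mono)
    show "integrable (Ivl l) (\<lambda>x. \<bar>u x + v x\<bar> ^ 4)" using Lp4_integrable[OF Lp4_add[OF u v]] .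
    show "integrable (Ivl l) (\<lambda>x. (A + B) ^ 3 * (\<bar>u x\<bar> ^ 4 / A ^ 3 + \<bar>v x\<bar> ^ 4 / B ^ 3))"
      using i by (intro integrable_mult_right Bochner_Integration.integrable_add integrable_divide_zero) auto
    show "\<bar>u x + v x\<bar> ^ 4 \<le> (A + B) ^ 3 * (\<bar>u x\<bar> ^ 4 / A ^ 3 + \<bar>v x\<bar> ^ 4 / B ^ 3)" for x
      by (rule order_trans[OF power_mono[OF abs_triangle_ineq] fourth_power_add_weighted[OF AB]]) simp
  qed
  also have "\<dots> = (A + B) ^ 3 * ((Lnorm l 4 u) ^ 4 / A ^ 3 + (Lnorm l 4 v) ^ 4 / B ^ 3)"
    unfolding Lnorm4_pow using i by simp
  also have "\<dots> \<le> (A + B) ^ 3 * (A ^ 4 / A ^ 3 + B ^ 4 / B ^ 3)"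
    using AB \<open>e > 0\<close> Lnorm4_nonneg[of l u] Lnorm4_nonneg[of l v]
    by (intro mult_left_mono add_mono divide_right_mono power_mono) (auto simp: A_def B_def)
  also have "\<dots> = (A + B) ^ 4" using AB by (simp add: field_simps power3_eq_cube power4_eq_xxxx)
  finally have "Lnorm l 4 (\<lambda>x. u x + v x) \<le> A + B"
    using AB Lnorm4_nonneg power_mono_iff[of "Lnorm l 4 (\<lambda>x. u x + v x)" "A + B" 4] by simp
  then show "Lnorm l 4 (\<lambda>x. u x + v x) \<le> Lnorm l 4 u + Lnorm l 4 v + e" by (simp add: A_def B_def)
qed

lemma Lnorm4_minus: "Lnorm l 4 (\<lambda>x. u x - v x) = Lnorm l 4 (\<lambda>x. v x - u x)"
  by (simp add: Lnorm_def abs_minus_commute del: power_even_abs_numeral)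

lemma Lnorm4_diff_triangle:
  assumes "u \<in> Lp l 4" "v \<in> Lp l 4" "w \<in> Lp l 4"
  shows "Lnorm l 4 (\<lambda>x. u x - w x) \<le> Lnorm l 4 (\<lambda>x. u x - v x) + Lnorm l 4 (\<lambda>x. v x - w x)"
  using Lnorm4_triangle[OF Lp4_diff[OF assms(1,2)] Lp4_diff[OF assms(2,3)]] by simp

lemma Lnorm4_abs_diff:
  assumes u: "u \<in> Lp l 4" and v: "v \<in> Lp l 4"
  shows "\<bar>Lnorm l 4 u - Lnorm l 4 v\<bar> \<le> Lnorm l 4 (\<lambda>x. u x - v x)"
  using Lnorm4_triangle[OF Lp4_diff[OF u v] v] Lnorm4_triangle[OF Lp4_diff[OF v u] u] Lnorm4_minus[of l u v]
  by simp

lemma Hnorm_le_Lnorm4: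
  assumes u: "u \<in> Lp l 4"
  shows "Hnorm l u \<le> sqrt (sqrt (measure (Ivl l) (space (Ivl l)))) * Lnorm l 4 u"
proof -
  let ?m = "measure (Ivl l) (space (Ivl l))"
  have "(Hnorm l u) ^ 4 = ((Hnorm l u)\<^sup>2)\<^sup>2" by simp
  also have "\<dots> = (\<integral>x. (u x)\<^sup>2 \<partial>Ivl l)\<^sup>2" by (simp only: Hnorm_sq)
  also have "\<dots> \<le> (\<integral>x. \<bar>u x\<bar> ^ 4 \<partial>Ivl l) * ?m"
    by (rule sqint_of_fourth_power(3)[OF finite_Ivl Lp4_measurable[OF u] Lp4_integrable[OF u]])
  also have "\<dots> = (sqrt (sqrt ?m) * Lnorm l 4 u) ^ 4"
  proof -
    have "x ^ 4 = (x\<^sup>2)\<^sup>2" for x :: real by simp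
    then have "(sqrt (sqrt ?m)) ^ 4 = ((sqrt (sqrt ?m))\<^sup>2)\<^sup>2" by blast
    also have "(sqrt (sqrt ?m))\<^sup>2 = sqrt ?m" by simp
    also have "(sqrt ?m)\<^sup>2 = ?m" by simp
    finally show ?thesis by (simp only: power_mult_distrib Lnorm4_pow mult.commute)
  qed
  finally show ?thesis
    using Lnorm4_nonneg[of l u] Hnorm_nonneg[of l u]
      power_mono_iff[of "Hnorm l u" "sqrt (sqrt ?m) * Lnorm l 4 u" 4] by simp
qed

lemma Hnorm_abs_diff:
  assumes u: "sqint (Ivl l) u" and v: "sqint (Ivl l) v"
  shows "\<bar>Hnorm l u - Hnorm l v\<bar> \<le> Hnorm l (\<lambda>x. u x - v x)"
proof -
  have "Hnorm l (\<lambda>x. v x - u x) = Hnorm l (\<lambda>x. u x - v x)" using Hnorm_scale[of l "-1" "\<lambda>x. u x - v x"] by simp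
  then show ?thesis
    using Hnorm_triangle[OF sqint_diff[OF u v] v] Hnorm_triangle[OF sqint_diff[OF v u] u] by simp
qed

text \<open>The sum of the |f n| has finite integral, so it is finite a.e. and its terms tend to
  0.\<close>

lemma L1_summable_imp_AE_tendsto:
  fixes f :: "nat \<Rightarrow> 'a \<Rightarrow> real"
  assumes f: "\<And>n. integrable M (f n)" and b: "\<And>n. (\<integral>x. \<bar>f n x\<bar> \<partial>M) \<le> b n" and "summable b"
  shows "AE x in M. (\<lambda>n. f n x) \<longlonglongrightarrow> 0"
proof -
  have [measurable]: "f n \<in> borel_measurable M" for n using f by auto
  have b0: "0 \<le> b n" for n proof -
    have "0 \<le> (\<integral>x. \<bar>f n x\<bar> \<partial>M)" by (rule integral_nonneg_AE) simp
    then show ?thesis using b[of n] by linarith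
  qed
  have "(\<integral>\<^sup>+x. (\<Sum>n. ennreal \<bar>f n x\<bar>) \<partial>M) = (\<Sum>n. \<integral>\<^sup>+x. ennreal \<bar>f n x\<bar> \<partial>M)"
    by (rule nn_integral_suminf) measurable
  also have "\<dots> = (\<Sum>n. ennreal (\<integral>x. \<bar>f n x\<bar> \<partial>M))"
    using f by (intro suminf_cong nn_integral_eq_integral) auto
  also have "\<dots> \<le> (\<Sum>n. ennreal (b n))"
    using b by (intro suminf_le ennreal_leI) auto
  also have "\<dots> = ennreal (\<Sum>n. b n)" by (rule suminf_ennreal2[OF b0 \<open>summable b\<close>])
  finally have "(\<integral>\<^sup>+x. (\<Sum>n. ennreal \<bar>f n x\<bar>) \<partial>M) \<noteq> \<infinity>" by (auto simp: top_unique)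
  then have "AE x in M. (\<Sum>n. ennreal \<bar>f n x\<bar>) \<noteq> \<infinity>"
    by (intro nn_integral_PInf_AE) measurable
  then show ?thesis
  proof eventually_elim
    case (elim x)
    then have "summable (\<lambda>n. \<bar>f n x\<bar>)" by (intro summable_suminf_not_top) auto
    then show ?case using summable_LIMSEQ_zero tendsto_rabs_zero_iff by blast
  qed
qed

section \<open>Jointly measurable versions of paths continuous in L^4\<close>

locale L4_path = space_time +
  fixes W :: "real \<Rightarrow> real \<Rightarrow> real"
  assumes W_L4: "t \<in> {0..T} \<Longrightarrow> W t \<in> Lp l 4"
    and W_cont: "t \<in> {0..T} \<Longrightarrow> ((\<lambda>s. Lnorm l 4 (\<lambda>x. W s x - W t x)) \<longlongrightarrow> 0) (at t within {0..T})"
begin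

lemma Lnorm4_continuous: "continuous_on {0..T} (\<lambda>t. Lnorm l 4 (W t))"
  unfolding continuous_on_def
proof
  fix t assume t: "t \<in> {0..T}"
  have "((\<lambda>s. Lnorm l 4 (W s) - Lnorm l 4 (W t)) \<longlongrightarrow> 0) (at t within {0..T})"
  proof (rule tendsto_rabs_zero_cancel, rule real_tendsto_sandwich[OF _ _ tendsto_const W_cont[OF t]])
    show "\<forall>\<^sub>F s in at t within {0..T}. \<bar>Lnorm l 4 (W s) - Lnorm l 4 (W t)\<bar> \<le> Lnorm l 4 (\<lambda>x. W s x - W t x)"
      unfolding eventually_at_filter using Lnorm4_abs_diff[OF W_L4 W_L4[OF t]] by (intro always_eventually) auto
  qed simp
  then show "((\<lambda>t. Lnorm l 4 (W t)) \<longlongrightarrow> Lnorm l 4 (W t)) (at t within {0..T})"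
    by (simp add: LIM_zero_iff)
qed

lemma Hnorm_continuous: "continuous_on {0..T} (\<lambda>t. Hnorm l (W t))"
  unfolding continuous_on_def
proof
  fix t assume t: "t \<in> {0..T}"
  define K where "K = sqrt (sqrt (measure (Ivl l) (space (Ivl l))))"
  have lim: "((\<lambda>s. K * Lnorm l 4 (\<lambda>x. W s x - W t x)) \<longlongrightarrow> 0) (at t within {0..T})"
    using tendsto_mult_left[OF W_cont[OF t], of K] by simp
  have "((\<lambda>s. Hnorm l (W s) - Hnorm l (W t)) \<longlongrightarrow> 0) (at t within {0..T})"
  proof (rule tendsto_rabs_zero_cancel, rule real_tendsto_sandwich[OF _ _ tendsto_const lim])
    have "\<bar>Hnorm l (W s) - Hnorm l (W t)\<bar> \<le> K * Lnorm l 4 (\<lambda>x. W s x - W t x)" if "s \<in> {0..T}" for s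
      unfolding K_def
      by (rule order_trans[OF Hnorm_abs_diff Hnorm_le_Lnorm4]) (use W_L4 that t Lp4_sqint Lp4_diff in auto)
    then show "\<forall>\<^sub>F s in at t within {0..T}. \<bar>Hnorm l (W s) - Hnorm l (W t)\<bar> \<le> K * Lnorm l 4 (\<lambda>x. W s x - W t x)"
      unfolding eventually_at_filter by (intro always_eventually) auto
  qed simp
  then show "((\<lambda>t. Hnorm l (W t)) \<longlongrightarrow> Hnorm l (W t)) (at t within {0..T})"
    by (simp add: LIM_zero_iff)
qed

text \<open>The Heine-Cantor argument through sequential compactness of [0,T], carried out for a
  distance that is only a pseudometric on representatives.\<close>

lemma W_uniformly_continuous:
  assumes "e > 0"
  shows "\<exists>d>0. \<forall>s\<in>{0..T}. \<forall>t\<in>{0..T}. \<bar>s - t\<bar> < d \<longrightarrow> Lnorm l 4 (\<lambda>x. W s x - W t x) < e"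
proof (rule ccontr)
  assume neg: "\<not> ?thesis"
  have "\<exists>s t. s \<in> {0..T} \<and> t \<in> {0..T} \<and> \<bar>s - t\<bar> < inverse (real (Suc n)) \<and> \<not> Lnorm l 4 (\<lambda>x. W s x - W t x) < e" for n
  proof -
    have "inverse (real (Suc n)) > 0" by simp
    then show ?thesis using neg by blast
  qed
  then obtain s t where st: "\<And>n. s n \<in> {0..T}" "\<And>n. t n \<in> {0..T}" "\<And>n::nat. \<bar>s n - t n\<bar> < inverse (real (Suc n))"
    "\<And>n. \<not> Lnorm l 4 (\<lambda>x. W (s n) x - W (t n) x) < e" by metis
  have "seq_compact {0..T}" by (rule compact_imp_seq_compact) simp
  then obtain p r where p: "p \<in> {0..T}" "strict_mono r" "(s \<circ> r) \<longlonglongrightarrow> p"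
    using st(1) unfolding seq_compact_def by blast
  have d0: "(\<lambda>n. s n - t n) \<longlonglongrightarrow> 0"
    by (rule tendsto_rabs_zero_cancel, rule real_tendsto_sandwich[OF _ _ tendsto_const LIMSEQ_inverse_real_of_nat])
      (use st(3) in \<open>auto intro!: always_eventually less_imp_le\<close>)
  have "(\<lambda>n. (s \<circ> r) n - ((\<lambda>n. s n - t n) \<circ> r) n) \<longlonglongrightarrow> p - 0"
    by (intro tendsto_diff p(3) LIMSEQ_subseq_LIMSEQ[OF d0 p(2)])
  then have tl: "(t \<circ> r) \<longlonglongrightarrow> p" by (simp add: o_def)
  have lim: "(\<lambda>n. Lnorm l 4 (\<lambda>x. W (q n) x - W p x)) \<longlonglongrightarrow> 0" if q: "\<And>n. q n \<in> {0..T}" "q \<longlonglongrightarrow> p" for q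
  proof -
    have "((\<lambda>s. Lnorm l 4 (\<lambda>x. W s x - W p x)) \<longlongrightarrow> Lnorm l 4 (\<lambda>x. W p x - W p x)) (at p within {0..T})"
      using W_cont[OF p(1)] by (simp add: Lnorm_def)
    then have "continuous (at p within {0..T}) (\<lambda>s. Lnorm l 4 (\<lambda>x. W s x - W p x))" by (simp add: continuous_within)
    then have "(\<lambda>n. Lnorm l 4 (\<lambda>x. W (q n) x - W p x)) \<longlonglongrightarrow> Lnorm l 4 (\<lambda>x. W p x - W p x)"
      by (rule continuous_within_tendsto_compose'[OF _ _ q(2)]) (use q(1) in auto)
    then show ?thesis by (simp add: Lnorm_def)
  qed
  have "(\<lambda>n. Lnorm l 4 (\<lambda>x. W ((s \<circ> r) n) x - W p x) + Lnorm l 4 (\<lambda>x. W ((t \<circ> r) n) x - W p x)) \<longlonglongrightarrow> 0 + 0"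
    by (intro tendsto_add lim p(3) tl) (use st in auto)
  then have "\<forall>\<^sub>F n in sequentially. Lnorm l 4 (\<lambda>x. W ((s \<circ> r) n) x - W p x) + Lnorm l 4 (\<lambda>x. W ((t \<circ> r) n) x - W p x) < e"
    using assms by (intro order_tendstoD(2)) auto
  then obtain n where n: "Lnorm l 4 (\<lambda>x. W (s (r n)) x - W p x) + Lnorm l 4 (\<lambda>x. W (t (r n)) x - W p x) < e"
    by (auto simp: eventually_sequentially)
  have "Lnorm l 4 (\<lambda>x. W (s (r n)) x - W (t (r n)) x) < e"
    using Lnorm4_diff_triangle[OF W_L4[OF st(1)] W_L4[OF p(1)] W_L4[OF st(2)], of "r n" "r n"] n
      Lnorm4_minus[of l "W p" "W (t (r n))"] by simp
  then show False using st(4) by blast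
qed

text \<open>Freezing time on a grid makes joint measurability evident: only countably many slices
  occur, each measurable in x.\<close>

lemma W_step_approx:
  assumes e: "e > 0"
  shows "\<exists>P. (\<lambda>z. W (P (fst z)) (snd z)) \<in> borel_measurable PM \<and> (\<forall>t\<in>{0..T}. P t \<in> {0..T} \<and>
    Lnorm l 4 (\<lambda>x. W (P t) x - W t x) < e)"
proof -
  obtain d where d: "d > 0" "\<And>s t. s \<in> {0..T} \<Longrightarrow> t \<in> {0..T} \<Longrightarrow> \<bar>s - t\<bar> < d \<Longrightarrow> Lnorm l 4 (\<lambda>x. W s x - W t x) < e"
    using W_uniformly_continuous[OF e] by blast
  obtain h where h: "0 < h" "h < d" using d(1) dense by blast
  define i where "i t = nat \<lfloor>t / h\<rfloor>" for t
  \<comment> \<open>P rounds t down to a grid of width h < d. The cap at T keeps every grid value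
    inside [0,T], which the measurability argument needs for all indices.\<close>
  define P where "P t = min T (h * real (i t))" for t
  have P: "P t \<in> {0..T} \<and> \<bar>P t - t\<bar> < d" if t: "t \<in> {0..T}" for t
  proof -
    have fl: "real (i t) = of_int \<lfloor>t / h\<rfloor>" using t h by (simp add: i_def)
    have "real (i t) \<le> t / h" "t / h < real (i t) + 1" unfolding fl by linarith+
    then have "h * real (i t) \<le> t" "t < h * real (i t) + h" using h by (simp_all add: field_simps)
    then show ?thesis using t h T_pos by (auto simp: P_def)
  qed
  have "(\<lambda>z. W (min T (h * real (i (fst z)))) (snd z)) \<in> borel_measurable PM"
  proof (rule measurable_compose_countable[where f = "\<lambda>j z. W (min T (h * real j)) (snd z)" and g = "\<lambda>z. i (fst z)"])
    fix j :: nat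
    have "min T (h * real j) \<in> {0..T}" using h T_pos by auto
    then have [measurable]: "W (min T (h * real j)) \<in> borel_measurable (Ivl l)" using W_L4 Lp4_measurable by blast
    show "(\<lambda>z. W (min T (h * real j)) (snd z)) \<in> borel_measurable PM" by measurable
  next
    show "(\<lambda>z. i (fst z)) \<in> PM \<rightarrow>\<^sub>M count_space UNIV" unfolding i_def by measurable
  qed
  then show ?thesis using P d(2)
    by (intro exI[of _ P]) (auto simp: P_def)
qed

text \<open>Step approximations with errors (1/2)^n are summable in L^1(I) at every single t, so
  they converge for a.e. x there; the pointwise limit inherits joint measurability.\<close>

lemma W_representative:
  "\<exists>v. v \<in> borel_measurable PM \<and> integrable PM (\<lambda>z. \<bar>v z\<bar> ^ 4) \<and>
    (\<forall>t\<in>{0..T}. ae_eq l (W t) (\<lambda>x. v (t, x)))"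
proof -
  have "\<forall>n::nat. \<exists>P. (\<lambda>z. W (P (fst z)) (snd z)) \<in> borel_measurable PM \<and> (\<forall>t\<in>{0..T}. P t \<in> {0..T} \<and>
    Lnorm l 4 (\<lambda>x. W (P t) x - W t x) < (1/2) ^ n)"
    by (intro allI W_step_approx) simp
  from choice[OF this] obtain P where Pm: "\<And>n. (\<lambda>z. W (P n (fst z)) (snd z)) \<in> borel_measurable PM"
    and P: "\<And>n t. t \<in> {0..T} \<Longrightarrow> P n t \<in> {0..T}"
    and Pe: "\<And>n t. t \<in> {0..T} \<Longrightarrow> Lnorm l 4 (\<lambda>x. W (P n t) x - W t x) < (1/2) ^ n" by blast
  \<comment> \<open>\<open>lim\<close> is unspecified where the sequence diverges; for every t in
    [0,T] this concerns only a null set of x.\<close>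
  define v where "v z = lim (\<lambda>n. W (P n (fst z)) (snd z))" for z
  have v: "v \<in> borel_measurable PM" unfolding v_def by (rule borel_measurable_lim_metric[OF Pm])
  define m where "m = measure (Ivl l) (space (Ivl l))"
  have ae: "AE x in Ivl l. W t x = v (t, x)" if t: "t \<in> {0..T}" for t
  proof -
    have L: "(\<lambda>x. W (P n t) x - W t x) \<in> Lp l 4" for n by (intro Lp4_diff W_L4 P t)
    have "AE x in Ivl l. (\<lambda>n. W (P n t) x - W t x) \<longlonglongrightarrow> 0"
    proof (rule L1_summable_imp_AE_tendsto)
      show "integrable (Ivl l) (\<lambda>x. W (P n t) x - W t x)" for n
        by (rule sqint_integrable[OF finite_Ivl Lp4_sqint[OF L]])
      show "(\<integral>x. \<bar>W (P n t) x - W t x\<bar> \<partial>Ivl l) \<le> (sqrt (sqrt m) * sqrt m) * (1/2) ^ n" for n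
      proof -
        have "(\<integral>x. \<bar>W (P n t) x - W t x\<bar> \<partial>Ivl l) \<le> Hnorm l (\<lambda>x. W (P n t) x - W t x) * sqrt m"
          using integral_abs_le_sqrt[OF finite_Ivl Lp4_sqint[OF L]] by (simp add: Hnorm_eq m_def)
        also have "\<dots> \<le> (sqrt (sqrt m) * Lnorm l 4 (\<lambda>x. W (P n t) x - W t x)) * sqrt m"
          unfolding m_def by (intro mult_right_mono Hnorm_le_Lnorm4 L) simp
        also have "\<dots> \<le> (sqrt (sqrt m) * (1/2) ^ n) * sqrt m"
          using Pe[OF t, of n] by (intro mult_right_mono mult_left_mono) (auto simp: m_def)
        finally show ?thesis by (simp add: ac_simps)
      qed
      show "summable (\<lambda>n. (sqrt (sqrt m) * sqrt m) * (1/2) ^ n)" by (intro summable_mult summable_geometric) simp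
    qed
    then show ?thesis
    proof eventually_elim
      case (elim x)
      then have "(\<lambda>n. W (P n t) x) \<longlonglongrightarrow> W t x" by (simp add: LIM_zero_iff)
      then show ?case by (simp add: v_def limI)
    qed
  qed
  have N: "(\<integral>x. \<bar>v (t, x)\<bar> ^ 4 \<partial>Ivl l) = (Lnorm l 4 (W t)) ^ 4" if t: "t \<in> {0..T}" for t
    unfolding Lnorm4_pow
    by (rule integral_cong_AE_lebesgue_on) (use ae[OF t] in \<open>auto simp del: power_even_abs_numeral\<close>)
  have "integrable PM (\<lambda>z. \<bar>v z\<bar> ^ 4)"
  proof (rule PM.Fubini_integrable)
    show "(\<lambda>z. \<bar>v z\<bar> ^ 4) \<in> borel_measurable PM" using v by simp
    have "integrable (Time T) (\<lambda>t. (Lnorm l 4 (W t)) ^ 4)"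
      by (intro continuous_imp_integrable_real continuous_intros Lnorm4_continuous)
    also have "?this \<longleftrightarrow> integrable (Time T) (\<lambda>t. \<integral>x. norm (\<bar>v (t, x)\<bar> ^ 4) \<partial>Ivl l)"
      by (rule Bochner_Integration.integrable_cong) (use N in \<open>auto\<close>)
    finally show "integrable (Time T) (\<lambda>t. \<integral>x. norm (\<bar>v (t, x)\<bar> ^ 4) \<partial>Ivl l)" .
    show "AE t in Time T. integrable (Ivl l) (\<lambda>x. \<bar>v (t, x)\<bar> ^ 4)"
    proof (rule AE_I2)
      fix t assume "t \<in> space (Time T)"
      then have t: "t \<in> {0..T}" by simp
      have "AE x in Ivl l. \<bar>W t x\<bar> ^ 4 = \<bar>v (t, x)\<bar> ^ 4" using ae[OF t] by eventually_elim simp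
      from integrable_cong_AE_lebesgue_on[OF _ this]
      show "integrable (Ivl l) (\<lambda>x. \<bar>v (t, x)\<bar> ^ 4)" using Lp4_integrable[OF W_L4[OF t]] by simp
    qed
  qed
  then show ?thesis using v ae by (auto simp: ae_eq_def)
qed

end

section \<open>A lower bound for the product of the embedding constants\<close>

text \<open>The squared Gagliardo seminorm of order 1/2. On the diagonal the quotient is 0 / 0 =
  0.\<close>

definition Gag :: "real \<Rightarrow> rfun \<Rightarrow> real"
  where "Gag l v = (\<integral>z. (case z of (x, y) \<Rightarrow> ((v x - v y) / (x - y))\<^sup>2) \<partial>(Ivl l \<Otimes>\<^sub>M Ivl l))"

lemma Gag_nonneg: "0 \<le> Gag l v"
  unfolding Gag_def by (rule integral_nonneg_AE) auto

lemma Hhalf_norm_sq: "(Hhalf_norm l v)\<^sup>2 = (\<integral>x. (v x)\<^sup>2 \<partial>Ivl l) + Gag l v"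
  unfolding Hhalf_norm_def Gag_def[symmetric] Hnorm_sq
  by (rule real_sqrt_pow2) (auto intro: add_nonneg_nonneg Gag_nonneg integral_nonneg_AE)

lemma nn_integral_Ivl:
  "(\<integral>\<^sup>+x. f x \<partial>Ivl l) = (\<integral>\<^sup>+x. f x * indicator {-l<..<l} x \<partial>lborel)"
  by (subst nn_integral_restrict_space) (auto simp: nn_integral_completion)

lemma nn_integral_FTC_Ioo:
  fixes f F :: "real \<Rightarrow> real"
  assumes [measurable]: "f \<in> borel_measurable borel" and "a \<le> b"
    and F: "\<And>x. x \<in> {a..b} \<Longrightarrow> (F has_real_derivative f x) (at x)" and nn: "\<And>x. x \<in> {a..b} \<Longrightarrow> 0 \<le> f x"
  shows "(\<integral>\<^sup>+x. ennreal (f x) * indicator {a<..<b} x \<partial>lborel) = ennreal (F b - F a)"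
proof -
  have "(\<integral>\<^sup>+x. ennreal (f x) * indicator {a<..<b} x \<partial>lborel) = (\<integral>\<^sup>+x. ennreal (f x) * indicator {a..b} x \<partial>lborel)"
  proof (rule nn_integral_cong_AE)
    show "AE x in lborel. ennreal (f x) * indicator {a<..<b} x = ennreal (f x) * indicator {a..b} x"
      using AE_lborel_singleton[of a] AE_lborel_singleton[of b]
      by eventually_elim (auto simp: indicator_def)
  qed
  also have "\<dots> = ennreal (F b - F a)"
    by (rule nn_integral_FTC_Icc) (use assms in \<open>auto simp: has_field_derivative_at_within\<close>)
  finally show ?thesis .
qed

text \<open>B x B contributes nothing because v vanishes on B, and the two mixed blocks agree by
  symmetry of the integrand. It also passes from completed to Borel measure, where the inner
  integrals can be evaluated by antiderivatives.\<close>

lemma Gag_split: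
  assumes v[measurable]: "v \<in> borel_measurable borel" and vH: "v \<in> Hhalf l"
    and A[measurable]: "A \<in> sets borel" "A \<subseteq> {-l<..<l}" and B[measurable]: "B \<in> sets borel" "B = {-l<..<l} - A"
    and zero: "\<And>x. x \<in> B \<Longrightarrow> v x = 0"
  defines "g \<equiv> \<lambda>x y. ennreal (((v x - v y) / (x - y))\<^sup>2)"
  shows "ennreal (Gag l v) = (\<integral>\<^sup>+x. (\<integral>\<^sup>+y. g x y * indicator A y \<partial>lborel) * indicator A x \<partial>lborel)
     + 2 * (\<integral>\<^sup>+x. (\<integral>\<^sup>+y. g x y * indicator B y \<partial>lborel) * indicator A x \<partial>lborel)"
proof -
  interpret I: finite_measure "Ivl l" by (rule finite_Ivl)
  interpret II: pair_sigma_finite "Ivl l" "Ivl l" by unfold_locales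
  have int: "integrable (Ivl l \<Otimes>\<^sub>M Ivl l) (\<lambda>(x, y). ((v x - v y) / (x - y))\<^sup>2)"
    using vH by (simp add: Hhalf_def)
  have gm[measurable]: "(\<lambda>z. g (fst z) (snd z)) \<in> borel_measurable (lborel \<Otimes>\<^sub>M lborel)"
    unfolding g_def by measurable
  have gm2[measurable]: "(\<lambda>z. g (snd z) (fst z)) \<in> borel_measurable (lborel \<Otimes>\<^sub>M lborel)"
    unfolding g_def by measurable
  have gm1[measurable]: "g x \<in> borel_measurable borel" for x unfolding g_def by measurable
  have g_sym: "g x y = g y x" for x y
    unfolding g_def by (metis minus_diff_eq minus_divide_divide power2_eq_square)
  have "ennreal (Gag l v) = (\<integral>\<^sup>+z. ennreal (case z of (x, y) \<Rightarrow> ((v x - v y) / (x - y))\<^sup>2) \<partial>(Ivl l \<Otimes>\<^sub>M Ivl l))"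
    unfolding Gag_def by (rule nn_integral_eq_integral[OF int, symmetric]) auto
  also have "\<dots> = (\<integral>\<^sup>+x. (\<integral>\<^sup>+y. g x y \<partial>Ivl l) \<partial>Ivl l)"
    by (subst I.nn_integral_fst[symmetric]) (use int in \<open>auto simp: g_def\<close>)
  also have "\<dots> = (\<integral>\<^sup>+x. (\<integral>\<^sup>+y. g x y * indicator {-l<..<l} y \<partial>lborel) * indicator {-l<..<l} x \<partial>lborel)"
    by (simp only: nn_integral_Ivl)
  also have "\<dots> = (\<integral>\<^sup>+x. (\<integral>\<^sup>+y. g x y * indicator A y \<partial>lborel) * indicator A x
      + (\<integral>\<^sup>+y. g x y * indicator B y \<partial>lborel) * indicator A x
      + (\<integral>\<^sup>+y. g x y * indicator A y \<partial>lborel) * indicator B x \<partial>lborel)"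
  proof (rule nn_integral_cong)
    fix x :: real
    have J: "indicator {-l<..<l} y = (indicator A y + indicator B y :: ennreal)" for y
      using A(2) B(2) by (auto simp: indicator_def)
    have split: "(\<integral>\<^sup>+y. g x y * indicator {-l<..<l} y \<partial>lborel) =
        (\<integral>\<^sup>+y. g x y * indicator A y \<partial>lborel) + (\<integral>\<^sup>+y. g x y * indicator B y \<partial>lborel)"
      unfolding J distrib_left by (rule nn_integral_add) measurable
    consider "x \<in> A" "x \<notin> B" | "x \<in> B" "x \<notin> A" | "x \<notin> A" "x \<notin> B" using B(2) by blast
    then show "(\<integral>\<^sup>+y. g x y * indicator {-l<..<l} y \<partial>lborel) * indicator {-l<..<l} x =
      (\<integral>\<^sup>+y. g x y * indicator A y \<partial>lborel) * indicator A x
      + (\<integral>\<^sup>+y. g x y * indicator B y \<partial>lborel) * indicator A x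
      + (\<integral>\<^sup>+y. g x y * indicator A y \<partial>lborel) * indicator B x"
    proof cases
      case 2
      have gz: "g x y * indicator B y = 0" for y using zero[OF 2(1)] zero[of y] by (auto simp: g_def indicator_def)
      have "(\<integral>\<^sup>+y. g x y * indicator B y \<partial>lborel) = 0" by (simp only: gz) simp
      then show ?thesis using 2 by (subst split) (simp add: J)
    qed (subst split, simp add: J)+
  qed
  also have "\<dots> = (\<integral>\<^sup>+x. (\<integral>\<^sup>+y. g x y * indicator A y \<partial>lborel) * indicator A x \<partial>lborel)
      + (\<integral>\<^sup>+x. (\<integral>\<^sup>+y. g x y * indicator B y \<partial>lborel) * indicator A x \<partial>lborel)
      + (\<integral>\<^sup>+x. (\<integral>\<^sup>+y. g x y * indicator A y \<partial>lborel) * indicator B x \<partial>lborel)"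
  proof -
    have m: "(\<lambda>x. (\<integral>\<^sup>+y. g x y * indicator C y \<partial>lborel) * indicator D x) \<in> borel_measurable lborel"
      if [measurable]: "C \<in> sets borel" "D \<in> sets borel" for C D
    proof -
      have "(\<lambda>z. g (fst z) (snd z) * indicator C (snd z)) \<in> borel_measurable (lborel \<Otimes>\<^sub>M lborel)" by measurable
      then have "(\<lambda>x. \<integral>\<^sup>+y. g x y * indicator C y \<partial>lborel) \<in> borel_measurable lborel"
        by (intro lborel.borel_measurable_nn_integral) (simp add: split_beta')
      then show ?thesis by measurable
    qed
    show ?thesis by (subst nn_integral_add; (intro borel_measurable_add m A B)?)+ simp
  qed
  also have "(\<integral>\<^sup>+x. (\<integral>\<^sup>+y. g x y * indicator A y \<partial>lborel) * indicator B x \<partial>lborel) =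
      (\<integral>\<^sup>+x. (\<integral>\<^sup>+y. g x y * indicator A y * indicator B x \<partial>lborel) \<partial>lborel)"
    by (intro nn_integral_cong nn_integral_multc[symmetric]) measurable
  also have "\<dots> = (\<integral>\<^sup>+y. (\<integral>\<^sup>+x. g x y * indicator A y * indicator B x \<partial>lborel) \<partial>lborel)"
    by (rule pair_sigma_finite.Fubini'[OF pair_sigma_finite.intro[OF lborel.sigma_finite_measure_axioms lborel.sigma_finite_measure_axioms]]) (simp add: split_beta')
  also have "\<dots> = (\<integral>\<^sup>+y. (\<integral>\<^sup>+x. g y x * indicator B x \<partial>lborel) * indicator A y \<partial>lborel)"
  proof (rule nn_integral_cong)
    fix y :: real
    have "(\<integral>\<^sup>+x. g x y * indicator A y * indicator B x \<partial>lborel) = (\<integral>\<^sup>+x. (g y x * indicator B x) * indicator A y \<partial>lborel)"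
      by (rule nn_integral_cong) (simp add: g_sym[of _ y] mult_ac)
    then show "(\<integral>\<^sup>+x. g x y * indicator A y * indicator B x \<partial>lborel) = (\<integral>\<^sup>+x. g y x * indicator B x \<partial>lborel) * indicator A y"
      by (simp add: nn_integral_multc)
  qed
  finally show ?thesis by (simp add: mult_2 add.assoc)
qed

lemma integral_Ivl_piece:
  fixes f F :: "real \<Rightarrow> real"
  assumes ab: "a \<le> b" "-l \<le> a" "b \<le> l" and f: "continuous_on {a..b} f"
    and F: "\<And>x. x \<in> {a..b} \<Longrightarrow> (F has_real_derivative f x) (at x within {a..b})"
    and h: "\<And>x. x \<in> {-l<..<l} \<Longrightarrow> h x = (if x \<in> {a..b} then f x else 0)"
  shows "integrable (Ivl l) h" "(\<integral>x. h x \<partial>Ivl l) = F b - F a"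
proof -
  define k where "k x = indicator {a..b} x *\<^sub>R f x" for x
  have hb: "has_bochner_integral lborel k (F b - F a)"
    unfolding k_def
    by (rule has_bochner_integral_FTC_Icc[OF ab(1) _ f])
      (use F in \<open>simp add: has_real_derivative_iff_has_vector_derivative\<close>)
  then have kb: "integrable lborel k" "(\<integral>x. k x \<partial>lborel) = F b - F a"
    by (auto simp: has_bochner_integral_iff)
  then have km[measurable]: "k \<in> borel_measurable borel" by auto
  have kl: "integrable lebesgue k" using kb(1) by (subst integrable_completion) auto
  have hk: "h x = k x" if "x \<in> space (Ivl l)" for x using h[of x] that by (simp add: k_def)
  have "integrable (Ivl l) k"
    using integrable_mult_indicator[OF _ kl, of "{-l<..<l}"] by (simp add: integrable_restrict_space)
  then show "integrable (Ivl l) h" by (subst Bochner_Integration.integrable_cong[OF refl hk]) auto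
  have "(\<integral>x. h x \<partial>Ivl l) = (\<integral>x. k x \<partial>Ivl l)" by (rule Bochner_Integration.integral_cong[OF refl hk]) auto
  also have "\<dots> = (\<integral>x. indicator {-l<..<l} x *\<^sub>R k x \<partial>lebesgue)" by (rule integral_restrict_space) auto
  also have "\<dots> = (\<integral>x. indicator {-l<..<l} x *\<^sub>R k x \<partial>lborel)" by (rule integral_completion) measurable
  also have "\<dots> = (\<integral>x. k x \<partial>lborel)"
  proof (rule integral_cong_AE)
    show "AE x in lborel. indicator {-l<..<l} x *\<^sub>R k x = k x"
      using AE_lborel_singleton[of l] AE_lborel_singleton[of "-l"]
      by eventually_elim (use ab in \<open>auto simp: k_def indicator_def\<close>)
  qed measurable
  finally show "(\<integral>x. h x \<partial>Ivl l) = F b - F a" using kb(2) by simp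
qed

section \<open>Explicit test functions for the Sobolev and interpolation inequalities\<close>

locale embedding_constants = interval +
  fixes C1 C2 :: real
  assumes C1: "C1 > 0" and C2: "C2 > 0"
    and sobolev: "\<And>v. v \<in> Hhalf l \<Longrightarrow> v \<in> Lp l 4 \<and> Lnorm l 4 v \<le> C1 * Hhalf_norm l v"
    and interpolation: "\<And>v. v \<in> Hk l 1 \<Longrightarrow>
          v \<in> Hhalf l \<and> Hhalf_norm l v \<le> C2 * sqrt (Lnorm l 2 v) * sqrt (Hk_norm l 1 v)"
begin

lemma sobolev_pow:
  assumes "v \<in> Hk l 1"
  shows "(\<integral>x. \<bar>v x\<bar> ^ 4 \<partial>Ivl l) \<le> C1 ^ 4 * ((\<integral>x. (v x)\<^sup>2 \<partial>Ivl l) + Gag l v)\<^sup>2"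
proof -
  have "Lnorm l 4 v \<le> C1 * Hhalf_norm l v" using assms interpolation sobolev by blast
  then have "(Lnorm l 4 v) ^ 4 \<le> (C1 * Hhalf_norm l v) ^ 4" by (intro power_mono Lnorm4_nonneg)
  also have "\<dots> = C1 ^ 4 * ((Hhalf_norm l v)\<^sup>2)\<^sup>2" by (simp add: power_mult_distrib)
  finally show ?thesis unfolding Lnorm4_pow Hhalf_norm_sq .
qed

lemma interpolation_pow:
  assumes v: "v \<in> Hk l 1" and g: "weak_deriv l v g"
  shows "((\<integral>x. (v x)\<^sup>2 \<partial>Ivl l) + Gag l v)\<^sup>2 \<le>
    C2 ^ 4 * ((\<integral>x. (v x)\<^sup>2 \<partial>Ivl l) * ((\<integral>x. (v x)\<^sup>2 \<partial>Ivl l) + (\<integral>x. (g x)\<^sup>2 \<partial>Ivl l)))"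
proof -
  have nn: "0 \<le> (\<integral>x. (v x)\<^sup>2 \<partial>Ivl l)" "0 \<le> (\<integral>x. (g x)\<^sup>2 \<partial>Ivl l)" by (auto intro: integral_nonneg_AE)
  have le: "Hhalf_norm l v \<le> C2 * sqrt (Lnorm l 2 v) * sqrt (Hk_norm l 1 v)" using v interpolation by blast
  have H0: "0 \<le> Hhalf_norm l v"
    unfolding Hhalf_norm_def Gag_def[symmetric] by (simp add: Gag_nonneg)
  have pow4: "(sqrt x) ^ 4 = x\<^sup>2" if "0 \<le> x" for x
  proof -
    have "y ^ 4 = (y\<^sup>2)\<^sup>2" for y :: real by simp
    then have "(sqrt x) ^ 4 = ((sqrt x)\<^sup>2)\<^sup>2" by blast
    also have "(sqrt x)\<^sup>2 = x" using that by simp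
    finally show ?thesis .
  qed
  have "((Hhalf_norm l v)\<^sup>2)\<^sup>2 = (Hhalf_norm l v) ^ 4" by simp
  also have "\<dots> \<le> (C2 * sqrt (Lnorm l 2 v) * sqrt (Hk_norm l 1 v)) ^ 4" by (rule power_mono[OF le H0])
  also have "\<dots> = C2 ^ 4 * ((Lnorm l 2 v)\<^sup>2 * (Hk_norm l 1 v)\<^sup>2)"
    by (simp only: power_mult_distrib pow4[OF Hnorm_nonneg] pow4[OF Vnorm_nonneg] mult.assoc)
  also have "(Hk_norm l 1 v)\<^sup>2 = (\<integral>x. (v x)\<^sup>2 \<partial>Ivl l) + (\<integral>x. (g x)\<^sup>2 \<partial>Ivl l)"
    using nn by (simp add: Vnorm_weak[OF g])
  finally show ?thesis unfolding Hhalf_norm_sq Hnorm_sq .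
qed

lemma Hk1I: "sqint (Ivl l) v \<Longrightarrow> weak_deriv l v g \<Longrightarrow> v \<in> Hk l 1"
  by (auto simp: Hk1_iff)

text \<open>The constant function suffices on short intervals; on long ones its \<open>L\<^sup>2\<close> norm is too large.\<close>

lemma C1_lower_small:
  assumes "l \<le> 6" shows "225 / 2704 \<le> C1 ^ 4"
proof -
  have w: "weak_deriv l (\<lambda>x. 1) (\<lambda>x. 0)" by (rule weak_deriv_C1[OF l_pos]) auto
  have s: "sqint (Ivl l) (\<lambda>x. 1)" by (rule sqint_cont) auto
  have m: "(\<integral>x. 1 \<partial>Ivl l) = 2 * l"
    using l_pos continuous_imp_integrable_Ivl(2)[of l "\<lambda>x. 1"] by simp
  have "Gag l (\<lambda>x. 1) = 0" by (simp add: Gag_def split_beta')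
  then have "2 * l \<le> C1 ^ 4 * (2 * l)\<^sup>2" using sobolev_pow[OF Hk1I[OF s w]] m by simp
  then have "(2 * l) * 1 \<le> (2 * l) * (C1 ^ 4 * (2 * l))" by (simp add: power2_eq_square ac_simps)
  then have "1 \<le> C1 ^ 4 * (2 * l)" using l_pos by (subst (asm) mult_le_cancel_left_pos) auto
  \<comment> \<open>1/12 is just above 225/2704, which fixes the threshold l = 6.\<close>
  also have "\<dots> \<le> C1 ^ 4 * 12" using assms C1 by (intro mult_left_mono) auto
  finally show ?thesis by simp
qed

text \<open>Test function: the square of a linear ramp falling from 1 to 0 over length 9, which fits
  since 2 l \<ge> 12. At an end of I only one side contributes exterior seminorm. Its integrals are
  \<integral>q^4 = 1 and \<integral>q^2 = 9/5, and the seminorm is at most 7/6 + 2/4 = 5/3; 225/2704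
  is the inverse square of 9/5 + 5/3.\<close>

lemma C1_lower_large:
  assumes l6: "6 \<le> l" shows "225 / 2704 \<le> C1 ^ 4"
proof -
  define p where "p x = 1 - (x + l) / 9" for x
  define q where "q x = (max 0 (p x))\<^sup>2" for x
  define q' where "q' x = - 2 / 9 * max 0 (p x)" for x
  have p_pos: "p x > 0 \<longleftrightarrow> x < 9 - l" for x by (auto simp: p_def field_simps)
  have pc: "continuous_on S p" for S unfolding p_def by (intro continuous_intros) auto
  have pd: "(p has_real_derivative - 1 / 9) (at x within S)" for x S
    unfolding p_def by (auto intro!: derivative_eq_intros)
  have qc: "continuous_on S q" "continuous_on S q'" for S unfolding q_def q'_def by (intro continuous_intros pc)+
  have w: "weak_deriv l q q'"
  proof (rule weak_deriv_piecewise[OF l_pos, of "{9 - l}"])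
    fix x assume x: "x \<in> {-l<..<l} - {9 - l}"
    show "(q has_real_derivative q' x) (at x)"
    proof (cases "x < 9 - l")
      case True
      have "((\<lambda>x. (p x)\<^sup>2) has_real_derivative q' x) (at x)"
        using True p_pos[of x] by (auto intro!: derivative_eq_intros pd simp: q'_def)
      then show ?thesis
        by (rule has_field_derivative_transform_within_open[of _ _ _ "{..<9 - l}"])
          (use True p_pos in \<open>auto simp: q_def less_imp_le max_absorb2\<close>)
    next
      case False
      then have F: "9 - l < x" using x by auto
      have np: "p y \<le> 0" if "9 - l < y" for y using p_pos[of y] that by linarith
      have "((\<lambda>x. 0) has_real_derivative q' x) (at x)" using np[OF F] by (simp add: q'_def max_absorb1)
      then show ?thesis
        by (rule has_field_derivative_transform_within_open[of _ _ _ "{9 - l<..}"])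
          (use F np in \<open>auto simp: q_def max_absorb1\<close>)
    qed
  qed (auto intro!: qc sqint_cont)
  have sq: "sqint (Ivl l) q" by (rule sqint_cont[OF qc(1)])
  have qH: "q \<in> Hhalf l" using interpolation[OF Hk1I[OF sq w]] by blast
  have qpos: "q x = (p x)\<^sup>2" if "x \<le> 9 - l" for x
    using that p_pos[of x] by (cases "x = 9 - l") (auto simp: q_def p_def)
  have qzero: "q x = 0" if "9 - l \<le> x" for x
    using that p_pos[of x] by (simp add: q_def)
  have N2: "(\<integral>x. (q x)\<^sup>2 \<partial>Ivl l) = 9 / 5"
  proof -
    have "(\<integral>x. (q x)\<^sup>2 \<partial>Ivl l) = - 9 / 5 * (p (9 - l)) ^ 5 - (- 9 / 5 * (p (-l)) ^ 5)"
    proof (rule integral_Ivl_piece(2)[where f = "\<lambda>x. (p x) ^ 4" and F = "\<lambda>x. - 9 / 5 * (p x) ^ 5" and a = "-l" and b = "9 - l"])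
      show "((\<lambda>x. - 9 / 5 * (p x) ^ 5) has_real_derivative (p x) ^ 4) (at x within {-l..9 - l})" for x
        by (auto intro!: derivative_eq_intros pd)
      show "(q x)\<^sup>2 = (if x \<in> {-l..9 - l} then (p x) ^ 4 else 0)" if "x \<in> {-l<..<l}" for x
        using that qpos[of x] qzero[of x] by auto
    qed (use l6 in \<open>auto intro!: continuous_intros pc\<close>)
    then show ?thesis by (simp add: p_def)
  qed
  have N4: "(\<integral>x. \<bar>q x\<bar> ^ 4 \<partial>Ivl l) = 1"
  proof -
    have "(\<integral>x. \<bar>q x\<bar> ^ 4 \<partial>Ivl l) = - ((p (9 - l)) ^ 9) - (- ((p (-l)) ^ 9))"
    proof (rule integral_Ivl_piece(2)[where f = "\<lambda>x. (p x) ^ 8" and F = "\<lambda>x. - ((p x) ^ 9)" and a = "-l" and b = "9 - l"])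
      show "((\<lambda>x. - ((p x) ^ 9)) has_real_derivative (p x) ^ 8) (at x within {-l..9 - l})" for x
        by (auto intro!: derivative_eq_intros pd)
      show "\<bar>q x\<bar> ^ 4 = (if x \<in> {-l..9 - l} then (p x) ^ 8 else 0)" if "x \<in> {-l<..<l}" for x
        using that qpos[of x] qzero[of x] by (auto simp: power_mult[symmetric])
    qed (use l6 in \<open>auto intro!: continuous_intros pc\<close>)
    then show ?thesis by (simp add: p_def)
  qed
  have G: "Gag l q \<le> 5 / 3"
  proof -
    define A where "A = {-l<..<9 - l}"
    define B where "B = {9 - l..<l}"
    define g where "g x y = ennreal (((q x - q y) / (x - y))\<^sup>2)" for x y
    have qb[measurable]: "q \<in> borel_measurable borel" "p \<in> borel_measurable borel"
      by (intro borel_measurable_continuous_onI qc pc)+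
    have eq: "ennreal (Gag l q) = (\<integral>\<^sup>+x. (\<integral>\<^sup>+y. g x y * indicator A y \<partial>lborel) * indicator A x \<partial>lborel)
       + 2 * (\<integral>\<^sup>+x. (\<integral>\<^sup>+y. g x y * indicator B y \<partial>lborel) * indicator A x \<partial>lborel)"
      unfolding g_def
      by (rule Gag_split[OF qb(1) qH]) (use l6 qzero in \<open>auto simp: A_def B_def\<close>)
    have "(\<integral>\<^sup>+x. (\<integral>\<^sup>+y. g x y * indicator A y \<partial>lborel) * indicator A x \<partial>lborel) \<le>
      (\<integral>\<^sup>+x. ennreal ((3 * (p x)\<^sup>2 + 3 * p x + 1) / 27) * indicator A x \<partial>lborel)"
    proof (rule nn_integral_mono)
      fix x :: real
      have "(\<integral>\<^sup>+y. g x y * indicator A y \<partial>lborel) \<le> ennreal ((3 * (p x)\<^sup>2 + 3 * p x + 1) / 27)" if x: "x \<in> A"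
      proof -
        have "(\<integral>\<^sup>+y. g x y * indicator A y \<partial>lborel) \<le> (\<integral>\<^sup>+y. ennreal (((p x + p y) / 9)\<^sup>2) * indicator A y \<partial>lborel)"
        proof (rule nn_integral_mono)
          fix y
          have "((q x - q y) / (x - y))\<^sup>2 \<le> ((p x + p y) / 9)\<^sup>2" if y: "y \<in> A"
          proof (cases "x = y")
            case False
            \<comment> \<open>On the support the difference quotient of p^2 is - (p x + p y) / 9, so
              the inner integral is a cubic in p.\<close>
            have "q x - q y = (p x - p y) * (p x + p y)"
              using x y qpos by (simp add: A_def power2_eq_square algebra_simps)
            also have "p x - p y = - (x - y) / 9" by (simp add: p_def field_simps)
            finally have "(q x - q y) / (x - y) = - ((p x + p y) / 9)" using False by (simp add: field_simps)
            then show ?thesis by (simp only: power2_minus order_refl)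
          qed simp
          then show "g x y * indicator A y \<le> ennreal (((p x + p y) / 9)\<^sup>2) * indicator A y"
            unfolding g_def by (auto simp: indicator_def intro: ennreal_leI)
        qed
        also have "\<dots> = ennreal (- ((p x + p (9 - l)) ^ 3) / 27 - (- ((p x + p (- l)) ^ 3) / 27))"
          unfolding A_def
        proof (rule nn_integral_FTC_Ioo[where F = "\<lambda>y. - ((p x + p y) ^ 3) / 27"])
          show "((\<lambda>y. - ((p x + p y) ^ 3) / 27) has_real_derivative ((p x + p y) / 9)\<^sup>2) (at y)" for y
            by (auto intro!: derivative_eq_intros pd simp: power2_eq_square)
        qed auto
        also have "- ((p x + p (9 - l)) ^ 3) / 27 - (- ((p x + p (- l)) ^ 3) / 27) = (3 * (p x)\<^sup>2 + 3 * p x + 1) / 27"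
        proof -
          have "p (9 - l) = 0" "p (-l) = 1" by (simp_all add: p_def)
          then show ?thesis by (simp add: power2_eq_square power3_eq_cube field_simps)
        qed
        finally show ?thesis .
      qed
      then show "(\<integral>\<^sup>+y. g x y * indicator A y \<partial>lborel) * indicator A x \<le> ennreal ((3 * (p x)\<^sup>2 + 3 * p x + 1) / 27) * indicator A x"
        by (auto simp: indicator_def)
    qed
    also have "\<dots> = ennreal (- (9 * (p (9 - l)) ^ 3 + 27 / 2 * (p (9 - l))\<^sup>2 + 9 * p (9 - l)) / 27 -
       (- (9 * (p (-l)) ^ 3 + 27 / 2 * (p (-l))\<^sup>2 + 9 * p (-l)) / 27))"
      unfolding A_def
    proof (rule nn_integral_FTC_Ioo[where F = "\<lambda>x. - (9 * (p x) ^ 3 + 27 / 2 * (p x)\<^sup>2 + 9 * p x) / 27"])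
      show "((\<lambda>x. - (9 * (p x) ^ 3 + 27 / 2 * (p x)\<^sup>2 + 9 * p x) / 27) has_real_derivative (3 * (p x)\<^sup>2 + 3 * p x + 1) / 27) (at x)" for x
        by (auto intro!: derivative_eq_intros pd simp: field_simps)
      show "0 \<le> (3 * (p x)\<^sup>2 + 3 * p x + 1) / 27" if "x \<in> {-l..9 - l}" for x
      proof -
        have "0 \<le> p x" using that by (auto simp: p_def)
        then show ?thesis by simp
      qed
    qed auto
    also have "\<dots> = ennreal (7 / 6)" by (simp add: p_def)
    finally have AA: "(\<integral>\<^sup>+x. (\<integral>\<^sup>+y. g x y * indicator A y \<partial>lborel) * indicator A x \<partial>lborel) \<le> ennreal (7 / 6)" .
    have "(\<integral>\<^sup>+x. (\<integral>\<^sup>+y. g x y * indicator B y \<partial>lborel) * indicator A x \<partial>lborel) \<le>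
      (\<integral>\<^sup>+x. ennreal ((p x) ^ 3 / 9) * indicator A x \<partial>lborel)"
    proof (rule nn_integral_mono)
      fix x :: real
      have "(\<integral>\<^sup>+y. g x y * indicator B y \<partial>lborel) \<le> ennreal ((p x) ^ 3 / 9)" if x: "x \<in> A"
      proof -
        have px: "p x > 0" using x p_pos[of x] by (auto simp: A_def)
        \<comment> \<open>The end of the support is at distance 9 p(x) from x. Integrating p^4 / (y
          - x)^2 beyond it gives at most p^4 / (9 p) = p^3 / 9.\<close>
        have px2: "9 - l - x = 9 * p x" by (simp add: p_def field_simps)
        have "(\<integral>\<^sup>+y. g x y * indicator B y \<partial>lborel) = (\<integral>\<^sup>+y. ennreal ((p x) ^ 4 / (y - x)\<^sup>2) * indicator B y \<partial>lborel)"
        proof (rule nn_integral_cong)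
          fix y
          have "((q x - q y) / (x - y))\<^sup>2 = (p x) ^ 4 / (y - x)\<^sup>2" if y: "y \<in> B"
            using x y qpos[of x] qzero[of y] by (simp add: A_def B_def power_divide power2_commute power_mult[symmetric])
          then show "g x y * indicator B y = ennreal ((p x) ^ 4 / (y - x)\<^sup>2) * indicator B y"
            unfolding g_def by (auto simp: indicator_def)
        qed
        also have "\<dots> = (\<integral>\<^sup>+y. ennreal ((p x) ^ 4 / (y - x)\<^sup>2) * indicator {9 - l..l} y \<partial>lborel)"
          by (rule nn_integral_cong_AE, use AE_lborel_singleton[of l] in eventually_elim) (auto simp: B_def indicator_def)
        also have "\<dots> = ennreal (- ((p x) ^ 4) / (l - x) - (- ((p x) ^ 4) / (9 - l - x)))"
        proof (rule nn_integral_FTC_Icc[where F = "\<lambda>y. - ((p x) ^ 4) / (y - x)"])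
          show "((\<lambda>y. - ((p x) ^ 4) / (y - x)) has_real_derivative (p x) ^ 4 / (y - x)\<^sup>2) (at y)"
            if "y \<in> {9 - l..l}" for y
            using that x by (auto intro!: derivative_eq_intros simp: A_def power2_eq_square)
        qed (use l6 in auto)
        also have "\<dots> \<le> ennreal ((p x) ^ 3 / 9)"
        proof (rule ennreal_leI)
          have "(p x) ^ 4 / (9 * p x) = (p x) ^ 3 / 9" using px by (simp add: power4_eq_xxxx power3_eq_cube)
          moreover have "0 \<le> (p x) ^ 4 / (l - x)" using x l6 by (auto simp: A_def)
          ultimately show "- ((p x) ^ 4) / (l - x) - (- ((p x) ^ 4) / (9 - l - x)) \<le> (p x) ^ 3 / 9"
            unfolding px2 minus_divide_left[symmetric] by linarith
        qed
        finally show ?thesis .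
      qed
      then show "(\<integral>\<^sup>+y. g x y * indicator B y \<partial>lborel) * indicator A x \<le> ennreal ((p x) ^ 3 / 9) * indicator A x"
        by (auto simp: indicator_def)
    qed
    also have "\<dots> = ennreal (- ((p (9 - l)) ^ 4) / 4 - (- ((p (-l)) ^ 4) / 4))"
      unfolding A_def
    proof (rule nn_integral_FTC_Ioo[where F = "\<lambda>x. - ((p x) ^ 4) / 4"])
      show "((\<lambda>x. - ((p x) ^ 4) / 4) has_real_derivative (p x) ^ 3 / 9) (at x)" for x
        by (auto intro!: derivative_eq_intros pd)
      show "0 \<le> (p x) ^ 3 / 9" if "x \<in> {-l..9 - l}" for x
        using that by (auto simp: p_def)
    qed auto
    also have "\<dots> = ennreal (1 / 4)" by (simp add: p_def)
    finally have AB: "(\<integral>\<^sup>+x. (\<integral>\<^sup>+y. g x y * indicator B y \<partial>lborel) * indicator A x \<partial>lborel) \<le> ennreal (1 / 4)" .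
    have "ennreal (Gag l q) \<le> ennreal (7 / 6) + 2 * ennreal (1 / 4)"
      unfolding eq by (intro add_mono mult_left_mono AA AB) auto
    also have "\<dots> = ennreal (7 / 6) + ennreal 2 * ennreal (1 / 4)" by simp
    also have "\<dots> = ennreal (7 / 6 + 2 * (1 / 4))" by (simp only: ennreal_mult[symmetric] ennreal_plus[symmetric])
    finally show ?thesis by (subst (asm) ennreal_le_iff) auto
  qed
  have "1 \<le> C1 ^ 4 * (9 / 5 + Gag l q)\<^sup>2" using sobolev_pow[OF Hk1I[OF sq w]] unfolding N2 N4 .
  also have "\<dots> \<le> C1 ^ 4 * (9 / 5 + 5 / 3)\<^sup>2"
    using G Gag_nonneg[of l q] C1 by (intro mult_left_mono power_mono) auto
  finally show ?thesis by (simp add: power2_eq_square)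
qed

lemma C1_lower: "225 / 2704 \<le> C1 ^ 4"
  using C1_lower_small C1_lower_large by linarith

text \<open>A narrow parabolic bump: for \<open>\<delta> \<rightarrow> 0\<close> both sides of the interpolation inequality are scale invariant.\<close>

lemma C2_lower: "21.02 \<le> C2 ^ 4"
proof -
  \<comment> \<open>l/22 leaves room inside I for tails up to 21 \<delta>; 1/8 keeps the L^2 part of
    the V norm small.\<close>
  define \<delta> where "\<delta> = min (l / 22) (1 / 8)"
  have \<delta>: "\<delta> > 0" "\<delta> \<le> 1 / 8" "22 * \<delta> \<le> l" using l_pos by (auto simp: \<delta>_def)
  define p where "p x = 1 - x\<^sup>2 / \<delta>\<^sup>2" for x
  define b where "b x = max 0 (p x)" for x
  define b' where "b' x = (if x \<in> {-\<delta>..\<delta>} then - 2 * x / \<delta>\<^sup>2 else 0)" for x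
  have p_pos: "p x > 0 \<longleftrightarrow> \<bar>x\<bar> < \<delta>" for x
    using \<delta>(1) abs_le_square_iff[of \<delta> x] by (auto simp: p_def field_simps)
  have p_ends: "p \<delta> = 0" "p (-\<delta>) = 0" using \<delta>(1) by (simp_all add: p_def)
  have pc: "continuous_on S p" for S unfolding p_def by (intro continuous_intros) (use \<delta>(1) in auto)
  have pd: "(p has_real_derivative - 2 * x / \<delta>\<^sup>2) (at x within S)" for x S
    unfolding p_def using \<delta>(1) by (auto intro!: derivative_eq_intros simp: field_simps power2_eq_square power4_eq_xxxx)
  have bc: "continuous_on S b" for S unfolding b_def by (intro continuous_intros pc)
  have bp: "b x = p x" if "x \<in> {-\<delta>..\<delta>}" for x
  proof -
    have "x = \<delta> \<or> x = -\<delta> \<or> \<bar>x\<bar> < \<delta>" using that by auto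
    then show ?thesis using p_pos[of x] p_ends by (auto simp: b_def)
  qed
  have bz: "b x = 0" if "\<delta> \<le> \<bar>x\<bar>" for x
    using that p_pos[of x] by (simp add: b_def)
  have "\<bar>x\<bar> < \<delta> \<longleftrightarrow> x \<in> {-\<delta><..<\<delta>}" for x by auto
  have b'2: "(\<integral>x. (b' x)\<^sup>2 \<partial>Ivl l) = 8 / (3 * \<delta>)" "integrable (Ivl l) (\<lambda>x. (b' x)\<^sup>2)"
  proof -
    have c: "continuous_on {-\<delta>..\<delta>} (\<lambda>x. 4 * x\<^sup>2 / \<delta> ^ 4)" using \<delta>(1) by (intro continuous_intros) auto
    have d: "((\<lambda>x. 4 * x ^ 3 / (3 * \<delta> ^ 4)) has_real_derivative 4 * x\<^sup>2 / \<delta> ^ 4) (at x within {-\<delta>..\<delta>})" for x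
      using \<delta>(1) by (auto intro!: derivative_eq_intros simp: field_simps)
    have h: "(b' x)\<^sup>2 = (if x \<in> {-\<delta>..\<delta>} then 4 * x\<^sup>2 / \<delta> ^ 4 else 0)" for x
      by (simp add: b'_def power_divide power_mult_distrib power_mult[symmetric])
    note P = integral_Ivl_piece[where f = "\<lambda>x. 4 * x\<^sup>2 / \<delta> ^ 4" and F = "\<lambda>x. 4 * x ^ 3 / (3 * \<delta> ^ 4)" and a = "-\<delta>" and b = \<delta> and l = l,
        OF _ _ _ c d h]
    show "integrable (Ivl l) (\<lambda>x. (b' x)\<^sup>2)" by (rule P(1)) (use \<delta> in auto)
    have "(\<integral>x. (b' x)\<^sup>2 \<partial>Ivl l) = 4 * \<delta> ^ 3 / (3 * \<delta> ^ 4) - 4 * (-\<delta>) ^ 3 / (3 * \<delta> ^ 4)"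
      by (rule P(2)) (use \<delta> in auto)
    also have "\<dots> = 8 / (3 * \<delta>)" using \<delta>(1) by (simp add: field_simps power3_eq_cube power4_eq_xxxx)
    finally show "(\<integral>x. (b' x)\<^sup>2 \<partial>Ivl l) = 8 / (3 * \<delta>)" .
  qed
  have w: "weak_deriv l b b'"
  proof (rule weak_deriv_piecewise[OF l_pos, of "{-\<delta>, \<delta>}"])
    have "b' \<in> borel_measurable borel" unfolding b'_def by measurable
    then have "b' \<in> borel_measurable (Ivl l)"
      by (intro measurable_restrict_space1 measurable_completion) simp
    then show "sqint (Ivl l) b'" using b'2(2) by (simp add: sqint_def)
    fix x assume x: "x \<in> {-l<..<l} - {-\<delta>, \<delta>}"
    show "(b has_real_derivative b' x) (at x)"
    proof (cases "x \<in> {-\<delta><..<\<delta>}")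
      case True
      have "(p has_real_derivative b' x) (at x)" using pd[of x UNIV] True by (simp add: b'_def)
      then show ?thesis
        by (rule has_field_derivative_transform_within_open[of _ _ _ "{-\<delta><..<\<delta>}"])
          (use True bp in auto)
    next
      case False
      then have F: "x \<in> {..<-\<delta>} \<union> {\<delta><..}" using x by auto
      have "((\<lambda>x. 0) has_real_derivative b' x) (at x)" using F \<delta>(1) by (auto simp: b'_def)
      then show ?thesis
        by (rule has_field_derivative_transform_within_open[of _ _ _ "{..<-\<delta>} \<union> {\<delta><..}"])
          (use F bz \<delta>(1) in auto)
    qed
  qed (auto intro!: bc)
  have sb: "sqint (Ivl l) b" by (rule sqint_cont[OF bc])
  have bH: "b \<in> Hhalf l" using interpolation[OF Hk1I[OF sb w]] by blast
  define P2 where "P2 x = x - 2 * x ^ 3 / (3 * \<delta>\<^sup>2) + x ^ 5 / (5 * \<delta> ^ 4)" for x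
  have P2d: "(P2 has_real_derivative (p x)\<^sup>2) (at x within S)" for x S
    unfolding P2_def p_def using \<delta>(1)
    by (auto intro!: derivative_eq_intros simp: field_simps power2_eq_square power4_eq_xxxx)
  have P2v: "P2 \<delta> - P2 (-\<delta>) = 16 * \<delta> / 15"
    using \<delta>(1) by (simp add: P2_def field_simps power2_eq_square eval_nat_numeral One_nat_def)
  have N2: "(\<integral>x. (b x)\<^sup>2 \<partial>Ivl l) = 16 * \<delta> / 15"
  proof -
    have "(\<integral>x. (b x)\<^sup>2 \<partial>Ivl l) = P2 \<delta> - P2 (-\<delta>)"
    proof (rule integral_Ivl_piece(2)[where f = "\<lambda>x. (p x)\<^sup>2" and F = P2 and a = "-\<delta>" and b = \<delta>])
      show "(P2 has_real_derivative (p x)\<^sup>2) (at x within {-\<delta>..\<delta>})" for x by (rule P2d)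
      show "(b x)\<^sup>2 = (if x \<in> {-\<delta>..\<delta>} then (p x)\<^sup>2 else 0)" for x
        using bp[of x] bz[of x] by auto
    qed (use \<delta> in \<open>auto intro!: continuous_intros pc\<close>)
    then show ?thesis using P2v by simp
  qed
  have G: "8 - 16 / 75 \<le> Gag l b"
  proof -
    define A where "A = {-\<delta><..<\<delta>}"
    define B where "B = {-l<..<l} - A"
    define g where "g x y = ennreal (((b x - b y) / (x - y))\<^sup>2)" for x y
    have bb[measurable]: "b \<in> borel_measurable borel" "p \<in> borel_measurable borel"
      by (intro borel_measurable_continuous_onI bc pc)+
    have Bb[measurable]: "B \<in> sets borel" "A \<in> sets borel" unfolding B_def A_def by auto
    have eq: "ennreal (Gag l b) = (\<integral>\<^sup>+x. (\<integral>\<^sup>+y. g x y * indicator A y \<partial>lborel) * indicator A x \<partial>lborel)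
       + 2 * (\<integral>\<^sup>+x. (\<integral>\<^sup>+y. g x y * indicator B y \<partial>lborel) * indicator A x \<partial>lborel)"
      unfolding g_def
      by (rule Gag_split[OF bb(1) bH Bb(2) _ Bb(1) B_def]) (use \<delta> bz in \<open>auto simp: A_def B_def\<close>)
    \<comment> \<open>On the bump the difference quotient is - (x + y) / \<delta>^2. R is the
      integral of its square over y, and R integrates to 8/3.\<close>
    define R where "R x = ((x + \<delta>) ^ 3 - (x - \<delta>) ^ 3) / (3 * \<delta> ^ 4)" for x
    have AAx: "(\<integral>\<^sup>+y. g x y * indicator A y \<partial>lborel) = ennreal (R x)" if x: "x \<in> A" for x
    proof -
      have "(\<integral>\<^sup>+y. g x y * indicator A y \<partial>lborel) = (\<integral>\<^sup>+y. ennreal (((x + y) / \<delta>\<^sup>2)\<^sup>2) * indicator A y \<partial>lborel)"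
      proof (rule nn_integral_cong_AE)
        show "AE y in lborel. g x y * indicator A y = ennreal (((x + y) / \<delta>\<^sup>2)\<^sup>2) * indicator A y"
          using AE_lborel_singleton[of x]
        proof eventually_elim
          case (elim y)
          have "((b x - b y) / (x - y))\<^sup>2 = ((x + y) / \<delta>\<^sup>2)\<^sup>2" if y: "y \<in> A"
          proof -
            have "b x - b y = (x - y) * (- ((x + y) / \<delta>\<^sup>2))"
              using x y bp[of x] bp[of y] \<delta>(1) by (simp add: A_def p_def field_simps power2_eq_square)
            moreover have "x - y \<noteq> 0" using elim by simp
            ultimately have "(b x - b y) / (x - y) = - ((x + y) / \<delta>\<^sup>2)" by (metis nonzero_mult_div_cancel_left)
            then show ?thesis by (simp only: power2_minus)
          qed
          then show ?case unfolding g_def by (auto simp: indicator_def)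
        qed
      qed
      also have "\<dots> = ennreal ((x + \<delta>) ^ 3 / (3 * \<delta> ^ 4) - (x + (-\<delta>)) ^ 3 / (3 * \<delta> ^ 4))"
        unfolding A_def
      proof (rule nn_integral_FTC_Ioo[where F = "\<lambda>y. (x + y) ^ 3 / (3 * \<delta> ^ 4)"])
        show "((\<lambda>y. (x + y) ^ 3 / (3 * \<delta> ^ 4)) has_real_derivative ((x + y) / \<delta>\<^sup>2)\<^sup>2) (at y)" for y
          using \<delta>(1) by (auto intro!: derivative_eq_intros simp: field_simps power2_eq_square power4_eq_xxxx)
      qed (use \<delta> in auto)
      finally show ?thesis by (simp add: R_def diff_divide_distrib)
    qed
    have "(\<integral>\<^sup>+x. (\<integral>\<^sup>+y. g x y * indicator A y \<partial>lborel) * indicator A x \<partial>lborel) = (\<integral>\<^sup>+x. ennreal (R x) * indicator A x \<partial>lborel)"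
    proof (rule nn_integral_cong)
      show "(\<integral>\<^sup>+y. g x y * indicator A y \<partial>lborel) * indicator A x = ennreal (R x) * indicator A x" for x
        by (cases "x \<in> A") (simp_all add: AAx)
    qed
    also have "\<dots> = ennreal (((\<delta> + \<delta>) ^ 4 - (\<delta> - \<delta>) ^ 4) / (12 * \<delta> ^ 4) - ((-\<delta> + \<delta>) ^ 4 - (-\<delta> - \<delta>) ^ 4) / (12 * \<delta> ^ 4))"
      unfolding A_def
    proof (rule nn_integral_FTC_Ioo[where F = "\<lambda>x. ((x + \<delta>) ^ 4 - (x - \<delta>) ^ 4) / (12 * \<delta> ^ 4)"])
      show "R \<in> borel_measurable borel" unfolding R_def by measurable
      show "((\<lambda>x. ((x + \<delta>) ^ 4 - (x - \<delta>) ^ 4) / (12 * \<delta> ^ 4)) has_real_derivative R x) (at x)" for x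
        unfolding R_def using \<delta>(1) by (auto intro!: derivative_eq_intros simp: field_simps)
      show "0 \<le> R x" if "x \<in> {-\<delta>..\<delta>}" for x
      proof -
        have "(x + \<delta>) ^ 3 - (x - \<delta>) ^ 3 = 6 * x\<^sup>2 * \<delta> + 2 * \<delta> ^ 3" by (simp add: power2_eq_square power3_eq_cube algebra_simps)
        then show ?thesis using \<delta>(1) by (simp add: R_def)
      qed
    qed (use \<delta> in auto)
    also have "\<dots> = ennreal (8 / 3)"
    proof -
      have "((\<delta> + \<delta>) ^ 4 - (\<delta> - \<delta>) ^ 4) / (12 * \<delta> ^ 4) - ((-\<delta> + \<delta>) ^ 4 - (-\<delta> - \<delta>) ^ 4) / (12 * \<delta> ^ 4) = 8 / 3"
        using \<delta>(1) by (simp add: field_simps power4_eq_xxxx)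
      then show ?thesis by simp
    qed
    finally have AA: "(\<integral>\<^sup>+x. (\<integral>\<^sup>+y. g x y * indicator A y \<partial>lborel) * indicator A x \<partial>lborel) = ennreal (8 / 3)" .
    \<comment> \<open>A lower bound for the exterior part: the first term is the full contribution
      p^2/(\<delta> - x) + p^2/(\<delta> + x) of two infinite tails, the second pays for cutting
      them at 21 \<delta>.\<close>
    define Q where "Q x = 2 * (\<delta>\<^sup>2 - x\<^sup>2) / \<delta> ^ 3 - (p x)\<^sup>2 / (10 * \<delta>)" for x
    have Q0: "0 \<le> Q x" if x: "x \<in> {-\<delta>..\<delta>}" for x
    proof -
      have p01: "0 \<le> p x" "p x \<le> 1" using bp[OF x] by (auto simp: b_def p_def max_def split: if_splits)
      have "2 * (\<delta>\<^sup>2 - x\<^sup>2) / \<delta> ^ 3 = 2 * p x / \<delta>" using \<delta>(1) by (simp add: p_def field_simps power2_eq_square power3_eq_cube)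
      moreover have "(p x)\<^sup>2 / (10 * \<delta>) \<le> p x / (10 * \<delta>)" using p01 \<delta>(1) by (intro divide_right_mono) (auto simp: power2_eq_square mult_left_le)
      moreover have "p x / (10 * \<delta>) \<le> 2 * p x / \<delta>" using p01 \<delta>(1) by (simp add: field_simps)
      ultimately show ?thesis unfolding Q_def by linarith
    qed
    have ABx: "ennreal (Q x) \<le> (\<integral>\<^sup>+y. g x y * indicator B y \<partial>lborel)" if x: "x \<in> A" for x
    proof -
      have xb: "-\<delta> < x" "x < \<delta>" using x by (auto simp: A_def)
      have px: "p x > 0" using p_pos[of x] xb by auto
      have gB: "((b x - b y) / (x - y))\<^sup>2 = (p x)\<^sup>2 / (y - x)\<^sup>2" if "\<delta> \<le> \<bar>y\<bar>" for y
        using bp[of x] xb bz[OF that] by (simp add: power_divide power2_commute)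
      have r: "(\<integral>\<^sup>+y. ennreal ((p x)\<^sup>2 / (y - x)\<^sup>2) * indicator {\<delta>..21 * \<delta>} y \<partial>lborel) =
          ennreal (- ((p x)\<^sup>2) / (21 * \<delta> - x) - (- ((p x)\<^sup>2) / (\<delta> - x)))"
      proof (rule nn_integral_FTC_Icc[where F = "\<lambda>y. - ((p x)\<^sup>2) / (y - x)"])
        show "((\<lambda>y. - ((p x)\<^sup>2) / (y - x)) has_real_derivative (p x)\<^sup>2 / (y - x)\<^sup>2) (at y)"
          if "y \<in> {\<delta>..21 * \<delta>}" for y
          using that xb by (auto intro!: derivative_eq_intros simp: power2_eq_square)
      qed (use \<delta> in auto)
      have le: "(\<integral>\<^sup>+y. ennreal ((p x)\<^sup>2 / (y - x)\<^sup>2) * indicator {-(21 * \<delta>)..-\<delta>} y \<partial>lborel) =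
          ennreal (- ((p x)\<^sup>2) / (-\<delta> - x) - (- ((p x)\<^sup>2) / (-(21 * \<delta>) - x)))"
      proof (rule nn_integral_FTC_Icc[where F = "\<lambda>y. - ((p x)\<^sup>2) / (y - x)"])
        show "((\<lambda>y. - ((p x)\<^sup>2) / (y - x)) has_real_derivative (p x)\<^sup>2 / (y - x)\<^sup>2) (at y)"
          if "y \<in> {-(21 * \<delta>)..-\<delta>}" for y
          using that xb by (auto intro!: derivative_eq_intros simp: power2_eq_square)
      qed (use \<delta> in auto)
      have "(\<integral>\<^sup>+y. ennreal ((p x)\<^sup>2 / (y - x)\<^sup>2) * indicator {\<delta>..21 * \<delta>} y \<partial>lborel) +
          (\<integral>\<^sup>+y. ennreal ((p x)\<^sup>2 / (y - x)\<^sup>2) * indicator {-(21 * \<delta>)..-\<delta>} y \<partial>lborel) =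
          (\<integral>\<^sup>+y. ennreal ((p x)\<^sup>2 / (y - x)\<^sup>2) * indicator {\<delta>..21 * \<delta>} y + ennreal ((p x)\<^sup>2 / (y - x)\<^sup>2) * indicator {-(21 * \<delta>)..-\<delta>} y \<partial>lborel)"
        by (rule nn_integral_add[symmetric]) measurable
      also have "\<dots> \<le> (\<integral>\<^sup>+y. g x y * indicator B y \<partial>lborel)"
      proof (rule nn_integral_mono)
        fix y
        consider "y \<in> {\<delta>..21 * \<delta>}" | "y \<in> {-(21 * \<delta>)..-\<delta>}" | "y \<notin> {\<delta>..21 * \<delta>}" "y \<notin> {-(21 * \<delta>)..-\<delta>}" by blast
        then show "ennreal ((p x)\<^sup>2 / (y - x)\<^sup>2) * indicator {\<delta>..21 * \<delta>} y + ennreal ((p x)\<^sup>2 / (y - x)\<^sup>2) * indicator {-(21 * \<delta>)..-\<delta>} y \<le> g x y * indicator B y"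
        proof cases
          case 1
          then have "y \<notin> {-(21 * \<delta>)..-\<delta>}" "y \<in> B" "\<delta> \<le> \<bar>y\<bar>" using \<delta> by (auto simp: B_def A_def)
          then show ?thesis using 1 gB by (simp add: g_def)
        next
          case 2
          then have "y \<notin> {\<delta>..21 * \<delta>}" "y \<in> B" "\<delta> \<le> \<bar>y\<bar>" using \<delta> by (auto simp: B_def A_def)
          then show ?thesis using 2 gB by (simp add: g_def)
        qed simp
      qed
      finally have *: "ennreal (- ((p x)\<^sup>2) / (21 * \<delta> - x) - (- ((p x)\<^sup>2) / (\<delta> - x))) +
          ennreal (- ((p x)\<^sup>2) / (-\<delta> - x) - (- ((p x)\<^sup>2) / (-(21 * \<delta>) - x))) \<le> (\<integral>\<^sup>+y. g x y * indicator B y \<partial>lborel)"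
        unfolding r le .
      have f: "(p x)\<^sup>2 / (\<delta> - x) + (p x)\<^sup>2 / (\<delta> + x) = 2 * (\<delta>\<^sup>2 - x\<^sup>2) / \<delta> ^ 3"
      proof -
        have px: "p x = (\<delta> - x) * (\<delta> + x) / \<delta>\<^sup>2" using \<delta>(1) by (simp add: p_def field_simps power2_eq_square)
        have nz: "\<delta> - x \<noteq> 0" "\<delta> + x \<noteq> 0" "\<delta> \<noteq> 0" using xb \<delta>(1) by auto
        have "(p x)\<^sup>2 / (\<delta> - x) = (\<delta> - x) * (\<delta> + x)\<^sup>2 / \<delta> ^ 4"
          unfolding px using nz by (simp add: power2_eq_square power4_eq_xxxx ac_simps)
        moreover have "(p x)\<^sup>2 / (\<delta> + x) = (\<delta> - x)\<^sup>2 * (\<delta> + x) / \<delta> ^ 4"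
          unfolding px using nz by (simp add: power2_eq_square power4_eq_xxxx ac_simps)
        moreover have "(\<delta> - x) * (\<delta> + x)\<^sup>2 / \<delta> ^ 4 + (\<delta> - x)\<^sup>2 * (\<delta> + x) / \<delta> ^ 4 = ((\<delta> - x) * (\<delta> + x)\<^sup>2 + (\<delta> - x)\<^sup>2 * (\<delta> + x)) / \<delta> ^ 4"
          by (simp add: add_divide_distrib)
        moreover have "(\<delta> - x) * (\<delta> + x)\<^sup>2 + (\<delta> - x)\<^sup>2 * (\<delta> + x) = \<delta> * (2 * (\<delta>\<^sup>2 - x\<^sup>2))"
          by algebra
        moreover have "\<delta> * (2 * (\<delta>\<^sup>2 - x\<^sup>2)) / \<delta> ^ 4 = 2 * (\<delta>\<^sup>2 - x\<^sup>2) / \<delta> ^ 3"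
          using nz by (simp add: power4_eq_xxxx power3_eq_cube)
        ultimately show ?thesis by simp
      qed
      \<comment> \<open>|x| < \<delta> makes both cut-off denominators at least 20 \<delta>; the two
        losses together give the 10 \<delta> in Q.\<close>
      have t: "(p x)\<^sup>2 / (21 * \<delta> - x) \<le> (p x)\<^sup>2 / (20 * \<delta>)" "(p x)\<^sup>2 / (21 * \<delta> + x) \<le> (p x)\<^sup>2 / (20 * \<delta>)"
        using xb \<delta>(1) by (intro divide_left_mono mult_pos_pos; simp)+
      have n1: "- ((p x)\<^sup>2) / (-\<delta> - x) = (p x)\<^sup>2 / (\<delta> + x)"
        using minus_divide_divide[of "(p x)\<^sup>2" "\<delta> + x"] minus_add_distrib[of "\<delta>" x] by (simp only: diff_conv_add_uminus)
      have n2: "- ((p x)\<^sup>2) / (-(21 * \<delta>) - x) = (p x)\<^sup>2 / (21 * \<delta> + x)"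
        using minus_divide_divide[of "(p x)\<^sup>2" "21 * \<delta> + x"] minus_add_distrib[of "21 * \<delta>" x] by (simp only: diff_conv_add_uminus)
      have nn: "(p x)\<^sup>2 / (21 * \<delta> - x) \<le> (p x)\<^sup>2 / (\<delta> - x)" "(p x)\<^sup>2 / (21 * \<delta> + x) \<le> (p x)\<^sup>2 / (\<delta> + x)"
        using xb \<delta>(1) by (intro divide_left_mono mult_pos_pos; simp)+
      have "Q x \<le> ((p x)\<^sup>2 / (\<delta> - x) - (p x)\<^sup>2 / (21 * \<delta> - x)) + ((p x)\<^sup>2 / (\<delta> + x) - (p x)\<^sup>2 / (21 * \<delta> + x))"
        unfolding Q_def f[symmetric] using t by (simp add: field_simps)
      then have "ennreal (Q x) \<le> ennreal (((p x)\<^sup>2 / (\<delta> - x) - (p x)\<^sup>2 / (21 * \<delta> - x)) + ((p x)\<^sup>2 / (\<delta> + x) - (p x)\<^sup>2 / (21 * \<delta> + x)))"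
        by (rule ennreal_leI)
      also have "\<dots> = ennreal ((p x)\<^sup>2 / (\<delta> - x) - (p x)\<^sup>2 / (21 * \<delta> - x)) + ennreal ((p x)\<^sup>2 / (\<delta> + x) - (p x)\<^sup>2 / (21 * \<delta> + x))"
        using nn by (intro ennreal_plus) auto
      also have "\<dots> \<le> (\<integral>\<^sup>+y. g x y * indicator B y \<partial>lborel)" using * unfolding n1 n2 by simp
      finally show ?thesis .
    qed
    define QF where "QF x = 2 * (\<delta>\<^sup>2 * x - x ^ 3 / 3) / \<delta> ^ 3 - P2 x / (10 * \<delta>)" for x
    have "ennreal (QF \<delta> - QF (-\<delta>)) = (\<integral>\<^sup>+x. ennreal (Q x) * indicator A x \<partial>lborel)"
      unfolding A_def
    proof (rule nn_integral_FTC_Ioo[symmetric])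
      show "Q \<in> borel_measurable borel" unfolding Q_def by measurable
      show "(QF has_real_derivative Q x) (at x)" for x
        unfolding QF_def Q_def using \<delta>(1)
        by (auto intro!: derivative_eq_intros P2d simp: field_simps)
    qed (use \<delta> Q0 in auto)
    also have "\<dots> \<le> (\<integral>\<^sup>+x. (\<integral>\<^sup>+y. g x y * indicator B y \<partial>lborel) * indicator A x \<partial>lborel)"
    proof (rule nn_integral_mono)
      show "ennreal (Q x) * indicator A x \<le> (\<integral>\<^sup>+y. g x y * indicator B y \<partial>lborel) * indicator A x" for x
        by (cases "x \<in> A") (simp_all add: ABx)
    qed
    also have "QF \<delta> - QF (-\<delta>) = 8 / 3 - 8 / 75"
    proof -
      have "QF \<delta> - QF (-\<delta>) = 8 / 3 - (P2 \<delta> - P2 (-\<delta>)) / (10 * \<delta>)"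
        using \<delta>(1) by (simp add: QF_def field_simps power2_eq_square power3_eq_cube)
      then show ?thesis unfolding P2v using \<delta>(1) by (simp add: field_simps)
    qed
    finally have AB: "ennreal (8 / 3 - 8 / 75) \<le> (\<integral>\<^sup>+x. (\<integral>\<^sup>+y. g x y * indicator B y \<partial>lborel) * indicator A x \<partial>lborel)" .
    \<comment> \<open>8 = 8/3 + 16/3 is the seminorm of the bump on the whole line; 16/75 is the
      most that the cut tails can cost.\<close>
    have "ennreal (8 - 16 / 75) = ennreal (8 / 3 + 2 * (8 / 3 - 8 / 75))" by simp
    also have "\<dots> = ennreal (8 / 3) + ennreal (2 * (8 / 3 - 8 / 75))" by (rule ennreal_plus) simp_all
    also have "ennreal (2 * (8 / 3 - 8 / 75)) = ennreal 2 * ennreal (8 / 3 - 8 / 75)" by (rule ennreal_mult) simp_all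
    finally have sum: "ennreal (8 - 16 / 75) = ennreal (8 / 3) + ennreal 2 * ennreal (8 / 3 - 8 / 75)" .
    have "ennreal (8 - 16 / 75) \<le> ennreal (Gag l b)"
      unfolding sum eq AA by (intro add_mono mult_mono AB) auto
    then show ?thesis by (subst (asm) ennreal_le_iff) (auto simp: Gag_nonneg)
  qed
  have i: "(\<integral>x. (b x)\<^sup>2 \<partial>Ivl l) * ((\<integral>x. (b x)\<^sup>2 \<partial>Ivl l) + (\<integral>x. (b' x)\<^sup>2 \<partial>Ivl l)) \<le> 2.8623"
  proof -
    have "(16 * \<delta> / 15) * (16 * \<delta> / 15 + 8 / (3 * \<delta>)) = (16 / 15)\<^sup>2 * \<delta>\<^sup>2 + 128 / 45"
      using \<delta>(1) by (simp add: field_simps power2_eq_square)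
    also have "\<dots> \<le> (16 / 15)\<^sup>2 * (1 / 8)\<^sup>2 + 128 / 45"
      using \<delta> by (intro add_mono mult_left_mono power_mono) auto
    finally show ?thesis unfolding N2 b'2(1) by (simp add: power2_eq_square)
  qed
  \<comment> \<open>The L^2 part of the H^(1/2) norm is discarded. The resulting quotient is about
    21.18, slightly above the claimed constant.\<close>
  have "(8 - 16 / 75)\<^sup>2 \<le> ((\<integral>x. (b x)\<^sup>2 \<partial>Ivl l) + Gag l b)\<^sup>2"
    using G integral_nonneg_AE[of "\<lambda>x. (b x)\<^sup>2" "Ivl l"] by (intro power_mono) (simp_all add: N2)
  also have "\<dots> \<le> C2 ^ 4 * ((\<integral>x. (b x)\<^sup>2 \<partial>Ivl l) * ((\<integral>x. (b x)\<^sup>2 \<partial>Ivl l) + (\<integral>x. (b' x)\<^sup>2 \<partial>Ivl l)))"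
    by (rule interpolation_pow[OF Hk1I[OF sb w] w])
  also have "\<dots> \<le> C2 ^ 4 * 2.8623" using i C2 by (intro mult_left_mono) auto
  finally show ?thesis by (simp add: power2_eq_square)
qed

text \<open>Origin of 21.02: it lies just above 1.15^4 times 2704/225, so that the two fourth-power
  bounds multiply to at least 1.15^4.\<close>

lemma C1C2_lower: "1.15 \<le> C1 * C2"
proof -
  have "1.15 ^ 4 \<le> (225 / 2704) * (21.02 :: real)" by (simp add: power4_eq_xxxx)
  also have "\<dots> \<le> C1 ^ 4 * C2 ^ 4" using C1_lower C2_lower by (intro mult_mono) auto
  also have "\<dots> = (C1 * C2) ^ 4" by (simp add: power_mult_distrib)
  finally show ?thesis using C1 C2 power_mono_iff[of "1.15" "C1 * C2" 4] by simp
qed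

end

section \<open>The energy estimate at a fixed time\<close>

text \<open>
  The weights \<open>71/100\<close> and \<open>87/100\<close> are tuned so that this inequality and \<open>energy_quadratic_form\<close>
  both hold down to \<open>K = 23/20\<close>; there the margins are below one per cent.
\<close>

lemma weighted_arithmetic_geometric:
  fixes a s r K :: real
  assumes a: "a > 0" and s: "s \<ge> 0" and r: "r \<ge> 0" and K: "K \<ge> 23/20"
  shows "2 * (s * r) \<le> K * a\<^sup>2 / 2 * s ^ 4 + 71/100 * r + 87/100 * (r\<^sup>2 / a\<^sup>2)"
proof -
  \<comment> \<open>This substitution removes a: the fourth-power term becomes A^2, the last term
    B^2, and A B = s^2 r.\<close>
  define A B where "A = a * s\<^sup>2" and "B = r / a"
  have AB: "A * B = s\<^sup>2 * r" using a by (simp add: A_def B_def)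
  \<comment> \<open>575/1000 is half of 23/20. The factor 123/100 brings the cross coefficient to
    1.4145, close to sqrt 2, and the coefficient of B^2 to just below 87/100.\<close>
  have "0 \<le> 575/1000 * (A - 123/100 * B)\<^sup>2" by simp
  also have "\<dots> = 575/1000 * A\<^sup>2 - 14145/10000 * (A * B) + 86991750/100000000 * B\<^sup>2"
    by (simp add: power2_eq_square algebra_simps)
  finally have 1: "14145/10000 * (A * B) \<le> 575/1000 * A\<^sup>2 + 87/100 * B\<^sup>2"
    using zero_le_power2[of B] by linarith
  have 2: "575/1000 * A\<^sup>2 \<le> K / 2 * A\<^sup>2" using K by (intro mult_right_mono) auto
  have 3: "K / 2 * A\<^sup>2 = K * a\<^sup>2 / 2 * s ^ 4"
    by (simp add: A_def power_mult_distrib flip: power_mult)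
  \<comment> \<open>Lowers s^2 r to s r at the cost of a multiple of r; 10000/14145 is just below
    71/100.\<close>
  have "0 \<le> 14145/10000 * (s - 10000/14145)\<^sup>2" by simp
  also have "\<dots> = 14145/10000 * s\<^sup>2 - 2 * s + 10000/14145"
    by (simp add: power2_eq_square algebra_simps)
  finally have "0 \<le> 14145/10000 * s\<^sup>2 - 2 * s + 71/100" by simp
  then have "0 \<le> (14145/10000 * s\<^sup>2 - 2 * s + 71/100) * r" using r by simp
  then have 4: "2 * (s * r) \<le> 14145/10000 * (s\<^sup>2 * r) + 71/100 * r" by (simp add: algebra_simps)
  have 5: "B\<^sup>2 = r\<^sup>2 / a\<^sup>2" by (simp add: B_def power_divide)
  show ?thesis using 1 2 4 unfolding AB 3 5 by linarith
qed

lemma energy_quadratic_form: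
  fixes a b d K :: real
  assumes K: "K \<ge> 23/20" and a: "a \<ge> 0" and d: "d \<ge> 0" and b: "b\<^sup>2 \<le> a * d"
  shows "4 * b\<^sup>2 + a\<^sup>2 + 71/100 * (a * b) + 29/100 * (b * d) \<le> 2 * d\<^sup>2 + 1/2 * (2 + 3/4 * K)\<^sup>2 * a\<^sup>2"
proof -
  have "b\<^sup>2 \<le> (5/11 * d + 11/20 * a)\<^sup>2"
  proof -
    have "(5/11 * d + 11/20 * a)\<^sup>2 = (5/11 * d - 11/20 * a)\<^sup>2 + a * d"
      by (simp add: power2_eq_square algebra_simps)
    then show ?thesis using b zero_le_power2[of "5/11 * d - 11/20 * a"] by linarith
  qed
  \<comment> \<open>Weighted arithmetic-geometric mean of a and d; the weights have product 1/4.
    Equality holds at d = 1.21 a, close to where the final quadratic form is tight.\<close>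
  then have b1: "b \<le> 5/11 * d + 11/20 * a" by (rule power2_le_imp_le) (use a d in simp)
  have "b * d \<le> (5/11 * d + 11/20 * a) * d" "a * b \<le> a * (5/11 * d + 11/20 * a)"
    using b1 a d by (auto intro: mult_left_mono mult_right_mono)
  then have bd: "b * d \<le> 5/11 * d\<^sup>2 + 11/20 * (a * d)" and ab: "a * b \<le> 5/11 * (a * d) + 11/20 * a\<^sup>2"
    by (simp_all add: power2_eq_square algebra_simps)
  have "(2 + 3/4 * (23/20))\<^sup>2 \<le> (2 + 3/4 * K)\<^sup>2" using K by (intro power_mono) auto
  \<comment> \<open>At K = 23/20 the right side is about 4.097.\<close>
  then have "409/100 \<le> 1/2 * (2 + 3/4 * K)\<^sup>2" by (simp add: power2_eq_square)
  then have k: "409/100 * a\<^sup>2 \<le> 1/2 * (2 + 3/4 * K)\<^sup>2 * a\<^sup>2" by (intro mult_right_mono) auto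
  have "0 \<le> 18/10 * (d - 125/100 * a)\<^sup>2" by simp
  also have "\<dots> = 18/10 * d\<^sup>2 - 45/10 * (a * d) + 28125/10000 * a\<^sup>2"
    by (simp add: power2_eq_square algebra_simps)
  finally have q1: "45/10 * (a * d) \<le> 18/10 * d\<^sup>2 + 28125/10000 * a\<^sup>2" by simp
  \<comment> \<open>Once b is eliminated, about 4.482 a d stands against 1.868 d^2 and 2.70 a^2; a
    square that vanishes at d = 6/5 a just covers it.\<close>
  have "0 \<le> 1868/1000 * (d - 12/10 * a)\<^sup>2" by simp
  also have "\<dots> = 1868/1000 * d\<^sup>2 - 44832/10000 * (a * d) + 268992/100000 * a\<^sup>2"
    by (simp add: power2_eq_square algebra_simps)
  finally have q: "44832/10000 * (a * d) \<le> 1868/1000 * d\<^sup>2 + 268992/100000 * a\<^sup>2" by simp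
  have "0 \<le> a * d" using a d by simp
  then show ?thesis using b bd ab k q zero_le_power2[of a] zero_le_power2[of d] by linarith
qed

context interval
begin

text \<open>The derivative of y^2 is integrated from both endpoints and the results are added, so 2
  y(x)^2 \<le> 2 \<integral>|y y_x|. A single endpoint would lose a factor 2.\<close>

lemma sp_sq_le:
  assumes x: "x \<in> {-l..l}"
  shows "(sp N c x)\<^sup>2 \<le> (\<integral>x. \<bar>sp N c x * sp' N c x\<bar> \<partial>Ivl l)"
proof -
  let ?h = "\<lambda>x. 2 * (sp N c x * sp' N c x)"
  have cont: "continuous_on S ?h" "continuous_on S (\<lambda>x. \<bar>?h x\<bar>)" for S by (intro continuous_intros)+
  have d: "((\<lambda>x. (sp N c x)\<^sup>2) has_real_derivative ?h y) (at y within S)" for y S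
    by (rule derivative_eq_intros sp_has_derivative refl)+ simp
  have FTC: "integral {p..q} ?h = (sp N c q)\<^sup>2 - (sp N c p)\<^sup>2" if "p \<le> q" for p q
    by (rule integral_unique, rule fundamental_theorem_of_calculus[OF that])
      (use d in \<open>simp add: has_real_derivative_iff_has_vector_derivative\<close>)
  have i: "?h integrable_on {p..q}" "(\<lambda>x. \<bar>?h x\<bar>) integrable_on {p..q}" for p q
    by (rule integrable_continuous_interval[OF cont(1)], rule integrable_continuous_interval[OF cont(2)])
  have "\<bar>integral {p..q} ?h\<bar> \<le> integral {p..q} (\<lambda>x. \<bar>?h x\<bar>)" for p q
    using Henstock_Kurzweil_Integration.integral_norm_bound_integral[OF i] by simp
  note this[of "-l" x] this[of x l]
  moreover have "integral {-l..x} ?h = (sp N c x)\<^sup>2" "integral {x..l} ?h = - ((sp N c x)\<^sup>2)"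
    using x FTC[of "-l" x] FTC[of x l] by auto
  ultimately have "2 * (sp N c x)\<^sup>2 \<le> integral {-l..x} (\<lambda>x. \<bar>?h x\<bar>) + integral {x..l} (\<lambda>x. \<bar>?h x\<bar>)"
    by (simp only: abs_minus_cancel abs_power2)
  also have "\<dots> = integral {-l..l} (\<lambda>x. \<bar>?h x\<bar>)"
    using x i(2) by (intro Henstock_Kurzweil_Integration.integral_combine) auto
  also have "\<dots> = (\<integral>x. \<bar>?h x\<bar> \<partial>Ivl l)"
    by (rule continuous_imp_integrable_Ivl(2)[OF cont(2), symmetric])
  also have "\<dots> = 2 * (\<integral>x. \<bar>sp N c x * sp' N c x\<bar> \<partial>Ivl l)"
    by (simp add: abs_mult del: Bochner_Integration.integral_mult_right_zero flip: Bochner_Integration.integral_mult_right_zero)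
  finally show ?thesis by simp
qed

lemma integral_abs_mult_le:
  assumes "continuous_on {-l..l} f" "continuous_on {-l..l} g"
  shows "(\<integral>x. \<bar>f x * g x\<bar> \<partial>Ivl l) \<le> sqrt (\<integral>x. (f x)\<^sup>2 \<partial>Ivl l) * sqrt (\<integral>x. (g x)\<^sup>2 \<partial>Ivl l)"
proof -
  have "sqint (Ivl l) (\<lambda>x. \<bar>f x\<bar>)" "sqint (Ivl l) (\<lambda>x. \<bar>g x\<bar>)"
    using assms by (auto intro!: sqint_cont continuous_intros)
  from sqint_Cauchy_Schwarz_abs[OF this] show ?thesis by (simp add: abs_mult)
qed

text \<open>In |y^3 y_xx| = y^2 |y y_xx| the first factor is at most a b by \<open>sp_sq_le\<close>,
  and the integral of the second is at most a d. The 1/3 comes from integrating the derivative of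
  y^3 y_x.\<close>

lemma sp_derivative_product_bound:
  "(\<integral>x. (sp N c x)\<^sup>2 * (sp' N c x)\<^sup>2 \<partial>Ivl l) \<le>
    (\<Sum>k<N. (c k)\<^sup>2) * sqrt (\<Sum>k<N. (mu k)\<^sup>2 * (c k)\<^sup>2) * sqrt (\<Sum>k<N. (mu k) ^ 4 * (c k)\<^sup>2) / 3"
proof -
  let ?p = "sp N c" and ?q = "sp' N c" and ?r = "sp N (\<lambda>k. - (mu k)\<^sup>2 * c k)"
  let ?a = "sqrt (\<Sum>k<N. (c k)\<^sup>2)" and ?b = "sqrt (\<Sum>k<N. (mu k)\<^sup>2 * (c k)\<^sup>2)"
    and ?d = "sqrt (\<Sum>k<N. (mu k) ^ 4 * (c k)\<^sup>2)"
  have r2: "(\<integral>x. (?r x)\<^sup>2 \<partial>Ivl l) = (\<Sum>k<N. (mu k) ^ 4 * (c k)\<^sup>2)"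
    unfolding sp_norm by (simp add: power_mult_distrib flip: power_mult)
  have "(\<integral>x. 3 * ((?p x)\<^sup>2 * (?q x)\<^sup>2) + (?p x) ^ 3 * ?r x \<partial>Ivl l) = (?p l) ^ 3 * ?q l - (?p (-l)) ^ 3 * ?q (-l)"
  proof (rule integral_Ivl_FTC)
    show "continuous_on {-l..l} (\<lambda>x. 3 * ((?p x)\<^sup>2 * (?q x)\<^sup>2) + (?p x) ^ 3 * ?r x)"
      by (intro continuous_intros)
    show "((\<lambda>x. (?p x) ^ 3 * ?q x) has_real_derivative 3 * ((?p x)\<^sup>2 * (?q x)\<^sup>2) + (?p x) ^ 3 * ?r x) (at x within {-l..l})" for x
      by (rule derivative_eq_intros sp_has_derivative sp'_has_derivative refl)+
        (simp add: power2_eq_square power3_eq_cube algebra_simps)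
  qed (use l_pos in simp)
  also have "\<dots> = 0" by simp
  also have "(\<integral>x. 3 * ((?p x)\<^sup>2 * (?q x)\<^sup>2) + (?p x) ^ 3 * ?r x \<partial>Ivl l) =
      3 * (\<integral>x. (?p x)\<^sup>2 * (?q x)\<^sup>2 \<partial>Ivl l) + (\<integral>x. (?p x) ^ 3 * ?r x \<partial>Ivl l)"
    by (subst Bochner_Integration.integral_add) (auto intro!: int_cont continuous_intros)
  finally have "3 * (\<integral>x. (?p x)\<^sup>2 * (?q x)\<^sup>2 \<partial>Ivl l) \<le> \<bar>\<integral>x. (?p x) ^ 3 * ?r x \<partial>Ivl l\<bar>" by linarith
  also have "\<dots> \<le> (\<integral>x. \<bar>(?p x) ^ 3 * ?r x\<bar> \<partial>Ivl l)" by (rule integral_abs_bound)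
  also have "\<dots> \<le> (\<integral>x. (?a * ?b) * \<bar>?p x * ?r x\<bar> \<partial>Ivl l)"
  proof (rule integral_mono)
    fix x assume "x \<in> space (Ivl l)"
    then have "(?p x)\<^sup>2 \<le> (\<integral>x. \<bar>?p x * ?q x\<bar> \<partial>Ivl l)" by (intro sp_sq_le) auto
    also have "\<dots> \<le> ?a * ?b"
      using integral_abs_mult_le[of ?p ?q] by (simp add: sp_norm sp'_norm sp_continuous sp'_continuous)
    finally have "(?p x)\<^sup>2 * \<bar>?p x * ?r x\<bar> \<le> (?a * ?b) * \<bar>?p x * ?r x\<bar>" by (rule mult_right_mono) simp
    moreover have "(?p x) ^ 3 * ?r x = (?p x)\<^sup>2 * (?p x * ?r x)"
      by (simp only: power2_eq_square power3_eq_cube ac_simps)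
    ultimately show "\<bar>(?p x) ^ 3 * ?r x\<bar> \<le> (?a * ?b) * \<bar>?p x * ?r x\<bar>"
      by (simp only: abs_mult[of "(?p x)\<^sup>2"] abs_power2)
  qed (auto intro!: int_cont continuous_intros)
  also have "\<dots> = (?a * ?b) * (\<integral>x. \<bar>?p x * ?r x\<bar> \<partial>Ivl l)" by simp
  also have "\<dots> \<le> (?a * ?b) * (?a * ?d)"
    using integral_abs_mult_le[of ?p ?r, unfolded r2 sp_norm]
    by (intro mult_left_mono) (auto simp: sp_continuous intro!: mult_nonneg_nonneg sum_nonneg)
  also have "\<dots> = (?a * ?a) * ?b * ?d" by (simp only: ac_simps)
  also have "?a * ?a = (\<Sum>k<N. (c k)\<^sup>2)" by (simp add: sum_nonneg)
  finally show ?thesis by simp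
qed

lemma interpolation_sum:
  "(\<Sum>k<N. (mu k)\<^sup>2 * (c k)\<^sup>2)\<^sup>2 \<le> (\<Sum>k<N. (c k)\<^sup>2) * (\<Sum>k<N. (mu k) ^ 4 * (c k)\<^sup>2)"
proof -
  have "(\<Sum>k<N. \<bar>c k\<bar> * ((mu k)\<^sup>2 * \<bar>c k\<bar>))\<^sup>2 \<le> (\<Sum>k<N. \<bar>c k\<bar>\<^sup>2) * (\<Sum>k<N. ((mu k)\<^sup>2 * \<bar>c k\<bar>)\<^sup>2)"
    by (rule Cauchy_Schwarz_ineq_sum)
  moreover have "\<bar>c k\<bar> * ((mu k)\<^sup>2 * \<bar>c k\<bar>) = (mu k)\<^sup>2 * (c k)\<^sup>2" for k
    by (simp add: power2_eq_square ac_simps abs_mult_self_eq)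
  moreover have "((mu k)\<^sup>2 * \<bar>c k\<bar>)\<^sup>2 = (mu k) ^ 4 * (c k)\<^sup>2" for k
    by (simp add: power_mult_distrib flip: power_mult)
  ultimately show ?thesis by simp
qed

end

section \<open>Energy bounds for infinite sine series\<close>

context sine_series
begin

lemma summable_sq: "summable (\<lambda>k. (c k)\<^sup>2)" "summable (\<lambda>k. (mu k)\<^sup>2 * (c k)\<^sup>2)"
  using ser_norm ser'_norm by (auto simp: sums_iff)

lemma ser_interpolation:
  "(\<integral>x. (ser' c x)\<^sup>2 \<partial>Ivl l)\<^sup>2 \<le> (\<integral>x. (ser c x)\<^sup>2 \<partial>Ivl l) * (\<Sum>k. (mu k) ^ 4 * (c k)\<^sup>2)"
proof (rule LIMSEQ_le)
  show "(\<lambda>N. (\<Sum>k<N. (mu k)\<^sup>2 * (c k)\<^sup>2)\<^sup>2) \<longlonglongrightarrow> (\<integral>x. (ser' c x)\<^sup>2 \<partial>Ivl l)\<^sup>2"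
    using ser'_norm by (intro tendsto_intros) (simp add: sums_def)
  show "(\<lambda>N. (\<Sum>k<N. (c k)\<^sup>2) * (\<Sum>k<N. (mu k) ^ 4 * (c k)\<^sup>2)) \<longlonglongrightarrow>
      (\<integral>x. (ser c x)\<^sup>2 \<partial>Ivl l) * (\<Sum>k. (mu k) ^ 4 * (c k)\<^sup>2)"
    using ser_norm summable_LIMSEQ[OF summable_mu4] by (intro tendsto_intros) (simp_all add: sums_def)
qed (use interpolation_sum in blast)

lemma ser_derivative_product_bound:
  "(\<integral>x. (ser c x)\<^sup>2 * (ser' c x)\<^sup>2 \<partial>Ivl l) \<le>
    (\<integral>x. (ser c x)\<^sup>2 \<partial>Ivl l) * sqrt (\<integral>x. (ser' c x)\<^sup>2 \<partial>Ivl l) * sqrt (\<Sum>k. (mu k) ^ 4 * (c k)\<^sup>2) / 3"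
proof (rule LIMSEQ_le)
  show "(\<lambda>N. \<integral>x. (sp N c x)\<^sup>2 * (sp' N c x)\<^sup>2 \<partial>Ivl l) \<longlonglongrightarrow> (\<integral>x. (ser c x)\<^sup>2 * (ser' c x)\<^sup>2 \<partial>Ivl l)"
  proof (rule integral_sp_limit)
    fix N x
    have "(sp N c x)\<^sup>2 \<le> bnd\<^sup>2" "(sp' N c x)\<^sup>2 \<le> bnd'\<^sup>2"
      using sp_bounded[of N x] sp'_bounded[of N x] by (auto simp: abs_le_square_iff[symmetric])
    then have "(sp N c x)\<^sup>2 * (sp' N c x)\<^sup>2 \<le> bnd\<^sup>2 * bnd'\<^sup>2" by (intro mult_mono) auto
    then show "\<bar>(sp N c x)\<^sup>2 * (sp' N c x)\<^sup>2\<bar> \<le> bnd\<^sup>2 * bnd'\<^sup>2" by simp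
  qed (auto intro!: continuous_intros tendsto_intros sp_tendsto sp'_tendsto)
  show "(\<lambda>N. (\<Sum>k<N. (c k)\<^sup>2) * sqrt (\<Sum>k<N. (mu k)\<^sup>2 * (c k)\<^sup>2) * sqrt (\<Sum>k<N. (mu k) ^ 4 * (c k)\<^sup>2) / 3) \<longlonglongrightarrow>
      (\<integral>x. (ser c x)\<^sup>2 \<partial>Ivl l) * sqrt (\<integral>x. (ser' c x)\<^sup>2 \<partial>Ivl l) * sqrt (\<Sum>k. (mu k) ^ 4 * (c k)\<^sup>2) / 3"
    using ser_norm ser'_norm summable_LIMSEQ[OF summable_mu4]
    by (intro tendsto_intros) (simp_all add: sums_def)
qed (use sp_derivative_product_bound in blast)

lemma integral_ser_sq_deriv: "(\<integral>x. (ser c x)\<^sup>2 * ser' c x \<partial>Ivl l) = 0"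
proof -
  have "(\<integral>x. (ser c x)\<^sup>2 * ser' c x \<partial>Ivl l) = ser c l * ser c l * ser c l / 3 - ser c (-l) * ser c (-l) * ser c (-l) / 3"
  proof (rule integral_Ivl_FTC)
    show "((\<lambda>x. ser c x * ser c x * ser c x / 3) has_real_derivative (ser c x)\<^sup>2 * ser' c x) (at x within {-l..l})" for x
      by (rule derivative_eq_intros ser_has_derivative refl)+ (simp_all add: power2_eq_square field_simps)
  qed (use l_pos in \<open>auto intro!: continuous_intros\<close>)
  then show ?thesis by (simp add: ser_ends)
qed

text \<open>\<open>weighted_arithmetic_geometric\<close> is applied pointwise with s = |w|, r = |y
  y_x| and the constant a = L^2 norm of y. Choosing a this way makes the quartic term exactly the
  one that \<open>f\<close> provides, and lets the last term be absorbed by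
  \<open>ser_derivative_product_bound\<close>.\<close>

lemma cross_term_bound:
  assumes w: "w \<in> Lp l 4" and K: "K \<ge> 23/20"
  shows "2 * (\<integral>x. w x * (ser c x * ser' c x) \<partial>Ivl l) \<le>
     K / 2 * (\<integral>x. \<bar>w x\<bar> ^ 4 \<partial>Ivl l) * (\<integral>x. (ser c x)\<^sup>2 \<partial>Ivl l)
     + 71/100 * (sqrt (\<integral>x. (ser c x)\<^sup>2 \<partial>Ivl l) * sqrt (\<integral>x. (ser' c x)\<^sup>2 \<partial>Ivl l))
     + 29/100 * (sqrt (\<integral>x. (ser' c x)\<^sup>2 \<partial>Ivl l) * sqrt (\<Sum>k. (mu k) ^ 4 * (c k)\<^sup>2))"
proof (cases "(\<integral>x. (ser c x)\<^sup>2 \<partial>Ivl l) = 0")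
  \<comment> \<open>The pointwise inequality divides by the norm of y, so the zero function is
    treated apart: all coefficients vanish and both sides are 0.\<close>
  case True
  have "(c k)\<^sup>2 \<le> 0" for k
    using sum_le_suminf[OF summable_sq(1), of "{k}"] ser_norm by (simp add: True sums_iff)
  then have "c k = 0" for k by (simp add: power2_eq_square) (metis linorder_not_less mult_eq_0_iff not_real_square_gt_zero)
  then have "ser c x = 0" "ser' c x = 0" for x by (simp_all add: ser_def ser'_def)
  then show ?thesis using \<open>\<And>k. c k = 0\<close> by simp
next
  case False
  define a2 where "a2 = (\<integral>x. (ser c x)\<^sup>2 \<partial>Ivl l)"
  define a where "a = sqrt a2"
  have "a2 \<ge> 0" by (simp add: a2_def)
  then have a: "a > 0" "a\<^sup>2 = a2" using False by (auto simp: a_def a2_def[symmetric])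
  let ?R = "\<lambda>x. ser c x * ser' c x"
  have R: "continuous_on S ?R" for S by (intro continuous_intros)
  have iw: "integrable (Ivl l) (\<lambda>x. w x * ?R x)"
    by (rule sqint_mult[OF Lp4_sqint[OF w] sqint_cont[OF R]])
  have i1: "integrable (Ivl l) (\<lambda>x. \<bar>w x\<bar> ^ 4)" by (rule Lp4_integrable[OF w])
  have i2: "integrable (Ivl l) (\<lambda>x. \<bar>?R x\<bar>)" "integrable (Ivl l) (\<lambda>x. (?R x)\<^sup>2)"
    using R by (auto intro!: int_cont continuous_intros)
  have "2 * (\<integral>x. w x * ?R x \<partial>Ivl l) = (\<integral>x. 2 * (w x * ?R x) \<partial>Ivl l)" by simp
  also have "\<dots> \<le> (\<integral>x. K * a2 / 2 * \<bar>w x\<bar> ^ 4 + 71/100 * \<bar>?R x\<bar> + 87/100 / a2 * (?R x)\<^sup>2 \<partial>Ivl l)"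
  proof (rule integral_mono)
    fix x
    have "w x * ?R x \<le> \<bar>w x\<bar> * \<bar>?R x\<bar>" by (metis abs_ge_self abs_mult)
    with weighted_arithmetic_geometric[OF a(1) abs_ge_zero abs_ge_zero K, of "w x" "?R x"]
    show "2 * (w x * ?R x) \<le> K * a2 / 2 * \<bar>w x\<bar> ^ 4 + 71/100 * \<bar>?R x\<bar> + 87/100 / a2 * (?R x)\<^sup>2"
      unfolding a(2) by simp
  qed (use iw i1 i2 in \<open>auto simp del: power_even_abs_numeral\<close>)
  also have "\<dots> = K * a2 / 2 * (\<integral>x. \<bar>w x\<bar> ^ 4 \<partial>Ivl l) + 71/100 * (\<integral>x. \<bar>?R x\<bar> \<partial>Ivl l) + 87/100 / a2 * (\<integral>x. (?R x)\<^sup>2 \<partial>Ivl l)"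
    using i1 i2 by (simp del: power_even_abs_numeral)
  also have "87/100 / a2 * (\<integral>x. (?R x)\<^sup>2 \<partial>Ivl l) \<le> 87/100 / a2 * (a2 * sqrt (\<integral>x. (ser' c x)\<^sup>2 \<partial>Ivl l) * sqrt (\<Sum>k. (mu k) ^ 4 * (c k)\<^sup>2) / 3)"
    using ser_derivative_product_bound \<open>a2 \<ge> 0\<close> unfolding a2_def by (intro mult_left_mono) (auto simp: power_mult_distrib)
  \<comment> \<open>29/100 is 87/100 times the 1/3 of the product bound, and the squared norm of y
    cancels.\<close>
  also have "\<dots> = 29/100 * (sqrt (\<integral>x. (ser' c x)\<^sup>2 \<partial>Ivl l) * sqrt (\<Sum>k. (mu k) ^ 4 * (c k)\<^sup>2))"
    using False by (simp add: a2_def)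
  also have "(\<integral>x. \<bar>?R x\<bar> \<partial>Ivl l) \<le> sqrt a2 * sqrt (\<integral>x. (ser' c x)\<^sup>2 \<partial>Ivl l)"
    unfolding a2_def by (intro integral_abs_mult_le continuous_intros)
  finally show ?thesis by (simp add: a2_def ac_simps)
qed

text \<open>The left side is the limiting power plus the squared V norm. Expanding v = w + y kills
  \<integral>y^2 y_x and splits the rest: the w^2 y_x term yields the 1/4 in the forcing at the
  price of one b^2, the \<kappa> terms reduce to \<integral>w y, the cross term is
  \<open>cross_term_bound\<close>, and \<open>energy_quadratic_form\<close> closes the
  balance.\<close>

lemma energy_estimate:
  assumes w: "w \<in> Lp l 4" and K: "K \<ge> 23/20" and \<kappa>: "\<kappa> \<ge> 0"
    and v: "AE x in Ivl l. v x = w x + ser c x"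
  defines "a2 \<equiv> (\<integral>x. (ser c x)\<^sup>2 \<partial>Ivl l)" and "b2 \<equiv> (\<integral>x. (ser' c x)\<^sup>2 \<partial>Ivl l)"
    and "d2 \<equiv> (\<Sum>k. (mu k) ^ 4 * (c k)\<^sup>2)"
  shows "- 2 * d2 + 2 * b2 - 2 * \<kappa> * a2 + (\<integral>x. (v x)\<^sup>2 * ser' c x \<partial>Ivl l)
      + 2 * \<kappa> * (\<integral>x. v x * ser c x \<partial>Ivl l) + (a2 + b2) \<le>
     1/2 * (2 * \<kappa> + (2 + 3/4 * K)\<^sup>2 + K * Lnorm l 4 w ^ 4) * a2 + (\<kappa> * (Hnorm l w)\<^sup>2 + 1/4 * Lnorm l 4 w ^ 4)"
proof -
  let ?y = "ser c" and ?z = "ser' c"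
  note ws = Lp4_sqint[OF w] Lp4_sqint_sq[OF w]
  have cy: "continuous_on S ?y" "continuous_on S ?z" for S by (intro continuous_intros)+
  have i1: "integrable (Ivl l) (\<lambda>x. (w x)\<^sup>2 * ?z x)" by (rule sqint_mult[OF ws(2) sqint_ser'])
  have i2: "integrable (Ivl l) (\<lambda>x. w x * (?y x * ?z x))"
    by (rule sqint_mult[OF ws(1) sqint_cont]) (intro continuous_intros)
  have i3: "integrable (Ivl l) (\<lambda>x. (?y x)\<^sup>2 * ?z x)" by (intro int_cont continuous_intros)
  have i4: "integrable (Ivl l) (\<lambda>x. w x * ?y x)" by (rule sqint_mult[OF ws(1) sqint_ser])
  have i5: "integrable (Ivl l) (\<lambda>x. (?y x)\<^sup>2)" "integrable (Ivl l) (\<lambda>x. (?z x)\<^sup>2)"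
    by (rule sqint_sq[OF sqint_ser], rule sqint_sq[OF sqint_ser'])
  have i6: "integrable (Ivl l) (\<lambda>x. (w x)\<^sup>2)" "integrable (Ivl l) (\<lambda>x. \<bar>w x\<bar> ^ 4)"
    by (rule sqint_sq[OF ws(1)], rule Lp4_integrable[OF w])
  have "(\<integral>x. (v x)\<^sup>2 * ?z x \<partial>Ivl l) = (\<integral>x. (w x)\<^sup>2 * ?z x + 2 * (w x * (?y x * ?z x)) + (?y x)\<^sup>2 * ?z x \<partial>Ivl l)"
  proof (rule integral_cong_AE_lebesgue_on)
    show "AE x in Ivl l. (v x)\<^sup>2 * ?z x = (w x)\<^sup>2 * ?z x + 2 * (w x * (?y x * ?z x)) + (?y x)\<^sup>2 * ?z x"
      using v by eventually_elim (simp add: power2_eq_square algebra_simps)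
  qed simp
  also have "\<dots> = (\<integral>x. (w x)\<^sup>2 * ?z x \<partial>Ivl l) + 2 * (\<integral>x. w x * (?y x * ?z x) \<partial>Ivl l)"
    using i1 i2 i3 integral_ser_sq_deriv by simp
  finally have e1: "(\<integral>x. (v x)\<^sup>2 * ?z x \<partial>Ivl l) = (\<integral>x. (w x)\<^sup>2 * ?z x \<partial>Ivl l) + 2 * (\<integral>x. w x * (?y x * ?z x) \<partial>Ivl l)" .
  have "(\<integral>x. v x * ?y x \<partial>Ivl l) = (\<integral>x. w x * ?y x + (?y x)\<^sup>2 \<partial>Ivl l)"
  proof (rule integral_cong_AE_lebesgue_on)
    show "AE x in Ivl l. v x * ?y x = w x * ?y x + (?y x)\<^sup>2"
      using v by eventually_elim (simp add: power2_eq_square algebra_simps)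
  qed simp
  also have "\<dots> = (\<integral>x. w x * ?y x \<partial>Ivl l) + a2" using i4 i5 by (simp add: a2_def)
  finally have e2: "(\<integral>x. v x * ?y x \<partial>Ivl l) = (\<integral>x. w x * ?y x \<partial>Ivl l) + a2" .
  \<comment> \<open>Completing the square with weight 1/2 on w^2 leaves |w|^4 / 4, the coefficient
    in \<open>g\<close>.\<close>
  have "(\<integral>x. (w x)\<^sup>2 * ?z x \<partial>Ivl l) \<le> (\<integral>x. 1/4 * \<bar>w x\<bar> ^ 4 + (?z x)\<^sup>2 \<partial>Ivl l)"
  proof (rule integral_mono)
    fix x
    have "0 \<le> ((w x)\<^sup>2 / 2 - ?z x)\<^sup>2" by simp
    also have "\<dots> = 1/4 * \<bar>w x\<bar> ^ 4 + (?z x)\<^sup>2 - (w x)\<^sup>2 * ?z x"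
      by (simp add: power2_diff power_divide flip: power_mult)
    finally show "(w x)\<^sup>2 * ?z x \<le> 1/4 * \<bar>w x\<bar> ^ 4 + (?z x)\<^sup>2" by simp
  qed (use i1 i5 i6 in \<open>auto simp del: power_even_abs_numeral\<close>)
  also have "\<dots> = 1/4 * Lnorm l 4 w ^ 4 + b2"
    unfolding Lnorm4_pow using i5 i6 by (simp add: b2_def del: power_even_abs_numeral)
  finally have e3: "(\<integral>x. (w x)\<^sup>2 * ?z x \<partial>Ivl l) \<le> 1/4 * Lnorm l 4 w ^ 4 + b2" .
  have "2 * (\<integral>x. w x * ?y x \<partial>Ivl l) = (\<integral>x. 2 * (w x * ?y x) \<partial>Ivl l)" by simp
  also have "\<dots> \<le> (\<integral>x. (w x)\<^sup>2 + (?y x)\<^sup>2 \<partial>Ivl l)"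
  proof (rule integral_mono)
    show "2 * (w x * ?y x) \<le> (w x)\<^sup>2 + (?y x)\<^sup>2" for x using sum_squares_bound[of "w x" "?y x"] by simp
  qed (use i4 i5 i6 in auto)
  also have "\<dots> = (Hnorm l w)\<^sup>2 + a2" unfolding Hnorm_sq using i5 i6 by (simp add: a2_def)
  finally have "\<kappa> * (2 * (\<integral>x. w x * ?y x \<partial>Ivl l)) \<le> \<kappa> * ((Hnorm l w)\<^sup>2 + a2)" using \<kappa> by (rule mult_left_mono)
  then have e4: "2 * \<kappa> * (\<integral>x. w x * ?y x \<partial>Ivl l) \<le> \<kappa> * (Hnorm l w)\<^sup>2 + \<kappa> * a2" by (simp add: algebra_simps)
  have nn: "0 \<le> a2" "0 \<le> b2" "0 \<le> d2"
    unfolding a2_def b2_def d2_def by (auto intro!: suminf_nonneg summable_mu4)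
  have "b2 \<le> sqrt a2 * sqrt d2"
    using ser_interpolation unfolding a2_def[symmetric] b2_def[symmetric] d2_def[symmetric] real_sqrt_mult[symmetric]
    by (rule real_le_rsqrt)
  then have "4 * b2 + a2 + 71/100 * (sqrt a2 * sqrt b2) + 29/100 * (sqrt b2 * sqrt d2) \<le> 2 * d2 + 1/2 * (2 + 3/4 * K)\<^sup>2 * a2"
    using energy_quadratic_form[OF K, of "sqrt a2" "sqrt d2" "sqrt b2"] nn by simp
  moreover have "2 * (\<integral>x. w x * (?y x * ?z x) \<partial>Ivl l) \<le> K / 2 * Lnorm l 4 w ^ 4 * a2 + 71/100 * (sqrt a2 * sqrt b2) + 29/100 * (sqrt b2 * sqrt d2)"
    using cross_term_bound[OF w K] unfolding a2_def b2_def d2_def Lnorm4_pow .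
  ultimately show ?thesis using e3 e4 unfolding e1 e2 by (simp add: algebra_simps)
qed

end

section \<open>The energy equality for mild solutions\<close>

text \<open>Duhamel's formula factors as exp(-r t) times u + \<integral>exp(r s) g, and the
  integrated product rule then gives the differential equation in integral form.\<close>

lemma variation_of_constants:
  fixes g y :: "real \<Rightarrow> real"
  assumes T: "0 \<le> T" and g: "integrable (lebesgue_on {0..T}) g"
    and y: "\<And>t. t \<in> {0..T} \<Longrightarrow> y t = exp (- r * t) * u + (\<integral>s. exp (- r * (t - s)) * g s \<partial>lebesgue_on {0..t})"
  shows "integrable (lebesgue_on {0..T}) (\<lambda>s. - r * y s + g s)"
    and "t \<in> {0..T} \<Longrightarrow> y t = u + (\<integral>s. - r * y s + g s \<partial>lebesgue_on {0..t})"
proof -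
  let ?X = "\<lambda>t. exp (- r * t)" and ?\<xi> = "\<lambda>t. - r * exp (- r * t)" and ?\<eta> = "\<lambda>s. exp (r * s) * g s"
  define Y where "Y t = u + (\<integral>s. ?\<eta> s \<partial>lebesgue_on {0..t})" for t
  note [measurable] = id_measurable_lebesgue_on borel_measurable_integrable[OF g]
  have c\<xi>: "continuous_on S ?\<xi>" for S by (intro continuous_intros)
  have \<xi>: "integrable (lebesgue_on {0..t}) ?\<xi>" for t by (rule continuous_imp_integrable_real[OF c\<xi>])
  have \<eta>: "integrable (lebesgue_on {0..T}) ?\<eta>"
  proof (rule Bochner_Integration.integrable_bound)
    show "integrable (lebesgue_on {0..T}) (\<lambda>s. exp (\<bar>r\<bar> * T) * g s)" using g by simp
    show "AE s in lebesgue_on {0..T}. norm (?\<eta> s) \<le> norm (exp (\<bar>r\<bar> * T) * g s)"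
    proof (rule AE_I2)
      fix s assume "s \<in> space (lebesgue_on {0..T})"
      then have "r * s \<le> \<bar>r\<bar> * T" by (intro mult_mono) auto
      then show "norm (?\<eta> s) \<le> norm (exp (\<bar>r\<bar> * T) * g s)" by (simp add: abs_mult mult_right_mono)
    qed
  qed measurable
  have X: "?X t = 1 + (\<integral>s. ?\<xi> s \<partial>lebesgue_on {0..t})" if "t \<in> {0..T}" for t
  proof -
    have "(\<integral>s. ?\<xi> s \<partial>lebesgue_on {0..t}) = integral {0..t} ?\<xi>" by (rule lebesgue_integral_eq_integral[OF \<xi>]) simp
    also have "\<dots> = ?X t - ?X 0"
    proof (rule integral_unique, rule fundamental_theorem_of_calculus)
      show "(?X has_vector_derivative ?\<xi> s) (at s within {0..t})" for s
        unfolding has_real_derivative_iff_has_vector_derivative[symmetric]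
        by (rule derivative_eq_intros refl)+ simp
    qed (use that in simp)
    finally show ?thesis by simp
  qed
  have yXY: "y t = ?X t * Y t" if t: "t \<in> {0..T}" for t
  proof -
    have "- r * (t - s) = - r * t + r * s" for s by (simp add: algebra_simps)
    then have "exp (- r * (t - s)) * g s = ?X t * ?\<eta> s" for s by (simp only: exp_add mult.assoc)
    then show ?thesis
      unfolding y[OF t] Y_def by (simp only: Bochner_Integration.integral_mult_right_zero distrib_left)
  qed
  note P = indefinite_integral_product[where \<xi>="?\<xi>" and \<eta>="?\<eta>" and X="?X" and Y=Y, OF \<xi> \<eta> X Y_def]
  have e: "?\<xi> s * Y s + ?X s * ?\<eta> s = - r * y s + g s" if "s \<in> {0..T}" for s
    using yXY[OF that] by (simp add: exp_minus)
  have "integrable (lebesgue_on {0..T}) (\<lambda>s. ?\<xi> s * Y s + ?X s * ?\<eta> s)"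
    by (rule Bochner_Integration.integrable_add[OF P(1)[of T] P(2)[of T]]) (use T in auto)
  moreover have "integrable (lebesgue_on {0..T}) (\<lambda>s. ?\<xi> s * Y s + ?X s * ?\<eta> s) \<longleftrightarrow>
      integrable (lebesgue_on {0..T}) (\<lambda>s. - r * y s + g s)"
    by (rule Bochner_Integration.integrable_cong[OF refl], rule e) simp
  ultimately show "integrable (lebesgue_on {0..T}) (\<lambda>s. - r * y s + g s)" by blast
  assume t: "t \<in> {0..T}"
  have "y t = 1 * u + (\<integral>s. ?\<xi> s * Y s + ?X s * ?\<eta> s \<partial>lebesgue_on {0..t})"
    unfolding yXY[OF t] by (rule P(3)[OF _ t]) auto
  also have "(\<integral>s. ?\<xi> s * Y s + ?X s * ?\<eta> s \<partial>lebesgue_on {0..t}) = (\<integral>s. - r * y s + g s \<partial>lebesgue_on {0..t})"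
    by (rule Bochner_Integration.integral_cong[OF refl], rule e) (use t in simp)
  finally show "y t = u + (\<integral>s. - r * y s + g s \<partial>lebesgue_on {0..t})" by simp
qed

lemma product_bounds:
  assumes "A \<ge> 0" "D \<ge> 0" "(B::real)\<^sup>2 \<le> A * D"
  shows "B \<le> D / 8 + 2 * A" "B \<le> D / 4 + A"
proof -
  have "B\<^sup>2 \<le> (D / 8 + 2 * A)\<^sup>2"
  proof -
    have "(D / 8 + 2 * A)\<^sup>2 = (D / 8 - 2 * A)\<^sup>2 + A * D" by (simp add: power2_eq_square algebra_simps)
    then show ?thesis using assms(3) zero_le_power2[of "D / 8 - 2 * A"] by linarith
  qed
  then show "B \<le> D / 8 + 2 * A" by (rule power2_le_imp_le) (use assms in simp)
  have "B\<^sup>2 \<le> (D / 4 + A)\<^sup>2"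
  proof -
    have "(D / 4 + A)\<^sup>2 = (D / 4 - A)\<^sup>2 + A * D" by (simp add: power2_eq_square algebra_simps)
    then show ?thesis using assms(3) zero_le_power2[of "D / 4 - A"] by linarith
  qed
  then show "B \<le> D / 4 + A" by (rule power2_le_imp_le) (use assms in simp)
qed

text \<open>The deterministic problem that remains for one noise path: \<kappa> is the constant c of
  the operator (the name c is taken by coefficient sequences), K is C1 C2, and v is a jointly
  measurable version of y + W.\<close>

locale mild_solution = L4_path +
  fixes \<kappa> K :: real and u0 :: rfun and y :: "real \<Rightarrow> rfun" and v :: "real \<times> real \<Rightarrow> real"
  assumes \<kappa>: "\<kappa> \<ge> 0" and K: "K \<ge> 23/20"
    and u0: "sqint (Ivl l) u0" and y_sqint: "t \<in> {0..T} \<Longrightarrow> sqint (Ivl l) (y t)"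
    and y_L2: "integrable (Time T) (\<lambda>t. (Hnorm l (y t))\<^sup>2)"
    and v_measurable: "v \<in> borel_measurable PM" and v_L4: "integrable PM (\<lambda>z. \<bar>v z\<bar> ^ 4)"
    and v_eq: "AE t in Time T. AE x in Ivl l. v (t, x) = W t x + y t x"
    and duhamel: "t \<in> {0..T} \<Longrightarrow> coef (y t) k = exp (- lam \<kappa> k * t) * coef u0 k +
      (\<integral>s. exp (- lam \<kappa> k * (t - s)) * gfun \<kappa> v k s \<partial>lebesgue_on {0..t})"
begin

abbreviation cf :: "real \<Rightarrow> nat \<Rightarrow> real"
  where "cf t k \<equiv> coef (y t) k"

text \<open>The density of the squared norm of the first N coefficients in time. Only the test
  function is truncated: \<open>gfun\<close> keeps the full v, so no approximate equation has to be
  solved.\<close>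

definition galerkin_power :: "nat \<Rightarrow> real \<Rightarrow> real"
  where "galerkin_power N s = (\<Sum>k<N. 2 * (cf s k * (- lam \<kappa> k * cf s k + gfun \<kappa> v k s)))"

lemma cf_integral:
  "integrable (Time T) (\<lambda>s. - lam \<kappa> k * cf s k + gfun \<kappa> v k s)"
  "t \<in> {0..T} \<Longrightarrow> cf t k = coef u0 k + (\<integral>s. - lam \<kappa> k * cf s k + gfun \<kappa> v k s \<partial>lebesgue_on {0..t})"
  using variation_of_constants[OF less_imp_le[OF T_pos] gfun_integrable[OF v_measurable v_L4] duhamel] by blast+

lemma cf_continuous: "continuous_on {0..T} (\<lambda>t. cf t k)"
proof -
  have "continuous_on {0..T} (\<lambda>t. coef u0 k + (\<integral>s. - lam \<kappa> k * cf s k + gfun \<kappa> v k s \<partial>lebesgue_on {0..t}))"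
    by (intro continuous_intros indefinite_integral_continuous_on cf_integral(1))
  then show ?thesis by (rule continuous_on_eq) (rule cf_integral(2)[symmetric])
qed

lemma cf_measurable [measurable]: "(\<lambda>t. cf t k) \<in> borel_measurable (Time T)"
  by (rule continuous_imp_measurable_on_sets_lebesgue[OF cf_continuous]) simp

lemma cf_sq_integrable: "integrable (Time T) (\<lambda>t. a * (cf t k)\<^sup>2)"
  by (rule continuous_imp_integrable_real) (intro continuous_intros cf_continuous)

lemma cf_sq:
  "integrable (Time T) (\<lambda>s. 2 * (cf s k * (- lam \<kappa> k * cf s k + gfun \<kappa> v k s)))"
  "t \<in> {0..T} \<Longrightarrow> (cf t k)\<^sup>2 = (coef u0 k)\<^sup>2 +
     (\<integral>s. 2 * (cf s k * (- lam \<kappa> k * cf s k + gfun \<kappa> v k s)) \<partial>lebesgue_on {0..t})"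
proof -
  let ?r = "\<lambda>s. - lam \<kappa> k * cf s k + gfun \<kappa> v k s"
  note P = indefinite_integral_product[where \<xi>="?r" and \<eta>="?r", OF cf_integral(1) cf_integral(1) cf_integral(2) cf_integral(2)]
  have "integrable (Time T) (\<lambda>s. cf s k * ?r s)"
    by (rule P(2)[of T]) (use T_pos in auto)
  then show "integrable (Time T) (\<lambda>s. 2 * (cf s k * ?r s))" by simp
  assume t: "t \<in> {0..T}"
  have "cf t k * cf t k = coef u0 k * coef u0 k + (\<integral>s. ?r s * cf s k + cf s k * ?r s \<partial>lebesgue_on {0..t})"
    by (rule P(3)) (use t in auto)
  also have "(\<lambda>s. ?r s * cf s k + cf s k * ?r s) = (\<lambda>s. 2 * (cf s k * ?r s))" by (simp add: algebra_simps)
  finally show "(cf t k)\<^sup>2 = (coef u0 k)\<^sup>2 + (\<integral>s. 2 * (cf s k * ?r s) \<partial>lebesgue_on {0..t})"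
    by (simp only: power2_eq_square)
qed

lemma galerkin_power_integrable: "integrable (Time T) (galerkin_power N)"
  unfolding galerkin_power_def by (intro Bochner_Integration.integrable_sum cf_sq(1))

lemma galerkin_energy:
  assumes t: "t \<in> {0..T}"
  shows "(\<Sum>k<N. (cf t k)\<^sup>2) = (\<Sum>k<N. (coef u0 k)\<^sup>2) + (\<integral>s. galerkin_power N s \<partial>lebesgue_on {0..t})"
proof -
  have "(\<integral>s. galerkin_power N s \<partial>lebesgue_on {0..t}) =
      (\<Sum>k<N. \<integral>s. 2 * (cf s k * (- lam \<kappa> k * cf s k + gfun \<kappa> v k s)) \<partial>lebesgue_on {0..t})"
    unfolding galerkin_power_def
    by (rule Bochner_Integration.integral_sum, rule integrable_lebesgue_on_initial[OF cf_sq(1)]) (use t in simp)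
  then show ?thesis by (simp only: cf_sq(2)[OF t] sum.distrib)
qed

lemma v_slice: "AE t in Time T. (\<lambda>x. v (t, x)) \<in> Lp l 4"
proof -
  have "AE t in Time T. integrable (Ivl l) (\<lambda>x. \<bar>v (t, x)\<bar> ^ 4)" by (rule PM.AE_integrable_fst'[OF v_L4])
  then show ?thesis
    using AE_space by eventually_elim (intro Lp4I measurable_Pair2[OF v_measurable], auto)
qed

lemma galerkin_power_eq:
  assumes s: "(\<lambda>x. v (s, x)) \<in> Lp l 4"
  shows "galerkin_power N s = - 2 * (\<Sum>k<N. (mu k) ^ 4 * (cf s k)\<^sup>2) + 2 * (\<Sum>k<N. (mu k)\<^sup>2 * (cf s k)\<^sup>2)
    - 2 * \<kappa> * (\<Sum>k<N. (cf s k)\<^sup>2) + (\<integral>x. (v (s, x))\<^sup>2 * sp' N (cf s) x \<partial>Ivl l)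
    + 2 * \<kappa> * (\<integral>x. v (s, x) * sp N (cf s) x \<partial>Ivl l)"
proof -
  let ?I = "\<lambda>k. \<integral>x. (v (s, x))\<^sup>2 * sb' k x \<partial>Ivl l" and ?J = "coef (\<lambda>x. v (s, x))"
  have i: "integrable (Ivl l) (\<lambda>x. (v (s, x))\<^sup>2 * sb' k x)" "integrable (Ivl l) (\<lambda>x. v (s, x) * sb k x)" for k
    using Lp4_sqint[OF s] Lp4_sqint_sq[OF s] by (auto intro: sqint_mult sqint_sb sqint_sb')
  have g: "gfun \<kappa> v k s = 1/2 * ?I k + \<kappa> * ?J k" for k
    unfolding gfun_def coef_def mult.assoc using i by simp
  have e1: "(\<integral>x. (v (s, x))\<^sup>2 * sp' N (cf s) x \<partial>Ivl l) = (\<Sum>k<N. cf s k * ?I k)"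
    unfolding sp'_def sum_distrib_left mult.left_commute[of "(_)\<^sup>2"] using i by simp
  have e2: "(\<integral>x. v (s, x) * sp N (cf s) x \<partial>Ivl l) = (\<Sum>k<N. cf s k * ?J k)"
    by (rule sp_inner[OF Lp4_sqint[OF s]])
  have t: "2 * (cf s k * (- lam \<kappa> k * cf s k + gfun \<kappa> v k s)) = - 2 * ((mu k) ^ 4 * (cf s k)\<^sup>2) + 2 * ((mu k)\<^sup>2 * (cf s k)\<^sup>2)
    - 2 * \<kappa> * (cf s k)\<^sup>2 + cf s k * ?I k + 2 * \<kappa> * (cf s k * ?J k)" for k
    unfolding g lam_def by (simp add: algebra_simps power2_eq_square)
  show ?thesis
    unfolding galerkin_power_def e1 e2 t by (simp only: sum.distrib sum_subtractf sum_distrib_left)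
qed

text \<open>An integrable majorant, independent of N, for everything that is left after the b^2
  terms have been absorbed into the fourth-order term.\<close>

definition dominant :: "real \<Rightarrow> real"
  where "dominant s = (5 + 3 * \<kappa>) * (Hnorm l (y s))\<^sup>2 + (\<integral>x. \<bar>v (s, x)\<bar> ^ 4 \<partial>Ivl l) / 4 + \<kappa> * (\<integral>x. (v (s, x))\<^sup>2 \<partial>Ivl l)"

text \<open>The one-sided bound keeps a full negative fourth-order term and yields regularity; the
  two-sided bound provides the domination for the limit in N.\<close>

lemma galerkin_power_bounds:
  assumes s: "(\<lambda>x. v (s, x)) \<in> Lp l 4" and t: "s \<in> {0..T}"
  shows "galerkin_power N s \<le> - (\<Sum>k<N. (mu k) ^ 4 * (cf s k)\<^sup>2) + dominant s"
    and "\<bar>galerkin_power N s\<bar> \<le> 3 * (\<Sum>k<N. (mu k) ^ 4 * (cf s k)\<^sup>2) + dominant s"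
proof -
  define A B D q p where "A = (\<Sum>k<N. (cf s k)\<^sup>2)" and "B = (\<Sum>k<N. (mu k)\<^sup>2 * (cf s k)\<^sup>2)"
    and "D = (\<Sum>k<N. (mu k) ^ 4 * (cf s k)\<^sup>2)" and "q = (\<integral>x. \<bar>v (s, x)\<bar> ^ 4 \<partial>Ivl l)"
    and "p = (\<integral>x. (v (s, x))\<^sup>2 \<partial>Ivl l)"
  have nn: "0 \<le> A" "0 \<le> B" "0 \<le> D" "0 \<le> q" "0 \<le> p"
    unfolding A_def B_def D_def q_def p_def by (auto intro!: sum_nonneg)
  note BAD = product_bounds[OF nn(1,3), of B, unfolded A_def B_def D_def, OF interpolation_sum, folded A_def B_def D_def]
  have Aa: "A \<le> (Hnorm l (y s))\<^sup>2" unfolding A_def Hnorm_sq by (rule Bessel[OF y_sqint[OF t]])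
  have "\<bar>\<integral>x. (v (s, x))\<^sup>2 * sp' N (cf s) x \<partial>Ivl l\<bar> \<le> sqrt (\<integral>x. ((v (s, x))\<^sup>2)\<^sup>2 \<partial>Ivl l) * sqrt (\<integral>x. (sp' N (cf s) x)\<^sup>2 \<partial>Ivl l)"
    by (rule sqint_Cauchy_Schwarz_abs[OF Lp4_sqint_sq[OF s] sqint_sp'])
  also have "(\<integral>x. ((v (s, x))\<^sup>2)\<^sup>2 \<partial>Ivl l) = q" by (simp add: q_def flip: power_mult)
  also have "(\<integral>x. (sp' N (cf s) x)\<^sup>2 \<partial>Ivl l) = B" by (simp add: sp'_norm B_def)
  also have "sqrt q * sqrt B \<le> q / 4 + B"
    using sum_squares_bound[of "sqrt q / 2" "sqrt B"] nn by (simp add: power_divide)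
  finally have I: "\<bar>\<integral>x. (v (s, x))\<^sup>2 * sp' N (cf s) x \<partial>Ivl l\<bar> \<le> q / 4 + B" .
  have "\<bar>\<integral>x. v (s, x) * sp N (cf s) x \<partial>Ivl l\<bar> \<le> sqrt p * sqrt (\<integral>x. (sp N (cf s) x)\<^sup>2 \<partial>Ivl l)"
    unfolding p_def by (rule sqint_Cauchy_Schwarz_abs[OF Lp4_sqint[OF s] sqint_sp])
  also have "(\<integral>x. (sp N (cf s) x)\<^sup>2 \<partial>Ivl l) = A" by (simp add: sp_norm A_def)
  also have "sqrt p * sqrt A \<le> (p + A) / 2"
    using sum_squares_bound[of "sqrt p" "sqrt A"] nn by simp
  finally have "2 * \<kappa> * \<bar>\<integral>x. v (s, x) * sp N (cf s) x \<partial>Ivl l\<bar> \<le> 2 * \<kappa> * ((p + A) / 2)"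
    using \<kappa> by (intro mult_left_mono) auto
  then have J: "\<bar>2 * \<kappa> * (\<integral>x. v (s, x) * sp N (cf s) x \<partial>Ivl l)\<bar> \<le> \<kappa> * p + \<kappa> * A"
    using \<kappa> by (simp add: abs_mult algebra_simps)
  have kA: "0 \<le> \<kappa> * A" "\<kappa> * A \<le> \<kappa> * (Hnorm l (y s))\<^sup>2" using \<kappa> nn Aa by (auto intro: mult_left_mono)
  have dom: "dominant s = 5 * (Hnorm l (y s))\<^sup>2 + 3 * (\<kappa> * (Hnorm l (y s))\<^sup>2) + q / 4 + \<kappa> * p"
    by (simp add: dominant_def q_def p_def algebra_simps del: power_even_abs_numeral)
  have h: "galerkin_power N s = - 2 * D + 2 * B - 2 * (\<kappa> * A) + (\<integral>x. (v (s, x))\<^sup>2 * sp' N (cf s) x \<partial>Ivl l)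
    + 2 * \<kappa> * (\<integral>x. v (s, x) * sp N (cf s) x \<partial>Ivl l)"
    unfolding galerkin_power_eq[OF s] A_def B_def D_def by simp
  show "galerkin_power N s \<le> - (\<Sum>k<N. (mu k) ^ 4 * (cf s k)\<^sup>2) + dominant s"
    using I J BAD kA Aa nn unfolding D_def[symmetric] dom h abs_le_iff by linarith
  show "\<bar>galerkin_power N s\<bar> \<le> 3 * (\<Sum>k<N. (mu k) ^ 4 * (cf s k)\<^sup>2) + dominant s"
    using I J BAD kA Aa nn unfolding D_def[symmetric] dom h abs_le_iff by linarith
qed

lemma dominant_integrable: "integrable (Time T) dominant"
proof -
  have "integrable (Time T) (\<lambda>s. \<integral>x. \<bar>v (s, x)\<bar> ^ 4 \<partial>Ivl l)" by (rule PM.integrable_fst'[OF v_L4])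
  moreover have "integrable (Time T) (\<lambda>s. \<integral>x. (v (s, x))\<^sup>2 \<partial>Ivl l)"
    by (rule PM.integrable_fst'[OF sqint_sq[OF sqint_of_fourth_power(1)[OF finite_PM v_measurable v_L4]]])
  ultimately show ?thesis unfolding dominant_def using y_L2 by (simp del: power_even_abs_numeral)
qed

text \<open>The squared L^2 norm of y_xx in coefficients. The value on the null set where the series
  diverges is immaterial.\<close>

definition dissipation :: "real \<Rightarrow> real"
  where "dissipation s = (\<Sum>k. (mu k) ^ 4 * (cf s k)\<^sup>2)"

text \<open>The Galerkin energy at time T is nonnegative, so the dissipation spent up to T is at
  most the initial energy plus the integral of \<open>dominant\<close>, uniformly in N.\<close>

lemma partial_dissipation_bound:
  "(\<Sum>k<N. \<integral>s. (mu k) ^ 4 * (cf s k)\<^sup>2 \<partial>Time T) \<le> (Hnorm l u0)\<^sup>2 + (\<integral>s. dominant s \<partial>Time T)"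
proof -
  have "0 \<le> (\<Sum>k<N. (cf T k)\<^sup>2)" by (simp add: sum_nonneg)
  also have "\<dots> = (\<Sum>k<N. (coef u0 k)\<^sup>2) + (\<integral>s. galerkin_power N s \<partial>Time T)"
    by (rule galerkin_energy) (use T_pos in simp)
  also have "(\<Sum>k<N. (coef u0 k)\<^sup>2) \<le> (Hnorm l u0)\<^sup>2" unfolding Hnorm_sq by (rule Bessel[OF u0])
  also have "(\<integral>s. galerkin_power N s \<partial>Time T) \<le> (\<integral>s. - (\<Sum>k<N. (mu k) ^ 4 * (cf s k)\<^sup>2) + dominant s \<partial>Time T)"
  proof (rule integral_mono_AE)
    show "AE s in Time T. galerkin_power N s \<le> - (\<Sum>k<N. (mu k) ^ 4 * (cf s k)\<^sup>2) + dominant s"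
      using v_slice AE_space by eventually_elim (rule galerkin_power_bounds(1), auto)
  qed (intro galerkin_power_integrable Bochner_Integration.integrable_add Bochner_Integration.integrable_minus
      Bochner_Integration.integrable_sum cf_sq_integrable dominant_integrable)+
  also have "\<dots> = - (\<Sum>k<N. \<integral>s. (mu k) ^ 4 * (cf s k)\<^sup>2 \<partial>Time T) + (\<integral>s. dominant s \<partial>Time T)"
  proof -
    have "integrable (Time T) (\<lambda>s. \<Sum>k<N. (mu k) ^ 4 * (cf s k)\<^sup>2)"
      by (intro Bochner_Integration.integrable_sum cf_sq_integrable)
    moreover have "(\<Sum>k<N. \<integral>s. (mu k) ^ 4 * (cf s k)\<^sup>2 \<partial>Time T) = (\<integral>s. (\<Sum>k<N. (mu k) ^ 4 * (cf s k)\<^sup>2) \<partial>Time T)"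
      by (rule Bochner_Integration.integral_sum[symmetric]) (rule cf_sq_integrable)
    ultimately show ?thesis using dominant_integrable by simp
  qed
  finally show ?thesis by simp
qed

text \<open>Monotone convergence: the uniform bound makes the integral of the whole series finite,
  so the series is finite for a.e. time. This is where the solution gains its regularity.\<close>

lemma dissipation_summable: "AE s in Time T. summable (\<lambda>k. (mu k) ^ 4 * (cf s k)\<^sup>2)"
proof -
  let ?f = "\<lambda>k s. (mu k) ^ 4 * (cf s k)\<^sup>2" and ?C = "(Hnorm l u0)\<^sup>2 + (\<integral>s. dominant s \<partial>Time T)"
  have nn: "0 \<le> ?f k s" for k s by simp
  have "(\<integral>\<^sup>+s. (\<Sum>k. ennreal (?f k s)) \<partial>Time T) = (\<Sum>k. \<integral>\<^sup>+s. ennreal (?f k s) \<partial>Time T)"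
    by (rule nn_integral_suminf) measurable
  also have "\<dots> \<le> ennreal ?C"
  proof (rule suminf_le_const[OF summableI])
    fix N
    have "(\<Sum>k<N. \<integral>\<^sup>+s. ennreal (?f k s) \<partial>Time T) = (\<Sum>k<N. ennreal (\<integral>s. ?f k s \<partial>Time T))"
      by (intro sum.cong refl nn_integral_eq_integral cf_sq_integrable AE_I2 nn)
    also have "\<dots> = ennreal (\<Sum>k<N. \<integral>s. ?f k s \<partial>Time T)"
      by (rule sum_ennreal) (rule Bochner_Integration.integral_nonneg, rule nn)
    also have "\<dots> \<le> ennreal ?C" by (rule ennreal_leI[OF partial_dissipation_bound])
    finally show "(\<Sum>k<N. \<integral>\<^sup>+s. ennreal (?f k s) \<partial>Time T) \<le> ennreal ?C" .
  qed
  finally have "(\<integral>\<^sup>+s. (\<Sum>k. ennreal (?f k s)) \<partial>Time T) \<noteq> \<infinity>" by (auto simp: top_unique)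
  then have "AE s in Time T. (\<Sum>k. ennreal (?f k s)) \<noteq> \<infinity>" by (intro nn_integral_noteq_infinite) measurable
  then show ?thesis
  proof eventually_elim
    case (elim s)
    then show ?case by (intro summable_suminf_not_top nn) simp
  qed
qed

lemma dissipation_integrable: "integrable (Time T) dissipation"
  unfolding dissipation_def
proof (rule integrable_suminf)
  show "AE s in Time T. summable (\<lambda>k. norm ((mu k) ^ 4 * (cf s k)\<^sup>2))"
    using dissipation_summable by (simp add: abs_mult)
  show "summable (\<lambda>k. \<integral>s. norm ((mu k) ^ 4 * (cf s k)\<^sup>2) \<partial>Time T)"
    using partial_dissipation_bound by (intro summableI_nonneg_bounded) (auto simp: abs_mult)
qed (rule cf_sq_integrable)

lemma series_slice:
  assumes s: "s \<in> {0..T}" and D: "summable (\<lambda>k. (mu k) ^ 4 * (cf s k)\<^sup>2)"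
  shows "sine_series l (cf s)" "AE x in Ivl l. y s x = ser (cf s) x"
    and "(\<integral>x. (ser (cf s) x)\<^sup>2 \<partial>Ivl l) = (Hnorm l (y s))\<^sup>2"
proof -
  show ss: "sine_series l (cf s)" by unfold_locales (rule D)
  interpret sine_series l "cf s" by (rule ss)
  have "AE x in Ivl l. 1 * y s x + (-1) * ser (cf s) x = 0"
    by (rule coef_zero_imp_AE[OF sqint_lin[OF y_sqint[OF s] sqint_ser]])
      (simp add: coef_lin[OF y_sqint[OF s] sqint_ser, of 1 "-1", simplified] coef_ser)
  then show ae: "AE x in Ivl l. y s x = ser (cf s) x" by eventually_elim simp
  show "(\<integral>x. (ser (cf s) x)\<^sup>2 \<partial>Ivl l) = (Hnorm l (y s))\<^sup>2"
    unfolding Hnorm_sq by (rule sq_integral_cong_AE[OF ae, symmetric])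
qed

text \<open>The sine polynomials and their derivatives converge in L^2, while v and v^2 are in L^2
  on the slice, so the integrals against v converge by Cauchy-Schwarz.\<close>

lemma galerkin_power_tendsto:
  assumes v: "(\<lambda>x. v (s, x)) \<in> Lp l 4" and s: "s \<in> {0..T}" and D: "summable (\<lambda>k. (mu k) ^ 4 * (cf s k)\<^sup>2)"
  shows "(\<lambda>N. galerkin_power N s) \<longlonglongrightarrow> - 2 * dissipation s + 2 * (\<integral>x. (ser' (cf s) x)\<^sup>2 \<partial>Ivl l)
    - 2 * \<kappa> * (\<integral>x. (ser (cf s) x)\<^sup>2 \<partial>Ivl l) + (\<integral>x. (v (s, x))\<^sup>2 * ser' (cf s) x \<partial>Ivl l)
    + 2 * \<kappa> * (\<integral>x. v (s, x) * ser (cf s) x \<partial>Ivl l)"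
proof -
  interpret sine_series l "cf s" by (rule series_slice(1)[OF s D])
  have lim: "(\<lambda>N. \<integral>x. a x * F N x \<partial>Ivl l) \<longlonglongrightarrow> (\<integral>x. a x * G x \<partial>Ivl l)"
    if a: "sqint (Ivl l) a" and F: "\<And>N. sqint (Ivl l) (F N)" and G: "sqint (Ivl l) G"
      and FG: "(\<lambda>N. \<integral>x. (G x - F N x)\<^sup>2 \<partial>Ivl l) \<longlonglongrightarrow> 0" for a G :: rfun and F
  proof -
    have "(\<lambda>N. sqrt (\<integral>x. (a x)\<^sup>2 \<partial>Ivl l) * sqrt (\<integral>x. (G x - F N x)\<^sup>2 \<partial>Ivl l)) \<longlonglongrightarrow> sqrt (\<integral>x. (a x)\<^sup>2 \<partial>Ivl l) * sqrt 0"
      by (intro tendsto_intros FG)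
    then have z: "(\<lambda>N. sqrt (\<integral>x. (a x)\<^sup>2 \<partial>Ivl l) * sqrt (\<integral>x. (G x - F N x)\<^sup>2 \<partial>Ivl l)) \<longlonglongrightarrow> 0" by simp
    have "(\<lambda>N. (\<integral>x. a x * G x \<partial>Ivl l) - (\<integral>x. a x * F N x \<partial>Ivl l)) \<longlonglongrightarrow> 0"
    proof (rule Lim_null_comparison[OF _ z])
      show "\<forall>\<^sub>F N in sequentially. norm ((\<integral>x. a x * G x \<partial>Ivl l) - (\<integral>x. a x * F N x \<partial>Ivl l))
          \<le> sqrt (\<integral>x. (a x)\<^sup>2 \<partial>Ivl l) * sqrt (\<integral>x. (G x - F N x)\<^sup>2 \<partial>Ivl l)"
      proof (rule always_eventually, rule allI)
        fix N
        have "(\<integral>x. a x * G x \<partial>Ivl l) - (\<integral>x. a x * F N x \<partial>Ivl l) = (\<integral>x. a x * (G x - F N x) \<partial>Ivl l)"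
          using sqint_mult[OF a F] sqint_mult[OF a G] by (simp add: right_diff_distrib)
        then show "norm ((\<integral>x. a x * G x \<partial>Ivl l) - (\<integral>x. a x * F N x \<partial>Ivl l))
          \<le> sqrt (\<integral>x. (a x)\<^sup>2 \<partial>Ivl l) * sqrt (\<integral>x. (G x - F N x)\<^sup>2 \<partial>Ivl l)"
          using sqint_Cauchy_Schwarz_abs[OF a sqint_diff[OF G F]] by simp
      qed
    qed
    from tendsto_diff[OF tendsto_const this, of "\<integral>x. a x * G x \<partial>Ivl l"] show ?thesis by simp
  qed
  show ?thesis
    unfolding galerkin_power_eq[OF v] dissipation_def
    using ser_norm ser'_norm summable_LIMSEQ[OF D]
      lim[OF Lp4_sqint_sq[OF v] sqint_sp' sqint_ser' sp'_L2_tendsto]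
      lim[OF Lp4_sqint[OF v] sqint_sp sqint_ser sp_L2_tendsto]
    by (intro tendsto_intros) (simp_all add: sums_def)
qed

text \<open>Defined as a limit so that measurability in time comes from the Galerkin powers; it is
  unspecified on a null set of times.\<close>

definition total_power :: "real \<Rightarrow> real"
  where "total_power s = lim (\<lambda>N. galerkin_power N s)"

lemma total_power_eq:
  "AE s in Time T. (\<lambda>N. galerkin_power N s) \<longlonglongrightarrow> total_power s"
  using v_slice dissipation_summable AE_space
proof eventually_elim
  case (elim s)
  have "convergent (\<lambda>N. galerkin_power N s)" by (rule convergentI[OF galerkin_power_tendsto]) (use elim in auto)
  then show ?case by (simp add: convergent_LIMSEQ_iff total_power_def)
qed

text \<open>The Galerkin powers are dominated by 3 dissipation + dominant, and the energies converge
  by Parseval at every t, not just almost every t. The norm of y t is thereby continuous, although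
  at first y t is only known to lie in H for each t.\<close>

lemma energy_equality:
  "integrable (Time T) total_power"
  "t \<in> {0..T} \<Longrightarrow> (Hnorm l (y t))\<^sup>2 = (Hnorm l u0)\<^sup>2 + (\<integral>s. total_power s \<partial>lebesgue_on {0..t})"
proof -
  have [measurable]: "galerkin_power N \<in> borel_measurable (Time T)" for N
    by (rule borel_measurable_integrable[OF galerkin_power_integrable])
  have [measurable]: "total_power \<in> borel_measurable (Time T)"
    unfolding total_power_def[abs_def] by measurable
  let ?b = "\<lambda>s. 3 * dissipation s + dominant s"
  have b: "integrable (Time T) ?b" using dissipation_integrable dominant_integrable by simp
  have bound: "AE s in Time T. \<forall>N. \<bar>galerkin_power N s\<bar> \<le> ?b s"
    using v_slice dissipation_summable AE_space
  proof eventually_elim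
    case (elim s)
    have "(\<Sum>k<N. (mu k) ^ 4 * (cf s k)\<^sup>2) \<le> dissipation s" for N
      unfolding dissipation_def by (rule sum_le_suminf[OF elim(2)]) auto
    moreover have "\<bar>galerkin_power N s\<bar> \<le> 3 * (\<Sum>k<N. (mu k) ^ 4 * (cf s k)\<^sup>2) + dominant s" for N
      by (rule galerkin_power_bounds(2)[OF elim(1)]) (use elim(3) in simp)
    ultimately show ?case by (meson add_right_mono dual_order.trans mult_left_mono zero_le_numeral)
  qed
  show i: "integrable (Time T) total_power"
    by (rule integrable_dominated_convergence[where s=galerkin_power and w="?b"])
      (use b total_power_eq bound in \<open>auto elim: eventually_mono\<close>)
  assume t: "t \<in> {0..T}"
  have "(\<lambda>N. \<integral>s. indicator {..t} s * galerkin_power N s \<partial>Time T) \<longlonglongrightarrow> (\<integral>s. indicator {..t} s * total_power s \<partial>Time T)"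
  proof (rule integral_dominated_convergence[where w="?b"])
    show "AE s in Time T. (\<lambda>N. indicator {..t} s * galerkin_power N s) \<longlonglongrightarrow> indicator {..t} s * total_power s"
      using total_power_eq by eventually_elim (intro tendsto_intros)
    show "AE s in Time T. norm (indicator {..t} s * galerkin_power N s) \<le> ?b s" for N
      using bound
    proof eventually_elim
      case (elim s)
      then have "\<bar>galerkin_power N s\<bar> \<le> ?b s" by blast
      moreover have "0 \<le> ?b s" using calculation abs_ge_zero order_trans by blast
      ultimately show ?case by (simp add: indicator_def)
    qed
    show "(\<lambda>s. indicator {..t} s * total_power s) \<in> borel_measurable (Time T)"
      "(\<lambda>s. indicator {..t} s * galerkin_power N s) \<in> borel_measurable (Time T)" for N
      by (rule borel_measurable_integrable[OF integrable_indicator_atMost], rule i galerkin_power_integrable)+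
  qed (rule b)
  then have "(\<lambda>N. \<integral>s. galerkin_power N s \<partial>lebesgue_on {0..t}) \<longlonglongrightarrow> (\<integral>s. total_power s \<partial>lebesgue_on {0..t})"
    using t by (simp add: integral_lebesgue_on_initial[of t T])
  then have "(\<lambda>N. (\<Sum>k<N. (coef u0 k)\<^sup>2) + (\<integral>s. galerkin_power N s \<partial>lebesgue_on {0..t})) \<longlonglongrightarrow>
      (Hnorm l u0)\<^sup>2 + (\<integral>s. total_power s \<partial>lebesgue_on {0..t})"
    using Parseval[OF u0] by (intro tendsto_intros) (simp_all add: Hnorm_sq sums_def)
  moreover have "(\<lambda>N. \<Sum>k<N. (cf t k)\<^sup>2) \<longlonglongrightarrow> (Hnorm l (y t))\<^sup>2"
    using Parseval[OF y_sqint[OF t]] by (simp add: Hnorm_sq sums_def)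
  ultimately show "(Hnorm l (y t))\<^sup>2 = (Hnorm l u0)\<^sup>2 + (\<integral>s. total_power s \<partial>lebesgue_on {0..t})"
    unfolding galerkin_energy[OF t] by (rule LIMSEQ_unique[rotated])
qed

lemma Hnorm_sq_continuous: "continuous_on {0..T} (\<lambda>t. (Hnorm l (y t))\<^sup>2)"
proof -
  have "continuous_on {0..T} (\<lambda>t. (Hnorm l u0)\<^sup>2 + (\<integral>s. total_power s \<partial>lebesgue_on {0..t}))"
    by (intro continuous_intros indefinite_integral_continuous_on energy_equality(1))
  then show ?thesis by (rule continuous_on_eq) (simp add: energy_equality(2)[symmetric])
qed

definition growth :: "real \<Rightarrow> real"
  where "growth t = 1/2 * (2 * \<kappa> + (2 + 3/4 * K)\<^sup>2 + K * Lnorm l 4 (W t) ^ 4)"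

definition forcing :: "real \<Rightarrow> real"
  where "forcing t = \<kappa> * (Hnorm l (W t))\<^sup>2 + 1/4 * Lnorm l 4 (W t) ^ 4"

lemma growth_continuous: "continuous_on {0..T} growth"
  and forcing_continuous: "continuous_on {0..T} forcing"
  unfolding growth_def forcing_def by (intro continuous_intros Lnorm4_continuous Hnorm_continuous)+

lemma growth_nonneg: "0 \<le> growth t" and forcing_nonneg: "0 \<le> forcing t"
  using \<kappa> K by (auto simp: growth_def forcing_def intro!: add_nonneg_nonneg)

text \<open>Collects the a.e. facts about one time slice. The coefficient formula serves
  measurability, the first bound integrability, and the last inequality is
  \<open>energy_estimate\<close> for the slice.\<close>

lemma Vnorm_slice:
  "AE s in Time T. y s \<in> Vsp l \<and> (Vnorm l (y s))\<^sup>2 = (Hnorm l (y s))\<^sup>2 + (\<Sum>k. (mu k)\<^sup>2 * (cf s k)\<^sup>2) \<and>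
    (Vnorm l (y s))\<^sup>2 \<le> 2 * (Hnorm l (y s))\<^sup>2 + dissipation s \<and>
    total_power s + (Vnorm l (y s))\<^sup>2 \<le> growth s * (Hnorm l (y s))\<^sup>2 + forcing s"
  using v_slice dissipation_summable AE_space v_eq total_power_eq
proof eventually_elim
  case (elim s)
  then have s: "s \<in> {0..T}" by simp
  interpret sine_series l "cf s" by (rule series_slice(1)[OF s elim(2)])
  note ss = series_slice(2,3)[OF s elim(2)]
  have ae: "AE x in Ivl l. ser (cf s) x = y s x" using ss(1) by eventually_elim simp
  have "y s \<in> Vsp l" by (rule Vsp_cong_AE[OF ae ser_in_Vsp])
  moreover have "weak_deriv l (y s) (ser' (cf s))" by (rule weak_deriv_cong[OF ae weak_deriv_ser])
  from Vnorm_weak[OF this]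
  have V: "(Vnorm l (y s))\<^sup>2 = (Hnorm l (y s))\<^sup>2 + (\<integral>x. (ser' (cf s) x)\<^sup>2 \<partial>Ivl l)"
    unfolding Hnorm_sq by simp
  moreover have b: "(\<integral>x. (ser' (cf s) x)\<^sup>2 \<partial>Ivl l) = (\<Sum>k. (mu k)\<^sup>2 * (cf s k)\<^sup>2)"
    using ser'_norm by (rule sums_unique)
  moreover have "(\<integral>x. (ser' (cf s) x)\<^sup>2 \<partial>Ivl l) \<le> dissipation s / 4 + (Hnorm l (y s))\<^sup>2"
  proof (rule product_bounds(2))
    show "0 \<le> dissipation s" unfolding dissipation_def by (rule suminf_nonneg[OF elim(2)]) simp
    show "(\<integral>x. (ser' (cf s) x)\<^sup>2 \<partial>Ivl l)\<^sup>2 \<le> (Hnorm l (y s))\<^sup>2 * dissipation s"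
      using ser_interpolation unfolding ss(2) dissipation_def .
  qed simp
  moreover have "0 \<le> dissipation s" unfolding dissipation_def by (rule suminf_nonneg[OF elim(2)]) simp
  moreover have "AE x in Ivl l. v (s, x) = W s x + ser (cf s) x"
    using elim(4) ae by eventually_elim simp
  from energy_estimate[OF W_L4[OF s] K \<kappa> this]
  have "total_power s + (Vnorm l (y s))\<^sup>2 \<le> growth s * (Hnorm l (y s))\<^sup>2 + forcing s"
    unfolding LIMSEQ_unique[OF elim(5) galerkin_power_tendsto[OF elim(1) s elim(2)]] V ss(2) growth_def forcing_def dissipation_def .
  ultimately show ?case by simp
qed

text \<open>The V norm uses a weak derivative chosen separately at each time, so its measurability
  in time is read off the coefficient series.\<close>

lemma Vnorm_integrable: "integrable (Time T) (\<lambda>t. (Vnorm l (y t))\<^sup>2)"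
proof -
  let ?V = "\<lambda>s. (Hnorm l (y s))\<^sup>2 + (\<Sum>k. (mu k)\<^sup>2 * (cf s k)\<^sup>2)"
  have [measurable]: "(\<lambda>s. (Hnorm l (y s))\<^sup>2) \<in> borel_measurable (Time T)"
    by (rule borel_measurable_integrable[OF y_L2])
  have "integrable (Time T) ?V"
  proof (rule Bochner_Integration.integrable_bound)
    show "integrable (Time T) (\<lambda>s. 2 * (Hnorm l (y s))\<^sup>2 + dissipation s)"
      using y_L2 dissipation_integrable by simp
    show "AE s in Time T. norm (?V s) \<le> norm (2 * (Hnorm l (y s))\<^sup>2 + dissipation s)"
      using Vnorm_slice
    proof eventually_elim
      case (elim s)
      then have "norm (?V s) = ?V s" using zero_le_power2[of "Vnorm l (y s)"] by simp
      also have "\<dots> \<le> 2 * (Hnorm l (y s))\<^sup>2 + dissipation s" using elim by simp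
      also have "\<dots> \<le> norm (2 * (Hnorm l (y s))\<^sup>2 + dissipation s)" by simp
      finally show ?case .
    qed
  qed measurable
  moreover have "AE s in Time T. ?V s = (Vnorm l (y s))\<^sup>2" using Vnorm_slice by eventually_elim simp
  ultimately show ?thesis using integrable_cong_AE_lebesgue_on[of "{0..T}" ?V] by simp
qed

text \<open>Integrates the slice inequality from \<open>Vnorm_slice\<close> and inserts the energy
  equality. Keeping the V norm on the left serves both final bounds.\<close>

lemma energy_inequality:
  assumes t: "t \<in> {0..T}"
  shows "(Hnorm l (y t))\<^sup>2 + (\<integral>s. (Vnorm l (y s))\<^sup>2 \<partial>lebesgue_on {0..t}) \<le>
    (Hnorm l u0)\<^sup>2 + (\<integral>s. growth s * (Hnorm l (y s))\<^sup>2 + forcing s \<partial>lebesgue_on {0..t})"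
proof -
  let ?R = "\<lambda>s. growth s * (Hnorm l (y s))\<^sup>2 + forcing s"
  have R: "integrable (Time T) ?R"
    by (rule continuous_imp_integrable_real)
      (intro continuous_intros growth_continuous forcing_continuous Hnorm_sq_continuous)
  have tT: "t \<le> T" using t by simp
  have "(\<integral>s. total_power s \<partial>lebesgue_on {0..t}) + (\<integral>s. (Vnorm l (y s))\<^sup>2 \<partial>lebesgue_on {0..t}) =
      (\<integral>s. total_power s + (Vnorm l (y s))\<^sup>2 \<partial>lebesgue_on {0..t})"
    by (rule Bochner_Integration.integral_add[symmetric])
      (auto intro: integrable_lebesgue_on_initial[OF _ tT] energy_equality(1) Vnorm_integrable)
  also have "\<dots> \<le> (\<integral>s. ?R s \<partial>lebesgue_on {0..t})"
    unfolding integral_lebesgue_on_initial[OF tT]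
  proof (rule integral_mono_AE)
    show "AE s in Time T. indicator {..t} s * (total_power s + (Vnorm l (y s))\<^sup>2) \<le> indicator {..t} s * ?R s"
      using Vnorm_slice by eventually_elim (auto intro!: mult_left_mono)
  qed (intro integrable_indicator_atMost R Bochner_Integration.integrable_add energy_equality(1) Vnorm_integrable)+
  finally show ?thesis unfolding energy_equality(2)[OF t] by simp
qed

theorem Hnorm_bound:
  assumes t: "t \<in> {0..T}"
  shows "(Hnorm l (y t))\<^sup>2 \<le> exp (\<integral>s. growth s \<partial>Time T) * ((Hnorm l u0)\<^sup>2 + (\<integral>s. forcing s \<partial>Time T))"
proof (rule Gronwall_integral[OF growth_continuous forcing_continuous Hnorm_sq_continuous growth_nonneg forcing_nonneg _ _ t])
  fix t assume t: "t \<in> {0..T}"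
  have "0 \<le> (\<integral>s. (Vnorm l (y s))\<^sup>2 \<partial>lebesgue_on {0..t})" by simp
  then show "(Hnorm l (y t))\<^sup>2 \<le> (Hnorm l u0)\<^sup>2 + (\<integral>s. growth s * (Hnorm l (y s))\<^sup>2 + forcing s \<partial>lebesgue_on {0..t})"
    using energy_inequality[OF t] by linarith
qed simp

lemma Hnorm_bdd: "bdd_above ((\<lambda>t. (Hnorm l (y t))\<^sup>2) ` {0..T})"
  using Hnorm_bound by (intro bdd_aboveI2)

text \<open>The energy inequality at t = T without its nonnegative end term; since
  \<open>growth\<close> is nonnegative, the norm may be replaced by its supremum under the
  integral.\<close>

theorem Vnorm_bound:
  "(\<integral>s. (Vnorm l (y s))\<^sup>2 \<partial>Time T) \<le>
    (Hnorm l u0)\<^sup>2 + (SUP t\<in>{0..T}. (Hnorm l (y t))\<^sup>2) * (\<integral>s. growth s \<partial>Time T) + (\<integral>s. forcing s \<partial>Time T)"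
proof -
  let ?\<Sigma> = "SUP t\<in>{0..T}. (Hnorm l (y t))\<^sup>2"
  have i: "integrable (Time T) growth" "integrable (Time T) forcing" "integrable (Time T) (\<lambda>s. growth s * (Hnorm l (y s))\<^sup>2)"
    by (rule continuous_imp_integrable_real,
        intro continuous_intros growth_continuous forcing_continuous Hnorm_sq_continuous)+
  have "(\<integral>s. growth s * (Hnorm l (y s))\<^sup>2 + forcing s \<partial>Time T) \<le> (\<integral>s. ?\<Sigma> * growth s + forcing s \<partial>Time T)"
  proof (rule integral_mono)
    fix s assume "s \<in> space (Time T)"
    then have "(Hnorm l (y s))\<^sup>2 \<le> ?\<Sigma>" by (intro cSUP_upper Hnorm_bdd) simp
    then have "growth s * (Hnorm l (y s))\<^sup>2 \<le> growth s * ?\<Sigma>" by (rule mult_left_mono[OF _ growth_nonneg])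
    then show "growth s * (Hnorm l (y s))\<^sup>2 + forcing s \<le> ?\<Sigma> * growth s + forcing s" by (simp add: mult.commute)
  qed (use i in auto)
  also have "\<dots> = ?\<Sigma> * (\<integral>s. growth s \<partial>Time T) + (\<integral>s. forcing s \<partial>Time T)" using i by simp
  finally have 1: "(\<integral>s. growth s * (Hnorm l (y s))\<^sup>2 + forcing s \<partial>Time T) \<le> ?\<Sigma> * (\<integral>s. growth s \<partial>Time T) + (\<integral>s. forcing s \<partial>Time T)" .
  have "(Hnorm l (y T))\<^sup>2 + (\<integral>s. (Vnorm l (y s))\<^sup>2 \<partial>Time T) \<le>
      (Hnorm l u0)\<^sup>2 + (\<integral>s. growth s * (Hnorm l (y s))\<^sup>2 + forcing s \<partial>Time T)"
    by (rule energy_inequality) (use T_pos in simp)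
  with 1 show ?thesis using zero_le_power2[of "Hnorm l (y T)"] by linarith
qed

end

text \<open>For a fixed \<omega> the equation is reduced to \<open>mild_solution\<close>: a jointly
  measurable version of the full path, scalar Duhamel formulas for the sine coefficients, and square
  integrability of y in time.\<close>

theorem lemma4p2:
  fixes l T c C1 C2 :: real
    and S :: "real \<Rightarrow> rfun \<Rightarrow> rfun"
    and G :: "(real \<Rightarrow> rfun) \<Rightarrow> real \<Rightarrow> functional"
    and M :: "'w measure" and Q :: "rfun \<Rightarrow> rfun"
    and w wA :: "real \<Rightarrow> 'w \<Rightarrow> rfun" and \<omega> :: 'w
    and u0 :: rfun and y :: "real \<Rightarrow> rfun"
    and f g :: "real \<Rightarrow> real"
  assumes "l > 0" and "T > 0"
    and "C1 > 0"
    and sobolev_embedding: "\<And>v. v \<in> Hhalf l \<Longrightarrow> v \<in> Lp l 4 \<and> Lnorm l 4 v \<le> C1 * Hhalf_norm l v"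
    and "C2 > 0"
    and interpolation: "\<And>v. v \<in> Hk l 1 \<Longrightarrow>
          v \<in> Hhalf l \<and> Hhalf_norm l v \<le> C2 * sqrt (Lnorm l 2 v) * sqrt (Hk_norm l 1 v)"
    and "c > 0" and "A_strictly_negative l c"
    and semigroup: "semigroup_generated_by l (A_dom l) (A_op l c) S"
    and "prob_space M" and "Q_Wiener l M Q w"
    and "continuous_stochastic_convolution l T M Q w S wA"
    and "continuous_extension_G0 l T c G"
    and "u0 \<in> Hsp l"
    and "\<omega> \<in> space M"
    and "is_solution l T S G u0 (\<lambda>t. wA t \<omega>) y"
    and f_def: "\<And>t. f t = 1/2 * (2 * c + (2 + 3/4 * C1 * C2)\<^sup>2 + C1 * C2 * Lnorm l 4 (wA t \<omega>) ^ 4)"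
    and g_def: "\<And>t. g t = c * (Hnorm l (wA t \<omega>))\<^sup>2 + 1/4 * Lnorm l 4 (wA t \<omega>) ^ 4"
  shows "bdd_above ((\<lambda>t. (Hnorm l (y t))\<^sup>2) ` {0..T}) \<and>
    (SUP t\<in>{0..T}. (Hnorm l (y t))\<^sup>2)
      \<le> (Hnorm l u0)\<^sup>2 * exp (\<integral>s. f s \<partial>Time T)
        + (\<integral>\<tau>. exp (\<integral>s. f s \<partial>Time T) * g \<tau> \<partial>Time T) \<and>
    (AE t in Time T. y t \<in> Vsp l) \<and> integrable (Time T) (\<lambda>t. (Vnorm l (y t))\<^sup>2) \<and>
    (\<integral>t. (Vnorm l (y t))\<^sup>2 \<partial>Time T)
      \<le> (Hnorm l u0)\<^sup>2 + (SUP t\<in>{0..T}. (Hnorm l (y t))\<^sup>2) * (\<integral>\<tau>. f \<tau> \<partial>Time T)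
        + (\<integral>\<tau>. g \<tau> \<partial>Time T)"
proof -
  define W where "W t = wA t \<omega>" for t
  interpret interval l by unfold_locales fact
  interpret space_time l T by unfold_locales fact
  interpret kuramoto_semigroup l c S by unfold_locales fact
  interpret embedding_constants l C1 C2 by unfold_locales (fact+)
  have wA: "wA t \<omega> \<in> Lp l 4"
    "((\<lambda>s. Lnorm l 4 (\<lambda>x. wA s \<omega> x - wA t \<omega> x)) \<longlongrightarrow> 0) (at t within {0..T})" if "t \<in> {0..T}" for t
    using \<open>continuous_stochastic_convolution l T M Q w S wA\<close> \<open>\<omega> \<in> space M\<close> that
    unfolding continuous_stochastic_convolution_def by blast+
  interpret L4_path l T W by unfold_locales (simp_all add: W_def wA)
  note ext = \<open>continuous_extension_G0 l T c G\<close>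
  have yE: "y \<in> Esp l T" and yH: "\<And>t. t \<in> {0..T} \<Longrightarrow> sqint (Ivl l) (y t)"
    and sol: "\<And>t \<phi>. t \<in> {0..T} \<Longrightarrow> \<phi> \<in> Vsp l \<Longrightarrow>
      ip l (y t) \<phi> = ip l (S t u0) \<phi> + F_map S G (\<lambda>s x. y s x + W s x) t \<phi>"
    using \<open>is_solution l T S G u0 (\<lambda>t. wA t \<omega>) y\<close> unfolding is_solution_def Hsp_iff W_def by blast+
  have u0: "sqint (Ivl l) u0" using \<open>u0 \<in> Hsp l\<close> by (simp add: Hsp_iff)
  \<comment> \<open>Jointly measurable versions: for the noise from its continuity in L^4, for y
    from membership in E.\<close>
  obtain wr where wr: "wr \<in> borel_measurable PM" "integrable PM (\<lambda>z. \<bar>wr z\<bar> ^ 4)"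
    "\<And>t. t \<in> {0..T} \<Longrightarrow> ae_eq l (W t) (\<lambda>x. wr (t, x))"
    using W_representative by blast
  obtain yr where yr: "yr \<in> borel_measurable PM" "integrable PM (\<lambda>z. \<bar>yr z\<bar> ^ 4)"
    "AE t in Time T. ae_eq l (y t) (\<lambda>x. yr (t, x))" and yL: "AE t in Time T. y t \<in> Lp l 4"
    using yE unfolding Esp_def by blast
  define v where "v z = yr z + wr z" for z
  let ?u = "\<lambda>s x. y s x + W s x"
  have v: "v \<in> borel_measurable PM" "integrable PM (\<lambda>z. \<bar>v z\<bar> ^ 4)"
    unfolding v_def by (rule borel_measurable_add[OF yr(1) wr(1)], rule integrable_abs_add_power(1)[OF yr(1) wr(1) yr(2) wr(2)])
  have uv: "AE t in Time T. ae_eq l (?u t) (\<lambda>x. v (t, x))"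
    using yr(3) AE_space
  proof eventually_elim
    case (elim t)
    then have "ae_eq l (W t) (\<lambda>x. wr (t, x))" by (intro wr(3)) simp
    with elim(1) show ?case unfolding ae_eq_def v_def by eventually_elim simp
  qed
  have "AE t in Time T. ?u t \<in> Lp l 4"
    using yL AE_space by eventually_elim (auto intro!: Lp4_add W_L4)
  then have uE: "?u \<in> Esp l T" unfolding Esp_def using v uv by blast
  have GV: "AE s in Time T. G ?u s \<in> Vdual l"
    using ext uE by (simp add: continuous_extension_G0_def L2_Vdual_def)
  \<comment> \<open>Testing the equation with \<open>sb k\<close> makes it scalar: the semigroup
    acts on the test function as an exponential factor, and \<open>G_on_basis\<close> evaluates the
    nonlinearity.\<close>
  have duhamel: "coef (y t) k = exp (- lam c k * t) * coef u0 k +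
      (\<integral>s. exp (- lam c k * (t - s)) * gfun c v k s \<partial>lebesgue_on {0..t})" if t: "t \<in> {0..T}" for t k
  proof -
    have tT: "t \<le> T" "0 \<le> t" using t by auto
    have "F_map S G ?u t (sb k) = (\<integral>s. indicator {..t} s * G ?u s (S (t - s) (sb k)) \<partial>Time T)"
      unfolding F_map_def dual_op_def by (rule integral_lebesgue_on_initial[OF tT(1)])
    also have "\<dots> = (\<integral>s. indicator {..t} s * (exp (- lam c k * (t - s)) * gfun c v k s) \<partial>Time T)"
    proof (rule integral_cong_AE_lebesgue_on)
      show "AE s in Time T. indicator {..t} s * G ?u s (S (t - s) (sb k)) =
          indicator {..t} s * (exp (- lam c k * (t - s)) * gfun c v k s)"
        using GV G_on_basis[OF ext uE v uv, of k] AE_space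
      proof eventually_elim
        case (elim s)
        show ?case
        \<comment> \<open>Beyond t the indicator annihilates both sides; the formula for S is
          available only at nonnegative times.\<close>
        proof (cases "s \<le> t")
          case True
          let ?e = "\<lambda>x. exp (- lam c k * (t - s)) * sb k x + 0 * sb k x"
          have e: "?e \<in> Vsp l" by (rule Vsp_lin[OF sb_in_Vsp sb_in_Vsp])
          have "AE x in Ivl l. S (t - s) (sb k) x = exp (- lam c k * (t - s)) * sb k x"
            by (rule S_sb) (use True in simp)
          then have ae: "AE x in Ivl l. ?e x = S (t - s) (sb k) x" by eventually_elim simp
          \<comment> \<open>The image of \<open>sb k\<close> under the semigroup is a multiple of it
            only a.e.; elements of V' respect this because null functions have V norm 0.\<close>
          have "G ?u s (S (t - s) (sb k)) = G ?u s ?e"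
            by (rule Vdual_cong_AE[OF elim(1) e Vsp_cong_AE[OF ae e] ae, symmetric])
          also have "\<dots> = exp (- lam c k * (t - s)) * gfun c v k s"
            unfolding VdualD[OF elim(1) sb_in_Vsp sb_in_Vsp] elim(2) by simp
          finally show ?thesis by simp
        qed simp
      qed
    qed simp
    also have "\<dots> = (\<integral>s. exp (- lam c k * (t - s)) * gfun c v k s \<partial>lebesgue_on {0..t})"
      by (rule integral_lebesgue_on_initial[OF tT(1), symmetric])
    finally have "F_map S G ?u t (sb k) = (\<integral>s. exp (- lam c k * (t - s)) * gfun c v k s \<partial>lebesgue_on {0..t})" .
    then show ?thesis
      using sol[OF t sb_in_Vsp] coef_S[OF tT(2) u0] by (simp add: ip_def coef_def)
  qed
  have yL2: "integrable (Time T) (\<lambda>t. (Hnorm l (y t))\<^sup>2)"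
  proof -
    have "integrable (Time T) (\<lambda>t. \<integral>x. (yr (t, x))\<^sup>2 \<partial>Ivl l)"
      by (rule PM.integrable_fst'[OF sqint_sq[OF sqint_of_fourth_power(1)[OF finite_PM yr(1,2)]]])
    moreover have "AE t in Time T. (\<integral>x. (yr (t, x))\<^sup>2 \<partial>Ivl l) = (Hnorm l (y t))\<^sup>2"
      using yr(3) by eventually_elim (simp add: ae_eq_def Hnorm_sq sq_integral_cong_AE)
    ultimately show ?thesis
      using integrable_cong_AE_lebesgue_on[of "{0..T}" "\<lambda>t. \<integral>x. (yr (t, x))\<^sup>2 \<partial>Ivl l"] by simp
  qed
  have v_eq: "AE t in Time T. AE x in Ivl l. v (t, x) = W t x + y t x"
    using uv
  proof eventually_elim
    case (elim t)
    then show ?case unfolding ae_eq_def by eventually_elim simp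
  qed
  interpret mild_solution l T W c "C1 * C2" u0 y v
    by unfold_locales (use \<open>c > 0\<close> C1C2_lower u0 yH yL2 v v_eq duhamel in simp_all)
  \<comment> \<open>With \<kappa> = c and K = C1 C2 the abstract coefficients are the prescribed
    ones.\<close>
  have f: "f = growth" and g: "g = forcing"
    by (auto simp: f_def g_def growth_def forcing_def W_def mult.assoc)
  have "(SUP t\<in>{0..T}. (Hnorm l (y t))\<^sup>2) \<le> (Hnorm l u0)\<^sup>2 * exp (\<integral>s. f s \<partial>Time T)
        + (\<integral>\<tau>. exp (\<integral>s. f s \<partial>Time T) * g \<tau> \<partial>Time T)"
  proof (rule cSUP_least)
    show "(Hnorm l (y t))\<^sup>2 \<le> (Hnorm l u0)\<^sup>2 * exp (\<integral>s. f s \<partial>Time T)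
        + (\<integral>\<tau>. exp (\<integral>s. f s \<partial>Time T) * g \<tau> \<partial>Time T)" if "t \<in> {0..T}" for t
      using Hnorm_bound[OF that] unfolding f g by (simp add: algebra_simps)
  qed (use T_pos in simp)
  moreover have "AE t in Time T. y t \<in> Vsp l" using Vnorm_slice by eventually_elim blast
  ultimately show ?thesis
    using Hnorm_bdd Vnorm_integrable Vnorm_bound unfolding f g by blast
qed

end
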